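(* Let $\kappa=\sqrt[4]{24}$. For $\omega=(\sin\phi\cos\theta,\sin\phi\sin\theta,\cos\phi)\in\mathbb S^2$ with $\theta\in[0,2\pi)$, $\phi\in[0,\pi]$, $$D_\infty(Q_\phi(\omega))=\kappa\,(1-|\sin\phi|).$$ Moreover, if $\frac{\eta}{\xi}\to\infty$ as $\xi,\eta\to0$ and $Q_{\xi,\eta}$ minimizes $E_{\xi,\eta}$ over $\{Q\in Q_\infty+H^1(\Omega;\mathcal S_0): Q=Q_\phi\text{ on }\partial\Omega\}$, then $$\lim_{\xi,\eta\to0}\eta\,E_{\xi,\eta}(Q_{\xi,\eta})=\pi(4-\pi)\kappa.$$
   Context: $\Omega=\mathbb R^3\setminus B$, where $B$ is the closed unit ball centered at $0$. $\mathcal S_0$ is the space of symmetric traceless real $3\times3$ matrices with the Frobenius norm $|\cdot|$. $Q_\infty=\mathbf e_3\otimes \mathbf e_3-\frac13I$. Potentials: $f(Q)=\frac29-\frac12|Q|^2-\operatorname{tr}(Q^3)+\frac34|Q|^4$, which satisfies $f\ge0$ with equality iff $Q=n\otimes n-\frac13I$ for some $n\in\mathbb S^2$; and $g(Q)=\sqrt{\frac23}-\frac{Q_{33}}{|Q|}$ (the formula is for $Q\neq 0$; no value at $Q=0$ is specified). Energy: for $\xi,\eta>0$, $$E_{\xi,\eta}(Q)=\int_\Omega\left(\frac12|\nabla Q|^2+\frac1{\xi^2}f(Q)+\frac1{\eta^2}g(Q)\right)dx.$$ For $Q\in Q_\infty+H^1((1,\infty);\mathcal S_0)$, $F_\infty(Q)=\int_1^\infty\left[\frac12\left|\frac{dQ}{dr}\right|^2+g(Q)\right]dr$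 if $f(Q)=0$ a.e., and $F_\infty(Q)=+\infty$ otherwise; and $$D_\infty(Q_0)=\min\{F_\infty(Q): Q\in Q_\infty+H^1((1,\infty);\mathcal S_0),\ Q(1)=Q_0\}.$$ $Q_\phi=e_\phi\otimes e_\phi-\frac13I$, where $e_\phi=(\cos\phi\cos\theta,\cos\phi\sin\theta,-\sin\phi)$ at $\omega=(\sin\phi\cos\theta,\sin\phi\sin\theta,\cos\phi)$ is the longitudinal unit tangent vector; at the poles $\pm\mathbf e_3$, $e_\phi$ denotes an arbitrary unit vector orthogonal to $\mathbf e_3$. Limits $\xi,\eta\to0$ are taken along families (or sequences) of positive pairs $(\xi,\eta)\to(0,0)$ with $\eta/\xi\to\infty$. *)

theory Defs
  imports "HOL-Analysis.Analysis"
begin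

section \<open>Sobolev functions\<close>

(* In finite dimension: C^infinity. Differentiability of every iterated derivative
   makes all of them continuous. *)
coinductive smooth :: "('a::euclidean_space \<Rightarrow> 'b::euclidean_space) \<Rightarrow> bool" where
  "\<lbrakk>\<forall>x. f differentiable (at x); \<forall>v. smooth (\<lambda>x. frechet_derivative f (at x) v)\<rbrakk> \<Longrightarrow> smooth f"

definition test_fun :: "'a set \<Rightarrow> ('a::euclidean_space \<Rightarrow> 'b::euclidean_space) \<Rightarrow> bool" where
  "test_fun U \<psi> \<longleftrightarrow>
     smooth \<psi> \<and> compact (closure {x. \<psi> x \<noteq> 0}) \<and> closure {x. \<psi> x \<noteq> 0} \<subseteq> U"

definition locally_integrable_on ::
    "('a::euclidean_space \<Rightarrow> 'b::euclidean_space) \<Rightarrow> 'a set \<Rightarrow> bool" where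
  "locally_integrable_on u U \<longleftrightarrow> (\<forall>K. compact K \<and> K \<subseteq> U \<longrightarrow> set_integrable lebesgue K u)"

definition has_weak_deriv ::
    "'a set \<Rightarrow> 'a \<Rightarrow> ('a::euclidean_space \<Rightarrow> 'b::euclidean_space) \<Rightarrow> ('a \<Rightarrow> 'b) \<Rightarrow> bool" where
  "has_weak_deriv U b u v \<longleftrightarrow>
     locally_integrable_on u U \<and> locally_integrable_on v U \<and>
     (\<forall>\<psi>::'a \<Rightarrow> real. test_fun U \<psi> \<longrightarrow>
        (LINT x|lebesgue_on U. frechet_derivative \<psi> (at x) b *\<^sub>R u x)
          = - (LINT x|lebesgue_on U. \<psi> x *\<^sub>R v x))"

(* For open U a weak derivative is unique up to a null set; the choice is immaterial. *)
definition weak_deriv ::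
    "'a set \<Rightarrow> 'a \<Rightarrow> ('a::euclidean_space \<Rightarrow> 'b::euclidean_space) \<Rightarrow> 'a \<Rightarrow> 'b" where
  "weak_deriv U b u = (SOME v. has_weak_deriv U b u v)"

definition L2 :: "'a set \<Rightarrow> ('a::euclidean_space \<Rightarrow> 'b::euclidean_space) set" where
  "L2 U = {u. u \<in> borel_measurable (lebesgue_on U) \<and>
              integrable (lebesgue_on U) (\<lambda>x. (norm (u x))\<^sup>2)}"

definition H1 :: "'a set \<Rightarrow> 'b set \<Rightarrow> ('a::euclidean_space \<Rightarrow> 'b::euclidean_space) set" where
  "H1 U S = {u \<in> L2 U. (AE x in lebesgue_on U. u x \<in> S) \<and>
                       (\<forall>b\<in>Basis. \<exists>v \<in> L2 U. has_weak_deriv U b u v)}"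

section \<open>Q-tensors and potentials\<close>

(* The norm of the type real^3^3 is the Frobenius norm. *)
definition S0 :: "(real^3^3) set" where
  "S0 = {Q. transpose Q = Q \<and> trace Q = 0}"

definition uniaxial :: "real^3 \<Rightarrow> real^3^3" where
  "uniaxial n = (\<chi> i j. n $ i * n $ j) - (1/3) *\<^sub>R mat 1"

definition e3 :: "real^3" where
  "e3 = axis 3 1"

definition Q_inf :: "real^3^3" where
  "Q_inf = uniaxial e3"

definition f_pot :: "real^3^3 \<Rightarrow> real" where
  "f_pot Q = 2/9 - (1/2) * (norm Q)^2 - trace (Q ** Q ** Q) + (3/4) * (norm Q)^4"

(* g0 is the value at Q = 0, where the formula makes no sense. *)
definition g_pot :: "real \<Rightarrow> real^3^3 \<Rightarrow> real" where
  "g_pot g0 Q = (if Q = 0 then g0 else sqrt (2/3) - Q $ 3 $ 3 / norm Q)"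

section \<open>The three-dimensional problem\<close>

definition \<Omega> :: "(real^3) set" where
  "\<Omega> = - cball 0 1"

(* The integrand is nonnegative for g0 >= 0 and S0-valued Q, so that ennreal truncates nothing. *)
definition energy :: "real \<Rightarrow> real \<Rightarrow> real \<Rightarrow> (real^3 \<Rightarrow> real^3^3) \<Rightarrow> ennreal" where
  "energy g0 \<xi> \<eta> Q =
     (\<integral>\<^sup>+x. ennreal ((1/2) * (\<Sum>b\<in>Basis. (norm (weak_deriv \<Omega> b Q x))\<^sup>2)
              + f_pot (Q x) / \<xi>\<^sup>2 + g_pot g0 (Q x) / \<eta>\<^sup>2) \<partial>lebesgue_on \<Omega>)"

definition sph :: "real \<Rightarrow> real \<Rightarrow> real^3" where
  "sph \<phi> \<theta> = vector [sin \<phi> * cos \<theta>, sin \<phi> * sin \<theta>, cos \<phi>]"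

definition sphere_nn_integral :: "(real^3 \<Rightarrow> real) \<Rightarrow> ennreal" where
  "sphere_nn_integral h =
     (\<integral>\<^sup>+\<theta>\<in>{0..2*pi}. (\<integral>\<^sup>+\<phi>\<in>{0..pi}. ennreal (h (sph \<phi> \<theta>) * sin \<phi>) \<partial>lborel) \<partial>lborel)"

(* The trace operator H1(Omega) -> L2(sphere) is the continuous extension of the restriction
   map, initially given on the (dense) restrictions to Omega of smooth functions with
   compact support in the whole space. *)
definition has_trace :: "(real^3 \<Rightarrow> real^3^3) \<Rightarrow> (real^3 \<Rightarrow> real^3^3) \<Rightarrow> bool" where
  "has_trace u h \<longleftrightarrow>
     (\<exists>w :: nat \<Rightarrow> real^3 \<Rightarrow> real^3^3.
        (\<forall>k. test_fun UNIV (w k)) \<and>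
        (\<lambda>k. \<integral>\<^sup>+x. ennreal ((norm (w k x - u x))\<^sup>2) \<partial>lebesgue_on \<Omega>) \<longlonglongrightarrow> 0 \<and>
        (\<forall>b\<in>Basis. (\<lambda>k. \<integral>\<^sup>+x. ennreal ((norm (frechet_derivative (w k) (at x) b
                             - weak_deriv \<Omega> b u x))\<^sup>2) \<partial>lebesgue_on \<Omega>) \<longlonglongrightarrow> 0) \<and>
        (\<lambda>k. sphere_nn_integral (\<lambda>\<omega>. (norm (w k \<omega> - h \<omega>))\<^sup>2)) \<longlonglongrightarrow> 0)"

definition admissible :: "(real^3 \<Rightarrow> real^3^3) \<Rightarrow> (real^3 \<Rightarrow> real^3^3) set" where
  "admissible Q\<^sub>b = {Q. (\<lambda>x. Q x - Q_inf) \<in> H1 \<Omega> S0 \<and>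
                       has_trace (\<lambda>x. Q x - Q_inf) (\<lambda>\<omega>. Q\<^sub>b \<omega> - Q_inf)}"

definition minimizes ::
    "real \<Rightarrow> real \<Rightarrow> real \<Rightarrow> (real^3 \<Rightarrow> real^3^3) \<Rightarrow> (real^3 \<Rightarrow> real^3^3) \<Rightarrow> bool" where
  "minimizes g0 \<xi> \<eta> Q\<^sub>b Q \<longleftrightarrow>
     Q \<in> admissible Q\<^sub>b \<and> (\<forall>P \<in> admissible Q\<^sub>b. energy g0 \<xi> \<eta> Q \<le> energy g0 \<xi> \<eta> P)"

section \<open>The radial problem\<close>

definition F_inf :: "real \<Rightarrow> (real \<Rightarrow> real^3^3) \<Rightarrow> ennreal" where
  "F_inf g0 Q =
     (if AE r in lebesgue_on {1<..}. f_pot (Q r) = 0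
      then \<integral>\<^sup>+r. ennreal ((1/2) * (norm (weak_deriv {1<..} 1 Q r))\<^sup>2 + g_pot g0 (Q r))
             \<partial>lebesgue_on {1<..}
      else \<infinity>)"

(* The initial value is that of the representative of Q which is continuous up to r = 1. *)
definition radial_class :: "real^3^3 \<Rightarrow> (real \<Rightarrow> real^3^3) set" where
  "radial_class Q0 = {Q. (\<lambda>r. Q r - Q_inf) \<in> H1 {1<..} S0 \<and> continuous_on {1..} Q \<and> Q 1 = Q0}"

definition D_inf :: "real \<Rightarrow> real^3^3 \<Rightarrow> ennreal" where
  "D_inf g0 Q0 = (INF Q \<in> radial_class Q0. F_inf g0 Q)"

section \<open>The boundary datum\<close>

(* At the poles e is an arbitrary unit vector orthogonal to e3. *)
definition longitudinal :: "(real^3 \<Rightarrow> real^3) \<Rightarrow> bool" where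
  "longitudinal e \<longleftrightarrow>
     (\<forall>\<phi>\<in>{0<..<pi}. \<forall>\<theta>\<in>{0..<2*pi}.
        e (sph \<phi> \<theta>) = vector [cos \<phi> * cos \<theta>, cos \<phi> * sin \<theta>, - sin \<phi>]) \<and>
     (\<forall>p\<in>{e3, - e3}. norm (e p) = 1 \<and> e p \<bullet> e3 = 0)"

definition Q_phi :: "(real^3 \<Rightarrow> real^3) \<Rightarrow> real^3 \<Rightarrow> real^3^3" where
  "Q_phi e \<omega> = uniaxial (e \<omega>)"

end

theory Submission
  imports Defs "HOL-Real_Asymp.Real_Asymp"
begin

text \<open>
  Lower bound: on uniaxial tensors the energy of a radial profile is at least the variation of \<open>\<Phi> (uniaxial n) = \<kappa> * |n\<^sub>3|\<close>,
  since \<open>|grad \<Phi>| \<le> sqrt (2 * g)\<close> there. A Lipschitz extension of \<open>\<Phi>\<close> to all tensors, regularized near \<open>n\<^sub>3 = 0\<close> and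
  \<open>|n\<^sub>3| = 1\<close>, satisfies the same bound up to a large multiple of \<open>f\<close>, which \<open>\<eta> / \<xi> \<rightarrow> \<infinity>\<close> pays for. Hence
  on every ray the energy exceeds the difference of \<open>\<Phi>\<close> between \<open>Q_inf\<close> and the boundary value, which is nearly
  \<open>\<kappa> * (1 - |sin \<phi>|)\<close>.

  Upper bound: in the stereographic coordinate of the director the optimal radial profile is exponential, so multiplying an
  extension of the coordinate of the boundary datum by \<open>exp (- c * (r\<^sup>2 - 1) / (2 * \<eta>))\<close> gives a uniaxial competitor.
  The boundary datum is singular at the poles; extending it with a gradient of the order of the inverse distance to
  the poles keeps the additional energy finite.
\<close>

text \<open>In the lower bound the ray estimate is made for the smooth functions that realize the
  trace, not for \<open>Q\<close>, and only the integrated inequality passes to the limit. Closeness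
  in H1 does not control the quartic \<open>f_pot\<close>, so the bound by the potentials is applied
  to \<open>Q\<close> alone; what is carried over to the smooth functions is the square of the
  Lipschitz function \<open>G\<close>, the slope of the calibration.

  The regularization serves compactness. It makes the slope bound strict on the zero set of
  \<open>f_pot\<close>, away from \<open>Q_inf\<close>, so \<open>f_pot\<close> is bounded below
  where the bound fails without the multiple of \<open>f_pot\<close>.

  The constant \<kappa> is forced: on uniaxial tensors the squared gradient of \<kappa> |n3| is
  (\<kappa>^2 / 2) (1 - n3^2), which equals twice the potential \<open>g_pot\<close> exactly if
  \<kappa>^2 / 4 = sqrt (3/2).

  The exponent of the competitor is quadratic in r because its approximants must be smooth at the
  origin as well; (r^2 - 1) / 2 and r - 1 agree to first order at the sphere, near which the energy
  concentrates.\<close>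

section \<open>Iterated differentiability\<close>

text \<open>Closure under sums, products and composition follows by plain induction on the order,
  since the derivative of such an expression is built from functions of one order less. A direct
  coinduction on \<open>smooth\<close> would first need a class of functions closed under all these
  operations.\<close>

primrec ndiff :: "nat \<Rightarrow> ('a::euclidean_space \<Rightarrow> 'b::euclidean_space) \<Rightarrow> bool" where
  "ndiff 0 f = True"
| "ndiff (Suc n) f \<longleftrightarrow>
     (\<forall>x. f differentiable (at x)) \<and> (\<forall>v. ndiff n (\<lambda>x. frechet_derivative f (at x) v))"

text \<open>Differentiability to every finite order is inherited by directional derivatives, which
  makes it a valid invariant for the coinduction.\<close>

lemma smooth_iff_ndiff: "smooth f \<longleftrightarrow> (\<forall>n. ndiff n f)"
proof
  assume "smooth f"
  have "ndiff n f" for n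
    using \<open>smooth f\<close>
  proof (induction n arbitrary: f)
    case (Suc n)
    from Suc.prems show ?case
      by (cases rule: smooth.cases) (auto intro: Suc.IH)
  qed simp
  then show "\<forall>n. ndiff n f" ..
next
  assume "\<forall>n. ndiff n f"
  then show "smooth f"
  proof (coinduction arbitrary: f)
    case smooth
    then have "ndiff (Suc n) f" for n by blast
    then show ?case by auto
  qed
qed

lemma ndiff_Suc_D:
  assumes "ndiff (Suc n) f"
  shows "(f has_derivative frechet_derivative f (at x)) (at x)"
    and "ndiff n (\<lambda>x. frechet_derivative f (at x) v)"
  using assms by (auto simp: frechet_derivative_works[symmetric])

lemma ndiff_lower: "ndiff (Suc n) f \<Longrightarrow> ndiff n f"
proof (induction n arbitrary: f)
  case (Suc n)
  then show ?case by (metis ndiff.simps(2))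
qed simp

lemma ndiff_Suc_I:
  assumes "\<And>x. (f has_derivative f' x) (at x)" and "\<And>v. ndiff n (\<lambda>x. f' x v)"
  shows "ndiff (Suc n) f"
proof -
  have "frechet_derivative f (at x) = f' x" for x
    using frechet_derivative_at[OF assms(1)] by simp
  then show ?thesis using assms by (auto simp: differentiable_def)
qed

lemma ndiff_const: "ndiff n (\<lambda>x. c)"
proof (induction n arbitrary: c)
  case (Suc n)
  show ?case by (rule ndiff_Suc_I[OF has_derivative_const]) (rule Suc.IH)
qed simp

lemma ndiff_linear: "bounded_linear f \<Longrightarrow> ndiff n f"
proof (cases n)
  case (Suc m)
  assume "bounded_linear f"
  then show ?thesis unfolding Suc
    by (intro ndiff_Suc_I[OF bounded_linear_imp_has_derivative] ndiff_const)
qed simp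

lemma ndiff_add: "ndiff n f \<Longrightarrow> ndiff n g \<Longrightarrow> ndiff n (\<lambda>x. f x + g x)"
proof (induction n arbitrary: f g)
  case (Suc n)
  show ?case
    by (rule ndiff_Suc_I[OF has_derivative_add[OF ndiff_Suc_D(1)[OF Suc.prems(1)] ndiff_Suc_D(1)[OF Suc.prems(2)]]])
       (intro Suc.IH ndiff_Suc_D(2)[OF Suc.prems(1)] ndiff_Suc_D(2)[OF Suc.prems(2)])
qed simp

lemma ndiff_bilinear:
  assumes "bounded_bilinear pr" and "ndiff n f" and "ndiff n g"
  shows "ndiff n (\<lambda>x. pr (f x) (g x))"
  using assms(2,3)
proof (induction n arbitrary: f g)
  case (Suc n)
  show ?case
    by (rule ndiff_Suc_I[OF bounded_bilinear.FDERIV[OF assms(1) ndiff_Suc_D(1)[OF Suc.prems(1)] ndiff_Suc_D(1)[OF Suc.prems(2)]]])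
       (intro ndiff_add Suc.IH ndiff_Suc_D(2)[OF Suc.prems(1)] ndiff_Suc_D(2)[OF Suc.prems(2)]
          ndiff_lower[OF Suc.prems(1)] ndiff_lower[OF Suc.prems(2)])
qed simp

lemmas ndiff_mult = ndiff_bilinear[OF bounded_bilinear_mult]
  and ndiff_scaleR = ndiff_bilinear[OF bounded_bilinear_scaleR]
  and ndiff_inner = ndiff_bilinear[OF bounded_bilinear_inner]

lemma ndiff_linear_compose:
  assumes "bounded_linear h" "ndiff n f" shows "ndiff n (\<lambda>x. h (f x))"
  using assms(2)
proof (induction n arbitrary: f)
  case (Suc n)
  show ?case
    by (rule ndiff_Suc_I[OF bounded_linear.has_derivative[OF assms(1) ndiff_Suc_D(1)[OF Suc.prems]]])
       (intro Suc.IH ndiff_Suc_D(2)[OF Suc.prems])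
qed simp

lemma ndiff_minus: "ndiff n f \<Longrightarrow> ndiff n (\<lambda>x. - f x)"
  by (rule ndiff_linear_compose[OF bounded_linear_minus[OF bounded_linear_ident]])

lemma ndiff_diff: "ndiff n f \<Longrightarrow> ndiff n g \<Longrightarrow> ndiff n (\<lambda>x. f x - g x)"
  using ndiff_add[OF _ ndiff_minus, of n f g] by simp

lemma ndiff_power: "ndiff n f \<Longrightarrow> ndiff n (\<lambda>x. f x ^ k)" for f :: "_ \<Rightarrow> real"
  by (induction k) (simp_all add: ndiff_const ndiff_mult)

lemma ndiff_prod:
  "(\<And>i. i \<in> I \<Longrightarrow> ndiff n (f i)) \<Longrightarrow> ndiff n (\<lambda>x. \<Prod>i\<in>I. f i x :: real)"
  by (induction I rule: infinite_finite_induct) (simp_all add: ndiff_const ndiff_mult)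

lemma ndiff_compose_real:
  fixes h :: "real \<Rightarrow> 'b::euclidean_space" and f :: "'a::euclidean_space \<Rightarrow> real"
  assumes "ndiff n h" "ndiff n f" shows "ndiff n (\<lambda>x. h (f x))"
  using assms
proof (induction n arbitrary: h)
  case (Suc n)
  \<comment> \<open>With a real argument the derivative is determined by its value at 1. The chain
    rule thus becomes a product whose factors have one order less, and the induction applies to
    them.\<close>
  have lin: "frechet_derivative h (at y) t = t *\<^sub>R frechet_derivative h (at y) 1" for y t
  proof -
    have "linear (frechet_derivative h (at y))"
      using linear_frechet_derivative[of h "at y"] Suc.prems(1) by simp
    from linear_scale[OF this, of t 1] show ?thesis by simp
  qed
  have "((\<lambda>x. h (f x)) has_derivative
      (\<lambda>v. frechet_derivative f (at x) v *\<^sub>R frechet_derivative h (at (f x)) 1)) (at x)" for x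
    using has_derivative_compose[OF ndiff_Suc_D(1)[OF Suc.prems(2)] ndiff_Suc_D(1)[OF Suc.prems(1)]]
    by (subst (asm) lin) simp
  then show ?case
    by (rule ndiff_Suc_I)
       (intro ndiff_scaleR ndiff_Suc_D(2)[OF Suc.prems(2)] Suc.IH ndiff_Suc_D(2)[OF Suc.prems(1)] ndiff_lower[OF Suc.prems(2)])
qed simp

lemma ndiff_real_I:
  fixes h h' :: "real \<Rightarrow> real"
  assumes "\<And>x. (h has_real_derivative h' x) (at x)" "ndiff n h'"
  shows "ndiff (Suc n) h"
  by (rule ndiff_Suc_I[OF assms(1)[unfolded has_field_derivative_def]])
     (intro ndiff_mult assms(2) ndiff_const)

lemma ndiff_exp:
  assumes "ndiff n f" shows "ndiff n (\<lambda>x. exp (f x :: real))"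
proof (rule ndiff_compose_real[OF _ assms])
  show "ndiff n (exp :: real \<Rightarrow> real)"
    by (induction n) (simp, rule ndiff_real_I[OF DERIV_exp])
qed

lemma ndiff_inverse:
  fixes f :: "'a::euclidean_space \<Rightarrow> real"
  assumes "ndiff n f" "\<And>x. f x \<noteq> 0" shows "ndiff n (\<lambda>x. inverse (f x))"
  using assms(1)
proof (induction n)
  case (Suc n)
  show ?case
    by (rule ndiff_Suc_I[OF Deriv.has_derivative_inverse[OF assms(2) ndiff_Suc_D(1)[OF Suc.prems]]])
       (intro ndiff_minus ndiff_mult Suc.IH ndiff_Suc_D(2)[OF Suc.prems] ndiff_lower[OF Suc.prems])
qed simp

text \<open>The derivative contains the reciprocal of the root itself, so the induction hypothesis
  at the lower order, passed through \<open>ndiff_inverse\<close>, supplies it.\<close>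

lemma ndiff_sqrt:
  fixes f :: "'a::euclidean_space \<Rightarrow> real"
  assumes "ndiff n f" "\<And>x. f x > 0" shows "ndiff n (\<lambda>x. sqrt (f x))"
  using assms(1)
proof (induction n)
  case (Suc n)
  have "((\<lambda>x. sqrt (f x)) has_derivative
     (\<lambda>v. frechet_derivative f (at x) v * (inverse (sqrt (f x)) / 2))) (at x)" for x
    by (rule DERIV_compose_FDERIV[OF DERIV_real_sqrt[OF assms(2)] ndiff_Suc_D(1)[OF Suc.prems]])
  then show ?case
  proof (rule ndiff_Suc_I)
    fix v
    have "sqrt (f x) \<noteq> 0" for x using assms(2)[of x] by simp
    then have "ndiff n (\<lambda>x. inverse (sqrt (f x)))"
      by (intro ndiff_inverse Suc.IH ndiff_lower[OF Suc.prems])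
    then show "ndiff n (\<lambda>x. frechet_derivative f (at x) v * (inverse (sqrt (f x)) / 2))"
      unfolding divide_inverse[of _ "2::real"]
      by (intro ndiff_mult ndiff_Suc_D(2)[OF Suc.prems] ndiff_const)
  qed
qed simp

lemma smooth_derivative:
  assumes "smooth f"
  shows "(f has_derivative frechet_derivative f (at x)) (at x)"
    and "continuous_on S f" and "continuous_on S (\<lambda>x. frechet_derivative f (at x) v)"
proof -
  have *: "ndiff (Suc n) f" for n using assms smooth_iff_ndiff by blast
  show 1: "(f has_derivative frechet_derivative f (at x)) (at x)" for x
    using ndiff_Suc_D(1)[OF *] .
  show "continuous_on S f" 
    using has_derivative_continuous[OF 1] by (simp add: continuous_at_imp_continuous_on)
  have "(\<lambda>x. frechet_derivative f (at x) v) differentiable (at x)" for x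
    using *[of 1] by simp
  then show "continuous_on S (\<lambda>x. frechet_derivative f (at x) v)"
    by (meson continuous_at_imp_continuous_on differentiable_imp_continuous_within)
qed

section \<open>Bump functions\<close>

text \<open>The powers of \<open>inverse t\<close> are there to close the family under
  differentiation: the derivative of a member is a linear combination of members.
  \<open>bump 0\<close> is the classical flat function.\<close>

definition bump :: "nat \<Rightarrow> real \<Rightarrow> real" where
  "bump m t = (if t > 0 then inverse t ^ m * exp (- inverse t) else 0)"

lemma bump_nonneg: "bump m t \<ge> 0"
  by (simp add: bump_def)

lemma bump_pos: "t > 0 \<Longrightarrow> bump m t > 0"
  by (simp add: bump_def)

lemma bump_zero: "t \<le> 0 \<Longrightarrow> bump m t = 0"
  by (simp add: bump_def)

lemma bump_le_1: "bump 0 t \<le> 1"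
  by (simp add: bump_def)

lemma bump_deriv:
  "(bump m has_real_derivative (bump (m+2) t - real m * bump (m+1) t)) (at t)"
proof (cases t "0::real" rule: linorder_cases)
  case less
  have "(bump m has_real_derivative 0) (at t)"
    by (rule has_field_derivative_transform_within_open[where f="\<lambda>_. 0" and S="{..<0}"])
       (use less in \<open>auto simp: bump_def\<close>)
  then show ?thesis using less by (simp add: bump_def)
next
  case greater
  have "((\<lambda>t. inverse t ^ m * exp (- inverse t)) has_real_derivative
      (bump (m+2) t - real m * bump (m+1) t)) (at t)"
    using greater
    by (auto intro!: derivative_eq_intros simp: bump_def field_simps power2_eq_square)
       (cases m; simp add: field_simps)
  then show ?thesis
    by (rule has_field_derivative_transform_within_open[where S="{0<..}"])
       (use greater in \<open>auto simp: bump_def\<close>)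
next
  case equal
  \<comment> \<open>This is the difference quotient at 0 from the right: dividing by t raises the
    power by one, and the exponential still wins.\<close>
  have lim: "((\<lambda>t. inverse t ^ Suc m * exp (- inverse t)) \<longlongrightarrow> 0) (at_right (0::real))"
    using filterlim_compose[OF tendsto_power_div_exp_0[of "Suc m"] filterlim_inverse_at_top_right]
    by (simp add: exp_minus divide_inverse)
  have "((\<lambda>y. (bump m y - bump m 0) / (y - 0)) \<longlongrightarrow> 0) (at 0)"
  proof (rule filterlim_split_at)
    show "((\<lambda>y. (bump m y - bump m 0) / (y - 0)) \<longlongrightarrow> 0) (at_left 0)"
      by (rule tendsto_eventually, rule eventually_at_leftI[of "-1"]) (auto simp: bump_def)
    show "((\<lambda>y. (bump m y - bump m 0) / (y - 0)) \<longlongrightarrow> 0) (at_right 0)"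
      by (rule Lim_transform_eventually[OF lim], rule eventually_at_rightI[of _ 1])
         (auto simp: bump_def field_simps)
  qed
  then show ?thesis using equal
    by (simp add: has_field_derivative_iff bump_def)
qed

lemma ndiff_bump:
  assumes "ndiff n f" shows "ndiff n (\<lambda>x. bump m (f x))"
proof (rule ndiff_compose_real[OF _ assms])
  show "ndiff n (bump m)"
  proof (induction n arbitrary: m)
    case (Suc n)
    show ?case
      by (rule ndiff_real_I[OF bump_deriv]) (intro ndiff_diff ndiff_mult ndiff_const Suc.IH)
  qed simp
qed

section \<open>Weak derivatives\<close>

lemma bounded_of_compact_support:
  fixes g :: "'a::euclidean_space \<Rightarrow> 'b::real_normed_vector"
  assumes "continuous_on UNIV g" "compact K" "\<And>x. x \<notin> K \<Longrightarrow> g x = 0"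
  obtains M where "M > 0" "\<And>x. norm (g x) \<le> M"
proof -
  have "compact (g ` K)"
    using assms by (intro compact_continuous_image) (auto intro: continuous_on_subset)
  then obtain M where M: "M > 0" "\<And>x. x \<in> K \<Longrightarrow> norm (g x) \<le> M"
    by (force dest: compact_imp_bounded simp: bounded_pos)
  have "norm (g x) \<le> M" for x
    using M assms(3)[of x] by (cases "x \<in> K") auto
  with M show thesis using that by blast
qed

lemma frechet_derivative_zero:
  assumes "open S" "x \<in> S" "\<And>y. y \<in> S \<Longrightarrow> f y = 0"
  shows "frechet_derivative f (at x) = (\<lambda>v. 0)"
proof -
  have "(f has_derivative (\<lambda>v. 0)) (at x)"
    by (rule has_derivative_transform_within_open[OF has_derivative_const assms(1,2)]) (simp add: assms(3))
  then show ?thesis using frechet_derivative_at by metis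
qed

lemma test_fun_support:
  assumes "test_fun U \<psi>"
  obtains K where "compact K" "K \<subseteq> U" "\<And>x. x \<notin> K \<Longrightarrow> \<psi> x = 0"
    "\<And>x v. x \<notin> K \<Longrightarrow> frechet_derivative \<psi> (at x) v = 0"
proof (rule that[of "closure {x. \<psi> x \<noteq> 0}"])
  let ?K = "closure {x. \<psi> x \<noteq> 0}"
  show "compact ?K" "?K \<subseteq> U" using assms by (auto simp: test_fun_def)
  show z: "\<psi> x = 0" if "x \<notin> ?K" for x
    using that closure_subset[of "{x. \<psi> x \<noteq> 0}"] by blast
  show "frechet_derivative \<psi> (at x) v = 0" if "x \<notin> ?K" for x v
    using frechet_derivative_zero[of "- ?K" x \<psi>] that z by (metis ComplD ComplI closed_closure open_Compl)
qed

lemma has_derivative_imp_seq_quotient: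
  assumes "(f has_derivative f') (at x)" "norm b = 1"
  shows "(\<lambda>n. real (Suc n) *\<^sub>R (f (x + (1 / real (Suc n)) *\<^sub>R b) - f x)) \<longlonglongrightarrow> f' b"
proof -
  define y where "y n = x + (1 / real (Suc n)) *\<^sub>R b" for n
  have lin: "bounded_linear f'" and
    lim: "((\<lambda>y. norm (f y - f x - f' (y - x)) / norm (y - x)) \<longlongrightarrow> 0) (at x)"
    using assms(1) by (auto simp: has_derivative_iff_norm)
  have yx: "y n - x = (1 / real (Suc n)) *\<^sub>R b" "norm (y n - x) = 1 / real (Suc n)" for n
    using assms(2) by (auto simp: y_def)
  have "y \<longlonglongrightarrow> x"
  proof (rule Lim_null[THEN iffD2], rule tendsto_norm_zero_cancel)
    show "(\<lambda>n. norm (y n - x)) \<longlonglongrightarrow> 0"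
      unfolding yx(2) using LIMSEQ_inverse_real_of_nat by (simp add: inverse_eq_divide)
  qed
  moreover have "y n \<noteq> x" for n using yx(2)[of n] by auto
  ultimately have "filterlim y (at x) sequentially"
    by (simp add: filterlim_at)
  from filterlim_compose[OF lim this]
  have "(\<lambda>n. norm (f (y n) - f x - f' (y n - x)) / norm (y n - x)) \<longlonglongrightarrow> 0" .
  moreover have "norm (f (y n) - f x - f' (y n - x)) / norm (y n - x)
      = norm (real (Suc n) *\<^sub>R (f (y n) - f x) - f' b)" for n
  proof -
    have "f' (y n - x) = (1 / real (Suc n)) *\<^sub>R f' b"
      unfolding yx(1) using linear_scale[OF bounded_linear.linear[OF lin]] .
    then have "real (Suc n) *\<^sub>R (f (y n) - f x) - f' b
      = real (Suc n) *\<^sub>R (f (y n) - f x - f' (y n - x))"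
      by (simp add: algebra_simps)
    then have "norm (real (Suc n) *\<^sub>R (f (y n) - f x) - f' b) =
       real (Suc n) * norm (f (y n) - f x - f' (y n - x))" by simp
    then show ?thesis unfolding yx(2) by simp
  qed
  ultimately show ?thesis
    unfolding y_def by (simp add: tendsto_norm_zero_iff Lim_null[symmetric])
qed

text \<open>By translation invariance the difference quotients in direction \<open>b\<close> have
  integral zero; dominated convergence passes this on to the derivative, without splitting off the
  variable \<open>b\<close> by Fubini.\<close>

lemma integral_derivative_zero:
  fixes f :: "'a::euclidean_space \<Rightarrow> 'b::euclidean_space"
  assumes der: "\<And>x. (f has_derivative f' x) (at x)"
    and cont: "continuous_on UNIV (\<lambda>x. f' x b)"
    and b: "b \<in> Basis" and K: "compact K" "\<And>x. x \<notin> K \<Longrightarrow> f x = 0"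
  shows "(LINT x|lborel. f' x b) = 0"
proof -
  have fcont: "continuous_on UNIV f"
    using has_derivative_continuous[OF der] by (simp add: continuous_at_imp_continuous_on)
  have z: "f' x b = 0" if "x \<notin> K" for x
  proof -
    have "frechet_derivative f (at x) = (\<lambda>v. 0)"
      using frechet_derivative_zero[of "- K" x f] that K compact_imp_closed by blast
    then show ?thesis using frechet_derivative_at[OF der] by metis
  qed
  obtain M where M: "M > 0" "\<And>x. norm (f' x b) \<le> M"
    using bounded_of_compact_support[OF cont K(1) z] by blast
  obtain R where R: "R > 0" "\<And>x. x \<in> K \<Longrightarrow> norm x \<le> R"
    using compact_imp_bounded[OF K(1)] by (auto simp: bounded_pos)
  define t where "t n = 1 / real (Suc n)" for n
  define g where "g n x = real (Suc n) *\<^sub>R (f (x + t n *\<^sub>R b) - f x)" for n x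
  have t: "t n > 0" "t n \<le> 1" "real (Suc n) * t n = 1" for n by (auto simp: t_def)
  have nb: "norm b = 1" using b by simp
  have intf: "integrable lborel f"
  proof -
    have "indicator K x *\<^sub>R f x = f x" for x using K(2) by (auto simp: indicator_def)
    then show ?thesis
      using borel_integrable_compact[OF K(1) continuous_on_subset[OF fcont subset_UNIV]] by simp
  qed
  \<comment> \<open>The increments \<open>t n\<close> are at most 1, so all quotients vanish outside
    the ball of radius R + 1; inside it the mean value inequality gives the bound M.\<close>
  have bnd: "norm (g n x) \<le> M * indicator (cball 0 (R + 1)) x" for n x
  proof (cases "x \<in> cball 0 (R + 1)")
    case True
    have der': "((\<lambda>s. f (x + s *\<^sub>R b)) has_derivative (\<lambda>r. f' (x + s *\<^sub>R b) (r *\<^sub>R b))) (at s)" for s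
      by (rule has_derivative_compose[OF _ der, where f="\<lambda>s. x + s *\<^sub>R b"])
         (auto intro!: derivative_eq_intros)
    then have "continuous_on {0..t n} (\<lambda>s. f (x + s *\<^sub>R b))"
      by (meson continuous_at_imp_continuous_on has_derivative_continuous)
    from mvt_general[OF t(1) this der'] obtain s where
      "norm (f (x + t n *\<^sub>R b) - f (x + 0 *\<^sub>R b)) \<le> norm (f' (x + s *\<^sub>R b) ((t n - 0) *\<^sub>R b))"
      by blast
    also have "f' (x + s *\<^sub>R b) ((t n - 0) *\<^sub>R b) = t n *\<^sub>R f' (x + s *\<^sub>R b) b"
      using linear_scale[OF has_derivative_linear[OF der]] by simp
    also have "norm \<dots> \<le> t n * M"
      using M(2)[of "x + s *\<^sub>R b"] t(1)[of n] by simp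
    finally have "norm (f (x + t n *\<^sub>R b) - f x) \<le> t n * M" by simp
    then have "real (Suc n) * norm (f (x + t n *\<^sub>R b) - f x) \<le> real (Suc n) * (t n * M)"
      by (intro mult_left_mono) auto
    also have "\<dots> = M" using t(3)[of n] by (simp only: mult.assoc[symmetric] mult_1_left)
    finally show ?thesis using True by (simp add: g_def del: of_nat_Suc)
  next
    case False
    then have "norm x > R + 1" by simp
    moreover have "norm (t n *\<^sub>R b) \<le> 1" using nb t[of n] by simp
    moreover have "norm x \<le> norm (x + t n *\<^sub>R b) + norm (t n *\<^sub>R b)"
      by (metis add_diff_cancel_right' norm_triangle_ineq4)
    ultimately have "norm (x + t n *\<^sub>R b) > R" "norm x > R" by linarith+
    then have "x + t n *\<^sub>R b \<notin> K" "x \<notin> K" using R(2) by fastforce+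
    then show ?thesis using K(2) False by (simp add: g_def)
  qed
  have 0: "(LINT x|lborel. g n x) = 0" for n
  proof -
    have d: "distr lborel borel (\<lambda>x. t n *\<^sub>R b + x) = lborel"
      using lborel_distr_plus[of "t n *\<^sub>R b"] by simp
    have m: "f \<in> borel_measurable borel"
      using fcont by (rule borel_measurable_continuous_onI)
    have "(LINT x|lborel. f x) = (LINT x|distr lborel borel (\<lambda>x. t n *\<^sub>R b + x). f x)" by (simp only: d)
    also have "\<dots> = (LINT x|lborel. f (t n *\<^sub>R b + x))"
      by (rule integral_distr) (use m in auto)
    finally have 1: "(LINT x|lborel. f x) = (LINT x|lborel. f (t n *\<^sub>R b + x))" .
    have "integrable (distr lborel borel (\<lambda>x. t n *\<^sub>R b + x)) f" using intf by (simp only: d)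
    then have "integrable lborel (\<lambda>x. f (t n *\<^sub>R b + x))"
      by (subst (asm) integrable_distr_eq) (use m in auto)
    then show ?thesis using intf 1 by (simp add: g_def add.commute)
  qed
  have "(\<lambda>n. LINT x|lborel. g n x) \<longlonglongrightarrow> (LINT x|lborel. f' x b)"
  proof (rule integral_dominated_convergence[where w="\<lambda>x. M * indicator (cball 0 (R + 1)) x"])
    show "(\<lambda>x. f' x b) \<in> borel_measurable lborel"
      using cont by (simp add: borel_measurable_continuous_onI)
    have "continuous_on UNIV (g n)" for n
      unfolding g_def by (intro continuous_intros continuous_on_compose2[OF fcont]) auto
    then show "g n \<in> borel_measurable lborel" for n
      by (simp add: borel_measurable_continuous_onI)
    show "integrable lborel (\<lambda>x. M * indicator (cball 0 (R + 1)) x :: real)"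
      using borel_integrable_compact[OF compact_cball[of 0 "R+1"], of "\<lambda>x. M"] by (simp add: mult.commute)
    show "AE x in lborel. (\<lambda>n. g n x) \<longlonglongrightarrow> f' x b"
      using has_derivative_imp_seq_quotient[OF der nb] by (simp add: g_def t_def)
    show "AE x in lborel. norm (g n x) \<le> M * indicator (cball 0 (R + 1)) x" for n
      using bnd by simp
  qed
  then show ?thesis by (simp add: 0 LIMSEQ_const_iff)
qed

lemma integrable_test_mult:
  fixes p :: "'a::euclidean_space \<Rightarrow> real" and u :: "'a \<Rightarrow> 'b::euclidean_space"
  assumes "open U" "continuous_on UNIV p" "compact K" "K \<subseteq> U" "\<And>x. x \<notin> K \<Longrightarrow> p x = 0"
    and "locally_integrable_on u U"
  shows "integrable (lebesgue_on U) (\<lambda>x. p x *\<^sub>R u x)"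
proof -
  obtain M where M: "M > 0" "\<And>x. norm (p x) \<le> M"
    using bounded_of_compact_support[OF assms(2,3,5)] by blast
  have i: "integrable lebesgue (\<lambda>x. indicator K x *\<^sub>R u x)"
    using assms(3,4,6) by (simp add: locally_integrable_on_def set_integrable_def)
  have eq: "indicator U x *\<^sub>R p x *\<^sub>R u x = p x *\<^sub>R (indicator K x *\<^sub>R u x)" for x
    using assms(4,5) by (auto simp: indicator_def)
  have "integrable lebesgue (\<lambda>x. p x *\<^sub>R (indicator K x *\<^sub>R u x))"
  proof (rule Bochner_Integration.integrable_bound[OF integrable_scaleR_right[OF i, of M]])
    have "p \<in> borel_measurable lebesgue"
      using assms(2) by (simp add: borel_measurable_continuous_onI measurable_completion)
    with i show "(\<lambda>x. p x *\<^sub>R (indicator K x *\<^sub>R u x)) \<in> borel_measurable lebesgue"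
      using borel_measurable_scaleR borel_measurable_integrable by blast
    show "AE x in lebesgue. norm (p x *\<^sub>R (indicator K x *\<^sub>R u x)) \<le> norm (M *\<^sub>R (indicator K x *\<^sub>R u x))"
      using M by (intro AE_I2) (auto intro: mult_right_mono split: split_indicator)
  qed
  then show ?thesis
    unfolding eq[symmetric] using assms(1) by (subst integrable_restrict_space) auto
qed

lemma integrable_test:
  fixes \<psi> :: "'a::euclidean_space \<Rightarrow> real" and u :: "'a \<Rightarrow> 'b::euclidean_space"
  assumes "open U" "test_fun U \<psi>" "locally_integrable_on u U"
  shows "integrable (lebesgue_on U) (\<lambda>x. \<psi> x *\<^sub>R u x)"
    and "integrable (lebesgue_on U) (\<lambda>x. frechet_derivative \<psi> (at x) b *\<^sub>R u x)"
proof -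
  obtain K where K: "compact K" "K \<subseteq> U" "\<And>x. x \<notin> K \<Longrightarrow> \<psi> x = 0"
    "\<And>x v. x \<notin> K \<Longrightarrow> frechet_derivative \<psi> (at x) v = 0"
    using test_fun_support[OF assms(2)] by blast
  have s: "smooth \<psi>" using assms(2) by (simp add: test_fun_def)
  show "integrable (lebesgue_on U) (\<lambda>x. \<psi> x *\<^sub>R u x)"
    by (rule integrable_test_mult[OF assms(1) smooth_derivative(2)[OF s] K(1-3) assms(3)])
  show "integrable (lebesgue_on U) (\<lambda>x. frechet_derivative \<psi> (at x) b *\<^sub>R u x)"
    by (rule integrable_test_mult[OF assms(1) smooth_derivative(3)[OF s] K(1,2,4) assms(3)])
qed

lemma locally_integrable_continuous:
  assumes "continuous_on UNIV u" shows "locally_integrable_on u U"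
  unfolding locally_integrable_on_def set_integrable_def
proof (intro allI impI)
  fix K assume "compact K \<and> K \<subseteq> U"
  then have "integrable lborel (\<lambda>x. indicator K x *\<^sub>R u x)"
    using borel_integrable_compact continuous_on_subset[OF assms subset_UNIV] by blast
  then show "integrable lebesgue (\<lambda>x. indicator K x *\<^sub>R u x)"
    by (subst integrable_completion) auto
qed

lemma locally_integrable_add:
  "locally_integrable_on u U \<Longrightarrow> locally_integrable_on v U \<Longrightarrow> locally_integrable_on (\<lambda>x. u x + v x) U"
  unfolding locally_integrable_on_def by (auto intro: set_integral_add)

text \<open>Integration by parts: the product of \<open>u\<close> with a test function has compact
  support, so its derivative integrates to zero, and the product rule splits this integral.\<close>

lemma has_weak_deriv_C1:
  fixes u :: "'a::euclidean_space \<Rightarrow> 'b::euclidean_space"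
  assumes U: "open U" and b: "b \<in> Basis" and der: "\<And>x. (u has_derivative u' x) (at x)"
    and cont: "continuous_on UNIV (\<lambda>x. u' x b)"
  shows "has_weak_deriv U b u (\<lambda>x. u' x b)"
  unfolding has_weak_deriv_def
proof (intro conjI allI impI)
  have ucont: "continuous_on UNIV u"
    using has_derivative_continuous[OF der] by (simp add: continuous_at_imp_continuous_on)
  show li: "locally_integrable_on u U" "locally_integrable_on (\<lambda>x. u' x b) U"
    using ucont cont by (auto intro: locally_integrable_continuous)
  fix \<psi> :: "'a \<Rightarrow> real" assume t: "test_fun U \<psi>"
  then have s: "smooth \<psi>" by (simp add: test_fun_def)
  obtain K where K: "compact K" "K \<subseteq> U" "\<And>x. x \<notin> K \<Longrightarrow> \<psi> x = 0"
    "\<And>x v. x \<notin> K \<Longrightarrow> frechet_derivative \<psi> (at x) v = 0"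
    using test_fun_support[OF t] by blast
  let ?D = "\<lambda>x. frechet_derivative \<psi> (at x) b"
  let ?h = "\<lambda>x. \<psi> x *\<^sub>R u' x b + ?D x *\<^sub>R u x"
  have c: "continuous_on UNIV ?h"
    by (intro continuous_intros smooth_derivative s ucont cont)
  have "(LINT x|lborel. ?h x) = 0"
    by (rule integral_derivative_zero[OF has_derivative_scaleR[OF smooth_derivative(1)[OF s] der] c b K(1)])
       (simp add: K(3))
  moreover have "(LINT x|lebesgue_on U. ?h x) = (LINT x|lborel. ?h x)"
  proof -
    have "indicator U x *\<^sub>R ?h x = ?h x" for x
    proof (cases "x \<in> U")
      case False
      then have "x \<notin> K" using K(2) by auto
      then show ?thesis using K(3,4) by simp
    qed simp
    moreover have "(LINT x|lebesgue. ?h x) = (LINT x|lborel. ?h x)"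
      using c by (intro integral_completion) (simp add: borel_measurable_continuous_onI)
    ultimately show ?thesis using U by (simp add: integral_restrict_space)
  qed
  ultimately have "(LINT x|lebesgue_on U. ?h x) = 0" by simp
  then show "(LINT x|lebesgue_on U. ?D x *\<^sub>R u x) = - (LINT x|lebesgue_on U. \<psi> x *\<^sub>R u' x b)"
    using integrable_test[OF U t li(1)] integrable_test[OF U t li(2)]
    by (simp add: eq_neg_iff_add_eq_0 add.commute)
qed

lemma has_weak_deriv_add:
  assumes U: "open U" and "has_weak_deriv U b u1 v1" "has_weak_deriv U b u2 v2"
  shows "has_weak_deriv U b (\<lambda>x. u1 x + u2 x) (\<lambda>x. v1 x + v2 x)"
  unfolding has_weak_deriv_def
proof (intro conjI allI impI)
  have l: "locally_integrable_on u1 U" "locally_integrable_on v1 U"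
     "locally_integrable_on u2 U" "locally_integrable_on v2 U"
    using assms(2,3) by (auto simp: has_weak_deriv_def)
  then show "locally_integrable_on (\<lambda>x. u1 x + u2 x) U" "locally_integrable_on (\<lambda>x. v1 x + v2 x) U"
    by (auto intro: locally_integrable_add)
  fix \<psi> :: "'a \<Rightarrow> real" assume t: "test_fun U \<psi>"
  have "(LINT x|lebesgue_on U. frechet_derivative \<psi> (at x) b *\<^sub>R u1 x) = - (LINT x|lebesgue_on U. \<psi> x *\<^sub>R v1 x)"
    "(LINT x|lebesgue_on U. frechet_derivative \<psi> (at x) b *\<^sub>R u2 x) = - (LINT x|lebesgue_on U. \<psi> x *\<^sub>R v2 x)"
    using t assms(2,3) unfolding has_weak_deriv_def by blast+
  then show "(LINT x|lebesgue_on U. frechet_derivative \<psi> (at x) b *\<^sub>R (u1 x + u2 x))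
     = - (LINT x|lebesgue_on U. \<psi> x *\<^sub>R (v1 x + v2 x))"
    using integrable_test(2)[OF U t l(1), of b] integrable_test(1)[OF U t l(2)]
      integrable_test(2)[OF U t l(3), of b] integrable_test(1)[OF U t l(4)]
    by (simp add: scaleR_add_right)
qed

lemma has_weak_deriv_shift:
  fixes u v :: "'a::euclidean_space \<Rightarrow> 'b::euclidean_space"
  assumes "open U" "b \<in> Basis"
  shows "has_weak_deriv U b (\<lambda>x. u x - c) v \<longleftrightarrow> has_weak_deriv U b u v"
proof -
  have *: "has_weak_deriv U b (\<lambda>x. d) (\<lambda>x. 0)" for d :: 'b
    by (rule has_weak_deriv_C1[OF assms, where u'="\<lambda>x v. 0"]) auto
  show ?thesis
    using has_weak_deriv_add[OF assms(1) _ *, of "\<lambda>x. u x - c" v c]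
      has_weak_deriv_add[OF assms(1) _ *, of u v "- c"] by auto
qed

lemma weak_deriv_shift:
  assumes "open U" "b \<in> Basis"
  shows "weak_deriv U b (\<lambda>x. u x - c) = weak_deriv U b u"
  unfolding weak_deriv_def has_weak_deriv_shift[OF assms] ..

text \<open>Dominated convergence on both sides of the integration by parts. Pointwise convergence
  on \<open>U\<close> and one locally integrable bound suffice, so the limit may be singular at
  boundary points of \<open>U\<close>, as the competitor is at the poles.\<close>

lemma has_weak_deriv_limit:
  fixes u :: "'a::euclidean_space \<Rightarrow> 'b::euclidean_space" and d :: "'a \<Rightarrow> real"
  assumes U: "open U" and w: "\<And>k. has_weak_deriv U b (w k) (v k)"
    and d: "locally_integrable_on d U"
    and lim: "\<And>x. x \<in> U \<Longrightarrow> (\<lambda>k. w k x) \<longlonglongrightarrow> u x" "\<And>x. x \<in> U \<Longrightarrow> (\<lambda>k. v k x) \<longlonglongrightarrow> z x"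
    and bnd: "\<And>k x. x \<in> U \<Longrightarrow> norm (w k x) \<le> d x" "\<And>k x. x \<in> U \<Longrightarrow> norm (v k x) \<le> d x"
  shows "has_weak_deriv U b u z"
proof -
  have li: "locally_integrable_on s U"
    if s: "\<And>k. locally_integrable_on (r k) U" "\<And>x. x \<in> U \<Longrightarrow> (\<lambda>k. r k x) \<longlonglongrightarrow> s x"
      "\<And>k x. x \<in> U \<Longrightarrow> norm (r k x) \<le> d x" for r :: "nat \<Rightarrow> 'a \<Rightarrow> 'b" and s
    unfolding locally_integrable_on_def set_integrable_def
  proof (intro allI impI)
    fix K assume K: "compact K \<and> K \<subseteq> U"
    have m: "(\<lambda>x. indicator K x *\<^sub>R r k x) \<in> borel_measurable lebesgue" for k
      using s(1)[of k] K by (auto simp: locally_integrable_on_def set_integrable_def)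
    have di: "integrable lebesgue (\<lambda>x. indicator K x *\<^sub>R d x)"
      using d K by (auto simp: locally_integrable_on_def set_integrable_def)
    have l: "(\<lambda>k. indicator K x *\<^sub>R r k x) \<longlonglongrightarrow> indicator K x *\<^sub>R s x" for x
      using s(2)[of x] K by (cases "x \<in> K") auto
    show "integrable lebesgue (\<lambda>x. indicator K x *\<^sub>R s x)"
      by (rule integrable_dominated_convergence[where s="\<lambda>k x. indicator K x *\<^sub>R r k x",
            OF borel_measurable_LIMSEQ_metric[OF m l] m di])
         (use l s(3) K in \<open>auto intro!: AE_I2 split: split_indicator\<close>)
  qed
  have lu: "locally_integrable_on u U" and lz: "locally_integrable_on z U"
    using li[of w u] li[of v z] w lim bnd by (auto simp: has_weak_deriv_def)
  have conv: "(\<lambda>k. LINT x|lebesgue_on U. p x *\<^sub>R r k x) \<longlonglongrightarrow> (LINT x|lebesgue_on U. p x *\<^sub>R s x)"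
    if "continuous_on UNIV p" "compact K" "K \<subseteq> U" "\<And>x. x \<notin> K \<Longrightarrow> p x = 0"
      "\<And>k. locally_integrable_on (r k) U" "locally_integrable_on s U" "\<And>x. x \<in> U \<Longrightarrow> (\<lambda>k. r k x) \<longlonglongrightarrow> s x"
      "\<And>k x. x \<in> U \<Longrightarrow> norm (r k x) \<le> d x" for p :: "'a \<Rightarrow> real" and r :: "nat \<Rightarrow> 'a \<Rightarrow> 'b" and s K
  proof (rule integral_dominated_convergence[where w="\<lambda>x. \<bar>p x\<bar> *\<^sub>R d x"])
    show "integrable (lebesgue_on U) (\<lambda>x. \<bar>p x\<bar> *\<^sub>R d x)"
      by (rule integrable_test_mult[OF U _ that(2,3) _ d]) (use that in \<open>auto intro: continuous_intros\<close>)
    show "(\<lambda>x. p x *\<^sub>R s x) \<in> borel_measurable (lebesgue_on U)"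
      "(\<lambda>x. p x *\<^sub>R r k x) \<in> borel_measurable (lebesgue_on U)" for k
      using integrable_test_mult[OF U that(1-4)] that(5,6) borel_measurable_integrable by blast+
    show "AE x in lebesgue_on U. (\<lambda>k. p x *\<^sub>R r k x) \<longlonglongrightarrow> p x *\<^sub>R s x"
      using that(7) by (intro AE_I2 tendsto_intros) (auto simp: space_restrict_space)
    show "AE x in lebesgue_on U. norm (p x *\<^sub>R r k x) \<le> \<bar>p x\<bar> *\<^sub>R d x" for k
      using that(8) by (intro AE_I2) (auto simp: space_restrict_space mult_left_mono)
  qed
  show ?thesis
    unfolding has_weak_deriv_def
  proof (intro conjI allI impI lu lz)
    fix \<psi> :: "'a \<Rightarrow> real" assume t: "test_fun U \<psi>"
    then have s: "smooth \<psi>" by (simp add: test_fun_def)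
    obtain K where K: "compact K" "K \<subseteq> U" "\<And>x. x \<notin> K \<Longrightarrow> \<psi> x = 0"
      "\<And>x v. x \<notin> K \<Longrightarrow> frechet_derivative \<psi> (at x) v = 0"
      using test_fun_support[OF t] by blast
    have lw: "locally_integrable_on (w k) U" "locally_integrable_on (v k) U" for k
      using w by (auto simp: has_weak_deriv_def)
    note c1 = conv[OF smooth_derivative(3)[OF s] K(1,2) K(4) lw(1) lu lim(1) bnd(1)]
    note c2 = conv[OF smooth_derivative(2)[OF s] K(1-3) lw(2) lz lim(2) bnd(2)]
    have "(LINT x|lebesgue_on U. frechet_derivative \<psi> (at x) b *\<^sub>R w k x)
       = - (LINT x|lebesgue_on U. \<psi> x *\<^sub>R v k x)" for k
      using w t by (auto simp: has_weak_deriv_def)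
    then show "(LINT x|lebesgue_on U. frechet_derivative \<psi> (at x) b *\<^sub>R u x)
       = - (LINT x|lebesgue_on U. \<psi> x *\<^sub>R z x)"
      using LIMSEQ_unique[OF c1, of b] tendsto_minus[OF c2] by simp
  qed
qed

section \<open>Uniqueness of weak derivatives\<close>

definition box_bump :: "'a::euclidean_space \<Rightarrow> 'a \<Rightarrow> nat \<Rightarrow> 'a \<Rightarrow> real" where
  "box_bump l h n x = (\<Prod>b\<in>Basis. bump 0 (real (Suc n) * (x \<bullet> b - l \<bullet> b)) * bump 0 (real (Suc n) * (h \<bullet> b - x \<bullet> b)))"

lemma box_bump_zero: "x \<notin> box l h \<Longrightarrow> box_bump l h n x = 0"
  by (force simp: box_bump_def mem_box prod_zero_iff not_less intro!: bump_zero mult_nonneg_nonpos)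

lemma box_bump_bounds: "0 \<le> box_bump l h n x" "box_bump l h n x \<le> 1"
  unfolding box_bump_def
  by (auto intro!: prod_nonneg prod_le_1 mult_nonneg_nonneg bump_nonneg mult_le_one bump_le_1)

lemma box_bump_lim: "x \<in> box l h \<Longrightarrow> (\<lambda>n. box_bump l h n x) \<longlonglongrightarrow> 1"
proof -
  assume x: "x \<in> box l h"
  have *: "(\<lambda>n. bump 0 (real (Suc n) * t)) \<longlonglongrightarrow> 1" if "t > 0" for t
  proof -
    have "(\<lambda>n. exp (- (inverse (real (Suc n)) * inverse t))) \<longlonglongrightarrow> exp (- (0 * inverse t))"
      by (intro tendsto_intros LIMSEQ_inverse_real_of_nat)
    moreover have "bump 0 (real (Suc n) * t) = exp (- (inverse (real (Suc n)) * inverse t))" for n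
      using that by (simp add: bump_def del: of_nat_Suc)
    ultimately show ?thesis by simp
  qed
  have "(\<lambda>n. box_bump l h n x) \<longlonglongrightarrow> (\<Prod>b\<in>(Basis::'a set). 1 * 1)"
    unfolding box_bump_def using x by (intro tendsto_prod tendsto_mult *) (auto simp: mem_box)
  then show ?thesis by simp
qed

lemma test_fun_box_bump:
  assumes "cbox l h \<subseteq> U"
  shows "test_fun U (box_bump l h n)"
proof -
  have "closure {x. box_bump l h n x \<noteq> 0} \<subseteq> cbox l h"
    by (rule closure_minimal) (use box_bump_zero box_subset_cbox[of l h] in blast, rule closed_cbox)
  moreover from this have "compact (closure {x. box_bump l h n x \<noteq> 0})"
    by (meson bounded_cbox bounded_subset closed_closure compact_eq_bounded_closed)
  moreover have "ndiff m (box_bump l h n)" for m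
    unfolding box_bump_def[abs_def]
    by (intro ndiff_prod ndiff_mult ndiff_bump ndiff_diff ndiff_const ndiff_linear bounded_linear_inner_left)
  ultimately show ?thesis using assms by (auto simp: test_fun_def smooth_iff_ndiff)
qed

text \<open>The functions \<open>box_bump\<close> are admissible tests that tend to the indicator of
  the open box, so testing against them yields the integral over the box in the limit.\<close>

lemma integral_zero_of_test:
  fixes d :: "'a::euclidean_space \<Rightarrow> 'b::euclidean_space"
  assumes U: "open U" and d: "locally_integrable_on d U"
    and zero: "\<And>\<psi>::'a \<Rightarrow> real. test_fun U \<psi> \<Longrightarrow> (LINT x|lebesgue_on U. \<psi> x *\<^sub>R d x) = 0"
    and box: "cbox l h \<subseteq> U"
  shows "d integrable_on cbox l h" "integral (cbox l h) d = 0"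
proof -
  have i: "set_integrable lebesgue (cbox l h) d"
    using d box by (auto simp: locally_integrable_on_def)
  then show "d integrable_on cbox l h" by (rule set_lebesgue_integral_eq_integral)
  have ib: "set_integrable lebesgue (box l h) d"
    by (rule set_integrable_subset[OF i]) (auto simp: box_subset_cbox)
  have "(\<lambda>n. LINT x|lebesgue. indicator U x *\<^sub>R box_bump l h n x *\<^sub>R d x)
      \<longlonglongrightarrow> (LINT x|lebesgue. indicator (box l h) x *\<^sub>R d x)"
  proof (rule integral_dominated_convergence[where w="\<lambda>x. norm (indicator (cbox l h) x *\<^sub>R d x)"])
    show "integrable lebesgue (\<lambda>x. norm (indicator (cbox l h) x *\<^sub>R d x))"
      using i by (simp only: set_integrable_def integrable_norm)
    show "(\<lambda>x. indicator (box l h) x *\<^sub>R d x) \<in> borel_measurable lebesgue"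
      using ib unfolding set_integrable_def by (rule borel_measurable_integrable)
    show "(\<lambda>x. indicator U x *\<^sub>R box_bump l h n x *\<^sub>R d x) \<in> borel_measurable lebesgue" for n
      using integrable_test(1)[OF U test_fun_box_bump[OF box] d] U
      by (subst (asm) integrable_restrict_space) auto
    show "AE x in lebesgue. (\<lambda>n. indicator U x *\<^sub>R box_bump l h n x *\<^sub>R d x) \<longlonglongrightarrow> indicator (box l h) x *\<^sub>R d x"
    proof (rule AE_I2)
      fix x show "(\<lambda>n. indicator U x *\<^sub>R box_bump l h n x *\<^sub>R d x) \<longlonglongrightarrow> indicator (box l h) x *\<^sub>R d x"
      proof (cases "x \<in> box l h")
        case True
        then have "x \<in> U" using box box_subset_cbox by blast
        then show ?thesis using True tendsto_scaleR[OF box_bump_lim[OF True] tendsto_const] by simp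
      qed (simp add: box_bump_zero)
    qed
    show "AE x in lebesgue. norm (indicator U x *\<^sub>R box_bump l h n x *\<^sub>R d x) \<le> norm (indicator (cbox l h) x *\<^sub>R d x)" for n
    proof (rule AE_I2)
      fix x show "norm (indicator U x *\<^sub>R box_bump l h n x *\<^sub>R d x) \<le> norm (indicator (cbox l h) x *\<^sub>R d x)"
      proof (cases "x \<in> box l h")
        case True
        then have "x \<in> cbox l h" using box_subset_cbox by blast
        then show ?thesis using box_bump_bounds[of l h n x]
          by (auto split: split_indicator intro!: mult_left_le_one_le)
      qed (simp add: box_bump_zero)
    qed
  qed
  moreover have "(LINT x|lebesgue. indicator U x *\<^sub>R box_bump l h n x *\<^sub>R d x) = 0" for n
    using zero[OF test_fun_box_bump[OF box], of n] U by (simp add: integral_restrict_space)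
  ultimately have "(LINT x|lebesgue. indicator (box l h) x *\<^sub>R d x) = 0"
    by (simp add: LIMSEQ_const_iff)
  then have "integral (box l h) d = 0"
    using set_lebesgue_integral_eq_integral(2)[OF ib] by (simp add: set_lebesgue_integral_def)
  then show "integral (cbox l h) d = 0" by (simp add: integral_open_interval)
qed

text \<open>Lebesgue differentiation: almost everywhere the value is the limit of the averages over
  small cubes with lowest corner at the point, and all these averages vanish.\<close>

lemma negligible_of_zero_integrals:
  fixes d :: "'a::euclidean_space \<Rightarrow> 'b::euclidean_space"
  assumes d: "set_integrable lebesgue (cbox L H) d"
    and zero: "\<And>l h. cbox l h \<subseteq> cbox L H \<Longrightarrow> integral (cbox l h) d = 0"
  shows "negligible {x \<in> cbox L H. d x \<noteq> 0}"
proof -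
  define f where "f x = indicator (cbox L H) x *\<^sub>R d x" for x
  have "set_integrable lebesgue UNIV f"
    using d by (simp add: f_def set_integrable_def)
  then have "f integrable_on UNIV" by (rule set_lebesgue_integral_eq_integral)
  then have "f integrable_on cbox a b" for a b using integrable_on_subcbox by blast
  then obtain N where N: "negligible N"
    "\<And>x e. \<lbrakk>x \<notin> N; 0 < e\<rbrakk> \<Longrightarrow> \<exists>d>0. \<forall>h. 0 < h \<and> h < d \<longrightarrow>
        norm (integral (cbox x (x + h *\<^sub>R One)) f /\<^sub>R h ^ DIM('a) - f x) < e"
    using integrable_ccontinuous_explicit[of f] by metis
  have z: "d x = 0" if x: "x \<in> box L H" "x \<notin> N" for x
  proof (rule ccontr)
    assume "d x \<noteq> 0"
    have fx: "f x = d x" using subsetD[OF box_subset_cbox x(1)] by (simp add: f_def)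
    obtain \<delta> where \<delta>: "\<delta> > 0" "\<And>h. 0 < h \<and> h < \<delta> \<Longrightarrow>
        norm (integral (cbox x (x + h *\<^sub>R One)) f /\<^sub>R h ^ DIM('a) - f x) < norm (d x)"
      using N(2)[OF x(2), of "norm (d x)"] \<open>d x \<noteq> 0\<close> by auto
    obtain r where r: "r > 0" "ball x r \<subseteq> box L H"
      using x(1) open_box open_contains_ball by blast
    \<comment> \<open>Small enough for the differentiation theorem and for the upper corner of the
      cube to stay in the ball of radius r, which puts the whole cube into the box. The summand 1
      avoids a discussion of the size of \<open>One\<close>.\<close>
    define h where "h = min (\<delta>/2) (r / (2 * (norm (One::'a) + 1)))"
    have h: "0 < h" "h < \<delta>" using \<delta> r by (auto simp: h_def add_nonneg_pos)
    have "h * norm (One::'a) \<le> r / (2 * (norm (One::'a) + 1)) * (norm (One::'a) + 1)"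
      by (intro mult_mono) (use r in \<open>auto simp: h_def add_nonneg_pos\<close>)
    also have "\<dots> = r / 2" by (simp add: field_simps add_nonneg_eq_0_iff)
    also have "\<dots> < r" using r by simp
    finally have "x + h *\<^sub>R One \<in> box L H" using r(2) h by (intro subsetD[OF r(2)]) (simp add: dist_norm)
    then have sub: "cbox x (x + h *\<^sub>R One) \<subseteq> cbox L H"
      using x(1) by (fastforce simp: mem_box)
    have "integral (cbox x (x + h *\<^sub>R One)) f = integral (cbox x (x + h *\<^sub>R One)) d"
      by (rule Henstock_Kurzweil_Integration.integral_cong) (use sub in \<open>auto simp: f_def indicator_def\<close>)
    then show False using \<delta>(2)[of h] h zero[OF sub] fx by simp
  qed
  show ?thesis
  proof (rule negligible_subset)
    show "negligible (N \<union> (cbox L H - box L H))"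
      using N(1) by (intro negligible_Un negligible_frontier_interval)
  qed (use z in blast)
qed

text \<open>An open set is a countable union of closed boxes, and on each of them the difference of
  two weak derivatives vanishes off a null set.\<close>

lemma weak_deriv_unique:
  fixes u v1 v2 :: "'a::euclidean_space \<Rightarrow> 'b::euclidean_space"
  assumes U: "open U" and "has_weak_deriv U b u v1" "has_weak_deriv U b u v2"
  shows "AE x in lebesgue_on U. v1 x = v2 x"
proof -
  define d where "d x = v1 x + - v2 x" for x
  have l: "locally_integrable_on v1 U" "locally_integrable_on v2 U"
    using assms by (auto simp: has_weak_deriv_def)
  then have "locally_integrable_on (\<lambda>x. - v2 x) U"
    by (auto simp: locally_integrable_on_def set_integrable_def)
  then have d: "locally_integrable_on d U"
    unfolding d_def using l(1) by (rule locally_integrable_add[rotated])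
  have zero: "(LINT x|lebesgue_on U. \<psi> x *\<^sub>R d x) = 0" if t: "test_fun U \<psi>" for \<psi> :: "'a \<Rightarrow> real"
  proof -
    have "(LINT x|lebesgue_on U. \<psi> x *\<^sub>R v1 x) = (LINT x|lebesgue_on U. \<psi> x *\<^sub>R v2 x)"
      using assms(2,3) t unfolding has_weak_deriv_def by (metis neg_equal_iff_equal)
    then show ?thesis
      using integrable_test(1)[OF U t l(1)] integrable_test(1)[OF U t l(2)]
      by (simp add: d_def scaleR_diff_right)
  qed
  obtain \<D> where D: "countable \<D>" "\<D> \<subseteq> Pow U" "\<And>X. X \<in> \<D> \<Longrightarrow> \<exists>a b. X = cbox a b" "\<Union>\<D> = U"
    using open_countable_Union_open_cbox[OF U] by metis
  have "negligible {x \<in> X. d x \<noteq> 0}" if X: "X \<in> \<D>" for X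
  proof -
    obtain a b where ab: "X = cbox a b" using D(3)[OF X] by blast
    have "X \<subseteq> U" using X D(2) by blast
    then show ?thesis
      unfolding ab using d integral_zero_of_test(2)[OF U d zero]
      by (intro negligible_of_zero_integrals) (auto simp: locally_integrable_on_def)
  qed
  then have "negligible (\<Union>X\<in>\<D>. {x \<in> X. d x \<noteq> 0})"
    using D(1) by (intro negligible_countable_Union) auto
  moreover have "(\<Union>X\<in>\<D>. {x \<in> X. d x \<noteq> 0}) = {x \<in> U. v1 x \<noteq> v2 x}"
    using D(4) by (auto simp: d_def)
  ultimately have "{x \<in> U. v1 x \<noteq> v2 x} \<in> null_sets lebesgue"
    by (simp add: negligible_iff_null_sets)
  then have "AE x in lebesgue. x \<in> U \<longrightarrow> v1 x = v2 x"
    by (rule AE_I') auto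
  then show ?thesis using U by (subst AE_restrict_space_iff) auto
qed

lemma weak_deriv_AE:
  assumes "open U" "has_weak_deriv U b u v"
  shows "has_weak_deriv U b u (weak_deriv U b u)" "AE x in lebesgue_on U. weak_deriv U b u x = v x"
proof -
  show 1: "has_weak_deriv U b u (weak_deriv U b u)"
    unfolding weak_deriv_def using assms(2) by (rule someI[where P="has_weak_deriv U b u"])
  show "AE x in lebesgue_on U. weak_deriv U b u x = v x"
    by (rule weak_deriv_unique[OF assms(1) 1 assms(2)])
qed

section \<open>Spherical coordinates\<close>

lemma vec3_eq_iff: "(x::real^3) = y \<longleftrightarrow> x$1 = y$1 \<and> x$2 = y$2 \<and> x$3 = y$3"
  by (simp add: vec_eq_iff forall_3)

lemma vec3_axis: "vector [a, b, c] = a *\<^sub>R axis 1 1 + b *\<^sub>R axis 2 1 + c *\<^sub>R axis (3::3) (1::real)"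
  by (simp add: vec3_eq_iff axis_def)

lemma norm3_sq: "(norm (x::real^3))\<^sup>2 = (x$1)\<^sup>2 + (x$2)\<^sup>2 + (x$3)\<^sup>2"
  by (simp add: norm_vec_def L2_set_def sum_3)

text \<open>The components of the argument are the radius, the polar angle and the azimuth. The
  value is a combination of axis vectors so that rules for derivatives and continuity apply term by
  term.\<close>

definition polar :: "real^3 \<Rightarrow> real^3" where
  "polar y = (y$1 * sin (y$2) * cos (y$3)) *\<^sub>R axis 1 1 + (y$1 * sin (y$2) * sin (y$3)) *\<^sub>R axis 2 1
     + (y$1 * cos (y$2)) *\<^sub>R axis 3 1"

definition polar_deriv :: "real^3 \<Rightarrow> real^3 \<Rightarrow> real^3" where
  "polar_deriv y h =
     (h$1 * sin (y$2) * cos (y$3) + y$1 * cos (y$2) * h$2 * cos (y$3) - y$1 * sin (y$2) * sin (y$3) * h$3) *\<^sub>R axis 1 1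
   + (h$1 * sin (y$2) * sin (y$3) + y$1 * cos (y$2) * h$2 * sin (y$3) + y$1 * sin (y$2) * cos (y$3) * h$3) *\<^sub>R axis 2 1
   + (h$1 * cos (y$2) - y$1 * sin (y$2) * h$2) *\<^sub>R axis 3 1"

definition polar_dom :: "(real^3) set" where
  "polar_dom = {y. 1 < y$1 \<and> 0 < y$2 \<and> y$2 < pi \<and> 0 < y$3 \<and> y$3 < 2*pi}"

abbreviation polar_jac :: "real^3 \<Rightarrow> real" where
  "polar_jac y \<equiv> (y$1)\<^sup>2 * sin (y$2)"

lemma polar_component:
  "polar y $ 1 = y$1 * sin (y$2) * cos (y$3)" "polar y $ 2 = y$1 * sin (y$2) * sin (y$3)"
  "polar y $ 3 = y$1 * cos (y$2)"
  by (simp_all add: polar_def axis_def)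

lemma polar_sph: "polar y = y$1 *\<^sub>R sph (y$2) (y$3)"
  by (simp add: vec3_eq_iff polar_component sph_def vector_3)

lemma norm_sph: "norm (sph \<phi> \<theta>) = 1"
proof -
  have "(norm (sph \<phi> \<theta>))\<^sup>2 = (sin \<phi>)\<^sup>2 * ((cos \<theta>)\<^sup>2 + (sin \<theta>)\<^sup>2) + (cos \<phi>)\<^sup>2"
    by (simp add: norm3_sq sph_def vector_3 power_mult_distrib algebra_simps del: sin_cos_squared_add sin_cos_squared_add2)
  also have "\<dots> = 1" by simp
  finally show ?thesis by (simp add: power2_eq_1_iff) (smt (verit) norm_ge_zero)
qed

lemma polar_has_derivative: "(polar has_derivative polar_deriv y) (at y within S)"
proof -
  have [derivative_intros]: "((\<lambda>y::real^3. y$i) has_derivative (\<lambda>h. h$i)) (at y within S)" for i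
    by (rule bounded_linear_imp_has_derivative[OF bounded_linear_vec_nth])
  show ?thesis
    unfolding polar_def[abs_def] polar_deriv_def[abs_def]
    by (auto intro!: derivative_eq_intros simp: fun_eq_iff algebra_simps)
qed

lemma det_polar_deriv: "det (matrix (polar_deriv y)) = polar_jac y"
proof -
  have "det (matrix (polar_deriv y)) = (y$1)\<^sup>2 * sin (y$2) *
     ((sin (y$2))\<^sup>2 * ((sin (y$3))\<^sup>2 + (cos (y$3))\<^sup>2) + (cos (y$2))\<^sup>2 * ((sin (y$3))\<^sup>2 + (cos (y$3))\<^sup>2))"
    by (simp add: det_3 matrix_def polar_deriv_def axis_def power2_eq_square algebra_simps
        del: sin_cos_squared_add sin_cos_squared_add2 sin_cos_squared_add3)
  then show ?thesis by simp
qed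

lemma polar_inj: "inj_on polar polar_dom"
proof (rule inj_onI)
  fix x y assume x: "x \<in> polar_dom" and y: "y \<in> polar_dom" and eq: "polar x = polar y"
  have "norm (polar x) = norm (polar y)" using eq by simp
  then have 1: "x$1 = y$1" using x y by (simp add: polar_sph norm_sph polar_dom_def)
  have c2: "cos (x$2) = cos (y$2)"
    using arg_cong[OF eq, of "\<lambda>v. v$3"] 1 x by (simp add: polar_component polar_dom_def)
  have "0 \<le> x$2" "x$2 \<le> pi" "0 \<le> y$2" "y$2 \<le> pi" using x y by (simp_all add: polar_dom_def)
  from cos_inj_pi[OF this c2] have 2: "x$2 = y$2" .
  have "sin (y$2) > 0" using y by (simp add: polar_dom_def sin_gt_zero)
  then have "cos (x$3) = cos (y$3)" "sin (x$3) = sin (y$3)"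
    using arg_cong[OF eq, of "\<lambda>v. v$1"] arg_cong[OF eq, of "\<lambda>v. v$2"] 1 2 x
    by (simp_all add: polar_component polar_dom_def)
  then obtain n :: int where n: "x$3 = y$3 + 2 * pi * n"
    using sin_cos_eq_iff by blast
  have "\<bar>x$3 - y$3\<bar> < 2 * pi" using x y by (auto simp: polar_dom_def)
  then have "\<bar>2 * pi * real_of_int n\<bar> < 2 * pi * 1" using n by simp
  then have "\<bar>real_of_int n\<bar> < 1" by (simp add: abs_mult)
  then have "n = 0" by linarith
  with n 1 2 show "x = y" by (simp add: vec3_eq_iff)
qed

text \<open>The part of the exterior domain that is missed lies in the plane where the second
  coordinate vanishes. It is the price for an injective chart and is a null set.\<close>

lemma polar_image: "polar ` polar_dom = {x. norm x > 1 \<and> \<not> (x$2 = 0 \<and> x$1 \<ge> 0)}"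
proof (intro equalityI subsetI)
  fix x assume "x \<in> polar ` polar_dom"
  then obtain y where y: "y \<in> polar_dom" "x = polar y" by auto
  have s: "sin (y$2) > 0" using y by (simp add: polar_dom_def sin_gt_zero)
  have "norm x > 1" using y by (simp add: polar_sph norm_sph polar_dom_def)
  moreover have "x$1 < 0" if "x$2 = 0"
  proof -
    have "sin (y$3) = 0" using that s y by (simp add: polar_component polar_dom_def)
    moreover have "0 < y$3" "y$3 < 2*pi" using y by (auto simp: polar_dom_def)
    ultimately have "y$3 = pi"
      using sin_gt_zero[of "y$3"] sin_lt_zero[of "y$3"] by (cases "y$3" pi rule: linorder_cases) auto
    then show ?thesis using y s by (simp add: polar_component polar_dom_def)
  qed
  ultimately show "x \<in> {x. norm x > 1 \<and> \<not> (x$2 = 0 \<and> x$1 \<ge> 0)}" by auto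
next
  fix x :: "real^3" assume x: "x \<in> {x. norm x > 1 \<and> \<not> (x$2 = 0 \<and> x$1 \<ge> 0)}"
  define r where "r = norm x"
  define \<rho> where "\<rho> = sqrt ((x$1)\<^sup>2 + (x$2)\<^sup>2)"
  have r: "r > 1" using x by (simp add: r_def)
  have "(x$1)\<^sup>2 + (x$2)\<^sup>2 \<noteq> 0" using x by (auto simp: sum_power2_eq_zero_iff)
  moreover have "(x$1)\<^sup>2 + (x$2)\<^sup>2 \<ge> 0" by simp
  ultimately have \<rho>: "\<rho> > 0" unfolding \<rho>_def by (metis less_eq_real_def real_sqrt_gt_zero)
  have \<rho>2: "\<rho>\<^sup>2 = (x$1)\<^sup>2 + (x$2)\<^sup>2" by (simp add: \<rho>_def)
  have r2: "r\<^sup>2 = \<rho>\<^sup>2 + (x$3)\<^sup>2" by (simp add: r_def norm3_sq \<rho>2)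
  define \<phi> where "\<phi> = arccos (x$3 / r)"
  have "(x$3)\<^sup>2 < r\<^sup>2" using r2 \<rho> by simp
  then have lt: "\<bar>x$3\<bar> < r"
    using r power2_less_imp_less[of "\<bar>x$3\<bar>" r] by simp
  then have b: "-1 < x$3 / r" "x$3 / r < 1" using r by (simp_all add: less_divide_eq divide_less_eq)
  have \<phi>: "0 < \<phi>" "\<phi> < pi" "cos \<phi> = x$3 / r"
    using b arccos_lt_bounded[of "x$3/r"] by (auto simp: \<phi>_def)
  have "sin \<phi> = sqrt (1 - (x$3 / r)\<^sup>2)" using b by (simp add: \<phi>_def sin_arccos)
  also have "1 - (x$3 / r)\<^sup>2 = (r\<^sup>2 - (x$3)\<^sup>2) / r\<^sup>2" using r by (simp add: power_divide diff_divide_distrib)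
  also have "\<dots> = (\<rho> / r)\<^sup>2" using r2 by (simp add: power_divide)
  finally have s: "sin \<phi> = \<rho> / r" using r \<rho> by simp
  have "(x$1 / \<rho>)\<^sup>2 + (x$2 / \<rho>)\<^sup>2 = ((x$1)\<^sup>2 + (x$2)\<^sup>2) / \<rho>\<^sup>2"
    by (simp add: power_divide add_divide_distrib)
  also have "\<dots> = 1" using \<rho> unfolding \<rho>2[symmetric] by simp
  finally have "(x$1 / \<rho>)\<^sup>2 + (x$2 / \<rho>)\<^sup>2 = 1" .
  then obtain \<theta> where \<theta>: "0 \<le> \<theta>" "\<theta> < 2*pi" "x$1 / \<rho> = cos \<theta>" "x$2 / \<rho> = sin \<theta>"
    using sincos_total_2pi by metis
  have "\<theta> \<noteq> 0"
  proof
    assume "\<theta> = 0"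
    then have "x$2 = 0" "x$1 = \<rho>" using \<theta> \<rho> by (auto simp: field_simps)
    then show False using x \<rho> by auto
  qed
  then have "vector [r, \<phi>, \<theta>] \<in> polar_dom"
    using r \<phi> \<theta> by (simp add: polar_dom_def vector_3)
  moreover have "x = polar (vector [r, \<phi>, \<theta>])"
    using s \<phi>(3) \<theta>(3,4) r \<rho> by (auto simp: vec3_eq_iff polar_component vector_3 field_simps)
  ultimately show "x \<in> polar ` polar_dom" by blast
qed

section \<open>Integration in spherical coordinates\<close>

lemma continuous_on_polar: "continuous_on S polar"
  using polar_has_derivative has_derivative_continuous_on by blast

lemma polar_dom_borel [measurable]: "polar_dom \<in> sets borel"
proof -
  have "open polar_dom"
    unfolding polar_dom_def
    by (intro open_Collect_conj open_Collect_less continuous_intros)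
  then show ?thesis by simp
qed

lemma polar_borel [measurable]: "polar \<in> borel_measurable borel"
  using continuous_on_polar by (rule borel_measurable_continuous_onI)

lemma polar_jac_borel [measurable]: "(\<lambda>y::real^3. polar_jac y) \<in> borel_measurable borel"
  by (rule borel_measurable_continuous_onI) (intro continuous_intros)

lemma polar_jac_nonneg: "y \<in> polar_dom \<Longrightarrow> polar_jac y \<ge> 0"
  by (simp add: polar_dom_def sin_gt_zero less_imp_le)

text \<open>On a bounded set the Jacobian is integrable, which puts the change of variables for
  injective differentiable maps in reach; on \<open>polar_dom\<close> the determinant is
  nonnegative, so the absolute value disappears.\<close>

lemma emeasure_polar_image:
  assumes B: "B \<in> sets borel" "B \<subseteq> polar_dom" "bounded B"
  shows "emeasure lebesgue (polar ` B) = (\<integral>\<^sup>+y. ennreal (polar_jac y) * indicator B y \<partial>lborel)"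
proof -
  have jac: "\<bar>det (matrix (polar_deriv y))\<bar> = polar_jac y" if "y \<in> B" for y
    using that B(2) polar_jac_nonneg by (auto simp: det_polar_deriv)
  obtain a b where ab: "B \<subseteq> cbox a b" using bounded_subset_cbox_symmetric[OF B(3)] by blast
  have "set_integrable lborel (cbox a b) polar_jac"
    unfolding set_integrable_def
    by (rule borel_integrable_compact) (auto intro!: continuous_intros)
  then have si: "set_integrable lborel B polar_jac"
    by (rule set_integrable_subset) (use B ab in auto)
  have int: "polar_jac integrable_on B" "(LINT y:B|lborel. polar_jac y) = integral B polar_jac"
    using set_borel_integral_eq_integral[OF si] by auto
  have int': "(\<lambda>y. \<bar>det (matrix (polar_deriv y))\<bar>) integrable_on B"
    using int(1) by (rule integrable_eq) (use jac in auto)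
  have inj: "inj_on polar B" using polar_inj B(2) inj_on_subset by blast
  have BL: "B \<in> sets lebesgue" using B(1) by simp
  have m: "polar ` B \<in> lmeasurable"
    using measurable_differentiable_image_eq[OF BL polar_has_derivative inj] int' by simp
  have "measure lebesgue (polar ` B) = integral B (\<lambda>y. \<bar>det (matrix (polar_deriv y))\<bar>)"
    by (rule measure_differentiable_image_eq[OF BL polar_has_derivative inj int'])
  also have "\<dots> = integral B polar_jac"
    by (rule Henstock_Kurzweil_Integration.integral_cong) (use jac in auto)
  also have "\<dots> = (LINT y|lborel. indicator B y *\<^sub>R polar_jac y)"
    using int(2) by (simp add: set_lebesgue_integral_def)
  finally have eq: "measure lebesgue (polar ` B) = (LINT y|lborel. indicator B y *\<^sub>R polar_jac y)" .
  have "emeasure lebesgue (polar ` B) = ennreal (measure lebesgue (polar ` B))"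
    by (rule emeasure_eq_measure2[OF m])
  also have "\<dots> = (\<integral>\<^sup>+y. ennreal (indicator B y *\<^sub>R polar_jac y) \<partial>lborel)"
    unfolding eq using si B(2) polar_jac_nonneg
    by (intro nn_integral_eq_integral[symmetric]) (auto simp: set_integrable_def indicator_def)
  also have "\<dots> = (\<integral>\<^sup>+y. ennreal (polar_jac y) * indicator B y \<partial>lborel)"
    by (intro nn_integral_cong) (auto split: split_indicator)
  finally show ?thesis .
qed

lemma polar_image_borel [measurable]: "polar ` polar_dom \<in> sets borel"
proof -
  have "polar ` polar_dom = {x. norm x > 1} \<inter> - ({x. x$2 = 0} \<inter> {x. x$1 \<ge> 0})"
    unfolding polar_image by auto
  also have "open \<dots>"
    by (intro open_Int open_Compl closed_Int closed_Collect_eq closed_Collect_le open_Collect_less continuous_intros)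
  finally show ?thesis by simp
qed

text \<open>Stated as an equality of measures, so that it transfers to arbitrary nonnegative
  integrands. Inside a ball the radius and both angles are bounded, which is the case treated
  before; balls then exhaust the space.\<close>

lemma distr_polar:
  "distr (density lborel (\<lambda>y. ennreal (polar_jac y) * indicator polar_dom y)) borel polar
     = density lborel (indicator (polar ` polar_dom))" (is "?M = ?N")
proof -
  have bd: "emeasure ?M A = emeasure ?N A" if A: "A \<in> sets borel" "A \<subseteq> ball 0 (real n)" for A n
  proof -
    define B where "B = polar_dom \<inter> polar -` A"
    have Bm: "B \<in> sets borel" unfolding B_def
      using A(1) measurable_sets[OF polar_borel, of A] by auto
    have "B \<subseteq> cbox 0 (vector [real n, pi, 2*pi])"
    proof
      fix y assume "y \<in> B"
      then have y: "y \<in> polar_dom" "norm (polar y) < real n" using A(2) by (auto simp: B_def subset_eq)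
      then show "y \<in> cbox 0 (vector [real n, pi, 2*pi])"
        by (simp add: mem_box_cart forall_3 vector_3 polar_sph norm_sph polar_dom_def)
    qed
    then have bB: "bounded B" using bounded_cbox bounded_subset by blast
    have eq: "polar ` B = A \<inter> polar ` polar_dom" by (auto simp: B_def)
    have "emeasure ?M A = (\<integral>\<^sup>+y. ennreal (polar_jac y) * indicator polar_dom y * indicator (polar -` A) y \<partial>lborel)"
      using A(1) measurable_sets[OF polar_borel, of A] by (simp add: emeasure_distr emeasure_density)
    also have "\<dots> = (\<integral>\<^sup>+y. ennreal (polar_jac y) * indicator B y \<partial>lborel)"
      by (intro nn_integral_cong) (auto simp: B_def split: split_indicator)
    also have "\<dots> = emeasure lebesgue (A \<inter> polar ` polar_dom)"
      using emeasure_polar_image[OF Bm _ bB] eq by (simp add: B_def)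
    also have "\<dots> = emeasure lborel (A \<inter> polar ` polar_dom)"
      using A(1) by simp
    also have "\<dots> = emeasure ?N A"
    proof -
      have "emeasure ?N A = (\<integral>\<^sup>+x. indicator (polar ` polar_dom) x * indicator A x \<partial>lborel)"
        using A(1) by (subst emeasure_density) auto
      also have "\<dots> = (\<integral>\<^sup>+x. indicator (A \<inter> polar ` polar_dom) x \<partial>lborel)"
        by (intro nn_integral_cong) (auto split: split_indicator)
      also have "\<dots> = emeasure lborel (A \<inter> polar ` polar_dom)"
        using A(1) by (intro nn_integral_indicator) auto
      finally show ?thesis by simp
    qed
    finally show ?thesis .
  qed
  show ?thesis
  proof (rule measure_eqI)
    show "sets ?M = sets ?N" by simp
    fix A assume "A \<in> sets ?M"
    then have A: "A \<in> sets borel" by simp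
    define C where "C n = A \<inter> ball 0 (real n)" for n
    have C: "range C \<subseteq> sets borel" "incseq C" "(\<Union>n. C n) = A"
      using A by (auto simp: C_def incseq_def) (use reals_Archimedean2 in blast)
    have "emeasure ?M A = (SUP n. emeasure ?M (C n))"
      using SUP_emeasure_incseq[of C ?M] C by simp
    also have "\<dots> = (SUP n. emeasure ?N (C n))"
      using bd[of "C n" n for n] C(1) by (auto simp: C_def)
    also have "\<dots> = emeasure ?N A"
      using SUP_emeasure_incseq[of C ?N] C by simp
    finally show "emeasure ?M A = emeasure ?N A" .
  qed
qed

text \<open>The components are reversed, with the azimuth first and the radius last, so that
  iterated integration has the radius innermost and follows the order of
  \<open>sphere_nn_integral\<close>.\<close>

lemma lborel_vec3: "distr lborel borel (\<lambda>p::real\<times>real\<times>real. vector [snd (snd p), fst (snd p), fst p] :: real^3) = lborel"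
proof (rule lborel_eqI[symmetric])
  let ?v = "\<lambda>p::real\<times>real\<times>real. vector [snd (snd p), fst (snd p), fst p] :: real^3"
  have m: "?v \<in> borel_measurable borel"
    unfolding vec3_axis
    by (intro borel_measurable_continuous_onI continuous_on_add continuous_on_scaleR continuous_on_const
        continuous_on_fst continuous_on_snd continuous_on_id)
  fix l u :: "real^3" assume le: "\<And>b. b \<in> Basis \<Longrightarrow> l \<bullet> b \<le> u \<bullet> b"
  have le': "l$i \<le> u$i" for i using le[of "axis i 1"] by (simp add: inner_axis axis_in_Basis_iff)
  have "?v -` box l u = box (l$3, l$2, l$1) (u$3, u$2, u$1)"
    by (auto simp: mem_box_cart forall_3 vector_3 mem_box Basis_prod_def ball_Un)
  then have "emeasure (distr lborel borel ?v) (box l u) = emeasure lborel (box (l$3, l$2, l$1) (u$3, u$2, u$1))"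
    using m by (simp add: emeasure_distr)
  also have "\<dots> = ennreal ((u$3 - l$3) * ((u$2 - l$2) * (u$1 - l$1)))"
    using le' by (subst emeasure_lborel_box) (auto simp: Basis_prod_def prod.union_disjoint image_iff inner_Pair prod.reindex inj_on_def)
  also have "(u$3 - l$3) * ((u$2 - l$2) * (u$1 - l$1)) = (\<Prod>b\<in>Basis. (u - l) \<bullet> b)"
  proof -
    have "Basis = range (\<lambda>i::3. axis i (1::real))" by (auto simp: Basis_vec_def)
    then have "(\<Prod>b\<in>Basis. (u - l) \<bullet> b) = (\<Prod>b\<in>range (\<lambda>i::3. axis i (1::real)). (u - l) \<bullet> b)"
      by (rule arg_cong)
    also have "\<dots> = (\<Prod>i\<in>UNIV. (u - l) $ i)"
      by (subst prod.reindex) (auto simp: inj_on_def axis_eq_axis inner_axis)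
    also have "\<dots> = (u$3 - l$3) * ((u$2 - l$2) * (u$1 - l$1))"
      unfolding UNIV_3 by (simp add: ac_simps)
    finally show ?thesis by (rule sym)
  qed
  finally show "emeasure (distr lborel borel ?v) (box l u) = ennreal (\<Prod>b\<in>Basis. (u - l) \<bullet> b)" .
qed simp

theorem nn_integral_polar:
  fixes F :: "real^3 \<Rightarrow> ennreal"
  assumes F [measurable]: "F \<in> borel_measurable borel"
  shows "(\<integral>\<^sup>+x. F x * indicator \<Omega> x \<partial>lborel) =
    (\<integral>\<^sup>+\<theta>. (\<integral>\<^sup>+\<phi>. (\<integral>\<^sup>+r. F (r *\<^sub>R sph \<phi> \<theta>) * ennreal (r\<^sup>2 * sin \<phi>) * indicator {1<..} r \<partial>lborel)
        * indicator {0..pi} \<phi> \<partial>lborel) * indicator {0..2*pi} \<theta> \<partial>lborel)"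
proof -
  let ?v = "\<lambda>p::real\<times>real\<times>real. vector [snd (snd p), fst (snd p), fst p] :: real^3"
  have vm [measurable]: "?v \<in> borel_measurable borel"
    unfolding vec3_axis
    by (intro borel_measurable_continuous_onI continuous_on_add continuous_on_scaleR continuous_on_const
        continuous_on_fst continuous_on_snd continuous_on_id)
  define G where "G y = F (polar y) * (ennreal (polar_jac y) * indicator polar_dom y)" for y
  have Gm [measurable]: "G \<in> borel_measurable borel" unfolding G_def by measurable
  have "{x::real^3. x$2 = 0} \<in> null_sets lebesgue"
    using negligible_standard_hyperplane_cart[of "2::3"] by (simp add: negligible_iff_null_sets)
  moreover have "{x::real^3. x$2 = 0} \<in> sets borel"
    by (intro borel_closed closed_Collect_eq continuous_intros)
  ultimately have null: "{x::real^3. x$2 = 0} \<in> null_sets lborel"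
    by (simp add: null_sets_completion_iff)
  have "(\<integral>\<^sup>+x. F x * indicator \<Omega> x \<partial>lborel) = (\<integral>\<^sup>+x. indicator (polar ` polar_dom) x * F x \<partial>lborel)"
  proof (rule nn_integral_cong_AE)
    have "AE x in lborel. x \<notin> {x::real^3. x$2 = 0}" using null by (rule AE_not_in)
    then show "AE x in lborel. F x * indicator \<Omega> x = indicator (polar ` polar_dom) x * F x"
      unfolding polar_image by eventually_elim (auto simp: \<Omega>_def indicator_def)
  qed
  also have "\<dots> = (\<integral>\<^sup>+x. F x \<partial>density lborel (indicator (polar ` polar_dom)))"
    by (subst nn_integral_density) auto
  also have "\<dots> = (\<integral>\<^sup>+y. F (polar y) \<partial>density lborel (\<lambda>y. ennreal (polar_jac y) * indicator polar_dom y))"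
    unfolding distr_polar[symmetric] by (subst nn_integral_distr) auto
  also have "\<dots> = (\<integral>\<^sup>+y. G y \<partial>lborel)"
    by (subst nn_integral_density) (auto simp: G_def ac_simps intro!: nn_integral_cong)
  also have "\<dots> = (\<integral>\<^sup>+y. G y \<partial>distr lborel borel ?v)" by (simp only: lborel_vec3)
  also have "\<dots> = (\<integral>\<^sup>+p. G (?v p) \<partial>lborel)"
    by (subst nn_integral_distr) auto
  also have "\<dots> = (\<integral>\<^sup>+p. G (?v p) \<partial>(lborel \<Otimes>\<^sub>M lborel))" by (simp only: lborel_prod)
  also have "\<dots> = (\<integral>\<^sup>+\<theta>. (\<integral>\<^sup>+q. G (?v (\<theta>, q)) \<partial>lborel) \<partial>lborel)"
    by (subst lborel.nn_integral_fst[symmetric]) (auto simp: lborel_prod)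
  also have "\<dots> = (\<integral>\<^sup>+\<theta>. (\<integral>\<^sup>+\<phi>. (\<integral>\<^sup>+r. G (?v (\<theta>, \<phi>, r)) \<partial>lborel) \<partial>lborel) \<partial>lborel)"
  proof (rule nn_integral_cong)
    fix \<theta> :: real
    have "(\<lambda>q. G (?v (\<theta>, q))) \<in> borel_measurable borel"
      by (rule measurable_compose[OF _ Gm], rule measurable_compose[OF _ vm]) (auto intro!: borel_measurable_continuous_onI continuous_intros)
    then show "(\<integral>\<^sup>+q. G (?v (\<theta>, q)) \<partial>lborel) = (\<integral>\<^sup>+\<phi>. (\<integral>\<^sup>+r. G (?v (\<theta>, \<phi>, r)) \<partial>lborel) \<partial>lborel)"
      unfolding lborel_prod[symmetric] by (subst lborel.nn_integral_fst[symmetric]) (auto simp: borel_prod lborel_prod)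
  qed
  also have "\<dots> = (\<integral>\<^sup>+\<theta>. (\<integral>\<^sup>+\<phi>. (\<integral>\<^sup>+r. F (r *\<^sub>R sph \<phi> \<theta>) * ennreal (r\<^sup>2 * sin \<phi>) * indicator {1<..} r \<partial>lborel)
        * indicator {0..pi} \<phi> \<partial>lborel) * indicator {0..2*pi} \<theta> \<partial>lborel)"
  proof (rule nn_integral_cong_AE)
    have "AE \<theta> in lborel. \<theta> \<noteq> (0::real)" "AE \<theta> in lborel. \<theta> \<noteq> 2 * pi"
      by (auto simp: AE_lborel_singleton)
    then show "AE \<theta> in lborel. (\<integral>\<^sup>+\<phi>. (\<integral>\<^sup>+r. G (?v (\<theta>, \<phi>, r)) \<partial>lborel) \<partial>lborel) =
       (\<integral>\<^sup>+\<phi>. (\<integral>\<^sup>+r. F (r *\<^sub>R sph \<phi> \<theta>) * ennreal (r\<^sup>2 * sin \<phi>) * indicator {1<..} r \<partial>lborel)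
        * indicator {0..pi} \<phi> \<partial>lborel) * indicator {0..2*pi} \<theta>"
    proof eventually_elim
      case (elim \<theta>)
      have *: "(\<integral>\<^sup>+r. G (?v (\<theta>, \<phi>, r)) \<partial>lborel) =
         (\<integral>\<^sup>+r. F (r *\<^sub>R sph \<phi> \<theta>) * ennreal (r\<^sup>2 * sin \<phi>) * indicator {1<..} r \<partial>lborel) * indicator {0..pi} \<phi>"
        if "\<theta> \<in> {0..2*pi}" for \<phi>
      proof (cases "\<phi> \<in> {0..pi}")
        case True
        \<comment> \<open>At the poles, which \<open>polar_dom\<close> excludes, the right-hand side
          vanishes as well, because of the factor \<open>sin \<phi>\<close>.\<close>
        have "G (?v (\<theta>, \<phi>, r)) = F (r *\<^sub>R sph \<phi> \<theta>) * ennreal (r\<^sup>2 * sin \<phi>) * indicator {1<..} r" for r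
          using True that elim
          by (cases "\<phi> = 0 \<or> \<phi> = pi") (auto simp: G_def polar_sph vector_3 polar_dom_def indicator_def)
        then show ?thesis using True by simp
      qed (auto simp: G_def polar_dom_def vector_3)
      show ?case
      proof (cases "\<theta> \<in> {0..2*pi}")
        case False
        then show ?thesis by (auto simp: G_def polar_dom_def vector_3)
      next
        case True
        have "(\<integral>\<^sup>+\<phi>. (\<integral>\<^sup>+r. G (?v (\<theta>, \<phi>, r)) \<partial>lborel) \<partial>lborel) =
          (\<integral>\<^sup>+\<phi>. (\<integral>\<^sup>+r. F (r *\<^sub>R sph \<phi> \<theta>) * ennreal (r\<^sup>2 * sin \<phi>) * indicator {1<..} r \<partial>lborel) * indicator {0..pi} \<phi> \<partial>lborel)"
          by (rule nn_integral_cong) (rule *[OF True])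
        then show ?thesis using True by simp
      qed
    qed
  qed
  finally show ?thesis .
qed

section \<open>The calibration\<close>

subsection \<open>Bounded Lipschitz functions\<close>

text \<open>Boundedness is included because it is what makes the Lipschitz property stable under
  products. The constants of the calibration are obtained through this calculus without being
  computed.\<close>

definition BL :: "'a::real_normed_vector set \<Rightarrow> ('a \<Rightarrow> 'b::real_normed_vector) \<Rightarrow> bool" where
  "BL S f \<longleftrightarrow> (\<exists>M. \<forall>x\<in>S. norm (f x) \<le> M) \<and> (\<exists>L. \<forall>x\<in>S. \<forall>y\<in>S. norm (f x - f y) \<le> L * norm (x - y))"

lemma BL_D:
  assumes "BL S f"
  shows "\<exists>M>0. \<exists>L>0. (\<forall>x\<in>S. norm (f x) \<le> M) \<and> (\<forall>x\<in>S. \<forall>y\<in>S. norm (f x - f y) \<le> L * norm (x - y))"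
proof -
  obtain M L where bd: "\<forall>x\<in>S. norm (f x) \<le> M" "\<forall>x\<in>S. \<forall>y\<in>S. norm (f x - f y) \<le> L * norm (x - y)"
    using assms unfolding BL_def by blast
  show ?thesis
  proof (rule exI[of _ "max M 1"], rule conjI, simp, rule exI[of _ "max L 1"], intro conjI ballI)
    fix x assume x: "x \<in> S"
    show "norm (f x) \<le> max M 1" using bd(1) x by fastforce
    fix y assume y: "y \<in> S"
    have "norm (f x - f y) \<le> L * norm (x - y)" using bd(2) x y by blast
    then show "norm (f x - f y) \<le> max L 1 * norm (x - y)"
      using mult_right_mono[of L "max L 1" "norm (x - y)"] by simp
  qed auto
qed

lemma BL_const: "BL S (\<lambda>x. c)"
  unfolding BL_def by (intro conjI exI[of _ "norm c"] exI[of _ "0::real"]) auto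

lemma BL_ident: "bounded S \<Longrightarrow> BL S (\<lambda>x. x)"
  unfolding BL_def bounded_iff by (auto intro!: exI[of _ 1])

lemma BL_add: "BL S f \<Longrightarrow> BL S g \<Longrightarrow> BL S (\<lambda>x. f x + g x)"
proof -
  assume "BL S f" "BL S g"
  then obtain M L M' L' where
    f: "\<forall>x\<in>S. norm (f x) \<le> M" "\<forall>x\<in>S. \<forall>y\<in>S. norm (f x - f y) \<le> L * norm (x - y)"
    and g: "\<forall>x\<in>S. norm (g x) \<le> M'" "\<forall>x\<in>S. \<forall>y\<in>S. norm (g x - g y) \<le> L' * norm (x - y)"
    unfolding BL_def by blast
  show ?thesis
    unfolding BL_def
  proof (intro conjI exI ballI)
    fix x y assume x: "x \<in> S"
    show "norm (f x + g x) \<le> M + M'" using f(1)[rule_format, OF x] g(1)[rule_format, OF x] norm_triangle_le[of "f x" "g x"] by simp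
    assume y: "y \<in> S"
    have "f x + g x - (f y + g y) = (f x - f y) + (g x - g y)" by simp
    then have "norm (f x + g x - (f y + g y)) \<le> norm (f x - f y) + norm (g x - g y)"
      using norm_triangle_ineq by metis
    then show "norm (f x + g x - (f y + g y)) \<le> (L + L') * norm (x - y)"
      using f(2)[rule_format, OF x y] g(2)[rule_format, OF x y] by (simp add: distrib_right)
  qed
qed

lemma BL_bilinear:
  assumes "bounded_bilinear pr" "BL S f" "BL S g"
  shows "BL S (\<lambda>x. pr (f x) (g x))"
proof -
  interpret bounded_bilinear pr by (rule assms(1))
  obtain K where K: "K > 0" "\<And>a b. norm (pr a b) \<le> norm a * norm b * K" using pos_bounded by blast
  obtain M L where f: "M > 0" "L > 0" "\<forall>x\<in>S. norm (f x) \<le> M"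
     "\<forall>x\<in>S. \<forall>y\<in>S. norm (f x - f y) \<le> L * norm (x - y)" using BL_D[OF assms(2)] by metis
  obtain M' L' where g: "M' > 0" "L' > 0" "\<forall>x\<in>S. norm (g x) \<le> M'"
     "\<forall>x\<in>S. \<forall>y\<in>S. norm (g x - g y) \<le> L' * norm (x - y)" using BL_D[OF assms(3)] by metis
  show ?thesis
    unfolding BL_def
  proof (intro conjI exI ballI)
    fix x y assume x: "x \<in> S"
    have "norm (f x) * norm (g x) * K \<le> M * M' * K"
      using f(3)[rule_format, OF x] g(3)[rule_format, OF x] K(1) f(1) g(1) by (intro mult_right_mono mult_mono) auto
    then show "norm (pr (f x) (g x)) \<le> M * M' * K" using K(2) order_trans by blast
    assume y: "y \<in> S"
    have "pr (f x) (g x) - pr (f y) (g y) = pr (f x - f y) (g x) + pr (f y) (g x - g y)"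
      by (simp add: diff_left diff_right)
    then have "norm (pr (f x) (g x) - pr (f y) (g y)) \<le> norm (pr (f x - f y) (g x)) + norm (pr (f y) (g x - g y))"
      by (metis norm_triangle_ineq)
    also have "\<dots> \<le> norm (f x - f y) * norm (g x) * K + norm (f y) * norm (g x - g y) * K"
      by (intro add_mono K(2))
    also have "\<dots> \<le> (L * norm (x - y)) * M' * K + M * (L' * norm (x - y)) * K"
      using f(3)[rule_format, OF y] g(3)[rule_format, OF x] K(1) f(1,2) g(1,2) f(4)[rule_format, OF x y] g(4)[rule_format, OF x y]
      by (intro add_mono mult_right_mono mult_mono) auto
    also have "\<dots> = (L * M' * K + M * L' * K) * norm (x - y)" by (simp add: algebra_simps)
    finally show "norm (pr (f x) (g x) - pr (f y) (g y)) \<le> (L * M' * K + M * L' * K) * norm (x - y)" .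
  qed
qed

lemma BL_linear: "bounded_linear h \<Longrightarrow> BL S f \<Longrightarrow> BL S (\<lambda>x. h (f x))"
proof -
  assume h: "bounded_linear h" and "BL S f"
  then obtain M L where f: "M > 0" "L > 0" "\<forall>x\<in>S. norm (f x) \<le> M"
     "\<forall>x\<in>S. \<forall>y\<in>S. norm (f x - f y) \<le> L * norm (x - y)" using BL_D by metis
  obtain K where K: "K > 0" "\<And>a. norm (h a) \<le> norm a * K" using bounded_linear.pos_bounded[OF h] by blast
  show ?thesis
    unfolding BL_def
  proof (intro conjI exI ballI)
    fix x y assume x: "x \<in> S"
    show "norm (h (f x)) \<le> M * K" using K(2)[of "f x"] f(3)[rule_format, OF x] K(1) by (meson mult_right_mono less_imp_le order_trans)
    assume y: "y \<in> S"
    have "norm (h (f x) - h (f y)) \<le> norm (f x - f y) * K"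
      using K(2)[of "f x - f y"] by (simp add: linear_diff[OF bounded_linear.linear[OF h]])
    also have "\<dots> \<le> L * norm (x - y) * K" using f(4)[rule_format, OF x y] K(1) by (intro mult_right_mono) auto
    finally show "norm (h (f x) - h (f y)) \<le> L * K * norm (x - y)" by (simp add: mult_ac)
  qed
qed

lemma BL_compose:
  assumes "BL UNIV h" "BL S f" shows "BL S (\<lambda>x. h (f x))"
proof -
  obtain M L where f: "M > 0" "L > 0" "\<forall>x\<in>S. norm (f x) \<le> M"
     "\<forall>x\<in>S. \<forall>y\<in>S. norm (f x - f y) \<le> L * norm (x - y)" using BL_D[OF assms(2)] by metis
  obtain M' L' where h: "M' > 0" "L' > 0" "\<forall>x\<in>UNIV. norm (h x) \<le> M'"
     "\<forall>x\<in>UNIV. \<forall>y\<in>UNIV. norm (h x - h y) \<le> L' * norm (x - y)" using BL_D[OF assms(1)] by metis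
  show ?thesis
    unfolding BL_def
  proof (intro conjI exI ballI)
    fix x y assume x: "x \<in> S"
    show "norm (h (f x)) \<le> M'" using h(3) by blast
    assume y: "y \<in> S"
    have "norm (h (f x) - h (f y)) \<le> L' * norm (f x - f y)" using h(4) by blast
    also have "\<dots> \<le> L' * (L * norm (x - y))" using f(4)[rule_format, OF x y] h(2) by (intro mult_left_mono) auto
    finally show "norm (h (f x) - h (f y)) \<le> L' * L * norm (x - y)" by (simp add: mult_ac)
  qed
qed

lemma BL_norm: "BL S f \<Longrightarrow> BL S (\<lambda>x. norm (f x))"
proof -
  assume "BL S f"
  then obtain M L where f: "M > 0" "L > 0" "\<forall>x\<in>S. norm (f x) \<le> M"
     "\<forall>x\<in>S. \<forall>y\<in>S. norm (f x - f y) \<le> L * norm (x - y)" using BL_D by metis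
  show ?thesis
    unfolding BL_def
  proof (intro conjI exI ballI)
    fix x y assume x: "x \<in> S"
    show "norm (norm (f x)) \<le> M" using f(3)[rule_format, OF x] by simp
    assume "y \<in> S"
    from f(4)[rule_format, OF x this] show "norm (norm (f x) - norm (f y)) \<le> L * norm (x - y)"
      using norm_triangle_ineq3[of "f x" "f y"] by simp
  qed
qed

lemma BL_diff: "BL S f \<Longrightarrow> BL S g \<Longrightarrow> BL S (\<lambda>x. f x - g x)"
  using BL_add[of S f "\<lambda>x. - g x"] BL_linear[OF bounded_linear_minus[OF bounded_linear_ident], of S g] by simp

lemma BL_continuous: "BL S f \<Longrightarrow> continuous_on S f"
proof -
  assume "BL S f"
  then obtain M L where f: "L > 0" "\<forall>x\<in>S. \<forall>y\<in>S. norm (f x - f y) \<le> L * norm (x - y)"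
    using BL_D by metis
  then have "L-lipschitz_on S f"
    unfolding lipschitz_on_def dist_norm by (metis less_imp_le)
  then show ?thesis by (rule lipschitz_on_continuous_on)
qed

subsection \<open>The profile of the calibration\<close>

definition clamp01 :: "real \<Rightarrow> real" where
  "clamp01 t = max 0 (min 1 t)"

text \<open>The derivative of \<kappa> sqrt t, where t stands for the square of the third director
  component, made bounded at t = 0 by the shift \<delta>. The last factor is 1 up to t = 1 - 2
  \<delta> and 0 from t = 1 - \<delta> on.\<close>

definition slope :: "real \<Rightarrow> real \<Rightarrow> real \<Rightarrow> real" where
  "slope \<kappa> \<delta> t = (\<kappa> / 2) * inverse (sqrt (max t 0 + \<delta>)) * clamp01 ((1 - t) / \<delta> - 1)"

lemma BL_slope:
  assumes "\<delta> > 0" shows "BL UNIV (slope \<kappa> \<delta>)"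
proof -
  have 1: "BL UNIV (\<lambda>t. clamp01 ((1 - t) / \<delta> - 1))"
    unfolding BL_def
  proof (intro conjI exI ballI)
    fix x y :: real
    show "norm (clamp01 ((1 - x) / \<delta> - 1)) \<le> 1" by (simp add: clamp01_def)
    have "\<bar>clamp01 a - clamp01 b\<bar> \<le> \<bar>a - b\<bar>" for a b by (simp add: clamp01_def max_def min_def)
    then have "\<bar>clamp01 ((1 - x) / \<delta> - 1) - clamp01 ((1 - y) / \<delta> - 1)\<bar> \<le> \<bar>((1 - x) / \<delta> - 1) - ((1 - y) / \<delta> - 1)\<bar>" .
    also have "((1 - x) / \<delta> - 1) - ((1 - y) / \<delta> - 1) = - ((x - y) / \<delta>)"
      by (simp add: diff_divide_distrib)
    finally show "norm (clamp01 ((1 - x) / \<delta> - 1) - clamp01 ((1 - y) / \<delta> - 1)) \<le> (1 / \<delta>) * norm (x - y)"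
      using assms by simp
  qed
  have 2: "BL UNIV (\<lambda>t. inverse (sqrt (max t 0 + \<delta>)))"
    unfolding BL_def
  proof (intro conjI exI ballI)
    fix x y :: real
    define a where "a = sqrt (max x 0 + \<delta>)"
    define b where "b = sqrt (max y 0 + \<delta>)"
    have a: "a \<ge> sqrt \<delta>" "b \<ge> sqrt \<delta>" by (auto simp: a_def b_def)
    have p: "sqrt \<delta> > 0" using assms by simp
    show "norm (inverse (sqrt (max x 0 + \<delta>))) \<le> inverse (sqrt \<delta>)"
      using a p by (simp add: a_def[symmetric] le_imp_inverse_le)
    have sq: "a\<^sup>2 = max x 0 + \<delta>" "b\<^sup>2 = max y 0 + \<delta>" using assms by (auto simp: a_def b_def max_def)
    have "a + b > 0" using a p by linarith
    then have "\<bar>a - b\<bar> * (a + b) = \<bar>(a - b) * (a + b)\<bar>" by (simp add: abs_mult)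
    also have "(a - b) * (a + b) = a\<^sup>2 - b\<^sup>2" by (simp add: power2_eq_square algebra_simps)
    also have "\<bar>\<dots>\<bar> \<le> \<bar>x - y\<bar>" unfolding sq by (simp add: max_def)
    finally have "\<bar>a - b\<bar> * (a + b) \<le> \<bar>x - y\<bar>" .
    moreover have "\<bar>a - b\<bar> * (2 * sqrt \<delta>) \<le> \<bar>a - b\<bar> * (a + b)" using a by (intro mult_left_mono) auto
    ultimately have ab: "\<bar>a - b\<bar> \<le> \<bar>x - y\<bar> / (2 * sqrt \<delta>)" using p by (simp add: pos_le_divide_eq)
    have ab0: "a > 0" "b > 0" using a p by linarith+
    then have "inverse a - inverse b = (b - a) / (a * b)" by (simp add: field_simps)
    then have "\<bar>inverse a - inverse b\<bar> = \<bar>a - b\<bar> / (a * b)"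
      using ab0 by (simp add: abs_minus_commute abs_mult)
    also have "\<dots> \<le> \<bar>a - b\<bar> / (sqrt \<delta> * sqrt \<delta>)"
      using a p ab0 assms by (intro divide_left_mono mult_mono mult_pos_pos) auto
    also have "\<dots> = \<bar>a - b\<bar> / \<delta>" using assms by simp
    also have "\<dots> \<le> \<bar>x - y\<bar> / (2 * sqrt \<delta>) / \<delta>" using ab assms by (intro divide_right_mono) auto
    finally show "norm (inverse (sqrt (max x 0 + \<delta>)) - inverse (sqrt (max y 0 + \<delta>))) \<le> (1 / (2 * sqrt \<delta>) / \<delta>) * norm (x - y)"
      by (simp add: a_def b_def)
  qed
  show ?thesis
    unfolding slope_def[abs_def]
    by (intro BL_bilinear[OF bounded_bilinear_mult] BL_const 1 2)
qed

lemma slope_nonneg: "\<kappa> \<ge> 0 \<Longrightarrow> \<delta> > 0 \<Longrightarrow> slope \<kappa> \<delta> t \<ge> 0"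
  by (simp add: slope_def clamp01_def)

lemma slope_zero: "\<delta> > 0 \<Longrightarrow> t \<ge> 1 - \<delta> \<Longrightarrow> slope \<kappa> \<delta> t = 0"
  by (simp add: slope_def clamp01_def field_simps max_def)

text \<open>The shift gives the factor t / (t + \<delta>) below 1. Strictness is the point: the
  compactness argument in \<open>calibration_on_Cball\<close> rests on it.\<close>

lemma slope_sq_bound:
  assumes "\<kappa> > 0" "\<delta> > 0" "t \<ge> 0" shows "(slope \<kappa> \<delta> t)\<^sup>2 * t < \<kappa>\<^sup>2 / 4"
proof -
  have c: "0 \<le> clamp01 s" "clamp01 s \<le> 1" for s by (auto simp: clamp01_def)
  have "(slope \<kappa> \<delta> t)\<^sup>2 * t = (\<kappa>\<^sup>2 / 4) * (t / (t + \<delta>)) * (clamp01 ((1 - t) / \<delta> - 1))\<^sup>2"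
  proof -
    define C where "C = clamp01 ((1 - t) / \<delta> - 1)"
    have "slope \<kappa> \<delta> t = (\<kappa> / 2) * (C / sqrt (t + \<delta>))"
      using assms by (simp add: slope_def C_def inverse_eq_divide)
    moreover have "(C / sqrt (t + \<delta>))\<^sup>2 = C\<^sup>2 / (t + \<delta>)"
      using assms by (simp add: power_divide)
    ultimately have "(slope \<kappa> \<delta> t)\<^sup>2 = (\<kappa>\<^sup>2 / 4) * (C\<^sup>2 / (t + \<delta>))"
      by (simp only: power_mult_distrib) (simp add: power_divide)
    then show ?thesis by (simp add: C_def)
  qed
  also have "\<dots> \<le> (\<kappa>\<^sup>2 / 4) * (t / (t + \<delta>)) * 1"
    using assms c by (intro mult_left_mono) (auto intro!: power_le_one)
  also have "\<dots> < \<kappa>\<^sup>2 / 4 * 1"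
    using assms mult_strict_left_mono[of "t / (t + \<delta>)" 1 "\<kappa>\<^sup>2 / 4"] by simp
  finally show ?thesis by simp
qed

text \<open>What the regularization costs. Both the shift by \<delta> and the cutoff near 1 lose at
  most a multiple of \<open>sqrt \<delta>\<close>; a \<open>q\<close> beyond 1 - 2 \<delta> makes
  the right-hand side nonpositive, and monotonicity of \<open>h\<close> is enough.\<close>

lemma slope_integral_bound:
  assumes \<kappa>: "\<kappa> > 0" and \<delta>: "0 < \<delta>" "\<delta> \<le> 1/4" and q: "0 \<le> q" "q \<le> 1"
    and h: "\<And>t. t \<in> {0..1} \<Longrightarrow> (h has_real_derivative slope \<kappa> \<delta> t) (at t)"
  shows "h 1 - h q \<ge> \<kappa> * (1 - sqrt q) - 3 * \<kappa> * sqrt \<delta>"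
proof -
  have mono: "h s \<le> h t" if "0 \<le> s" "s \<le> t" "t \<le> 1" for s t
  proof (rule DERIV_nonneg_imp_nondecreasing[OF that(2)])
    fix x assume "s \<le> x" "x \<le> t"
    then show "\<exists>y. DERIV h x :> y \<and> 0 \<le> y"
      using h[of x] that \<kappa> \<delta>(1) by (intro exI[of _ "slope \<kappa> \<delta> x"]) (auto simp: slope_nonneg)
  qed
  have sd: "\<delta> \<le> sqrt \<delta>" using \<delta> by (intro real_le_rsqrt) (simp add: power2_eq_square mult_left_le)
  have sq: "sqrt (1 - t) \<ge> 1 - t" if "0 \<le> t" "t \<le> 1" for t
    using that by (intro real_le_rsqrt) (simp add: power2_eq_square mult_left_le)
  show ?thesis
  proof (cases "q \<le> 1 - 2 * \<delta>")
    case True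
    \<comment> \<open>On this range the cutoff factor is 1, so \<open>h\<close> and \<kappa> sqrt (t
      + \<delta>) have the same derivative.\<close>
    have "h q - \<kappa> * sqrt (q + \<delta>) \<le> h (1 - 2 * \<delta>) - \<kappa> * sqrt (1 - 2 * \<delta> + \<delta>)"
    proof (rule DERIV_nonneg_imp_nondecreasing[OF True])
      fix x assume x: "q \<le> x" "x \<le> 1 - 2 * \<delta>"
      have "slope \<kappa> \<delta> x = \<kappa> / 2 * inverse (sqrt (x + \<delta>))"
        using x q \<delta> by (simp add: slope_def clamp01_def field_simps max_def min_def)
      moreover have "((\<lambda>x. h x - \<kappa> * sqrt (x + \<delta>)) has_real_derivative slope \<kappa> \<delta> x - \<kappa> * (inverse (sqrt (x + \<delta>)) / 2)) (at x)"
        using x q \<delta> by (auto intro!: derivative_eq_intros h)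
      ultimately show "\<exists>y. ((\<lambda>x. h x - \<kappa> * sqrt (x + \<delta>)) has_real_derivative y) (at x) \<and> 0 \<le> y"
        by (intro exI[of _ "slope \<kappa> \<delta> x - \<kappa> * (inverse (sqrt (x + \<delta>)) / 2)"]) simp
    qed
    moreover have "h (1 - 2 * \<delta>) \<le> h 1" using \<delta> by (intro mono) auto
    moreover have "sqrt (q + \<delta>) \<le> sqrt q + sqrt \<delta>" using q \<delta> by (intro sqrt_add_le_add_sqrt) auto
    moreover have "sqrt (1 - \<delta>) \<ge> 1 - \<delta>" using sq[of \<delta>] \<delta> by simp
    ultimately have "h 1 - h q \<ge> \<kappa> * sqrt (1 - \<delta>) - \<kappa> * sqrt (q + \<delta>)" by simp
    also have "\<kappa> * sqrt (1 - \<delta>) - \<kappa> * sqrt (q + \<delta>) = \<kappa> * (sqrt (1 - \<delta>) - sqrt (q + \<delta>))" by (simp add: algebra_simps)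
    finally have "h 1 - h q \<ge> \<kappa> * (sqrt (1 - \<delta>) - sqrt (q + \<delta>))" .
    moreover have "\<kappa> * (sqrt (1 - \<delta>) - sqrt (q + \<delta>)) \<ge> \<kappa> * (1 - sqrt q - 3 * sqrt \<delta>)"
      using \<kappa> sd \<open>sqrt (q + \<delta>) \<le> sqrt q + sqrt \<delta>\<close> \<open>sqrt (1 - \<delta>) \<ge> 1 - \<delta>\<close> real_sqrt_ge_zero[of \<delta>] \<delta>
      by (intro mult_left_mono) auto
    ultimately show ?thesis by (simp add: algebra_simps)
  next
    case False
    have "sqrt q \<ge> sqrt (1 - 2 * \<delta>)" using False by simp
    moreover have "sqrt (1 - 2 * \<delta>) \<ge> 1 - 2 * \<delta>" using sq[of "2*\<delta>"] \<delta> by simp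
    ultimately have "1 - sqrt q \<le> 3 * sqrt \<delta>" using sd real_sqrt_ge_zero[of \<delta>] \<delta> by linarith
    then have "\<kappa> * (1 - sqrt q) \<le> \<kappa> * (3 * sqrt \<delta>)" using \<kappa> by (intro mult_left_mono) auto
    then show ?thesis using mono[of q 1] q by simp
  qed
qed

subsection \<open>Algebra of Q-tensors\<close>

definition outer :: "real^3 \<Rightarrow> real^3 \<Rightarrow> real^3^3" where
  "outer x y = (\<chi> i j. x$i * y$j)"

lemma bounded_bilinear_outer: "bounded_bilinear outer"
  unfolding bilinear_conv_bounded_bilinear[symmetric] bilinear_def linear_iff
  by (simp add: outer_def vec_eq_iff algebra_simps)

lemma bounded_bilinear_mv: "bounded_bilinear ((*v) :: real^3^3 \<Rightarrow> real^3 \<Rightarrow> real^3)"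
  unfolding bilinear_conv_bounded_bilinear[symmetric] bilinear_def linear_iff
  by (simp add: matrix_vector_mult_def vec_eq_iff sum.distrib sum_distrib_left algebra_simps)

lemma linear_transpose: "bounded_linear (transpose :: real^3^3 \<Rightarrow> real^3^3)"
  unfolding linear_conv_bounded_linear[symmetric] linear_iff
  by (simp add: transpose_def vec_eq_iff)

lemma inner_mat: "(A::real^3^3) \<bullet> B = (\<Sum>i\<in>UNIV. \<Sum>j\<in>UNIV. A$i$j * B$i$j)"
  by (simp add: inner_vec_def)

lemma outer_inner: "outer x y \<bullet> outer z w = (x \<bullet> z) * (y \<bullet> w)"
  by (simp add: inner_mat outer_def inner_vec_def sum_3 algebra_simps)

lemma outer_inner_mat: "outer x y \<bullet> H = x \<bullet> (H *v y)"
  by (simp add: inner_mat outer_def inner_vec_def matrix_vector_mult_def sum_distrib_left algebra_simps)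

lemma transpose_outer: "transpose (outer x y) = outer y x"
  by (simp add: transpose_def outer_def vec_eq_iff)

lemma transpose_inner: "transpose A \<bullet> B = A \<bullet> transpose (B::real^3^3)"
  unfolding inner_mat by (subst sum.swap) (simp add: transpose_def)

lemma sym_inner:
  assumes "transpose H = (H::real^3^3)" shows "x \<bullet> (H *v y) = (H *v x) \<bullet> y"
  using dot_lmul_matrix[of x H y] assms by (metis transpose_matrix_vector)

lemma uniaxial_outer: "uniaxial n = outer n n - (1/3) *\<^sub>R mat 1"
  by (simp add: uniaxial_def outer_def)

text \<open>On the tensors of the form projection minus a third of the identity, Pm is the projection.\<close>
definition Pm :: "real^3^3 \<Rightarrow> real^3^3" where
  "Pm Q = Q + (1/3) *\<^sub>R mat 1"

lemma S0_entries:
  assumes "Q \<in> S0"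
  shows "Q$2$1 = Q$1$2" "Q$3$1 = Q$1$3" "Q$3$2 = Q$2$3" "Q$3$3 = - Q$1$1 - Q$2$2"
proof -
  have t: "transpose Q = Q" "trace Q = 0" using assms by (auto simp: S0_def)
  have "transpose Q $ i $ j = Q $ j $ i" for i j by (simp add: transpose_def)
  then show "Q$2$1 = Q$1$2" "Q$3$1 = Q$1$3" "Q$3$2 = Q$2$3" using t(1) by metis+
  show "Q$3$3 = - Q$1$1 - Q$2$2" using t(2) by (simp add: trace_def sum_3)
qed

lemma norm_mat_sq: "(norm (A::real^3^3))\<^sup>2 = (\<Sum>i\<in>UNIV. \<Sum>j\<in>UNIV. (A$i$j)\<^sup>2)"
  unfolding power2_norm_eq_inner inner_mat by (simp add: power2_eq_square)

text \<open>The potential is the squared defect of \<open>Pm Q\<close> from being idempotent. As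
  \<open>Pm Q\<close> is symmetric with trace one, its zeros are the projections of rank one, that
  is, the uniaxial tensors.\<close>

lemma f_pot_eq:
  assumes "Q \<in> S0"
  shows "f_pot Q = (3/2) * (norm (Pm Q ** Pm Q - Pm Q))\<^sup>2"
proof -
  have n4: "(norm Q)^4 = ((norm Q)\<^sup>2)\<^sup>2" by simp
  show ?thesis
    unfolding f_pot_def n4 norm_mat_sq
    by (simp add: Pm_def sum_3 trace_def matrix_matrix_mult_def mat_def S0_entries[OF assms])
       (simp add: power2_eq_square algebra_simps, simp add: field_simps)
qed

lemma norm_S0_sq:
  assumes "Q \<in> S0"
  shows "(norm Q)\<^sup>2 = 2 * ((Q$1$1)\<^sup>2 + (Q$2$2)\<^sup>2 + Q$1$1 * Q$2$2 + (Q$1$2)\<^sup>2 + (Q$1$3)\<^sup>2 + (Q$2$3)\<^sup>2)"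
  unfolding norm_mat_sq
  by (simp add: sum_3 S0_entries[OF assms]) (simp add: power2_eq_square algebra_simps)

lemma trace_sq_le: "(trace (A::real^3^3))\<^sup>2 \<le> 3 * (norm A)\<^sup>2"
proof -
  have "3 * ((A$1$1)\<^sup>2 + (A$2$2)\<^sup>2 + (A$3$3)\<^sup>2) - (A$1$1 + A$2$2 + A$3$3)\<^sup>2
     = (A$1$1 - A$2$2)\<^sup>2 + (A$1$1 - A$3$3)\<^sup>2 + (A$2$2 - A$3$3)\<^sup>2"
    by (simp add: power2_eq_square algebra_simps)
  then have "(A$1$1 + A$2$2 + A$3$3)\<^sup>2 \<le> 3 * ((A$1$1)\<^sup>2 + (A$2$2)\<^sup>2 + (A$3$3)\<^sup>2)"
    by (smt (verit) zero_le_power2)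
  also have "\<dots> \<le> 3 * (norm A)\<^sup>2"
    unfolding norm_mat_sq by (simp add: sum_3)
  finally show ?thesis by (simp add: trace_def sum_3)
qed

text \<open>The trace of the idempotency defect is |Q|^2 - 2/3, and the square of a trace is at most
  three times the squared norm. This controls \<open>f_pot\<close> both near 0 and for large
  tensors.\<close>

lemma f_pot_lower:
  assumes "Q \<in> S0" shows "f_pot Q \<ge> ((norm Q)\<^sup>2 - 2/3)\<^sup>2 / 2"
proof -
  have "trace (Pm Q ** Pm Q - Pm Q) = (norm Q)\<^sup>2 - 2/3"
    unfolding norm_S0_sq[OF assms]
    by (simp add: Pm_def sum_3 trace_def matrix_matrix_mult_def mat_def S0_entries[OF assms])
       (simp add: power2_eq_square field_simps)
  then show ?thesis using trace_sq_le[of "Pm Q ** Pm Q - Pm Q"] f_pot_eq[OF assms] by simp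
qed

lemma f_pot_nonneg: "Q \<in> S0 \<Longrightarrow> f_pot Q \<ge> 0"
  by (simp add: f_pot_eq)

lemma f_pot_zero: "Q \<in> S0 \<Longrightarrow> f_pot Q = 0 \<longleftrightarrow> Pm Q ** Pm Q = Pm Q"
  by (simp add: f_pot_eq)

lemma f_pot_zero_norm:
  assumes "Q \<in> S0" "f_pot Q = 0" shows "(norm Q)\<^sup>2 = 2/3"
  using f_pot_lower[OF assms(1)] assms(2) by (simp add: zero_le_power2 order_antisym)

lemma g_pot_nonneg:
  assumes "Q \<in> S0" "g0 \<ge> 0" shows "g_pot g0 Q \<ge> 0"
proof (cases "Q = 0")
  case False
  have "(Q$3$3)\<^sup>2 \<le> (2/3) * (norm Q)\<^sup>2"
  proof -
    have "(2/3) * (norm Q)\<^sup>2 - (Q$3$3)\<^sup>2 = (1/3) * (Q$1$1 - Q$2$2)\<^sup>2 + (4/3) * ((Q$1$2)\<^sup>2 + (Q$1$3)\<^sup>2 + (Q$2$3)\<^sup>2)"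
      unfolding norm_S0_sq[OF assms(1)] S0_entries(4)[OF assms(1)]
      by (simp add: power2_eq_square field_simps)
    also have "\<dots> \<ge> 0" by simp
    finally show ?thesis by simp
  qed
  then have "Q$3$3 \<le> sqrt ((2/3) * (norm Q)\<^sup>2)" by (rule real_le_rsqrt)
  then have "Q$3$3 \<le> sqrt (2/3) * norm Q" by (simp only: real_sqrt_mult real_sqrt_abs abs_norm_cancel)
  then have "Q$3$3 / norm Q \<le> sqrt (2/3)" using False by (simp add: divide_le_eq)
  then show ?thesis using False by (simp add: g_pot_def)
qed (simp add: g_pot_def assms)

lemma uniaxial_props:
  assumes "norm n = 1"
  shows "uniaxial n \<in> S0" "Pm (uniaxial n) = outer n n" "f_pot (uniaxial n) = 0"
    "g_pot g0 (uniaxial n) = sqrt (3/2) * (1 - (n$3)\<^sup>2)" "(norm (uniaxial n))\<^sup>2 = 2/3"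
proof -
  have nn: "n \<bullet> n = 1" using assms by (simp add: norm_eq_1)
  then have n3: "n$1 * n$1 + n$2 * n$2 + n$3 * n$3 = 1" by (simp add: inner_vec_def sum_3)
  show S: "uniaxial n \<in> S0"
    using n3 by (auto simp: S0_def uniaxial_def transpose_def vec_eq_iff trace_def sum_3 mat_def algebra_simps)
  show P: "Pm (uniaxial n) = outer n n" by (simp add: Pm_def uniaxial_outer)
  have "outer n n ** outer n n = (n \<bullet> n) *\<^sub>R outer n n"
    by (simp add: matrix_matrix_mult_def outer_def vec_eq_iff inner_vec_def sum_distrib_left sum_distrib_right mult_ac)
  then show f: "f_pot (uniaxial n) = 0" using nn by (simp add: f_pot_zero[OF S] P)
  show nrm: "(norm (uniaxial n))\<^sup>2 = 2/3" by (rule f_pot_zero_norm[OF S f])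
  have ne: "uniaxial n \<noteq> 0" using nrm by auto
  have "norm (uniaxial n) = sqrt (2/3)" using nrm by (metis norm_ge_zero real_sqrt_unique)
  then have "g_pot g0 (uniaxial n) = sqrt (2/3) - ((n$3)\<^sup>2 - 1/3) / sqrt (2/3)"
    using ne by (simp add: g_pot_def uniaxial_def mat_def power2_eq_square)
  also have "\<dots> = sqrt (3/2) * (1 - (n$3)\<^sup>2)"
  proof -
    have ts: "sqrt (2/3) * sqrt (3/2) = 1" by (simp add: real_sqrt_mult[symmetric])
    have t: "sqrt (2/3) = (2/3) * sqrt (3/2)"
    proof -
      have "sqrt (2/3) = sqrt ((2/3)\<^sup>2 * (3/2))" by (simp add: power2_eq_square)
      then show ?thesis by (simp only: real_sqrt_mult real_sqrt_abs)
    qed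
    have inv: "y / sqrt (2/3) = y * sqrt (3/2)" for y :: real
    proof -
      have "y = y * (sqrt (2/3) * sqrt (3/2))" by (simp only: ts mult_1_right)
      also have "\<dots> = (y * sqrt (3/2)) * sqrt (2/3)" by (simp only: mult_ac)
      finally show ?thesis by (subst nonzero_divide_eq_eq) auto
    qed
    show ?thesis unfolding inv by (subst t) (simp only: left_diff_distrib right_diff_distrib, simp add: algebra_simps)
  qed
  finally show "g_pot g0 (uniaxial n) = sqrt (3/2) * (1 - (n$3)\<^sup>2)" .
qed

subsection \<open>Construction of the calibration\<close>

text \<open>The 33 entry of the purified projection \<open>3 P\<^sup>2 - 2 P\<^sup>3\<close>: on projections its gradient is tangential to the
  manifold of projections, so that no normal derivative has to be paid for.\<close>
definition qf :: "real^3^3 \<Rightarrow> real" where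
  "qf Q = 3 * ((Pm Q *v e3) \<bullet> (Pm Q *v e3)) - 2 * ((Pm Q *v e3) \<bullet> (Pm Q *v (Pm Q *v e3)))"

text \<open>Represents the derivative of \<open>qf\<close> in symmetric directions. The symmetrized
  \<open>Dq\<close> represents the same functional on them with a smaller norm, and only that norm
  matches the potential in \<open>Dq_on_projections\<close>.\<close>

definition Dq0 :: "real^3^3 \<Rightarrow> real^3^3" where
  "Dq0 Q = outer (6 *\<^sub>R (Pm Q *v e3) - 4 *\<^sub>R (Pm Q *v (Pm Q *v e3))) e3 - outer (2 *\<^sub>R (Pm Q *v e3)) (Pm Q *v e3)"

definition Dq :: "real^3^3 \<Rightarrow> real^3^3" where
  "Dq Q = (1/2) *\<^sub>R (Dq0 Q + transpose (Dq0 Q))"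

lemma Dq_inner:
  assumes "transpose H = H" shows "Dq Q \<bullet> H = Dq0 Q \<bullet> H"
  unfolding Dq_def using transpose_inner[of "Dq0 Q" H] assms by (simp add: inner_add_left)

lemma mv_simps:
  fixes A B :: "real^3^3"
  shows "A *v (x + y) = A *v x + A *v y" "A *v (x - y) = A *v x - A *v y" "(A + B) *v x = A *v x + B *v x"
    "A *v (c *\<^sub>R x) = c *\<^sub>R (A *v x)" "(c *\<^sub>R A) *v x = c *\<^sub>R (A *v x)"
  using bounded_bilinear.add_right[OF bounded_bilinear_mv] bounded_bilinear.diff_right[OF bounded_bilinear_mv]
    bounded_bilinear.add_left[OF bounded_bilinear_mv] bounded_bilinear.scaleR_right[OF bounded_bilinear_mv]
    bounded_bilinear.scaleR_left[OF bounded_bilinear_mv] by blast+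

lemma transpose_linear_simps:
  "transpose (A + B) = transpose A + transpose (B::real^3^3)" "transpose (c *\<^sub>R A) = c *\<^sub>R transpose A"
  "transpose (A - B) = transpose A - transpose B"
  by (simp_all add: transpose_def vec_eq_iff)

lemma transpose_Pm: "transpose Q = Q \<Longrightarrow> transpose (Pm Q) = Pm Q"
  by (simp add: Pm_def transpose_linear_simps)

lemma qf_line_deriv:
  assumes A: "transpose A = A" and H: "transpose H = H"
  shows "((\<lambda>t. qf (A + t *\<^sub>R H)) has_real_derivative (Dq (A + t *\<^sub>R H) \<bullet> H)) (at t)"
proof -
  define P where "P t = Pm (A + t *\<^sub>R H)" for t
  define a where "a t = P t *v e3" for t
  define k where "k = H *v e3"
  have P: "P t = Pm A + t *\<^sub>R H" for t by (simp add: P_def Pm_def)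
  have sP: "transpose (P t) = P t" for t
    unfolding P_def by (rule transpose_Pm) (simp add: transpose_linear_simps A H)
  have a_eq: "a t = Pm A *v e3 + t *\<^sub>R k" for t by (simp add: a_def P k_def mv_simps)
  have dP: "(P has_vector_derivative H) (at t)"
    unfolding P[abs_def] by (auto intro!: derivative_eq_intros)
  have da: "(a has_vector_derivative k) (at t)"
    unfolding a_eq[abs_def] by (auto intro!: derivative_eq_intros)
  have dPa: "((\<lambda>t. P t *v a t) has_vector_derivative (P t *v k + H *v a t)) (at t)"
    by (rule bounded_bilinear.has_vector_derivative[OF bounded_bilinear_mv dP da])
  have d1: "((\<lambda>t. a t \<bullet> a t) has_vector_derivative (a t \<bullet> k + k \<bullet> a t)) (at t)"
    by (rule bounded_bilinear.has_vector_derivative[OF bounded_bilinear_inner da da])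
  have d2: "((\<lambda>t. a t \<bullet> (P t *v a t)) has_vector_derivative (a t \<bullet> (P t *v k + H *v a t) + k \<bullet> (P t *v a t))) (at t)"
    by (rule bounded_bilinear.has_vector_derivative[OF bounded_bilinear_inner da dPa])
  have "((\<lambda>t. 3 * (a t \<bullet> a t) - 2 * (a t \<bullet> (P t *v a t))) has_real_derivative
     3 * (a t \<bullet> k + k \<bullet> a t) - 2 * (a t \<bullet> (P t *v k + H *v a t) + k \<bullet> (P t *v a t))) (at t)"
    using d1 d2 unfolding has_real_derivative_iff_has_vector_derivative[symmetric]
    by (intro DERIV_diff DERIV_cmult)
  moreover have "qf (A + t *\<^sub>R H) = 3 * (a t \<bullet> a t) - 2 * (a t \<bullet> (P t *v a t))" for t
    by (simp add: qf_def a_def P_def)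
  moreover have "3 * (a t \<bullet> k + k \<bullet> a t) - 2 * (a t \<bullet> (P t *v k + H *v a t) + k \<bullet> (P t *v a t))
      = Dq (A + t *\<^sub>R H) \<bullet> H"
  proof -
    have "Dq0 (A + t *\<^sub>R H) = outer (6 *\<^sub>R a t - 4 *\<^sub>R (P t *v a t)) e3 - outer (2 *\<^sub>R a t) (a t)"
      by (simp add: Dq0_def a_def P_def)
    then have "Dq0 (A + t *\<^sub>R H) \<bullet> H = (6 *\<^sub>R a t - 4 *\<^sub>R (P t *v a t)) \<bullet> k - (2 *\<^sub>R a t) \<bullet> (H *v a t)"
      by (simp add: inner_diff_left outer_inner_mat k_def)
    moreover have "a t \<bullet> (P t *v k) = (P t *v a t) \<bullet> k" by (rule sym_inner[OF sP])
    ultimately show ?thesis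
      unfolding Dq_inner[OF H] by (simp add: inner_diff_left inner_diff_right inner_add_right inner_commute)
  qed
  ultimately show ?thesis by simp
qed

lemma e3_simps: "e3 \<bullet> e3 = 1" "x \<bullet> e3 = x$3" "e3 \<bullet> x = x$3"
  by (simp_all add: e3_def inner_axis inner_axis')

text \<open>Split \<open>e3\<close> into its image \<open>a\<close> under the projection and the
  orthogonal rest \<open>b\<close>, with squared lengths q and 1 - q. The symmetrized gradient is
  the symmetric product of \<open>a\<close> and \<open>b\<close>, which is tangential to the
  projections.\<close>

lemma Dq_on_projections:
  assumes S: "Q \<in> S0" and f: "f_pot Q = 0"
  shows "0 \<le> qf Q" "qf Q \<le> 1" "(norm (Dq Q))\<^sup>2 = 2 * qf Q * (1 - qf Q)"
    "g_pot g0 Q = sqrt (3/2) * (1 - qf Q)"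
proof -
  have PP: "Pm Q ** Pm Q = Pm Q" using f_pot_zero[OF S] f by simp
  have sP: "transpose (Pm Q) = Pm Q" using S by (intro transpose_Pm) (simp add: S0_def)
  define a where "a = Pm Q *v e3"
  define b where "b = e3 - a"
  have Pa: "Pm Q *v a = a" by (simp add: a_def matrix_vector_mul_assoc PP)
  have qa: "qf Q = a \<bullet> a" by (simp add: qf_def a_def[symmetric] Pa)
  have ae: "a \<bullet> e3 = qf Q"
  proof -
    have "a \<bullet> a = a \<bullet> (Pm Q *v e3)" by (simp add: a_def)
    also have "\<dots> = (Pm Q *v a) \<bullet> e3" by (rule sym_inner[OF sP])
    finally show ?thesis by (simp add: Pa qa)
  qed
  have ab: "a \<bullet> b = 0" "b \<bullet> b = 1 - qf Q"
    using ae qa by (simp_all add: b_def inner_diff_left inner_diff_right inner_commute e3_simps(1))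
  show "0 \<le> qf Q" by (simp add: qa)
  show "qf Q \<le> 1" using ab(2) inner_ge_zero[of b] by simp
  have "Dq0 Q = outer (2 *\<^sub>R a) e3 - outer (2 *\<^sub>R a) a"
    by (simp add: Dq0_def a_def[symmetric] Pa scaleR_left_diff_distrib[symmetric])
  also have "\<dots> = 2 *\<^sub>R outer a b"
    by (simp add: b_def bounded_bilinear.diff_right[OF bounded_bilinear_outer] bounded_bilinear.scaleR_left[OF bounded_bilinear_outer]
      scaleR_diff_right)
  finally have "Dq Q = outer a b + outer b a"
    by (simp add: Dq_def transpose_linear_simps transpose_outer scaleR_add_right[symmetric])
  then have "(norm (Dq Q))\<^sup>2 = 2 * (a \<bullet> a) * (b \<bullet> b) + 2 * (a \<bullet> b) * (a \<bullet> b)"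
    unfolding power2_norm_eq_inner by (simp add: inner_add_left inner_add_right outer_inner inner_commute)
  then show "(norm (Dq Q))\<^sup>2 = 2 * qf Q * (1 - qf Q)" by (simp add: ab qa[symmetric])
  have nrm: "norm Q = sqrt (2/3)" using f_pot_zero_norm[OF S f] by (metis norm_ge_zero real_sqrt_unique)
  then have "Q \<noteq> 0" by auto
  have "a$3 = Q$3$3 + 1/3"
    by (simp add: a_def Pm_def e3_def matrix_vector_mult_def axis_def sum_3 mat_def)
  then have q33: "Q$3$3 = qf Q - 1/3" using ae by (simp add: e3_simps)
  have ts: "sqrt (2/3) * sqrt (3/2) = 1" by (simp add: real_sqrt_mult[symmetric])
  have t: "sqrt (2/3) = (2/3) * sqrt (3/2)"
  proof -
    have "sqrt (2/3) = sqrt ((2/3)\<^sup>2 * (3/2))" by (simp add: power2_eq_square)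
    then show ?thesis by (simp only: real_sqrt_mult real_sqrt_abs)
  qed
  have inv: "y / sqrt (2/3) = y * sqrt (3/2)" for y :: real
  proof -
    have "y = y * (sqrt (2/3) * sqrt (3/2))" by (simp only: ts mult_1_right)
    also have "\<dots> = (y * sqrt (3/2)) * sqrt (2/3)" by (simp only: mult_ac)
    finally show ?thesis by (subst nonzero_divide_eq_eq) auto
  qed
  show "g_pot g0 Q = sqrt (3/2) * (1 - qf Q)"
    using \<open>Q \<noteq> 0\<close> unfolding g_pot_def nrm q33 inv
    by (subst t) (simp add: algebra_simps)
qed

lemma qf_uniaxial:
  assumes "norm n = 1" shows "qf (uniaxial n) = (n$3)\<^sup>2"
proof -
  have nn: "n \<bullet> n = 1" using assms by (simp add: norm_eq_1)
  have o: "outer n n *v x = (n \<bullet> x) *\<^sub>R n" for x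
    by (simp add: vec_eq_iff outer_def matrix_vector_mult_def inner_vec_def sum_distrib_left sum_distrib_right mult_ac)
  show ?thesis
    by (simp add: qf_def uniaxial_props(2)[OF assms] o e3_simps nn power2_eq_square)
qed

lemma Q_inf_uniaxial: "Q_inf = uniaxial e3" "norm e3 = 1" "e3$3 = 1"
  by (simp_all add: Q_inf_def e3_def)

text \<open>A compact convex set with the uniaxial tensors, of norm sqrt (2/3), well inside.
  Convexity provides a nonexpansive nearest point map; outside the ball \<open>f_pot\<close> exceeds
  1.\<close>

definition Cball :: "(real^3^3) set" where
  "Cball = S0 \<inter> cball 0 2"

lemma subspace_S0: "subspace S0"
  by (auto simp: subspace_def S0_def transpose_linear_simps trace_add trace_def sum_distrib_left[symmetric])
     (simp_all add: transpose_def vec_eq_iff sum.distrib)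

lemma Cball_props: "compact Cball" "convex Cball" "closed Cball" "Cball \<noteq> {}" "bounded Cball"
proof -
  have c: "closed S0" by (rule closed_subspace[OF subspace_S0])
  show "closed Cball" "bounded Cball" using c by (auto simp: Cball_def intro: bounded_subset)
  then show "compact Cball" by (simp add: compact_eq_bounded_closed)
  show "convex Cball" unfolding Cball_def
    using subspace_imp_convex[OF subspace_S0] by (intro convex_Int) auto
  show "Cball \<noteq> {}" using subspace_0[OF subspace_S0] by (auto simp: Cball_def)
qed

lemma BL_Pm: "BL Cball Pm"
  unfolding Pm_def[abs_def] by (intro BL_add BL_ident Cball_props BL_const)

lemma BL_mv: "BL S A \<Longrightarrow> BL S x \<Longrightarrow> BL S (\<lambda>Q. (A Q :: real^3^3) *v x Q)"
  by (rule BL_bilinear[OF bounded_bilinear_mv])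

lemma BL_scale: "BL S f \<Longrightarrow> BL S (\<lambda>x. c *\<^sub>R f x)"
  by (rule BL_bilinear[OF bounded_bilinear_scaleR BL_const])

lemma BL_qf: "BL Cball qf"
proof -
  have "BL Cball (\<lambda>Q. 3 *\<^sub>R ((Pm Q *v e3) \<bullet> (Pm Q *v e3)) - 2 *\<^sub>R ((Pm Q *v e3) \<bullet> (Pm Q *v (Pm Q *v e3))))"
    by (intro BL_diff BL_scale BL_bilinear[OF bounded_bilinear_inner] BL_mv BL_Pm BL_const)
  then show ?thesis by (simp add: qf_def[abs_def])
qed

lemma BL_Dq: "BL Cball Dq"
  unfolding Dq_def[abs_def] Dq0_def
  by (intro BL_scale BL_add BL_linear[OF linear_transpose] BL_diff BL_bilinear[OF bounded_bilinear_outer] BL_mv BL_Pm BL_const)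

lemma continuous_on_f_pot: "continuous_on Cball f_pot"
proof -
  have "bounded_bilinear ((**) :: real^3^3 \<Rightarrow> real^3^3 \<Rightarrow> real^3^3)"
    unfolding bilinear_conv_bounded_bilinear[symmetric] bilinear_def linear_iff
    by (simp add: matrix_matrix_mult_def vec_eq_iff sum.distrib sum_distrib_left algebra_simps)
  then have "continuous_on Cball (\<lambda>Q. (3/2) * (norm (Pm Q ** Pm Q - Pm Q))\<^sup>2)"
    by (intro continuous_intros BL_continuous BL_diff BL_bilinear[of "(**)"] BL_Pm)
  then show ?thesis
    by (rule continuous_on_eq) (simp add: f_pot_eq Cball_def)
qed

text \<open>Where the bound fails without the multiple of \<open>f_pot\<close>, the tensor cannot be
  a zero of \<open>f_pot\<close>, since there the bound is strict. These tensors form a compact set,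
  so \<open>f_pot\<close> has a positive minimum on it and a large factor compensates.\<close>

lemma calibration_on_Cball:
  fixes \<kappa> \<delta> g0 :: real
  assumes \<kappa>: "\<kappa> = root 4 24" and g0: "g0 \<ge> 0" and \<delta>: "0 < \<delta>" "\<delta> \<le> 1/4"
  defines "G0 \<equiv> (\<lambda>Q. slope \<kappa> \<delta> (qf Q) * norm (Dq Q))"
  shows "\<exists>lam0>0. \<forall>Q\<in>Cball. \<forall>lam\<ge>lam0. (G0 Q)\<^sup>2 \<le> 2 * (lam\<^sup>2 * f_pot Q + g_pot g0 Q)"
proof -
  have \<kappa>pos: "\<kappa> > 0" by (simp add: \<kappa>)
  have k4: "\<kappa>\<^sup>2 / 4 = sqrt (3/2)"
  proof -
    have "(\<kappa>\<^sup>2)\<^sup>2 = 24" by (simp add: \<kappa> flip: power_mult)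
    then have "(\<kappa>\<^sup>2 / 4)\<^sup>2 = 3/2" by (simp add: power_divide)
    then show ?thesis by (metis real_sqrt_unique zero_le_divide_iff zero_le_numeral zero_le_power2)
  qed
  have BLG: "BL Cball G0"
    unfolding G0_def by (intro BL_bilinear[OF bounded_bilinear_mult] BL_compose[OF BL_slope[OF \<delta>(1)]] BL_norm BL_qf BL_Dq)
  obtain M where M: "M > 0" "\<forall>Q\<in>Cball. norm (G0 Q) \<le> M" using BL_D[OF BLG] by blast
  \<comment> \<open>A neighbourhood of 0 is removed because the quotient in \<open>g_pot\<close> is
    not continuous there.\<close>
  define C1 where "C1 = Cball \<inter> {Q. 1/10 \<le> norm Q}"
  \<comment> \<open>The formula for \<open>g_pot\<close> is written out to have a continuous
    function. The restriction of \<open>qf\<close> keeps away from \<open>Q_inf\<close>, where slope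
    and potential both vanish and strictness is lost.\<close>
  define K where "K = {Q \<in> {Q \<in> C1. qf Q \<le> 1 - \<delta>}. 2 * (sqrt (2/3) - Q$3$3 / norm Q) \<le> (G0 Q)\<^sup>2}"
  have C1: "closed C1" unfolding C1_def
    by (intro closed_Int Cball_props closed_Collect_le continuous_intros)
  have C1sub: "C1 \<subseteq> Cball" by (auto simp: C1_def)
  have C2: "closed {Q \<in> C1. qf Q \<le> 1 - \<delta>}"
    by (intro continuous_on_closed_Collect_le C1 continuous_on_const continuous_on_subset[OF BL_continuous[OF BL_qf] C1sub])
  have "closed K" unfolding K_def
  proof (rule continuous_on_closed_Collect_le[OF _ _ C2])
    show "continuous_on {Q \<in> C1. qf Q \<le> 1 - \<delta>} (\<lambda>Q. (G0 Q)\<^sup>2)"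
      using C1sub by (intro continuous_intros continuous_on_subset[OF BL_continuous[OF BLG]]) auto
    show "continuous_on {Q \<in> C1. qf Q \<le> 1 - \<delta>} (\<lambda>Q. 2 * (sqrt (2 / 3) - Q $ 3 $ 3 / norm Q))"
      by (intro continuous_intros) (auto simp: C1_def)
  qed
  moreover have Ksub: "K \<subseteq> Cball" using C1sub by (auto simp: K_def)
  ultimately have Kc: "compact K" using Cball_props(5) bounded_subset compact_eq_bounded_closed by metis
  have fpos: "f_pot Q > 0" if Q: "Q \<in> K" for Q
  proof (rule ccontr)
    assume "\<not> f_pot Q > 0"
    have S: "Q \<in> S0" using Q Ksub by (auto simp: Cball_def)
    have f0: "f_pot Q = 0" using f_pot_nonneg[OF S] \<open>\<not> f_pot Q > 0\<close> by simp
    note N = Dq_on_projections[OF S f0]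
    have "norm Q \<noteq> 0" using f_pot_zero_norm[OF S f0] by auto
    then have "2 * g_pot g0 Q \<le> (G0 Q)\<^sup>2" using Q by (simp add: K_def g_pot_def)
    also have "(G0 Q)\<^sup>2 = (slope \<kappa> \<delta> (qf Q))\<^sup>2 * qf Q * (2 * (1 - qf Q))"
      unfolding G0_def power_mult_distrib N(3) by simp
    \<comment> \<open>The inequality stays strict because \<open>qf Q\<close> is at most 1 -
      \<delta> on \<open>K\<close>, so the common factor is positive.\<close>
    also have "\<dots> < \<kappa>\<^sup>2 / 4 * (2 * (1 - qf Q))"
      using slope_sq_bound[OF \<kappa>pos \<delta>(1) N(1)] Q \<delta> by (intro mult_strict_right_mono) (auto simp: K_def)
    also have "\<dots> = 2 * g_pot g0 Q" unfolding k4 N(4)[of g0] by simp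
    finally show False by simp
  qed
  obtain c where c: "c > 0" "\<And>Q. Q \<in> K \<Longrightarrow> f_pot Q \<ge> c" "c \<le> 1/10"
  proof (cases "K = {}")
    case True
    then show thesis using that[of "1/10"] by auto
  next
    case False
    obtain Q0 where "Q0 \<in> K" "\<forall>Q\<in>K. f_pot Q0 \<le> f_pot Q"
      using continuous_attains_inf[OF Kc False continuous_on_subset[OF continuous_on_f_pot Ksub]] by blast
    then show thesis using fpos that[of "min (f_pot Q0) (1/10)"] by force
  qed
  \<comment> \<open>Chosen so that \<open>lam0\<^sup>2 * c\<close> is the square of the bound M of
    \<open>G0\<close>.\<close>
  define lam0 where "lam0 = M / sqrt c"
  have l0: "lam0 > 0" using M c by (simp add: lam0_def)
  have big: "(G0 Q)\<^sup>2 \<le> 2 * (lam\<^sup>2 * f_pot Q + g_pot g0 Q)" if "Q \<in> Cball" "f_pot Q \<ge> c" "lam \<ge> lam0" for Q lam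
  proof -
    have S: "Q \<in> S0" using that by (auto simp: Cball_def)
    have "(G0 Q)\<^sup>2 \<le> M\<^sup>2" using M that(1) by (metis abs_le_square_iff abs_of_pos real_norm_def)
    also have "\<dots> = lam0\<^sup>2 * c" using c by (simp add: lam0_def power_divide)
    also have "\<dots> \<le> lam\<^sup>2 * f_pot Q" using that l0 c by (intro mult_mono power_mono) auto
    also have "\<dots> \<le> 2 * (lam\<^sup>2 * f_pot Q + g_pot g0 Q)"
      using g_pot_nonneg[OF S g0] f_pot_nonneg[OF S] by simp
    finally show ?thesis .
  qed
  show ?thesis
  proof (intro exI[of _ lam0] conjI l0 ballI allI impI)
    fix Q lam assume Q: "Q \<in> Cball" and l: "lam0 \<le> lam"
    have S: "Q \<in> S0" using Q by (auto simp: Cball_def)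
    consider "norm Q < 1/10" | "norm Q \<ge> 1/10" "qf Q > 1 - \<delta>" | "Q \<in> K"
      | "norm Q \<ge> 1/10" "(G0 Q)\<^sup>2 < 2 * (sqrt (2/3) - Q$3$3 / norm Q)"
      using Q by (fastforce simp: K_def C1_def)
    then show "(G0 Q)\<^sup>2 \<le> 2 * (lam\<^sup>2 * f_pot Q + g_pot g0 Q)"
    proof cases
      \<comment> \<open>Near 0 the potential \<open>f_pot\<close> is at least 1/10, close to its
        value 2/9 at 0. This is why \<open>c\<close> was taken to be at most 1/10.\<close>
      case 1
      have "(norm Q)\<^sup>2 \<le> (1/10)\<^sup>2" using 1 by (intro power_mono) auto
      then have "2/3 - (norm Q)\<^sup>2 \<ge> 1/2" by (simp add: power2_eq_square)
      then have "(1/2)\<^sup>2 \<le> (2/3 - (norm Q)\<^sup>2)\<^sup>2" by (intro power_mono) auto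
      also have "\<dots> = ((norm Q)\<^sup>2 - 2/3)\<^sup>2" by (rule power2_commute)
      also have "\<dots> / 2 \<le> f_pot Q" by (rule f_pot_lower[OF S])
      finally have "f_pot Q \<ge> 1/10" by (simp add: power2_eq_square)
      then show ?thesis using big[OF Q _ l] c(3) by simp
    next
      case 2
      then have "G0 Q = 0" using slope_zero[OF \<delta>(1), of "qf Q" \<kappa>] by (simp add: G0_def)
      then show ?thesis using g_pot_nonneg[OF S g0] f_pot_nonneg[OF S] by simp
    next
      case 3
      then show ?thesis using big[OF Q c(2) l] by simp
    next
      case 4
      then have "Q \<noteq> 0" by auto
      then have "(G0 Q)\<^sup>2 < 2 * g_pot g0 Q" using 4 by (simp add: g_pot_def)
      then show ?thesis using f_pot_nonneg[OF S] by (simp add: add_increasing)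
    qed
  qed
qed

text \<open>The slope is expressed by finite increments because the extension is only Lipschitz: a
  tensor is first mapped to the nearest point of \<open>Cball\<close>. The term
  \<open>L * norm (A - B)\<close> in the increment bound disappears on fine partitions of a curve.
  \<open>G\<close> is itself Lipschitz, so that it can be compared between nearby maps.\<close>

theorem calibration:
  fixes \<kappa> g0 \<epsilon> :: real
  assumes \<kappa>: "\<kappa> = root 4 24" and g0: "g0 \<ge> 0" and \<epsilon>: "\<epsilon> > 0"
  obtains \<Phi> G :: "real^3^3 \<Rightarrow> real" and L K :: real where "L > 0" "K > 0"
    "\<And>A B. \<bar>\<Phi> A - \<Phi> B\<bar> \<le> (G A + L * norm (A - B)) * norm (A - B)"
    "\<And>A B. \<bar>G A - G B\<bar> \<le> L * norm (A - B)" "\<And>A. 0 \<le> G A" "G Q_inf = 0"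
    "\<And>A B. \<bar>\<Phi> A - \<Phi> B\<bar> \<le> L * norm (A - B)"
    "\<And>Q lam. Q \<in> S0 \<Longrightarrow> lam \<ge> K \<Longrightarrow> (G Q)\<^sup>2 \<le> 2 * (lam\<^sup>2 * f_pot Q + g_pot g0 Q)"
    "\<And>n. norm n = 1 \<Longrightarrow> \<bar>\<Phi> (uniaxial n) - \<Phi> Q_inf\<bar> \<ge> \<kappa> * (1 - \<bar>n$3\<bar>) - \<epsilon>"
proof -
  have \<kappa>pos: "\<kappa> > 0" by (simp add: \<kappa>)
  \<comment> \<open>Makes the loss \<open>3 * \<kappa> * sqrt \<delta>\<close> from
    \<open>slope_integral_bound\<close> at most \<epsilon>.\<close>
  define \<delta> where "\<delta> = min (1/4) ((\<epsilon> / (3 * \<kappa>))\<^sup>2)"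
  have \<delta>: "0 < \<delta>" "\<delta> \<le> 1/4" using \<epsilon> \<kappa>pos by (auto simp: \<delta>_def)
  have "sqrt \<delta> \<le> \<epsilon> / (3 * \<kappa>)"
    using \<epsilon> \<kappa>pos by (intro real_le_lsqrt) (auto simp: \<delta>_def)
  then have err: "3 * \<kappa> * sqrt \<delta> \<le> \<epsilon>" using \<kappa>pos by (simp add: field_simps)
  define G0 where "G0 Q = slope \<kappa> \<delta> (qf Q) * norm (Dq Q)" for Q
  obtain lam1 where l1: "lam1 > 0" "\<forall>Q\<in>Cball. \<forall>lam\<ge>lam1. (G0 Q)\<^sup>2 \<le> 2 * (lam\<^sup>2 * f_pot Q + g_pot g0 Q)"
    using calibration_on_Cball[OF \<kappa> g0 \<delta>] unfolding G0_def by blast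
  have BLG: "BL Cball G0"
    unfolding G0_def[abs_def] by (intro BL_bilinear[OF bounded_bilinear_mult] BL_compose[OF BL_slope[OF \<delta>(1)]] BL_norm BL_qf BL_Dq)
  obtain M L0 where M: "M > 0" "L0 > 0" "\<forall>Q\<in>Cball. norm (G0 Q) \<le> M"
      "\<forall>A\<in>Cball. \<forall>B\<in>Cball. norm (G0 A - G0 B) \<le> L0 * norm (A - B)" using BL_D[OF BLG] by blast
  have G0nn: "G0 Q \<ge> 0" for Q using slope_nonneg \<kappa>pos \<delta> by (simp add: G0_def)
  obtain K0 where K0: "K0 > 0" "\<forall>Q\<in>Cball. norm (qf Q) \<le> K0" using BL_D[OF BL_qf] by blast
  \<comment> \<open>The interior of this interval contains all values of \<open>qf\<close> on
    \<open>Cball\<close> and also the interval from 0 to 1, so the antiderivative \<open>h\<close>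
    has two-sided derivatives wherever they are needed.\<close>
  define K where "K = K0 + 2"
  have "continuous_on {-K..K} (slope \<kappa> \<delta>)"
    using BL_continuous[OF BL_slope[OF \<delta>(1)]] continuous_on_subset by blast
  then obtain h where h0: "\<And>x. x \<in> {-K..K} \<Longrightarrow> (h has_vector_derivative slope \<kappa> \<delta> x) (at x within {-K..K})"
    using antiderivative_continuous by blast
  have h: "(h has_real_derivative slope \<kappa> \<delta> x) (at x)" if "x \<in> {-K<..<K}" for x
    using h0[of x] that at_within_interior[of x "{-K..K}"]
    by (simp add: has_real_derivative_iff_has_vector_derivative)
  define pr where "pr = closest_point Cball"
  have pr_in: "pr Q \<in> Cball" for Q unfolding pr_def by (intro closest_point_in_set Cball_props)
  have pr_lip: "norm (pr A - pr B) \<le> norm (A - B)" for A B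
    unfolding pr_def dist_norm[symmetric] by (intro closest_point_lipschitz Cball_props)
  have pr_self: "pr Q = Q" if "Q \<in> Cball" for Q unfolding pr_def using that by (rule closest_point_self)
  have uni: "uniaxial n \<in> Cball" if "norm n = 1" for n
  proof -
    have "(norm (uniaxial n))\<^sup>2 \<le> 2\<^sup>2" using uniaxial_props(5)[OF that] by simp
    then have "norm (uniaxial n) \<le> 2" by (rule power2_le_imp_le) simp
    then show ?thesis using uniaxial_props(1)[OF that] by (simp add: Cball_def)
  qed
  \<comment> \<open>The mean value theorem along the segment from \<open>A\<close> to
    \<open>B\<close>, which convexity keeps inside \<open>Cball\<close>; \<open>Z\<close> is the
    intermediate point.\<close>
  have mvt: "\<exists>Z\<in>Cball. norm (Z - A) \<le> norm (A - B) \<and> \<bar>h (qf A) - h (qf B)\<bar> \<le> G0 Z * norm (A - B)"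
    if A: "A \<in> Cball" and B: "B \<in> Cball" for A B
  proof -
    define H where "H = B - A"
    have S: "transpose A = A" "transpose H = H"
      using A B by (auto simp: Cball_def S0_def H_def transpose_linear_simps)
    have seg: "A + t *\<^sub>R H \<in> Cball" if "0 \<le> t" "t \<le> 1" for t
    proof -
      have "A + t *\<^sub>R H = (1 - t) *\<^sub>R A + t *\<^sub>R B" by (simp add: H_def algebra_simps)
      then show ?thesis using convexD_alt[OF Cball_props(2) A B that] by simp
    qed
    have der: "((\<lambda>t. h (qf (A + t *\<^sub>R H))) has_real_derivative
        slope \<kappa> \<delta> (qf (A + t *\<^sub>R H)) * (Dq (A + t *\<^sub>R H) \<bullet> H)) (at t)" if "0 \<le> t" "t \<le> 1" for t
    proof (rule DERIV_chain2[OF h qf_line_deriv[OF S]])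
      have "\<bar>qf (A + t *\<^sub>R H)\<bar> \<le> K0" using K0(2) seg[OF that] by auto
      then show "qf (A + t *\<^sub>R H) \<in> {-K<..<K}" by (auto simp: K_def)
    qed
    obtain t where t: "0 < t" "t < 1" "h (qf (A + 1 *\<^sub>R H)) - h (qf (A + 0 *\<^sub>R H)) =
        (1 - 0) * (slope \<kappa> \<delta> (qf (A + t *\<^sub>R H)) * (Dq (A + t *\<^sub>R H) \<bullet> H))"
      using MVT2[of 0 1 "\<lambda>t. h (qf (A + t *\<^sub>R H))", OF _ der] by auto
    have "\<bar>h (qf A) - h (qf B)\<bar> = \<bar>h (qf (A + 1 *\<^sub>R H)) - h (qf (A + 0 *\<^sub>R H))\<bar>"
      by (simp add: H_def abs_minus_commute)
    also have "\<dots> = slope \<kappa> \<delta> (qf (A + t *\<^sub>R H)) * \<bar>Dq (A + t *\<^sub>R H) \<bullet> H\<bar>"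
      unfolding t(3) using slope_nonneg[of \<kappa> \<delta>] \<kappa>pos \<delta> by (simp add: abs_mult)
    also have "\<dots> \<le> slope \<kappa> \<delta> (qf (A + t *\<^sub>R H)) * (norm (Dq (A + t *\<^sub>R H)) * norm H)"
      using slope_nonneg[of \<kappa> \<delta>] \<kappa>pos \<delta> by (intro mult_left_mono Cauchy_Schwarz_ineq2) auto
    also have "\<dots> = G0 (A + t *\<^sub>R H) * norm H" by (simp add: G0_def)
    finally have "\<bar>h (qf A) - h (qf B)\<bar> \<le> G0 (A + t *\<^sub>R H) * norm (A - B)"
      by (simp add: H_def norm_minus_commute)
    moreover have "norm (A + t *\<^sub>R H - A) \<le> norm (A - B)"
      using t by (simp add: H_def norm_minus_commute mult_left_le_one_le)
    ultimately show ?thesis using seg[of t] t by (intro bexI[of _ "A + t *\<^sub>R H"]) auto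
  qed
  have inc: "\<bar>h (qf A) - h (qf B)\<bar> \<le> (G0 A + L0 * norm (A - B)) * norm (A - B)"
    and lipM: "\<bar>h (qf A) - h (qf B)\<bar> \<le> M * norm (A - B)"
    if A: "A \<in> Cball" and B: "B \<in> Cball" for A B
  proof -
    obtain Z where Z: "Z \<in> Cball" "norm (Z - A) \<le> norm (A - B)" "\<bar>h (qf A) - h (qf B)\<bar> \<le> G0 Z * norm (A - B)"
      using mvt[OF A B] by blast
    have "norm (G0 Z - G0 A) \<le> L0 * norm (Z - A)" using M(4) Z(1) A by blast
    also have "\<dots> \<le> L0 * norm (A - B)" using Z(2) M(2) by (intro mult_left_mono) auto
    finally have "G0 Z \<le> G0 A + L0 * norm (A - B)" by simp
    then have "G0 Z * norm (A - B) \<le> (G0 A + L0 * norm (A - B)) * norm (A - B)" by (rule mult_right_mono) simp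
    then show "\<bar>h (qf A) - h (qf B)\<bar> \<le> (G0 A + L0 * norm (A - B)) * norm (A - B)" using Z(3) by linarith
    have "norm (G0 Z) \<le> M" using M(3) Z(1) by blast
    then have "G0 Z * norm (A - B) \<le> M * norm (A - B)" by (intro mult_right_mono) auto
    then show "\<bar>h (qf A) - h (qf B)\<bar> \<le> M * norm (A - B)" using Z(3) by linarith
  qed
  define L where "L = M + L0"
  have L: "L > 0" "L0 \<le> L" "M \<le> L" using M by (auto simp: L_def)
  show thesis
  proof (rule that[where \<Phi> = "\<lambda>Q. h (qf (pr Q))" and G = "\<lambda>Q. G0 (pr Q)" and L = L and K = "max lam1 M"])
    show "L > 0" "max lam1 M > 0" using L l1 by auto
    show "\<bar>h (qf (pr A)) - h (qf (pr B))\<bar> \<le> (G0 (pr A) + L * norm (A - B)) * norm (A - B)" for A B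
    proof -
      have "\<bar>h (qf (pr A)) - h (qf (pr B))\<bar> \<le> (G0 (pr A) + L0 * norm (pr A - pr B)) * norm (pr A - pr B)"
        by (rule inc[OF pr_in pr_in])
      also have "\<dots> \<le> (G0 (pr A) + L * norm (A - B)) * norm (A - B)"
        using G0nn[of "pr A"] pr_lip[of A B] L M by (intro mult_mono add_mono) auto
      finally show ?thesis .
    qed
    show "\<bar>G0 (pr A) - G0 (pr B)\<bar> \<le> L * norm (A - B)" for A B
    proof -
      have "\<bar>G0 (pr A) - G0 (pr B)\<bar> \<le> L0 * norm (pr A - pr B)" using M(4) pr_in by auto
      also have "\<dots> \<le> L * norm (A - B)" using pr_lip[of A B] L M by (intro mult_mono) auto
      finally show ?thesis .
    qed
    show "0 \<le> G0 (pr A)" for A by (rule G0nn)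
    have qi: "qf Q_inf = 1" "pr Q_inf = Q_inf"
      using qf_uniaxial[of e3] uni[of e3] pr_self Q_inf_uniaxial by auto
    show "G0 (pr Q_inf) = 0"
      using qi slope_zero[OF \<delta>(1), of 1 \<kappa>] \<delta> by (simp add: G0_def)
    show "\<bar>h (qf (pr A)) - h (qf (pr B))\<bar> \<le> L * norm (A - B)" for A B
    proof -
      have "\<bar>h (qf (pr A)) - h (qf (pr B))\<bar> \<le> M * norm (pr A - pr B)" by (rule lipM[OF pr_in pr_in])
      also have "\<dots> \<le> L * norm (A - B)" using pr_lip[of A B] L M by (intro mult_mono) auto
      finally show ?thesis .
    qed
    show "(G0 (pr Q))\<^sup>2 \<le> 2 * (lam\<^sup>2 * f_pot Q + g_pot g0 Q)" if Q: "Q \<in> S0" and l: "lam \<ge> max lam1 M" for Q lam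
    proof (cases "Q \<in> Cball")
      case True
      then show ?thesis using l1(2) l pr_self by simp
    next
      \<comment> \<open>The nearest point map keeps \<open>G\<close> below M, whereas
        \<open>f_pot\<close> is at least 1 out here; hence the lower bound M for the multiplier
        besides \<open>lam1\<close>.\<close>
      case False
      then have "norm Q > 2" using Q by (auto simp: Cball_def)
      then have "2\<^sup>2 \<le> (norm Q)\<^sup>2" by (intro power_mono) auto
      then have "2 \<le> (norm Q)\<^sup>2 - 2/3" by simp
      then have "2\<^sup>2 \<le> ((norm Q)\<^sup>2 - 2/3)\<^sup>2" by (rule power_mono) simp
      then have "f_pot Q \<ge> 1" using f_pot_lower[OF Q] by simp
      have "(G0 (pr Q))\<^sup>2 \<le> M\<^sup>2" using M(1,3) pr_in by (metis abs_le_square_iff abs_of_pos real_norm_def)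
      also have "\<dots> \<le> lam\<^sup>2 * 1" using M(1) l by (simp add: power_mono)
      also have "\<dots> \<le> lam\<^sup>2 * f_pot Q" using \<open>f_pot Q \<ge> 1\<close> by (intro mult_left_mono) auto
      also have "\<dots> \<le> 2 * (lam\<^sup>2 * f_pot Q + g_pot g0 Q)"
        using g_pot_nonneg[OF Q g0] f_pot_nonneg[OF Q] by simp
      finally show ?thesis .
    qed
    show "\<kappa> * (1 - \<bar>n$3\<bar>) - \<epsilon> \<le> \<bar>h (qf (pr (uniaxial n))) - h (qf (pr Q_inf))\<bar>" if n: "norm n = 1" for n
    proof -
      have n3: "\<bar>n$3\<bar> \<le> 1" using n component_le_norm_cart[of n 3] by simp
      have "h 1 - h ((n$3)\<^sup>2) \<ge> \<kappa> * (1 - sqrt ((n$3)\<^sup>2)) - 3 * \<kappa> * sqrt \<delta>"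
        using K0(1) n3 by (intro slope_integral_bound[OF \<kappa>pos \<delta>] h) (auto simp: K_def abs_square_le_1)
      then show ?thesis
        using err qi pr_self[OF uni[OF n]] qf_uniaxial[OF n] by simp
    qed
  qed
qed

section \<open>Integrals along curves\<close>

lemma nn_integral_split_Ioc:
  assumes "(s::real) \<le> t" "t \<le> u" and [measurable]: "f \<in> borel_measurable lebesgue"
  shows "(\<integral>\<^sup>+x. f x * indicator {s<..u} x \<partial>lebesgue) =
     (\<integral>\<^sup>+x. f x * indicator {s<..t} x \<partial>lebesgue) + (\<integral>\<^sup>+x. f x * indicator {t<..u} x \<partial>lebesgue)"
proof -
  have "f x * indicator {s<..u} x = f x * indicator {s<..t} x + f x * indicator {t<..u} x" for x
    using assms(1,2) by (auto split: split_indicator)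
  moreover have "(\<lambda>x. f x * indicator {p<..q} x) \<in> borel_measurable lebesgue" for p q
    by (rule borel_measurable_times_ennreal[OF assms(3) borel_measurable_indicator]) simp
  ultimately show ?thesis by (simp only:) (rule nn_integral_add)
qed

text \<open>The curve need not be differentiable; it is enough that \<open>v\<close> controls its
  increments, as for the continuous representative of a Sobolev function. On short pieces
  \<open>G\<close> is almost constant along the curve, and the resulting error is proportional to
  the finite integral of \<open>v\<close>.\<close>

lemma upper_gradient_curve:
  fixes \<gamma> :: "real \<Rightarrow> 'a::real_normed_vector" and \<Phi> G :: "'a \<Rightarrow> real" and v :: "real \<Rightarrow> real"
  assumes inc: "\<And>A B. \<bar>\<Phi> A - \<Phi> B\<bar> \<le> (G A + L * norm (A - B)) * norm (A - B)"
    and lip: "\<And>A B. \<bar>G A - G B\<bar> \<le> L * norm (A - B)" and G: "\<And>A. 0 \<le> G A" and L: "L > 0"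
    and cont: "continuous_on {a..b} \<gamma>" and ab: "a \<le> b"
    and v [measurable]: "v \<in> borel_measurable lebesgue" and v0: "\<And>x. v x \<ge> 0"
    and ac: "\<And>s t. a \<le> s \<Longrightarrow> s \<le> t \<Longrightarrow> t \<le> b \<Longrightarrow> ennreal (norm (\<gamma> t - \<gamma> s)) \<le> (\<integral>\<^sup>+x. ennreal (v x) * indicator {s<..t} x \<partial>lebesgue)"
    and fin: "(\<integral>\<^sup>+x. ennreal (v x) * indicator {a<..b} x \<partial>lebesgue) < \<infinity>"
    and Gm [measurable]: "(\<lambda>x. G (\<gamma> x)) \<in> borel_measurable lebesgue"
  shows "ennreal \<bar>\<Phi> (\<gamma> b) - \<Phi> (\<gamma> a)\<bar> \<le> (\<integral>\<^sup>+x. ennreal (G (\<gamma> x) * v x) * indicator {a<..b} x \<partial>lebesgue)"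
proof -
  have [measurable]: "(\<lambda>x::real. x) \<in> borel_measurable lebesgue"
    by (rule measurable_completion) simp
  define V where "V = enn2real (\<integral>\<^sup>+x. ennreal (v x) * indicator {a<..b} x \<partial>lebesgue)"
  have V: "(\<integral>\<^sup>+x. ennreal (v x) * indicator {a<..b} x \<partial>lebesgue) = ennreal V" "V \<ge> 0"
    using fin by (auto simp: V_def)
  have main: "ennreal \<bar>\<Phi> (\<gamma> b) - \<Phi> (\<gamma> a)\<bar> \<le> (\<integral>\<^sup>+x. ennreal (G (\<gamma> x) * v x) * indicator {a<..b} x \<partial>lebesgue) + ennreal (2 * L * \<epsilon> * V)"
    if \<epsilon>: "\<epsilon> > 0" for \<epsilon> :: real
  proof -
    \<comment> \<open>One \<open>L * \<epsilon>\<close> comes from the increment bound for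
      \<open>\<Phi>\<close>, the other from the variation of \<open>G\<close> along the
      piece.\<close>
    define f where "f x = ennreal ((G (\<gamma> x) + 2 * L * \<epsilon>) * v x)" for x
    have fm [measurable]: "f \<in> borel_measurable lebesgue" unfolding f_def by measurable
    have "uniformly_continuous_on {a..b} \<gamma>" using cont compact_uniformly_continuous by blast
    then obtain d where d: "d > 0" "\<And>x y. x \<in> {a..b} \<Longrightarrow> y \<in> {a..b} \<Longrightarrow> dist x y < d \<Longrightarrow> norm (\<gamma> x - \<gamma> y) < \<epsilon>"
      unfolding uniformly_continuous_on_def dist_norm using \<epsilon> by (metis norm_minus_commute)
    have small: "ennreal \<bar>\<Phi> (\<gamma> t) - \<Phi> (\<gamma> s)\<bar> \<le> (\<integral>\<^sup>+x. f x * indicator {s<..t} x \<partial>lebesgue)"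
      if st: "a \<le> s" "s \<le> t" "t \<le> b" "t - s < d" for s t
    proof -
      have n: "norm (\<gamma> s - \<gamma> x) \<le> \<epsilon>" if "x \<in> {s..t}" for x
        using d(2)[of s x] st that by (auto simp: dist_real_def intro: less_imp_le)
      have "\<bar>\<Phi> (\<gamma> t) - \<Phi> (\<gamma> s)\<bar> \<le> (G (\<gamma> s) + L * norm (\<gamma> s - \<gamma> t)) * norm (\<gamma> s - \<gamma> t)"
        using inc[of "\<gamma> s" "\<gamma> t"] by (simp add: abs_minus_commute)
      also have "\<dots> \<le> (G (\<gamma> s) + L * \<epsilon>) * norm (\<gamma> t - \<gamma> s)"
        using n[of t] st(2) L by (intro mult_mono add_mono) (use \<epsilon> G in \<open>auto simp: norm_minus_commute\<close>)
      finally have "ennreal \<bar>\<Phi> (\<gamma> t) - \<Phi> (\<gamma> s)\<bar> \<le> ennreal (G (\<gamma> s) + L * \<epsilon>) * ennreal (norm (\<gamma> t - \<gamma> s))"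
        using G L \<epsilon> by (simp add: ennreal_mult[symmetric] ennreal_leI del: ennreal_plus)
      also have "\<dots> \<le> ennreal (G (\<gamma> s) + L * \<epsilon>) * (\<integral>\<^sup>+x. ennreal (v x) * indicator {s<..t} x \<partial>lebesgue)"
        by (intro mult_left_mono ac st) auto
      also have "\<dots> = (\<integral>\<^sup>+x. ennreal (G (\<gamma> s) + L * \<epsilon>) * (ennreal (v x) * indicator {s<..t} x) \<partial>lebesgue)"
        by (rule nn_integral_cmult[symmetric]) measurable
      also have "\<dots> \<le> (\<integral>\<^sup>+x. f x * indicator {s<..t} x \<partial>lebesgue)"
      proof (rule nn_integral_mono)
        fix x show "ennreal (G (\<gamma> s) + L * \<epsilon>) * (ennreal (v x) * indicator {s<..t} x) \<le> f x * indicator {s<..t} x"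
        proof (cases "x \<in> {s<..t}")
          case True
          have "\<bar>G (\<gamma> s) - G (\<gamma> x)\<bar> \<le> L * norm (\<gamma> s - \<gamma> x)" by (rule lip)
          also have "\<dots> \<le> L * \<epsilon>" using n[of x] True L by (intro mult_left_mono) auto
          finally have "G (\<gamma> s) + L * \<epsilon> \<le> G (\<gamma> x) + 2 * L * \<epsilon>" by simp
          then have "(G (\<gamma> s) + L * \<epsilon>) * v x \<le> (G (\<gamma> x) + 2 * L * \<epsilon>) * v x" using v0 by (intro mult_right_mono) auto
          then show ?thesis using True G L \<epsilon> v0 by (simp add: f_def ennreal_mult[symmetric] ennreal_leI del: ennreal_plus)
        qed simp
      qed
      finally show ?thesis .
    qed
    \<comment> \<open>Steps of length d / 2 stay below the modulus d of uniform continuity; the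
      induction is on their number.\<close>
    have "\<forall>t. a \<le> t \<and> t \<le> b \<and> t - a \<le> real n * (d/2) \<longrightarrow> ennreal \<bar>\<Phi> (\<gamma> t) - \<Phi> (\<gamma> a)\<bar> \<le> (\<integral>\<^sup>+x. f x * indicator {a<..t} x \<partial>lebesgue)" for n
    proof (induction n)
      case (Suc n)
      show ?case
      proof (intro allI impI)
        fix t assume t: "a \<le> t \<and> t \<le> b \<and> t - a \<le> real (Suc n) * (d/2)"
        define s where "s = max a (t - d/2)"
        have s: "a \<le> s" "s \<le> t" "t - s < d" "s - a \<le> real n * (d/2)"
          using t d(1) by (auto simp: s_def max_def algebra_simps add_divide_distrib)
        have "ennreal \<bar>\<Phi> (\<gamma> t) - \<Phi> (\<gamma> a)\<bar> \<le> ennreal (\<bar>\<Phi> (\<gamma> s) - \<Phi> (\<gamma> a)\<bar> + \<bar>\<Phi> (\<gamma> t) - \<Phi> (\<gamma> s)\<bar>)"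
          by (rule ennreal_leI) simp
        also have "\<dots> = ennreal \<bar>\<Phi> (\<gamma> s) - \<Phi> (\<gamma> a)\<bar> + ennreal \<bar>\<Phi> (\<gamma> t) - \<Phi> (\<gamma> s)\<bar>"
          by (rule ennreal_plus) auto
        also have "\<dots> \<le> (\<integral>\<^sup>+x. f x * indicator {a<..s} x \<partial>lebesgue) + (\<integral>\<^sup>+x. f x * indicator {s<..t} x \<partial>lebesgue)"
          using Suc.IH s t by (intro add_mono[OF _ small[OF s(1,2) _ s(3)]]) auto
        also have "\<dots> = (\<integral>\<^sup>+x. f x * indicator {a<..t} x \<partial>lebesgue)"
          using s by (intro nn_integral_split_Ioc[symmetric] fm) auto
        finally show "ennreal \<bar>\<Phi> (\<gamma> t) - \<Phi> (\<gamma> a)\<bar> \<le> (\<integral>\<^sup>+x. f x * indicator {a<..t} x \<partial>lebesgue)" .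
      qed
    qed (auto simp: antisym)
    moreover obtain n where "(b - a) / (d/2) \<le> real n" using real_arch_simple by blast
    then have "b - a \<le> real n * (d/2)" using d(1) by (simp add: field_simps)
    ultimately have "ennreal \<bar>\<Phi> (\<gamma> b) - \<Phi> (\<gamma> a)\<bar> \<le> (\<integral>\<^sup>+x. f x * indicator {a<..b} x \<partial>lebesgue)"
      using ab by blast
    also have "\<dots> = (\<integral>\<^sup>+x. ennreal (G (\<gamma> x) * v x) * indicator {a<..b} x + ennreal (2 * L * \<epsilon>) * (ennreal (v x) * indicator {a<..b} x) \<partial>lebesgue)"
      using G L \<epsilon> v0 by (intro nn_integral_cong) (auto simp: f_def ennreal_mult[symmetric] ennreal_plus[symmetric] distrib_right simp del: ennreal_plus split: split_indicator)
    also have "\<dots> = (\<integral>\<^sup>+x. ennreal (G (\<gamma> x) * v x) * indicator {a<..b} x \<partial>lebesgue) + ennreal (2 * L * \<epsilon>) * (\<integral>\<^sup>+x. ennreal (v x) * indicator {a<..b} x \<partial>lebesgue)"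
      by (subst nn_integral_add) (auto simp: nn_integral_cmult)
    also have "ennreal (2 * L * \<epsilon>) * (\<integral>\<^sup>+x. ennreal (v x) * indicator {a<..b} x \<partial>lebesgue) = ennreal (2 * L * \<epsilon> * V)"
      unfolding V(1) using L \<epsilon> V(2) by (simp add: ennreal_mult)
    finally show ?thesis .
  qed
  show ?thesis
  proof (rule ennreal_le_epsilon)
    fix e :: real assume e: "0 < e"
    \<comment> \<open>The accumulated error \<open>2 * L * \<epsilon> * V\<close> is then at most e;
      V + 1 instead of V covers a constant curve.\<close>
    define \<epsilon> where "\<epsilon> = e / (2 * L * (V + 1))"
    have "\<epsilon> > 0" using e L V by (simp add: \<epsilon>_def)
    have "2 * L * \<epsilon> * V = e * (V / (V + 1))" using L V by (simp add: \<epsilon>_def)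
    also have "\<dots> \<le> e * 1" using e V by (intro mult_left_mono) auto
    finally have "2 * L * \<epsilon> * V \<le> e" by simp
    then show "ennreal \<bar>\<Phi> (\<gamma> b) - \<Phi> (\<gamma> a)\<bar> \<le> (\<integral>\<^sup>+x. ennreal (G (\<gamma> x) * v x) * indicator {a<..b} x \<partial>lebesgue) + ennreal e"
      using main[OF \<open>\<epsilon> > 0\<close>] by (meson add_left_mono ennreal_leI order_trans)
  qed
qed

section \<open>Stereographic coordinates\<close>

text \<open>Inverse stereographic projection with centre \<open>- e3\<close>, applied to vectors of
  the horizontal plane: 0 goes to \<open>e3\<close> and the closed unit disc to the upper
  hemisphere. In this coordinate the optimal radial profiles are exponentials.\<close>

definition stereo :: "real^3 \<Rightarrow> real^3" where
  "stereo z = inverse (1 + z \<bullet> z) *\<^sub>R (2 *\<^sub>R z + (1 - z \<bullet> z) *\<^sub>R e3)"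

definition dstereo :: "real^3 \<Rightarrow> real^3 \<Rightarrow> real^3" where
  "dstereo z h = (2 * inverse (1 + z \<bullet> z)) *\<^sub>R (h - (z \<bullet> h) *\<^sub>R e3 - (z \<bullet> h) *\<^sub>R stereo z)"

lemma one_plus_inner_pos: "1 + z \<bullet> z > (0::real)"
  using inner_ge_zero[of z] by linarith

lemma stereo_props:
  assumes "z$3 = 0"
  shows "norm (stereo z) = 1" "stereo z $ 3 = (1 - z \<bullet> z) / (1 + z \<bullet> z)"
    "z \<bullet> h = z $ 1 * h $ 1 + z $ 2 * h $ 2"
proof -
  define d where "d = 1 + z \<bullet> z"
  have d: "d > 0" "z \<bullet> z = d - 1" using one_plus_inner_pos[of z] by (auto simp: d_def)
  have ze: "z \<bullet> e3 = 0" "e3 \<bullet> z = 0" using assms by (simp_all add: e3_simps)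
  have "stereo z \<bullet> stereo z = (inverse d)\<^sup>2 * (4 * (z \<bullet> z) + (1 - z \<bullet> z)\<^sup>2)"
    unfolding stereo_def d_def[symmetric]
    by (simp add: inner_add_left inner_add_right ze e3_simps(1) power2_eq_square) (simp add: algebra_simps)
  also have "4 * (z \<bullet> z) + (1 - z \<bullet> z)\<^sup>2 = d\<^sup>2" unfolding d(2) by (simp add: power2_eq_square algebra_simps)
  finally show "norm (stereo z) = 1" using d by (simp add: norm_eq_1 power_inverse)
  show "stereo z $ 3 = (1 - z \<bullet> z) / (1 + z \<bullet> z)"
    by (simp add: stereo_def assms Q_inf_uniaxial divide_inverse)
  show "z \<bullet> h = z $ 1 * h $ 1 + z $ 2 * h $ 2" using assms by (simp add: inner_vec_def sum_3)
qed

lemma stereo_has_derivative: "(stereo has_derivative dstereo z) (at z within S)"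
proof -
  have d: "1 + z \<bullet> z \<noteq> 0" using one_plus_inner_pos[of z] by simp
  have s: "2 *\<^sub>R z + (1 - z \<bullet> z) *\<^sub>R e3 = (1 + z \<bullet> z) *\<^sub>R stereo z"
    using d by (simp add: stereo_def)
  have "(stereo has_derivative (\<lambda>h. inverse (1 + z \<bullet> z) *\<^sub>R (2 *\<^sub>R h + (- (z \<bullet> h + h \<bullet> z)) *\<^sub>R e3)
      + (- (inverse (1 + z \<bullet> z) * (z \<bullet> h + h \<bullet> z) * inverse (1 + z \<bullet> z))) *\<^sub>R (2 *\<^sub>R z + (1 - z \<bullet> z) *\<^sub>R e3))) (at z within S)"
    unfolding stereo_def[abs_def] using d by (auto intro!: derivative_eq_intros)
  moreover have "inverse (1 + z \<bullet> z) *\<^sub>R (2 *\<^sub>R h + (- (z \<bullet> h + h \<bullet> z)) *\<^sub>R e3)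
      + (- (inverse (1 + z \<bullet> z) * (z \<bullet> h + h \<bullet> z) * inverse (1 + z \<bullet> z))) *\<^sub>R (2 *\<^sub>R z + (1 - z \<bullet> z) *\<^sub>R e3) = dstereo z h" for h
  proof -
    define i where "i = inverse (1 + z \<bullet> z)"
    have i: "i * (1 + z \<bullet> z) = 1" using d by (simp add: i_def)
    have "(- (i * (z \<bullet> h + h \<bullet> z) * i)) * (1 + z \<bullet> z) = - (2 * i * (z \<bullet> h))"
      using i by (simp add: inner_commute[of h z])
    then have "(- (i * (z \<bullet> h + h \<bullet> z) * i)) *\<^sub>R ((1 + z \<bullet> z) *\<^sub>R stereo z) = (- (2 * i * (z \<bullet> h))) *\<^sub>R stereo z"
      by (simp only: scaleR_scaleR)
    then show ?thesis
      unfolding s dstereo_def i_def[symmetric] by (simp only:) (simp add: inner_commute[of h z] algebra_simps)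
  qed
  ultimately show ?thesis by (simp add: fun_eq_iff[symmetric])
qed

text \<open>Stereographic projection is conformal with factor 2 / (1 + |z|^2). Hence the gradient
  energy depends on the coordinate only through |z| and the length of its derivative.\<close>

lemma dstereo_props:
  assumes z: "z$3 = 0" and h: "h$3 = 0"
  shows "(norm (dstereo z h))\<^sup>2 = 4 * (norm h)\<^sup>2 / (1 + z \<bullet> z)\<^sup>2" "stereo z \<bullet> dstereo z h = 0"
proof -
  define d where "d = 1 + z \<bullet> z"
  define s where "s = z \<bullet> h"
  define n where "n = stereo z"
  have d: "d > 0" "z \<bullet> z = d - 1" using one_plus_inner_pos[of z] by (auto simp: d_def)
  have nn: "n \<bullet> n = 1" using stereo_props(1)[OF z] by (simp add: n_def norm_eq_1)
  have he: "h \<bullet> e3 = 0" "e3 \<bullet> h = 0" "z \<bullet> e3 = 0" "e3 \<bullet> z = 0" using h z by (simp_all add: e3_simps)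
  have n_eq: "n = inverse d *\<^sub>R (2 *\<^sub>R z + (2 - d) *\<^sub>R e3)"
    unfolding n_def stereo_def d_def by simp
  have nh: "n \<bullet> h = 2 * s / d" "h \<bullet> n = 2 * s / d"
    unfolding n_eq by (simp_all add: inner_add_left inner_add_right he s_def inner_commute divide_inverse)
  have ne: "n \<bullet> e3 = (2 - d) / d" "e3 \<bullet> n = (2 - d) / d"
    unfolding n_eq by (simp_all add: inner_add_left inner_add_right he e3_simps(1) divide_inverse)
  have D: "dstereo z h = (2 / d) *\<^sub>R (h - s *\<^sub>R e3 - s *\<^sub>R n)"
    unfolding dstereo_def d_def s_def n_def by (simp add: divide_inverse)
  have "n \<bullet> (h - s *\<^sub>R e3 - s *\<^sub>R n) = 0"
    using d(1) by (simp add: inner_diff_right nn nh ne) (simp add: field_simps)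
  then show "stereo z \<bullet> dstereo z h = 0" by (simp add: D n_def[symmetric])
  have "(h - s *\<^sub>R e3 - s *\<^sub>R n) \<bullet> (h - s *\<^sub>R e3 - s *\<^sub>R n) = h \<bullet> h"
    using d(1) by (simp add: inner_diff_right inner_diff_left nn nh ne he e3_simps(1)) (simp add: field_simps)
  then show "(norm (dstereo z h))\<^sup>2 = 4 * (norm h)\<^sup>2 / (1 + z \<bullet> z)\<^sup>2"
    unfolding D power2_norm_eq_inner d_def[symmetric] by (simp add: power2_eq_square)
qed

text \<open>The deviation from \<open>Q_inf\<close> and not the tensor itself, because it lies in
  the Sobolev space and vanishes at z = 0. Cutting off the coordinate therefore yields compact
  support while the tensor stays uniaxial.\<close>

definition Uz :: "real^3 \<Rightarrow> real^3^3" where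
  "Uz z = outer (stereo z) (stereo z) - outer e3 e3"

definition dUz :: "real^3 \<Rightarrow> real^3 \<Rightarrow> real^3^3" where
  "dUz z h = outer (stereo z) (dstereo z h) + outer (dstereo z h) (stereo z)"

lemma Uz_has_derivative: "(Uz has_derivative dUz z) (at z within S)"
proof -
  have "(Uz has_derivative (\<lambda>h. outer (stereo z) (dstereo z h) + outer (dstereo z h) (stereo z) - 0)) (at z within S)"
    unfolding Uz_def[abs_def]
    by (intro has_derivative_diff has_derivative_const bounded_bilinear.FDERIV[OF bounded_bilinear_outer] stereo_has_derivative)
  then show ?thesis by (simp add: dUz_def[abs_def])
qed

lemma dUz_norm:
  assumes z: "z$3 = 0" and h: "h$3 = 0"
  shows "(norm (dUz z h))\<^sup>2 = 8 * (norm h)\<^sup>2 / (1 + z \<bullet> z)\<^sup>2"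
proof -
  have n: "stereo z \<bullet> stereo z = 1" using stereo_props(1)[OF z] by (simp add: norm_eq_1)
  have "(norm (dUz z h))\<^sup>2 = 2 * (norm (dstereo z h))\<^sup>2"
    unfolding power2_norm_eq_inner dUz_def
    using dstereo_props(2)[OF z h] by (simp add: inner_add_left inner_add_right outer_inner n inner_commute)
  then show ?thesis by (simp add: dstereo_props(1)[OF z h])
qed

lemma Uz_norm:
  assumes z: "z$3 = 0"
  shows "(norm (Uz z))\<^sup>2 = 8 * (z \<bullet> z) / (1 + z \<bullet> z)\<^sup>2"
proof -
  define d where "d = 1 + z \<bullet> z"
  have d: "d > 0" "z \<bullet> z = d - 1" using one_plus_inner_pos[of z] by (auto simp: d_def)
  have n: "stereo z \<bullet> stereo z = 1" using stereo_props(1)[OF z] by (simp add: norm_eq_1)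
  have e: "stereo z \<bullet> e3 = (2 - d) / d" "e3 \<bullet> stereo z = (2 - d) / d"
    using stereo_props(2)[OF z] unfolding d(2) by (simp_all add: e3_simps)
  have "(norm (Uz z))\<^sup>2 = 2 - 2 * ((2 - d) / d)\<^sup>2"
    unfolding power2_norm_eq_inner Uz_def
    by (simp add: inner_diff_left inner_diff_right outer_inner n e e3_simps(1) power2_eq_square)
  also have "\<dots> = 8 * (d - 1) / d\<^sup>2" using d(1) by (simp add: power2_eq_square field_simps)
  finally show ?thesis by (simp add: d_def)
qed

lemma Uz_uniaxial: "Q_inf + Uz z = uniaxial (stereo z)" "uniaxial (stereo z) - Q_inf = Uz z"
  by (simp_all add: Q_inf_def uniaxial_outer Uz_def)

lemma Q_inf_S0: "Q_inf \<in> S0"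
  unfolding Q_inf_uniaxial(1) by (rule uniaxial_props(1)[OF Q_inf_uniaxial(2)])

lemma Uz_S0: "z$3 = 0 \<Longrightarrow> Uz z \<in> S0"
  unfolding Uz_uniaxial(2)[symmetric]
  by (intro subspace_diff[OF subspace_S0] Q_inf_S0 uniaxial_props(1) stereo_props(1))

lemma g_pot_Uz:
  assumes z: "z$3 = 0"
  shows "g_pot g0 (Q_inf + Uz z) = sqrt (3/2) * (4 * (z \<bullet> z) / (1 + z \<bullet> z)\<^sup>2)"
proof -
  define d where "d = 1 + z \<bullet> z"
  have d: "d > 0" "z \<bullet> z = d - 1" using one_plus_inner_pos[of z] by (auto simp: d_def)
  have "g_pot g0 (Q_inf + Uz z) = sqrt (3/2) * (1 - ((2 - d) / d)\<^sup>2)"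
    unfolding Uz_uniaxial(1) uniaxial_props(4)[OF stereo_props(1)[OF z]] stereo_props(2)[OF z] d(2) by simp
  also have "1 - ((2 - d) / d)\<^sup>2 = 4 * (d - 1) / d\<^sup>2" using d(1) by (simp add: power2_eq_square field_simps)
  finally show ?thesis by (simp add: d_def)
qed

lemma f_pot_Uz: "z$3 = 0 \<Longrightarrow> f_pot (Q_inf + Uz z) = 0"
  unfolding Uz_uniaxial(1) by (intro uniaxial_props(3) stereo_props(1))

lemma stereo_inverse:
  assumes n: "norm n = 1" and n3: "n$3 \<ge> 0"
  defines "z \<equiv> (1 / (1 + n$3)) *\<^sub>R (n - n$3 *\<^sub>R e3)"
  shows "stereo z = n" "z$3 = 0" "z \<bullet> z = (1 - n$3) / (1 + n$3)"
proof -
  show "z$3 = 0" by (simp add: z_def Q_inf_uniaxial)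
  have p: "1 + n$3 > 0" using n3 by simp
  have nn: "n \<bullet> n = 1" using n by (simp add: norm_eq_1)
  have "z \<bullet> z = (1 / (1 + n$3))\<^sup>2 * (1 - (n$3)\<^sup>2)"
    by (simp add: z_def inner_diff_left inner_diff_right e3_simps nn power2_eq_square Q_inf_uniaxial)
  also have "1 - (n$3)\<^sup>2 = (1 - n$3) * (1 + n$3)" by (simp add: power2_eq_square algebra_simps)
  finally show zz: "z \<bullet> z = (1 - n$3) / (1 + n$3)" using p by (simp add: power2_eq_square)
  have 1: "inverse (1 + z \<bullet> z) = (1 + n$3) / 2" unfolding zz using p by (simp add: field_simps)
  have 2: "(1 + n$3) * (1 - z \<bullet> z) = 2 * n$3" unfolding zz using p by (simp add: field_simps)
  have "stereo z = ((1 + n$3) / 2 * 2) *\<^sub>R z + ((1 + n$3) / 2 * (1 - z \<bullet> z)) *\<^sub>R e3"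
    unfolding stereo_def 1 by (simp add: scaleR_add_right)
  also have "(1 + n$3) / 2 * (1 - z \<bullet> z) = n$3" using 2 by simp
  also have "(1 + n$3) / 2 * 2 = 1 + n$3" by simp
  also have "(1 + n$3) *\<^sub>R z = n - n$3 *\<^sub>R e3" using p by (simp add: z_def)
  finally show "stereo z = n" by simp
qed

lemma ndiff_Uz:
  fixes f :: "'a::euclidean_space \<Rightarrow> real^3"
  assumes "ndiff n f" shows "ndiff n (\<lambda>x. Uz (f x))"
proof -
  have "1 + f x \<bullet> f x \<noteq> 0" for x using one_plus_inner_pos[of "f x"] by simp
  then have "ndiff n (\<lambda>x. stereo (f x))"
    unfolding stereo_def
    by (intro ndiff_scaleR ndiff_inverse ndiff_add ndiff_diff ndiff_const ndiff_inner assms)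
  then show ?thesis
    unfolding Uz_def by (intro ndiff_diff ndiff_bilinear[OF bounded_bilinear_outer] ndiff_const)
qed

lemma tendsto_stereo:
  assumes f: "(f \<longlongrightarrow> z) F" shows "((\<lambda>x. stereo (f x)) \<longlongrightarrow> stereo z) F"
  unfolding stereo_def using one_plus_inner_pos[of z] by (intro tendsto_intros f) simp

lemma tendsto_Uz:
  assumes "(f \<longlongrightarrow> z) F" shows "((\<lambda>x. Uz (f x)) \<longlongrightarrow> Uz z) F"
  unfolding Uz_def by (intro tendsto_diff tendsto_const bounded_bilinear.tendsto[OF bounded_bilinear_outer] tendsto_stereo assms)

lemma tendsto_dUz:
  assumes "(f \<longlongrightarrow> z) F" "(g \<longlongrightarrow> h) F" shows "((\<lambda>x. dUz (f x) (g x)) \<longlongrightarrow> dUz z h) F"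
proof -
  have "((\<lambda>x. dstereo (f x) (g x)) \<longlongrightarrow> dstereo z h) F"
    unfolding dstereo_def using one_plus_inner_pos[of z]
    by (intro tendsto_intros tendsto_stereo assms) simp
  then show ?thesis
    unfolding dUz_def by (intro tendsto_add bounded_bilinear.tendsto[OF bounded_bilinear_outer] tendsto_stereo assms)
qed

section \<open>Weak derivatives on a half-line\<close>

definition step01 :: "real \<Rightarrow> real" where
  "step01 x = bump 0 x * inverse (bump 0 x + bump 0 (1 - x))"

lemma step01_props:
  "x \<le> 0 \<Longrightarrow> step01 x = 0" "x \<ge> 1 \<Longrightarrow> step01 x = 1" "0 \<le> step01 x" "step01 x \<le> 1"
  "ndiff n step01"
proof -
  have pos: "bump 0 x + bump 0 (1 - x) > 0" for x
    using bump_pos[of x 0] bump_pos[of "1-x" 0] bump_nonneg[of 0 x] bump_nonneg[of 0 "1-x"]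
    by (cases "x > 0") (auto intro: add_pos_nonneg add_nonneg_pos)
  show "x \<le> 0 \<Longrightarrow> step01 x = 0" by (simp add: step01_def bump_zero)
  show "x \<ge> 1 \<Longrightarrow> step01 x = 1" using pos[of x] by (simp add: step01_def bump_zero)
  show "0 \<le> step01 x" using pos[of x] bump_nonneg[of 0 x] by (simp add: step01_def)
  show "step01 x \<le> 1" using pos[of x] bump_nonneg[of 0 "1 - x"]
    by (simp add: step01_def divide_inverse[symmetric])
  have "bump 0 x + bump 0 (1 - x) \<noteq> 0" for x using pos[of x] by simp
  then show "ndiff n step01"
    unfolding step01_def[abs_def]
    by (intro ndiff_mult ndiff_inverse ndiff_add ndiff_bump ndiff_diff ndiff_const ndiff_linear bounded_linear_ident)
qed

definition dstep :: "real \<Rightarrow> real" where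
  "dstep x = frechet_derivative step01 (at x) 1"

lemma dstep_props:
  "(step01 has_real_derivative dstep x) (at x)" "continuous_on S dstep" "x \<notin> {0..1} \<Longrightarrow> dstep x = 0"
  "(LINT x|lborel. dstep x) = 1"
proof -
  have s: "smooth step01" using step01_props(5) smooth_iff_ndiff by blast
  have d: "(step01 has_derivative frechet_derivative step01 (at x)) (at x)" for x by (rule smooth_derivative(1)[OF s])
  have "frechet_derivative step01 (at x) = (\<lambda>h. dstep x * h)" for x
  proof
    fix h :: real
    have "frechet_derivative step01 (at x) (h *\<^sub>R 1) = h *\<^sub>R frechet_derivative step01 (at x) 1"
      by (rule linear_scale[OF has_derivative_linear[OF d]])
    then show "frechet_derivative step01 (at x) h = dstep x * h" by (simp add: dstep_def)
  qed
  with d show der: "(step01 has_real_derivative dstep x) (at x)" for x by (simp add: has_field_derivative_def)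
  show c: "continuous_on S dstep" for S
    unfolding dstep_def[abs_def] by (rule smooth_derivative(3)[OF s])
  show z: "dstep x = 0" if "x \<notin> {0..1}" for x
  proof (cases "x < 0")
    case True
    have "(step01 has_real_derivative 0) (at x)"
      by (rule has_field_derivative_transform_within_open[where f="\<lambda>_. 0" and S="{..<0}"])
         (use True step01_props(1) in auto)
    then show ?thesis using der DERIV_unique by blast
  next
    case False
    have "(step01 has_real_derivative 0) (at x)"
      by (rule has_field_derivative_transform_within_open[where f="\<lambda>_. 1" and S="{1<..}"])
         (use False that step01_props(2) in auto)
    then show ?thesis using der DERIV_unique by blast
  qed
  have "(LINT x|lborel. dstep x * indicator {0..1} x) = step01 1 - step01 0"
    using c[of UNIV] by (intro integral_FTC_Icc_real der) (auto simp: continuous_on_eq_continuous_at)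
  also have "(\<lambda>x. dstep x * indicator {0..1} x) = dstep" using z by (auto simp: fun_eq_iff indicator_def)
  finally show "(LINT x|lborel. dstep x) = 1" using step01_props(1)[of 0] step01_props(2)[of 1] by simp
qed

text \<open>The rescaled derivatives of the step have integral one and supports shrinking to
  \<open>s\<close> from the right, so they act as an approximate identity. After rescaling, the
  argument of \<open>u\<close> stays in an interval of length 1.\<close>

lemma dstep_mollify:
  fixes u :: "real \<Rightarrow> 'b::euclidean_space"
  assumes u: "continuous_on UNIV u"
  shows "(\<lambda>n. LINT x|lborel. (real (Suc n) * dstep (real (Suc n) * (x - s))) *\<^sub>R u x) \<longlonglongrightarrow> u s"
proof -
  have eq: "(LINT x|lborel. (real (Suc n) * dstep (real (Suc n) * (x - s))) *\<^sub>R u x) =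
     (LINT y|lborel. dstep y *\<^sub>R u (s + y / real (Suc n)))" for n
  proof -
    have "(LINT x|lborel. (real (Suc n) * dstep (real (Suc n) * (x - s))) *\<^sub>R u x) =
      \<bar>1 / real (Suc n)\<bar> *\<^sub>R (LINT y|lborel. (real (Suc n) * dstep (real (Suc n) * ((s + 1 / real (Suc n) * y) - s))) *\<^sub>R u (s + 1 / real (Suc n) * y))"
      by (rule lborel_integral_real_affine) simp
    also have "\<dots> = \<bar>1 / real (Suc n)\<bar> *\<^sub>R (LINT y|lborel. real (Suc n) *\<^sub>R (dstep y *\<^sub>R u (s + y / real (Suc n))))"
      by (simp del: of_nat_Suc)
    also have "\<dots> = (LINT y|lborel. dstep y *\<^sub>R u (s + y / real (Suc n)))"
      unfolding integral_scaleR_right by (simp del: of_nat_Suc)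
    finally show ?thesis .
  qed
  obtain M where M: "\<And>x. x \<in> {s..s+1} \<Longrightarrow> norm (u x) \<le> M"
  proof -
    have "compact (u ` {s..s+1})" by (intro compact_continuous_image continuous_on_subset[OF u]) auto
    then have "bounded (u ` {s..s+1})" by (rule compact_imp_bounded)
    then show thesis using that unfolding bounded_iff by blast
  qed
  have um: "u \<in> borel_measurable borel" using u by (rule borel_measurable_continuous_onI)
  have dm: "dstep \<in> borel_measurable borel" using dstep_props(2) by (rule borel_measurable_continuous_onI)
  have "(\<lambda>n. LINT y|lborel. dstep y *\<^sub>R u (s + y / real (Suc n))) \<longlonglongrightarrow> (LINT y|lborel. dstep y *\<^sub>R u s)"
  proof (rule integral_dominated_convergence[where w="\<lambda>y. \<bar>indicator {0..1} y *\<^sub>R dstep y\<bar> * M"])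
    show "(\<lambda>y. dstep y *\<^sub>R u s) \<in> borel_measurable lborel" using dm by simp
    show "(\<lambda>y. dstep y *\<^sub>R u (s + y / real (Suc n))) \<in> borel_measurable lborel" for n
      using dm by (simp add: borel_measurable_scaleR measurable_compose[OF _ um])
    show "integrable lborel (\<lambda>y. \<bar>indicator {0..1} y *\<^sub>R dstep y\<bar> * M)"
      by (intro integrable_mult_left integrable_abs borel_integrable_compact dstep_props) auto
    show "AE y in lborel. (\<lambda>n. dstep y *\<^sub>R u (s + y / real (Suc n))) \<longlonglongrightarrow> dstep y *\<^sub>R u s"
    proof (rule AE_I2)
      fix y
      have "(\<lambda>n. s + y * inverse (real (Suc n))) \<longlonglongrightarrow> s + y * 0" by (intro tendsto_intros LIMSEQ_inverse_real_of_nat)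
      then have "(\<lambda>n. s + y / real (Suc n)) \<longlonglongrightarrow> s" by (simp add: divide_inverse)
      moreover have "isCont u s" using u by (simp add: continuous_on_eq_continuous_at)
      ultimately have "(\<lambda>n. u (s + y / real (Suc n))) \<longlonglongrightarrow> u s" by (rule isCont_tendsto_compose[rotated])
      then show "(\<lambda>n. dstep y *\<^sub>R u (s + y / real (Suc n))) \<longlonglongrightarrow> dstep y *\<^sub>R u s"
        by (intro tendsto_intros)
    qed
    show "AE y in lborel. norm (dstep y *\<^sub>R u (s + y / real (Suc n))) \<le> \<bar>indicator {0..1} y *\<^sub>R dstep y\<bar> * M" for n
    proof (rule AE_I2)
      fix y show "norm (dstep y *\<^sub>R u (s + y / real (Suc n))) \<le> \<bar>indicator {0..1} y *\<^sub>R dstep y\<bar> * M"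
      proof (cases "y \<in> {0..1}")
        case True
        then have "y / real (Suc n) \<le> y / 1" by (intro divide_left_mono) auto
        then have "s + y / real (Suc n) \<in> {s..s+1}" using True by auto
        from M[OF this] show ?thesis using True by (simp add: mult_left_mono del: of_nat_Suc)
      qed (simp add: dstep_props(3))
    qed
  qed
  moreover have "(LINT y|lborel. dstep y *\<^sub>R u s) = u s"
  proof -
    have "integrable lborel (\<lambda>y. indicator {0..1} y *\<^sub>R dstep y)"
      by (intro borel_integrable_compact dstep_props) auto
    moreover have "(\<lambda>y. indicator {0..1} y *\<^sub>R dstep y) = dstep" using dstep_props(3) by (auto simp: fun_eq_iff indicator_def)
    ultimately have "integrable lborel dstep" by simp
    then show ?thesis using dstep_props(4) by simp
  qed
  ultimately show ?thesis unfolding eq by simp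
qed

text \<open>The test function rises from 0 to 1 just right of \<open>s\<close> and falls just right
  of \<open>t\<close>. It tends to the indicator of the interval, while its derivative is a
  difference of mollifiers at the end points and picks out Q s - Q t. Working to the right keeps the
  support inside the half-line.\<close>

lemma weak_deriv_increment:
  fixes Q v :: "real \<Rightarrow> 'b::euclidean_space"
  assumes Q: "continuous_on UNIV Q" and w: "has_weak_deriv {1<..} 1 Q v" and st: "1 < s" "s \<le> t"
  shows "Q t - Q s = (LINT x|lebesgue. indicator {s<..t} x *\<^sub>R v x)"
proof -
  define \<psi> where "\<psi> n x = step01 (real (Suc n) * (x - s)) - step01 (real (Suc n) * (x - t))" for n x
  define d\<psi> where "d\<psi> n x = real (Suc n) * dstep (real (Suc n) * (x - s)) - real (Suc n) * dstep (real (Suc n) * (x - t))" for n x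
  let ?U = "{1::real<..}"
  have supp: "\<psi> n x = 0" if "x \<notin> {s..t+1}" for n x
  proof (cases "x < s")
    case True
    then have xs: "x - s \<le> 0" "x - t \<le> 0" using st by auto
    have "real (Suc n) * y \<le> 0" if "y \<le> 0" for y :: real
      using that by (intro mult_nonneg_nonpos) simp_all
    then have "real (Suc n) * (x - s) \<le> 0" "real (Suc n) * (x - t) \<le> 0" using xs by blast+
    then show ?thesis unfolding \<psi>_def by (simp only: step01_props(1))
  next
    case False
    then have x: "x - t > 1" "x - s > 1" using that st by auto
    have "1 * 1 \<le> real (Suc n) * y" if "y > 1" for y :: real using that by (intro mult_mono) auto
    then have "1 * 1 \<le> real (Suc n) * (x - t)" "1 * 1 \<le> real (Suc n) * (x - s)" using x by blast+
    then show ?thesis unfolding \<psi>_def by (simp only: step01_props(2) mult_1_left)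
  qed
  have nd: "ndiff m (\<psi> n)" for m n
    unfolding \<psi>_def[abs_def]
    by (intro ndiff_diff ndiff_compose_real[OF step01_props(5)] ndiff_mult ndiff_const ndiff_linear bounded_linear_ident)
  have der: "(\<psi> n has_real_derivative d\<psi> n x) (at x)" for n x
  proof -
    have "((\<lambda>x. step01 (real (Suc n) * (x - r))) has_real_derivative real (Suc n) * dstep (real (Suc n) * (x - r))) (at x)" for r
    proof -
      have "((\<lambda>x. real (Suc n) * (x - r)) has_real_derivative real (Suc n)) (at x)"
        by (auto intro!: derivative_eq_intros simp del: of_nat_Suc)
      from DERIV_chain2[OF dstep_props(1) this] show ?thesis by (simp only: mult.commute)
    qed
    then show ?thesis unfolding \<psi>_def[abs_def] d\<psi>_def by (intro DERIV_diff)
  qed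
  have fr: "frechet_derivative (\<psi> n) (at x) 1 = d\<psi> n x" for n x
    using frechet_derivative_at[OF der[unfolded has_field_derivative_def], of n x] by (metis mult.right_neutral)
  have sub: "closure {x. \<psi> n x \<noteq> 0} \<subseteq> {s..t+1}" for n
    by (rule closure_minimal) (use supp in blast, simp)
  then have "compact (closure {x. \<psi> n x \<noteq> 0})" for n
    by (metis bounded_subset closed_closure compact_eq_bounded_closed bounded_closed_interval)
  then have t: "test_fun ?U (\<psi> n)" for n
    using sub[of n] st nd by (auto simp: test_fun_def smooth_iff_ndiff)
  have dsupp: "d\<psi> n x = 0" if "x \<notin> {s..t+1}" for n x
  proof -
    have "frechet_derivative (\<psi> n) (at x) = (\<lambda>v. 0)"
      by (rule frechet_derivative_zero[OF open_Compl[OF closed_atLeastAtMost]]) (use that supp in blast)+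
    then show ?thesis using fr[of n x] by simp
  qed
  have eq: "(LINT x|lebesgue_on ?U. d\<psi> n x *\<^sub>R Q x) = - (LINT x|lebesgue_on ?U. \<psi> n x *\<^sub>R v x)" for n
  proof -
    have "(LINT x|lebesgue_on ?U. frechet_derivative (\<psi> n) (at x) 1 *\<^sub>R Q x) = - (LINT x|lebesgue_on ?U. \<psi> n x *\<^sub>R v x)"
      using w t[of n] unfolding has_weak_deriv_def by blast
    then show ?thesis by (simp only: fr)
  qed
  have dsc: "continuous_on UNIV (\<lambda>x. real (Suc n) * dstep (real (Suc n) * (x - r)))" for n r
    by (intro continuous_on_mult continuous_on_const continuous_on_compose2[OF dstep_props(2)[of UNIV]])
       (auto intro!: continuous_on_mult continuous_on_diff continuous_on_const continuous_on_id)
  have dc: "continuous_on UNIV (d\<psi> n)" for n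
    unfolding d\<psi>_def[abs_def] by (intro continuous_on_diff dsc)
  have c1: "continuous_on UNIV (\<lambda>x. (real (Suc n) * dstep (real (Suc n) * (x - r))) *\<^sub>R Q x)" for n r
    by (intro continuous_on_scaleR dsc Q)
  have i1: "integrable lborel (\<lambda>x. (real (Suc n) * dstep (real (Suc n) * (x - r))) *\<^sub>R Q x)" for n r
  proof -
    have "integrable lborel (\<lambda>x. indicator {r..r+1} x *\<^sub>R ((real (Suc n) * dstep (real (Suc n) * (x - r))) *\<^sub>R Q x))"
      by (intro borel_integrable_compact continuous_on_subset[OF c1]) auto
    moreover have "indicator {r..r+1} x *\<^sub>R ((real (Suc n) * dstep (real (Suc n) * (x - r))) *\<^sub>R Q x) =
      (real (Suc n) * dstep (real (Suc n) * (x - r))) *\<^sub>R Q x" for x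
    proof (cases "x \<in> {r..r+1}")
      case False
      have "real (Suc n) * (x - r) \<notin> {0..1}"
      proof (cases "x < r")
        case True
        then have "real (Suc n) * (x - r) < 0" by (intro mult_pos_neg) auto
        then show ?thesis by (simp only: atLeastAtMost_iff not_le de_Morgan_conj simp_thms)
      next
        case False
        then have "x - r > 1" using \<open>x \<notin> {r..r+1}\<close> by auto
        then have "1 * (x - r) \<le> real (Suc n) * (x - r)" by (intro mult_right_mono) auto
        then have "real (Suc n) * (x - r) > 1"
          using less_le_trans[of 1 "1 * (x - r)" "real (Suc n) * (x - r)"] \<open>x - r > 1\<close>
          by (simp only: mult_1_left)
        then show ?thesis by (simp only: atLeastAtMost_iff not_le de_Morgan_conj simp_thms)
      qed
      then show ?thesis using dstep_props(3) by simp
    qed simp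
    ultimately show ?thesis by (simp only:)
  qed
  have lhs: "(LINT x|lebesgue_on ?U. d\<psi> n x *\<^sub>R Q x) =
      (LINT x|lborel. (real (Suc n) * dstep (real (Suc n) * (x - s))) *\<^sub>R Q x)
     - (LINT x|lborel. (real (Suc n) * dstep (real (Suc n) * (x - t))) *\<^sub>R Q x)" for n
  proof -
    have "(LINT x|lebesgue_on ?U. d\<psi> n x *\<^sub>R Q x) = (LINT x|lebesgue. indicator ?U x *\<^sub>R d\<psi> n x *\<^sub>R Q x)"
      by (rule integral_restrict_space) simp
    also have "(\<lambda>x. indicator ?U x *\<^sub>R d\<psi> n x *\<^sub>R Q x) = (\<lambda>x. d\<psi> n x *\<^sub>R Q x)"
    proof (rule ext)
      fix x show "indicator ?U x *\<^sub>R d\<psi> n x *\<^sub>R Q x = d\<psi> n x *\<^sub>R Q x"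
        using dsupp[of x n] st by (cases "x \<in> {s..t+1}") auto
    qed
    also have "(LINT x|lebesgue. d\<psi> n x *\<^sub>R Q x) = (LINT x|lborel. d\<psi> n x *\<^sub>R Q x)"
      using dc Q by (intro integral_completion) (auto intro!: borel_measurable_continuous_onI continuous_intros)
    also have "\<dots> = (LINT x|lborel. (real (Suc n) * dstep (real (Suc n) * (x - s))) *\<^sub>R Q x)
     - (LINT x|lborel. (real (Suc n) * dstep (real (Suc n) * (x - t))) *\<^sub>R Q x)"
      unfolding d\<psi>_def scaleR_diff_left by (rule Bochner_Integration.integral_diff[OF i1 i1])
    finally show ?thesis .
  qed
  have L: "(\<lambda>n. LINT x|lebesgue_on ?U. d\<psi> n x *\<^sub>R Q x) \<longlonglongrightarrow> Q s - Q t"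
    unfolding lhs by (intro tendsto_diff dstep_mollify[OF Q])
  have vi: "integrable lebesgue (\<lambda>x. indicator {s..t+1} x *\<^sub>R v x)"
  proof -
    have "locally_integrable_on v ?U" using w by (simp add: has_weak_deriv_def)
    then have "compact {s..t+1} \<and> {s..t+1} \<subseteq> ?U \<Longrightarrow> set_integrable lebesgue {s..t+1} v"
      unfolding locally_integrable_on_def by blast
    moreover have "{s..t+1} \<subseteq> ?U" using st by auto
    ultimately show ?thesis by (simp add: set_integrable_def)
  qed
  have lim: "(\<lambda>n. \<psi> n x) \<longlonglongrightarrow> indicator {s<..t} x" for x
  proof -
    have up: "(\<lambda>n. step01 (real (Suc n) * (x - r))) \<longlonglongrightarrow> indicator {r<..} x" for r
    proof (cases "x > r")
      case True
      obtain N where N: "1 / (x - r) \<le> real N" using real_arch_simple by blast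
      have "step01 (real (Suc n) * (x - r)) = 1" if "n \<ge> N" for n
      proof (rule step01_props(2))
        have "1 = 1 / (x - r) * (x - r)" using True by simp
        also have "\<dots> \<le> real (Suc n) * (x - r)" using N that True by (intro mult_right_mono) auto
        finally show "1 \<le> real (Suc n) * (x - r)" .
      qed
      then have "eventually (\<lambda>n. step01 (real (Suc n) * (x - r)) = 1) sequentially"
        by (auto simp: eventually_sequentially)
      then show ?thesis using True by (simp add: tendsto_eventually del: of_nat_Suc)
    next
      case False
      then have "step01 (real (Suc n) * (x - r)) = 0" for n
        by (intro step01_props(1)) (auto intro!: mult_nonneg_nonpos)
      then show ?thesis using False by simp
    qed
    have "(\<lambda>n. \<psi> n x) \<longlonglongrightarrow> indicator {s<..} x - indicator {t<..} x"
      unfolding \<psi>_def by (intro tendsto_diff up)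
    also have "indicator {s<..} x - indicator {t<..} x = (indicator {s<..t} x :: real)"
      using st by (auto simp: indicator_def)
    finally show ?thesis .
  qed
  have bnd: "\<bar>\<psi> n x\<bar> \<le> 1" for n x
    using step01_props(3,4)[of "real (Suc n) * (x - s)"] step01_props(3,4)[of "real (Suc n) * (x - t)"]
    unfolding \<psi>_def by linarith
  have li: "locally_integrable_on v ?U" using w by (simp add: has_weak_deriv_def)
  have R: "(\<lambda>n. LINT x|lebesgue. indicator ?U x *\<^sub>R \<psi> n x *\<^sub>R v x) \<longlonglongrightarrow> (LINT x|lebesgue. indicator {s<..t} x *\<^sub>R v x)"
  proof (rule integral_dominated_convergence[where w="\<lambda>x. norm (indicator {s..t+1} x *\<^sub>R v x)"])
    show "integrable lebesgue (\<lambda>x. norm (indicator {s..t+1} x *\<^sub>R v x))" using vi by (rule integrable_norm)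
    have "set_integrable lebesgue {s<..t} v"
      by (rule set_integrable_subset[of _ "{s..t+1}"]) (use vi in \<open>auto simp: set_integrable_def\<close>)
    then show "(\<lambda>x. indicator {s<..t} x *\<^sub>R v x) \<in> borel_measurable lebesgue"
      unfolding set_integrable_def by (rule borel_measurable_integrable)
    have "integrable lebesgue (\<lambda>x. indicator ?U x *\<^sub>R \<psi> n x *\<^sub>R v x)" for n
      using integrable_test(1)[OF open_greaterThan t li, of n] by (subst (asm) integrable_restrict_space) auto
    then show "(\<lambda>x. indicator ?U x *\<^sub>R \<psi> n x *\<^sub>R v x) \<in> borel_measurable lebesgue" for n
      by (rule borel_measurable_integrable)
    show "AE x in lebesgue. (\<lambda>n. indicator ?U x *\<^sub>R \<psi> n x *\<^sub>R v x) \<longlonglongrightarrow> indicator {s<..t} x *\<^sub>R v x"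
    proof (rule AE_I2)
      fix x
      have "(\<lambda>n. indicator ?U x *\<^sub>R \<psi> n x *\<^sub>R v x) \<longlonglongrightarrow> indicator ?U x *\<^sub>R indicator {s<..t} x *\<^sub>R v x"
        by (intro tendsto_intros lim)
      also have "indicator ?U x *\<^sub>R indicator {s<..t} x *\<^sub>R v x = indicator {s<..t} x *\<^sub>R v x"
        using st by (auto simp: indicator_def)
      finally show "(\<lambda>n. indicator ?U x *\<^sub>R \<psi> n x *\<^sub>R v x) \<longlonglongrightarrow> indicator {s<..t} x *\<^sub>R v x" .
    qed
    show "AE x in lebesgue. norm (indicator ?U x *\<^sub>R \<psi> n x *\<^sub>R v x) \<le> norm (indicator {s..t+1} x *\<^sub>R v x)" for n
    proof (rule AE_I2)
      fix x show "norm (indicator ?U x *\<^sub>R \<psi> n x *\<^sub>R v x) \<le> norm (indicator {s..t+1} x *\<^sub>R v x)"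
        using bnd[of n x] supp[of x n] by (cases "x \<in> {s..t+1}") (auto simp: indicator_def mult_left_le_one_le)
    qed
  qed
  have "(LINT x|lebesgue_on ?U. \<psi> n x *\<^sub>R v x) = (LINT x|lebesgue. indicator ?U x *\<^sub>R \<psi> n x *\<^sub>R v x)" for n
    by (rule integral_restrict_space) simp
  then have "(\<lambda>n. LINT x|lebesgue_on ?U. d\<psi> n x *\<^sub>R Q x) \<longlonglongrightarrow> - (LINT x|lebesgue. indicator {s<..t} x *\<^sub>R v x)"
    unfolding eq using tendsto_minus[OF R] by simp
  from LIMSEQ_unique[OF L this] show ?thesis by (metis minus_diff_eq minus_minus)
qed

text \<open>No test function reaches the end point 1 of the half-line, so s = 1 is obtained by
  letting interior points tend to it and using continuity of \<open>Q\<close>.\<close>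

lemma weak_deriv_increment_le:
  fixes Q v :: "real \<Rightarrow> 'b::euclidean_space"
  assumes Q: "continuous_on UNIV Q" and w: "has_weak_deriv {1<..} 1 Q v" and st: "1 \<le> s" "s \<le> t"
  shows "ennreal (norm (Q t - Q s)) \<le> (\<integral>\<^sup>+x. ennreal (norm (indicator {1<..} x *\<^sub>R v x)) * indicator {s<..t} x \<partial>lebesgue)"
proof -
  let ?I = "(\<integral>\<^sup>+x. ennreal (norm (indicator {1<..} x *\<^sub>R v x)) * indicator {s<..t} x \<partial>lebesgue)"
  have 1: "ennreal (norm (Q t - Q p)) \<le> ?I" if p: "1 < p" "s \<le> p" "p \<le> t" for p
  proof -
    have "norm (Q t - Q p) = norm (LINT x|lebesgue. indicator {p<..t} x *\<^sub>R v x)"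
      using weak_deriv_increment[OF Q w p(1,3)] by simp
    moreover have "ennreal (norm (LINT x|lebesgue. indicator {p<..t} x *\<^sub>R v x)) \<le> (\<integral>\<^sup>+x. norm (indicator {p<..t} x *\<^sub>R v x) \<partial>lebesgue)"
    proof (rule integral_norm_bound_ennreal)
      have "set_integrable lebesgue {p..t} v"
      proof -
        have "locally_integrable_on v {1<..}" using w by (simp add: has_weak_deriv_def)
        then have "compact {p..t} \<and> {p..t} \<subseteq> {1<..} \<Longrightarrow> set_integrable lebesgue {p..t} v"
          unfolding locally_integrable_on_def by blast
        moreover have "{p..t} \<subseteq> {1<..}" using p by auto
        ultimately show ?thesis by simp
      qed
      then have "set_integrable lebesgue {p<..t} v" by (rule set_integrable_subset) auto
      then show "integrable lebesgue (\<lambda>x. indicator {p<..t} x *\<^sub>R v x)" by (simp add: set_integrable_def)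
    qed
    moreover have "(\<integral>\<^sup>+x. norm (indicator {p<..t} x *\<^sub>R v x) \<partial>lebesgue) \<le> ?I"
      using p by (intro nn_integral_mono) (auto split: split_indicator)
    ultimately show ?thesis by simp
  qed
  show ?thesis
  proof (cases "s = t")
    case False
    define p where "p n = s + (t - s) / real (Suc n)" for n
    have "(\<lambda>n. s + (t - s) * inverse (real (Suc n))) \<longlonglongrightarrow> s + (t - s) * 0"
      by (intro tendsto_intros LIMSEQ_inverse_real_of_nat)
    then have "p \<longlonglongrightarrow> s" by (simp add: p_def[abs_def] divide_inverse)
    moreover have "isCont Q s" using Q by (simp add: continuous_on_eq_continuous_at)
    ultimately have "(\<lambda>n. Q (p n)) \<longlonglongrightarrow> Q s" by (rule isCont_tendsto_compose[rotated])
    then have L1: "(\<lambda>n. ennreal (norm (Q t - Q (p n)))) \<longlonglongrightarrow> ennreal (norm (Q t - Q s))"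
      by (intro tendsto_intros)
    have L2: "ennreal (norm (Q t - Q (p n))) \<le> ?I" for n
    proof (rule 1)
      have d: "t - s > 0" using False st by simp
      then have "(t - s) / real (Suc n) \<le> (t - s) / 1" by (intro divide_left_mono) auto
      then have "(t - s) / real (Suc n) \<le> t - s" by (simp only: div_by_1)
      moreover have "(t - s) / real (Suc n) > 0" using d by simp
      ultimately show "1 < p n" "s \<le> p n" "p n \<le> t" using st unfolding p_def by linarith+
    qed
    show ?thesis by (rule LIMSEQ_le_const2[OF L1]) (use L2 in blast)
  qed simp
qed

section \<open>The radial problem\<close>

lemma kappa_sq:
  assumes "\<kappa> = root 4 24"
  shows "\<kappa> > 0" "(\<kappa> / 2)\<^sup>2 = sqrt (3/2)" "\<kappa> / 2 > 0"
proof -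
  show "\<kappa> > 0" "\<kappa> / 2 > 0" by (simp_all add: assms)
  have "(\<kappa>\<^sup>2)\<^sup>2 = 24" by (simp add: assms flip: power_mult)
  then have "((\<kappa> / 2)\<^sup>2)\<^sup>2 = 3/2" by (simp add: power_divide)
  then show "(\<kappa> / 2)\<^sup>2 = sqrt (3/2)" by (metis real_sqrt_unique zero_le_power2)
qed

text \<open>A square integrable function cannot stay away from 0 on a set of infinite measure. This
  replaces the limit at infinity: one radius close to \<open>Q_inf\<close> is enough.\<close>

lemma L2_close:
  fixes u :: "real \<Rightarrow> 'b::euclidean_space"
  assumes "u \<in> L2 {1<..}" "e > 0"
  shows "\<exists>t>1. norm (u t) < e"
proof (rule ccontr)
  assume "\<not> (\<exists>t>1. norm (u t) < e)"
  then have ge: "norm (u t) \<ge> e" if "t > 1" for t using that by force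
  have "(\<integral>\<^sup>+x. ennreal (norm ((norm (u x))\<^sup>2)) \<partial>lebesgue_on {1<..}) < \<infinity>"
    using assms(1) unfolding L2_def integrable_iff_bounded by blast
  moreover have "(\<integral>\<^sup>+x. ennreal (e\<^sup>2) \<partial>lebesgue_on {1::real<..}) \<le> (\<integral>\<^sup>+x. ennreal (norm ((norm (u x))\<^sup>2)) \<partial>lebesgue_on {1<..})"
  proof (intro nn_integral_mono ennreal_leI)
    fix x :: real assume "x \<in> space (lebesgue_on {1<..})"
    then have "e \<le> norm (u x)" using ge by (simp add: space_restrict_space)
    then show "e\<^sup>2 \<le> norm ((norm (u x))\<^sup>2)" using assms(2) by (simp add: power_mono)
  qed
  moreover have "(\<integral>\<^sup>+x. ennreal (e\<^sup>2) \<partial>lebesgue_on {1::real<..}) = \<infinity>"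
  proof -
    have "emeasure lebesgue {1::real<..} = \<infinity>"
    proof (rule ccontr)
      assume "emeasure lebesgue {1::real<..} \<noteq> \<infinity>"
      then obtain M where M: "emeasure lebesgue {1::real<..} = ennreal M" "M \<ge> 0" by (cases "emeasure lebesgue {1::real<..}") auto
      have "ennreal (M + 1) = emeasure lebesgue {2..M + 3::real}" using M(2) by simp
      also have "\<dots> \<le> emeasure lebesgue {1::real<..}" by (rule emeasure_mono) auto
      finally show False using M by simp
    qed
    then show ?thesis using assms(2) by (simp add: emeasure_restrict_space ennreal_mult_top)
  qed
  ultimately show False by simp
qed

text \<open>Up to a radius where \<open>Q\<close> is close to \<open>Q_inf\<close>, the variation of
  the calibration is at most the integral of slope times speed. By Young's inequality this is at
  most the energy, as \<open>f_pot\<close> vanishes almost everywhere and the slope is bounded by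
  \<open>g_pot\<close> alone.\<close>

lemma D_inf_lower:
  fixes \<kappa> g0 :: real
  assumes \<kappa>: "\<kappa> = root 4 24" and g0: "g0 \<ge> 0" and n: "norm n = 1" and Q: "Q \<in> radial_class (uniaxial n)"
  shows "ennreal (\<kappa> * (1 - \<bar>n$3\<bar>)) \<le> F_inf g0 Q"
proof (cases "AE r in lebesgue_on {1<..}. f_pot (Q r) = 0")
  case False
  then show ?thesis by (simp add: F_inf_def)
next
  case f0: True
  let ?U = "{1::real<..}"
  have H: "(\<lambda>r. Q r - Q_inf) \<in> H1 ?U S0" and Qc: "continuous_on {1..} Q" and Q1: "Q 1 = uniaxial n"
    using Q by (auto simp: radial_class_def)
  have L2Q: "(\<lambda>r. Q r - Q_inf) \<in> L2 ?U" and S0Q: "AE x in lebesgue_on ?U. Q x - Q_inf \<in> S0"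
    using H by (auto simp: H1_def)
  obtain v where v: "v \<in> L2 ?U" "has_weak_deriv ?U 1 (\<lambda>r. Q r - Q_inf) v"
    using H by (auto simp: H1_def)
  have vQ: "has_weak_deriv ?U 1 Q v" using v(2) by (subst (asm) has_weak_deriv_shift) auto
  have vAE: "AE x in lebesgue_on ?U. weak_deriv ?U 1 Q x = v x"
    by (rule weak_deriv_AE(2)[OF _ vQ]) simp
  \<comment> \<open>Constant continuation to the left of 1, which makes the function continuous on
    the whole line and changes nothing on the half-line.\<close>
  define q where "q x = Q (max 1 x)" for x
  have qc: "continuous_on UNIV q"
    unfolding q_def by (rule continuous_on_compose2[OF Qc]) (auto intro: continuous_intros)
  have wq: "has_weak_deriv ?U 1 q v"
  proof -
    have i: "(LINT x|lebesgue_on ?U. p x *\<^sub>R Q x) = (LINT x|lebesgue_on ?U. p x *\<^sub>R q x)" for p :: "real \<Rightarrow> real"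
      by (rule Bochner_Integration.integral_cong) (auto simp: q_def space_restrict_space max_def)
    then show ?thesis
      using vQ unfolding has_weak_deriv_def by (simp add: locally_integrable_continuous[OF qc])
  qed
  define w where "w x = norm (indicator ?U x *\<^sub>R v x)" for x
  have vm: "(\<lambda>x. indicator ?U x *\<^sub>R v x) \<in> borel_measurable lebesgue"
    using v(1) by (simp add: L2_def borel_measurable_restrict_space_iff)
  then have wm [measurable]: "w \<in> borel_measurable lebesgue" unfolding w_def by (rule measurable_compose[OF _ borel_measurable_norm])
  have F: "F_inf g0 Q = (\<integral>\<^sup>+r. ennreal ((1/2) * (norm (weak_deriv ?U 1 Q r))\<^sup>2 + g_pot g0 (Q r)) \<partial>lebesgue_on ?U)"
    using f0 by (simp add: F_inf_def)
  have main: "ennreal (\<kappa> * (1 - \<bar>n$3\<bar>) - \<epsilon> - \<epsilon>) \<le> F_inf g0 Q" if \<epsilon>: "\<epsilon> > 0" for \<epsilon>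
  proof -
    obtain \<Phi> G L K where cal: "L > 0" "K > 0"
      "\<And>A B. \<bar>\<Phi> A - \<Phi> B\<bar> \<le> (G A + L * norm (A - B)) * norm (A - B)"
      "\<And>A B. \<bar>G A - G B\<bar> \<le> L * norm (A - B)" "\<And>A. 0 \<le> G A" "G Q_inf = 0"
      "\<And>A B. \<bar>\<Phi> A - \<Phi> B\<bar> \<le> L * norm (A - B)"
      "\<And>Q lam. Q \<in> S0 \<Longrightarrow> lam \<ge> K \<Longrightarrow> (G Q)\<^sup>2 \<le> 2 * (lam\<^sup>2 * f_pot Q + g_pot g0 Q)"
      "\<And>n. norm n = 1 \<Longrightarrow> \<bar>\<Phi> (uniaxial n) - \<Phi> Q_inf\<bar> \<ge> \<kappa> * (1 - \<bar>n$3\<bar>) - \<epsilon>"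
      using calibration[OF \<kappa> g0 \<epsilon>] by metis
    obtain T where T: "T > 1" "norm (Q T - Q_inf) < \<epsilon> / L"
      using L2_close[OF L2Q, of "\<epsilon> / L"] \<epsilon> cal(1) by auto
    have "L-lipschitz_on UNIV G"
      unfolding lipschitz_on_def dist_norm using cal(1,4) by auto
    then have Gc: "continuous_on UNIV G" by (rule lipschitz_on_continuous_on)
    have Gm: "(\<lambda>x. G (q x)) \<in> borel_measurable lebesgue"
    proof (rule measurable_completion)
      have "continuous_on UNIV (\<lambda>x. G (q x))" by (rule continuous_on_compose2[OF Gc qc]) simp
      then show "(\<lambda>x. G (q x)) \<in> borel_measurable lborel" by (simp add: borel_measurable_continuous_onI)
    qed
    have fin: "(\<integral>\<^sup>+x. ennreal (w x) * indicator {1<..T} x \<partial>lebesgue) < \<infinity>"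
    proof -
      have "(\<integral>\<^sup>+x. ennreal (w x) * indicator {1<..T} x \<partial>lebesgue)
        \<le> (\<integral>\<^sup>+x. ennreal ((w x)\<^sup>2) + indicator {1<..T} x \<partial>lebesgue)"
      proof (rule nn_integral_mono)
        fix x
        have "w x \<le> (w x)\<^sup>2 + 1"
          using zero_le_power2[of "w x - 1/2"] by (simp add: power2_eq_square algebra_simps)
        then have "ennreal (w x) \<le> ennreal ((w x)\<^sup>2 + 1)" by (rule ennreal_leI)
        also have "\<dots> = ennreal ((w x)\<^sup>2) + ennreal 1" by (rule ennreal_plus) auto
        finally have "ennreal (w x) \<le> ennreal ((w x)\<^sup>2) + ennreal 1" .
        then show "ennreal (w x) * indicator {1<..T} x \<le> ennreal ((w x)\<^sup>2) + indicator {1<..T} x"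
          by (auto split: split_indicator)
      qed
      also have "\<dots> = (\<integral>\<^sup>+x. ennreal ((w x)\<^sup>2) \<partial>lebesgue) + emeasure lebesgue {1<..T}"
        by (subst nn_integral_add) (auto intro!: borel_measurable_indicator)
      also have "(\<integral>\<^sup>+x. ennreal ((w x)\<^sup>2) \<partial>lebesgue) = (\<integral>\<^sup>+x. ennreal (norm ((norm (v x))\<^sup>2)) \<partial>lebesgue_on ?U)"
        by (subst nn_integral_restrict_space) (auto simp: w_def intro!: nn_integral_cong split: split_indicator)
      finally show ?thesis
        using v(1) T by (auto simp: L2_def integrable_iff_bounded order.strict_iff_not top_unique)
    qed
    have "ennreal \<bar>\<Phi> (q T) - \<Phi> (q 1)\<bar> \<le> (\<integral>\<^sup>+x. ennreal (G (q x) * w x) * indicator {1<..T} x \<partial>lebesgue)"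
    proof (rule upper_gradient_curve[OF cal(3,4,5,1) continuous_on_subset[OF qc] _ wm _ _ fin Gm])
      show "ennreal (norm (q t - q s)) \<le> (\<integral>\<^sup>+x. ennreal (w x) * indicator {s<..t} x \<partial>lebesgue)"
        if "1 \<le> s" "s \<le> t" "t \<le> T" for s t
        unfolding w_def by (rule weak_deriv_increment_le[OF qc wq that(1,2)])
    qed (use T in \<open>auto simp: w_def\<close>)
    also have "\<dots> \<le> (\<integral>\<^sup>+x. ennreal (G (q x) * w x) * indicator ?U x \<partial>lebesgue)"
      by (intro nn_integral_mono) (auto split: split_indicator)
    also have "\<dots> = (\<integral>\<^sup>+x. ennreal (G (q x) * w x) \<partial>lebesgue_on ?U)"
      by (subst nn_integral_restrict_space) auto
    also have "\<dots> \<le> F_inf g0 Q"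
      unfolding F
    proof (rule nn_integral_mono_AE)
      have sp: "AE x in lebesgue_on ?U. x \<in> ?U" by (rule AE_I2) (simp add: space_restrict_space)
      show "AE x in lebesgue_on ?U. ennreal (G (q x) * w x) \<le> ennreal ((1/2) * (norm (weak_deriv ?U 1 Q x))\<^sup>2 + g_pot g0 (Q x))"
        using f0 S0Q vAE sp
      proof eventually_elim
        case (elim x)
        have S: "Q x \<in> S0" using subspace_add[OF subspace_S0 elim(2) Q_inf_S0] by simp
        have qx: "q x = Q x" "w x = norm (v x)" using elim(4) by (auto simp: q_def w_def)
        have "(G (Q x))\<^sup>2 \<le> 2 * g_pot g0 (Q x)" using cal(8)[OF S order_refl] elim(1) by simp
        moreover have "2 * (G (Q x) * norm (v x)) \<le> (G (Q x))\<^sup>2 + (norm (v x))\<^sup>2"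
          using zero_le_power2[of "G (Q x) - norm (v x)"] by (simp add: power2_eq_square algebra_simps)
        ultimately show ?case unfolding qx elim(3) by (intro ennreal_leI) simp
      qed
    qed
    finally have 1: "ennreal \<bar>\<Phi> (q T) - \<Phi> (q 1)\<bar> \<le> F_inf g0 Q" .
    have "\<bar>\<Phi> (Q T) - \<Phi> Q_inf\<bar> \<le> L * norm (Q T - Q_inf)" by (rule cal(7))
    also have "\<dots> \<le> \<epsilon>" using T(2) cal(1) by (simp add: field_simps less_imp_le)
    finally have "\<bar>\<Phi> (Q T) - \<Phi> Q_inf\<bar> \<le> \<epsilon>" .
    moreover have "q T = Q T" "q 1 = uniaxial n" using T Q1 by (auto simp: q_def max_def)
    \<comment> \<open>One \<epsilon> is the loss of the calibration, the other the distance to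
      \<open>Q_inf\<close> that remains at the radius T.\<close>
    ultimately have "\<kappa> * (1 - \<bar>n$3\<bar>) - \<epsilon> - \<epsilon> \<le> \<bar>\<Phi> (q T) - \<Phi> (q 1)\<bar>" using cal(9)[OF n] by simp
    then show ?thesis using 1 by (meson ennreal_leI order_trans)
  qed
  show ?thesis
  proof (rule ennreal_le_epsilon)
    fix e :: real assume e: "0 < e"
    have "ennreal (\<kappa> * (1 - \<bar>n$3\<bar>)) \<le> ennreal (\<kappa> * (1 - \<bar>n$3\<bar>) - e/2 - e/2) + ennreal e"
      by (cases "\<kappa> * (1 - \<bar>n$3\<bar>) \<ge> e") (use e in \<open>auto simp: ennreal_plus[symmetric] ennreal_neg simp del: ennreal_plus intro: ennreal_leI\<close>)
    also have "\<dots> \<le> F_inf g0 Q + ennreal e" using main[of "e/2"] e by (intro add_right_mono) simp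
    finally show "ennreal (\<kappa> * (1 - \<bar>n$3\<bar>)) \<le> F_inf g0 Q + ennreal e" .
  qed
qed

text \<open>The integrand is the derivative of 2 c (1 - y) / (1 + y). This quotient is the third
  component of the director when y is the squared length of the stereographic coordinate.\<close>

lemma nn_integral_profile:
  fixes c y0 :: real
  assumes c: "c > 0" and y: "y0 \<ge> 0"
  defines "y \<equiv> (\<lambda>r. y0 * exp (- 2 * c * (r - 1)))"
  shows "(\<integral>\<^sup>+r. ennreal (8 * c\<^sup>2 * y r / (1 + y r)\<^sup>2) \<partial>lebesgue_on {1<..}) = ennreal (2 * c * (1 - (1 - y0) / (1 + y0)))"
proof -
  have y0: "y r \<ge> 0" for r using y by (simp add: y_def)
  then have p: "1 + y r > 0" for r by (simp add: add_pos_nonneg)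
  have dy: "(y has_real_derivative - 2 * c * y r) (at r)" for r
    unfolding y_def by (auto intro!: derivative_eq_intros)
  have der: "((\<lambda>r. 2 * c * ((1 - y r) / (1 + y r))) has_real_derivative 8 * c\<^sup>2 * y r / (1 + y r)\<^sup>2) (at r)" for r
  proof -
    have "((\<lambda>r. 2 * c * ((1 - y r) / (1 + y r))) has_real_derivative
      2 * c * (((0 - (- 2 * c * y r)) * (1 + y r) - (1 - y r) * (0 + (- 2 * c * y r))) / ((1 + y r) * (1 + y r)))) (at r)"
      using p[of r] by (intro DERIV_cmult DERIV_divide DERIV_diff DERIV_add DERIV_const dy) auto
    moreover have "2 * c * (((0 - (- 2 * c * y r)) * (1 + y r) - (1 - y r) * (0 + (- 2 * c * y r))) / ((1 + y r) * (1 + y r)))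
      = 8 * c\<^sup>2 * y r / (1 + y r)\<^sup>2"
      by (simp add: power2_eq_square algebra_simps add_divide_distrib[symmetric])
    ultimately show ?thesis by simp
  qed
  have "filterlim (\<lambda>r::real. - (2 * c) * (r - 1)) at_bot at_top"
    using c by real_asymp
  then have "((\<lambda>r::real. exp (- (2 * c) * (r - 1))) \<longlongrightarrow> 0) at_top"
    by (rule filterlim_compose[OF exp_at_bot])
  then have "((\<lambda>r. y0 * exp (- (2 * c) * (r - 1))) \<longlongrightarrow> y0 * 0) at_top" by (intro tendsto_intros)
  then have lim: "(y \<longlongrightarrow> 0) at_top" by (simp add: y_def)
  have "((\<lambda>r. 2 * c * ((1 - y r) / (1 + y r))) \<longlongrightarrow> 2 * c * ((1 - 0) / (1 + 0))) at_top"
    by (intro tendsto_intros lim) simp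
  then have lim2: "((\<lambda>r. 2 * c * ((1 - y r) / (1 + y r))) \<longlongrightarrow> 2 * c) at_top" by simp
  have cy: "continuous_on UNIV y" unfolding y_def by (intro continuous_intros)
  have pn: "1 + y r \<noteq> 0" for r using p[of r] by simp
  have "continuous_on UNIV (\<lambda>r. 8 * c\<^sup>2 * y r / (1 + y r)\<^sup>2)"
    by (intro continuous_intros cy) (use pn in auto)
  then have m: "(\<lambda>r. 8 * c\<^sup>2 * y r / (1 + y r)\<^sup>2) \<in> borel_measurable borel"
    by (rule borel_measurable_continuous_onI)
  have "(\<integral>\<^sup>+r. ennreal (8 * c\<^sup>2 * y r / (1 + y r)\<^sup>2) \<partial>lebesgue_on {1<..})
     = (\<integral>\<^sup>+r. ennreal (8 * c\<^sup>2 * y r / (1 + y r)\<^sup>2) * indicator {1<..} r \<partial>lborel)"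
    by (subst nn_integral_restrict_space) (auto simp: nn_integral_completion)
  also have "\<dots> = (\<integral>\<^sup>+r. ennreal (8 * c\<^sup>2 * y r / (1 + y r)\<^sup>2) * indicator {1..} r \<partial>lborel)"
  proof (rule nn_integral_cong_AE)
    have "AE r in lborel. r \<noteq> (1::real)" by (rule AE_lborel_singleton)
    then show "AE r in lborel. ennreal (8 * c\<^sup>2 * y r / (1 + y r)\<^sup>2) * indicator {1<..} r = ennreal (8 * c\<^sup>2 * y r / (1 + y r)\<^sup>2) * indicator {1..} r"
      by eventually_elim (auto split: split_indicator)
  qed
  also have "\<dots> = ennreal (2 * c - 2 * c * ((1 - y 1) / (1 + y 1)))"
    using y0 by (intro nn_integral_FTC_atLeast[OF m der _ lim2]) auto
  finally show ?thesis by (simp add: y_def algebra_simps)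
qed

text \<open>In the stereographic coordinate the minimizer is an exponential with rate c = \<kappa> /
  2. For this rate gradient term and potential coincide pointwise, so equality holds in Young's
  inequality.\<close>

lemma D_inf_attained:
  fixes \<kappa> g0 :: real
  assumes \<kappa>: "\<kappa> = root 4 24" and n: "norm n = 1"
  obtains Q where "Q \<in> radial_class (uniaxial n)" "F_inf g0 Q = ennreal (\<kappa> * (1 - \<bar>n$3\<bar>))"
proof -
  define c where "c = \<kappa> / 2"
  have c: "c > 0" "c\<^sup>2 = sqrt (3/2)" "2 * c = \<kappa>" using kappa_sq[OF \<kappa>] by (auto simp: c_def)
  \<comment> \<open>Opposite directors give the same tensor; the one in the upper hemisphere has the
    shorter way to \<open>e3\<close>. This is the origin of the absolute value.\<close>
  define n' where "n' = (if n$3 \<ge> 0 then n else - n)"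
  have n': "norm n' = 1" "n'$3 = \<bar>n$3\<bar>" "n'$3 \<ge> 0" using n by (auto simp: n'_def)
  have un: "uniaxial n' = uniaxial n" by (auto simp: n'_def uniaxial_def)
  define z0 where "z0 = (1 / (1 + n'$3)) *\<^sub>R (n' - n'$3 *\<^sub>R e3)"
  note z0 = stereo_inverse[OF n'(1,3), folded z0_def]
  define z where "z r = exp (- c * (r - 1)) *\<^sub>R z0" for r
  define Q where "Q r = Q_inf + Uz (z r)" for r
  define y where "y r = (z0 \<bullet> z0) * exp (- 2 * c * (r - 1))" for r
  let ?U = "{1::real<..}"
  have zz: "z r \<bullet> z r = y r" for r by (simp add: z_def y_def exp_add[symmetric] algebra_simps)
  have z3: "z r $ 3 = 0" for r by (simp add: z_def z0(2))
  have dz: "(z has_vector_derivative (- c) *\<^sub>R z r) (at r)" for r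
    unfolding z_def by (auto intro!: derivative_eq_intros)
  have dz': "(z has_derivative (\<lambda>t. t *\<^sub>R ((- c) *\<^sub>R z r))) (at r)" for r
    using dz by (simp add: has_vector_derivative_def)
  have dQ: "((\<lambda>r. Uz (z r)) has_derivative (\<lambda>t. dUz (z r) (t *\<^sub>R ((- c) *\<^sub>R z r)))) (at r)" for r
    by (rule has_derivative_compose[OF dz' Uz_has_derivative])
  have zc: "continuous_on UNIV z" unfolding z_def by (intro continuous_intros)
  have cd: "continuous_on UNIV (\<lambda>r. dUz (z r) (1 *\<^sub>R ((- c) *\<^sub>R z r)))"
    using zc unfolding continuous_on_def by (intro ballI tendsto_dUz tendsto_intros) auto
  have wd: "has_weak_deriv ?U 1 (\<lambda>r. Uz (z r)) (\<lambda>r. dUz (z r) ((- c) *\<^sub>R z r))"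
    using has_weak_deriv_C1[OF _ _ dQ cd, of ?U] by simp
  have QU: "(\<lambda>r. Q r - Q_inf) = (\<lambda>r. Uz (z r))" by (simp add: Q_def)
  have nd: "(norm (dUz (z r) ((- c) *\<^sub>R z r)))\<^sup>2 = 8 * c\<^sup>2 * y r / (1 + y r)\<^sup>2" for r
    using dUz_norm[OF z3, of "(- c) *\<^sub>R z r" r] z3[of r] zz[of r] by (simp add: power_mult_distrib power2_norm_eq_inner)
  have nU: "(norm (Uz (z r)))\<^sup>2 = 8 * y r / (1 + y r)\<^sup>2" for r
    using Uz_norm[OF z3, of r] by (simp add: zz)
  have y0: "y r \<ge> 0" for r by (simp add: y_def)
  have int: "(\<integral>\<^sup>+r. ennreal (8 * c\<^sup>2 * y r / (1 + y r)\<^sup>2) \<partial>lebesgue_on ?U) = ennreal (2 * c * (1 - (1 - z0 \<bullet> z0) / (1 + z0 \<bullet> z0)))"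
    unfolding y_def by (rule nn_integral_profile[OF c(1)]) simp
  \<comment> \<open>The squared norms of the deviation from \<open>Q_inf\<close> and of its
    derivative are both multiples of the energy density, so membership in L2 reduces to the finite
    integral just computed.\<close>
  have L2I: "u \<in> L2 ?U" if "continuous_on UNIV u" "\<And>r. (norm (u r))\<^sup>2 = k * (8 * c\<^sup>2 * y r / (1 + y r)\<^sup>2)" "k \<ge> 0" for u :: "real \<Rightarrow> real^3^3" and k
  proof -
    have m: "u \<in> borel_measurable (lebesgue_on ?U)"
      using that(1) by (intro measurable_restrict_space1 measurable_completion) (simp add: borel_measurable_continuous_onI)
    have "(\<integral>\<^sup>+r. ennreal (norm ((norm (u r))\<^sup>2)) \<partial>lebesgue_on ?U) = (\<integral>\<^sup>+r. ennreal k * ennreal (8 * c\<^sup>2 * y r / (1 + y r)\<^sup>2) \<partial>lebesgue_on ?U)"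
    proof (rule nn_integral_cong)
      fix r
      have "norm ((norm (u r))\<^sup>2) = k * (8 * c\<^sup>2 * y r / (1 + y r)\<^sup>2)" unfolding that(2)[symmetric] by simp
      also have "ennreal \<dots> = ennreal k * ennreal (8 * c\<^sup>2 * y r / (1 + y r)\<^sup>2)"
        using that(3) y0 by (intro ennreal_mult) auto
      finally show "ennreal (norm ((norm (u r))\<^sup>2)) = ennreal k * ennreal (8 * c\<^sup>2 * y r / (1 + y r)\<^sup>2)" .
    qed
    also have "\<dots> = ennreal k * (\<integral>\<^sup>+r. ennreal (8 * c\<^sup>2 * y r / (1 + y r)\<^sup>2) \<partial>lebesgue_on ?U)"
    proof (rule nn_integral_cmult)
      have "1 + y r \<noteq> 0" for r using y0[of r] by simp
      then have "continuous_on UNIV (\<lambda>r. 8 * c\<^sup>2 * y r / (1 + y r)\<^sup>2)"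
        unfolding y_def by (intro continuous_intros) auto
      then show "(\<lambda>r. ennreal (8 * c\<^sup>2 * y r / (1 + y r)\<^sup>2)) \<in> borel_measurable (lebesgue_on ?U)"
        by (intro measurable_compose[OF _ measurable_ennreal] measurable_restrict_space1 measurable_completion) (simp add: borel_measurable_continuous_onI)
    qed
    also have "\<dots> < \<infinity>" unfolding int by (simp add: ennreal_mult[symmetric] ennreal_mult_less_top)
    finally show ?thesis using m by (auto simp: L2_def integrable_iff_bounded)
  qed
  have Uc: "continuous_on UNIV (\<lambda>r. Uz (z r))"
    using has_derivative_continuous[OF dQ] by (simp add: continuous_at_imp_continuous_on)
  have "(\<lambda>r. Q r - Q_inf) \<in> H1 ?U S0"
    unfolding H1_def QU
  proof (intro CollectI conjI ballI)
    show "(\<lambda>r. Uz (z r)) \<in> L2 ?U"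
      by (rule L2I[OF Uc, of "1 / c\<^sup>2"]) (use c(1) in \<open>auto simp: nU\<close>)
    show "AE x in lebesgue_on ?U. Uz (z x) \<in> S0" using Uz_S0[OF z3] by simp
    fix b :: real assume "b \<in> Basis"
    then have b: "b = 1" by simp
    have "(\<lambda>r. dUz (z r) ((- c) *\<^sub>R z r)) \<in> L2 ?U"
      by (rule L2I[of _ 1]) (use cd nd in auto)
    then show "\<exists>v\<in>L2 ?U. has_weak_deriv ?U b (\<lambda>r. Uz (z r)) v" using wd b by blast
  qed
  moreover have "continuous_on {1..} Q"
    unfolding Q_def by (intro continuous_intros continuous_on_subset[OF Uc]) auto
  moreover have "Q 1 = uniaxial n"
    unfolding Q_def Uz_uniaxial(1) by (simp add: z_def z0(1) un)
  ultimately have "Q \<in> radial_class (uniaxial n)" by (simp add: radial_class_def)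
  moreover have "F_inf g0 Q = ennreal (\<kappa> * (1 - \<bar>n$3\<bar>))"
  proof -
    have f0: "f_pot (Q r) = 0" for r unfolding Q_def by (rule f_pot_Uz[OF z3])
    have "weak_deriv ?U 1 Q = weak_deriv ?U 1 (\<lambda>r. Q r - Q_inf)"
      by (rule weak_deriv_shift[symmetric]) auto
    then have AE: "AE r in lebesgue_on ?U. weak_deriv ?U 1 Q r = dUz (z r) ((- c) *\<^sub>R z r)"
      using weak_deriv_AE(2)[OF _ wd] unfolding QU by simp
    have "F_inf g0 Q = (\<integral>\<^sup>+r. ennreal ((1/2) * (norm (weak_deriv ?U 1 Q r))\<^sup>2 + g_pot g0 (Q r)) \<partial>lebesgue_on ?U)"
      by (simp add: F_inf_def f0)
    also have "\<dots> = (\<integral>\<^sup>+r. ennreal (8 * c\<^sup>2 * y r / (1 + y r)\<^sup>2) \<partial>lebesgue_on ?U)"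
    proof (rule nn_integral_cong_AE)
      show "AE r in lebesgue_on ?U. ennreal ((1/2) * (norm (weak_deriv ?U 1 Q r))\<^sup>2 + g_pot g0 (Q r)) = ennreal (8 * c\<^sup>2 * y r / (1 + y r)\<^sup>2)"
        using AE
      proof eventually_elim
        case (elim r)
        have "g_pot g0 (Q r) = c\<^sup>2 * (4 * y r / (1 + y r)\<^sup>2)"
          unfolding Q_def g_pot_Uz[OF z3] zz c(2) ..
        then have "(1/2) * (norm (weak_deriv ?U 1 Q r))\<^sup>2 + g_pot g0 (Q r) = 8 * c\<^sup>2 * y r / (1 + y r)\<^sup>2"
          unfolding elim nd by simp
        then show ?case by (rule arg_cong)
      qed
    qed
    also have "\<dots> = ennreal (2 * c * (1 - (1 - z0 \<bullet> z0) / (1 + z0 \<bullet> z0)))" by (rule int)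
    also have "(1 - z0 \<bullet> z0) / (1 + z0 \<bullet> z0) = n'$3"
      using stereo_props(2)[OF z0(2)] z0(1) by simp
    finally show ?thesis by (simp add: c(3) n'(2))
  qed
  ultimately show thesis by (rule that)
qed

lemma longitudinal_sph:
  assumes e: "longitudinal e" and \<phi>: "\<phi> \<in> {0..pi}" and \<theta>: "\<theta> \<in> {0..<2*pi}"
  shows "norm (e (sph \<phi> \<theta>)) = 1" "\<bar>e (sph \<phi> \<theta>) $ 3\<bar> = \<bar>sin \<phi>\<bar>"
proof -
  consider "\<phi> = 0" | "\<phi> = pi" | "0 < \<phi>" "\<phi> < pi" using \<phi> by force
  then have "norm (e (sph \<phi> \<theta>)) = 1 \<and> \<bar>e (sph \<phi> \<theta>) $ 3\<bar> = \<bar>sin \<phi>\<bar>"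
  proof cases
    case 1
    then have s: "sph \<phi> \<theta> = e3" by (simp add: sph_def vec3_eq_iff vector_3 e3_def axis_def)
    then show ?thesis using e 1 by (simp add: longitudinal_def e3_simps)
  next
    case 2
    then have s: "sph \<phi> \<theta> = - e3" by (simp add: sph_def vec3_eq_iff vector_3 e3_def axis_def)
    then show ?thesis using e 2 by (simp add: longitudinal_def e3_simps)
  next
    case 3
    then have eq: "e (sph \<phi> \<theta>) = vector [cos \<phi> * cos \<theta>, cos \<phi> * sin \<theta>, - sin \<phi>]"
      using e \<theta> by (simp add: longitudinal_def)
    have "(norm (e (sph \<phi> \<theta>)))\<^sup>2 = (cos \<phi>)\<^sup>2 * ((cos \<theta>)\<^sup>2 + (sin \<theta>)\<^sup>2) + (sin \<phi>)\<^sup>2"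
      unfolding eq by (simp add: norm3_sq vector_3 power_mult_distrib algebra_simps del: sin_cos_squared_add sin_cos_squared_add2)
    also have "\<dots> = 1" by simp
    finally have "norm (e (sph \<phi> \<theta>)) = 1" by (metis norm_ge_zero one_power2 power2_eq_imp_eq zero_le_one)
    then show ?thesis by (simp add: eq vector_3)
  qed
  then show "norm (e (sph \<phi> \<theta>)) = 1" "\<bar>e (sph \<phi> \<theta>) $ 3\<bar> = \<bar>sin \<phi>\<bar>" by auto
qed

theorem radial_problem:
  fixes \<kappa> g0 :: real
  assumes \<kappa>: "\<kappa> = root 4 24" and g0: "g0 \<ge> 0" and e: "longitudinal e"
    and \<phi>: "\<phi> \<in> {0..pi}" and \<theta>: "\<theta> \<in> {0..<2*pi}"
  shows "D_inf g0 (Q_phi e (sph \<phi> \<theta>)) = ennreal (\<kappa> * (1 - \<bar>sin \<phi>\<bar>)) \<and>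
            (\<exists>Q \<in> radial_class (Q_phi e (sph \<phi> \<theta>)). F_inf g0 Q = D_inf g0 (Q_phi e (sph \<phi> \<theta>)))"
proof -
  define n where "n = e (sph \<phi> \<theta>)"
  have n: "norm n = 1" "\<bar>n$3\<bar> = \<bar>sin \<phi>\<bar>" using longitudinal_sph[OF e \<phi> \<theta>] by (auto simp: n_def)
  obtain Q where Q: "Q \<in> radial_class (uniaxial n)" "F_inf g0 Q = ennreal (\<kappa> * (1 - \<bar>n$3\<bar>))"
    using D_inf_attained[OF \<kappa> n(1)] by metis
  have "D_inf g0 (uniaxial n) = ennreal (\<kappa> * (1 - \<bar>n$3\<bar>))"
    unfolding D_inf_def
  proof (rule antisym)
    show "(INF Q\<in>radial_class (uniaxial n). F_inf g0 Q) \<le> ennreal (\<kappa> * (1 - \<bar>n$3\<bar>))"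
      using INF_lower[OF Q(1), of "F_inf g0"] Q(2) by simp
    show "ennreal (\<kappa> * (1 - \<bar>n$3\<bar>)) \<le> (INF Q\<in>radial_class (uniaxial n). F_inf g0 Q)"
      by (intro INF_greatest D_inf_lower[OF \<kappa> g0 n(1)])
  qed
  then show ?thesis using Q unfolding Q_phi_def n_def[symmetric] n(2) by auto
qed

section \<open>Integrals over the sphere\<close>

text \<open>Surface integral over the unit sphere of an integrand given in the angles. In contrast
  to \<open>sphere_nn_integral\<close> it takes extended values, since the integrand may be a radial
  integral that is not known to be finite.\<close>

definition sint :: "(real \<Rightarrow> real \<Rightarrow> ennreal) \<Rightarrow> ennreal" where
  "sint k = (\<integral>\<^sup>+\<theta>. (\<integral>\<^sup>+\<phi>. k \<phi> \<theta> * ennreal (sin \<phi>) * indicator {0..pi} \<phi> \<partial>lborel) * indicator {0..2*pi} \<theta> \<partial>lborel)"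

text \<open>The weight \<open>sin \<phi>\<close> annihilates the poles and the meridian at 2 \<pi>
  is null, so a comparison is needed only where the boundary datum is prescribed by its
  formula.\<close>

lemma sint_mono:
  assumes "\<And>\<phi> \<theta>. 0 < \<phi> \<Longrightarrow> \<phi> < pi \<Longrightarrow> 0 \<le> \<theta> \<Longrightarrow> \<theta> < 2*pi \<Longrightarrow> k \<phi> \<theta> \<le> l \<phi> \<theta>"
  shows "sint k \<le> sint l"
  unfolding sint_def
proof (rule nn_integral_mono_AE)
  have "AE \<theta> in lborel. \<theta> \<noteq> 2 * pi" by (rule AE_lborel_singleton)
  then show "AE \<theta> in lborel. (\<integral>\<^sup>+\<phi>. k \<phi> \<theta> * ennreal (sin \<phi>) * indicator {0..pi} \<phi> \<partial>lborel) * indicator {0..2*pi} \<theta>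
     \<le> (\<integral>\<^sup>+\<phi>. l \<phi> \<theta> * ennreal (sin \<phi>) * indicator {0..pi} \<phi> \<partial>lborel) * indicator {0..2*pi} \<theta>"
  proof eventually_elim
    case (elim \<theta>)
    have "(\<integral>\<^sup>+\<phi>. k \<phi> \<theta> * ennreal (sin \<phi>) * indicator {0..pi} \<phi> \<partial>lborel)
       \<le> (\<integral>\<^sup>+\<phi>. l \<phi> \<theta> * ennreal (sin \<phi>) * indicator {0..pi} \<phi> \<partial>lborel)" if "\<theta> \<in> {0..2*pi}"
    proof (rule nn_integral_mono)
      fix \<phi> show "k \<phi> \<theta> * ennreal (sin \<phi>) * indicator {0..pi} \<phi> \<le> l \<phi> \<theta> * ennreal (sin \<phi>) * indicator {0..pi} \<phi>"
      proof (cases "0 < \<phi> \<and> \<phi> < pi")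
        case True
        then show ?thesis using assms[of \<phi> \<theta>] that elim by (intro mult_right_mono) auto
      next
        case False
        then have "\<phi> = 0 \<or> \<phi> = pi \<or> \<phi> \<notin> {0..pi}" by auto
        then show ?thesis by auto
      qed
    qed
    then show ?case by (cases "\<theta> \<in> {0..2*pi}") auto
  qed
qed

lemma sint_cong:
  assumes "\<And>\<phi> \<theta>. 0 < \<phi> \<Longrightarrow> \<phi> < pi \<Longrightarrow> 0 \<le> \<theta> \<Longrightarrow> \<theta> < 2*pi \<Longrightarrow> k \<phi> \<theta> = l \<phi> \<theta>"
  shows "sint k = sint l"
  by (intro antisym sint_mono) (simp_all add: assms)

lemma sphere_nn_integral_sint:
  assumes "\<And>x. h x \<ge> 0"
  shows "sphere_nn_integral h = sint (\<lambda>\<phi> \<theta>. ennreal (h (sph \<phi> \<theta>)))"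
  unfolding sphere_nn_integral_def sint_def
proof (rule nn_integral_cong)
  fix \<theta> :: real
  have "(\<integral>\<^sup>+\<phi>\<in>{0..pi}. ennreal (h (sph \<phi> \<theta>) * sin \<phi>) \<partial>lborel) =
    (\<integral>\<^sup>+\<phi>. ennreal (h (sph \<phi> \<theta>)) * ennreal (sin \<phi>) * indicator {0..pi} \<phi> \<partial>lborel)"
    by (intro nn_integral_cong) (auto simp: ennreal_mult assms sin_ge_zero split: split_indicator)
  then show "(\<integral>\<^sup>+\<phi>\<in>{0..pi}. ennreal (h (sph \<phi> \<theta>) * sin \<phi>) \<partial>lborel) * indicator {0..2*pi} \<theta> =
    (\<integral>\<^sup>+\<phi>. ennreal (h (sph \<phi> \<theta>)) * ennreal (sin \<phi>) * indicator {0..pi} \<phi> \<partial>lborel) * indicator {0..2*pi} \<theta>" by simp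
qed

lemma measurable_swap:
  assumes "(\<lambda>p. k (fst p) (snd p)) \<in> borel_measurable (borel :: (real \<times> real) measure)"
  shows "(\<lambda>(\<theta>, \<phi>). k \<phi> \<theta> * ennreal (sin \<phi>) * indicator {0..pi} \<phi> :: ennreal) \<in> borel_measurable (lborel \<Otimes>\<^sub>M lborel)"
proof -
  have [measurable]: "(\<lambda>p. k (fst p) (snd p)) \<in> borel_measurable (lborel \<Otimes>\<^sub>M lborel)"
    using assms by (simp add: lborel_prod)
  have "(\<lambda>p. (snd p, fst p)) \<in> (lborel \<Otimes>\<^sub>M lborel) \<rightarrow>\<^sub>M ((lborel :: real measure) \<Otimes>\<^sub>M (lborel :: real measure))" by measurable
  then have [measurable]: "(\<lambda>p. k (snd p) (fst p)) \<in> borel_measurable (lborel \<Otimes>\<^sub>M lborel)"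
    by (rule measurable_compose[where f="\<lambda>p. (snd p, fst p)" and g="\<lambda>p. k (fst p) (snd p)", simplified]) measurable
  show ?thesis unfolding case_prod_unfold by measurable
qed

lemma sint_add:
  assumes k: "(\<lambda>p. k (fst p) (snd p)) \<in> borel_measurable (borel :: (real \<times> real) measure)"
    and l: "(\<lambda>p. l (fst p) (snd p)) \<in> borel_measurable (borel :: (real \<times> real) measure)"
  shows "sint (\<lambda>\<phi> \<theta>. k \<phi> \<theta> + l \<phi> \<theta>) = sint k + sint l"
proof -
  note [measurable] = measurable_swap[OF k] measurable_swap[OF l]
  have mk: "(\<lambda>\<theta>. \<integral>\<^sup>+\<phi>. k \<phi> \<theta> * ennreal (sin \<phi>) * indicator {0..pi} \<phi> \<partial>lborel) \<in> borel_measurable lborel"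
    by (rule lborel.borel_measurable_nn_integral) (rule measurable_swap[OF k])
  have ml: "(\<lambda>\<theta>. \<integral>\<^sup>+\<phi>. l \<phi> \<theta> * ennreal (sin \<phi>) * indicator {0..pi} \<phi> \<partial>lborel) \<in> borel_measurable lborel"
    by (rule lborel.borel_measurable_nn_integral) (rule measurable_swap[OF l])
  have sec: "(\<lambda>\<phi>. k \<phi> \<theta> * ennreal (sin \<phi>) * indicator {0..pi} \<phi>) \<in> borel_measurable lborel"
     "(\<lambda>\<phi>. l \<phi> \<theta> * ennreal (sin \<phi>) * indicator {0..pi} \<phi>) \<in> borel_measurable lborel" for \<theta>
    using measurable_Pair2[OF measurable_swap[OF k], of \<theta>] measurable_Pair2[OF measurable_swap[OF l], of \<theta>] by auto
  have "sint (\<lambda>\<phi> \<theta>. k \<phi> \<theta> + l \<phi> \<theta>) = (\<integral>\<^sup>+\<theta>. ((\<integral>\<^sup>+\<phi>. k \<phi> \<theta> * ennreal (sin \<phi>) * indicator {0..pi} \<phi> \<partial>lborel) * indicator {0..2*pi} \<theta>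
      + (\<integral>\<^sup>+\<phi>. l \<phi> \<theta> * ennreal (sin \<phi>) * indicator {0..pi} \<phi> \<partial>lborel) * indicator {0..2*pi} \<theta>) \<partial>lborel)"
    unfolding sint_def distrib_right by (subst nn_integral_add[OF sec]) (simp add: distrib_right)
  also have "\<dots> = sint k + sint l"
    unfolding sint_def using mk ml by (intro nn_integral_add) auto
  finally show ?thesis .
qed

lemma sint_cmult:
  assumes k: "(\<lambda>p. k (fst p) (snd p)) \<in> borel_measurable (borel :: (real \<times> real) measure)"
  shows "sint (\<lambda>\<phi> \<theta>. c * k \<phi> \<theta>) = c * sint k"
proof -
  have mk: "(\<lambda>\<theta>. \<integral>\<^sup>+\<phi>. k \<phi> \<theta> * ennreal (sin \<phi>) * indicator {0..pi} \<phi> \<partial>lborel) \<in> borel_measurable lborel"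
    by (rule lborel.borel_measurable_nn_integral) (rule measurable_swap[OF k])
  have sec: "(\<lambda>\<phi>. k \<phi> \<theta> * ennreal (sin \<phi>) * indicator {0..pi} \<phi>) \<in> borel_measurable lborel" for \<theta>
    using measurable_Pair2[OF measurable_swap[OF k], of \<theta>] by auto
  have "sint (\<lambda>\<phi> \<theta>. c * k \<phi> \<theta>) = (\<integral>\<^sup>+\<theta>. c * ((\<integral>\<^sup>+\<phi>. k \<phi> \<theta> * ennreal (sin \<phi>) * indicator {0..pi} \<phi> \<partial>lborel) * indicator {0..2*pi} \<theta>) \<partial>lborel)"
    unfolding sint_def by (simp only: mult.assoc nn_integral_cmult[OF sec[unfolded mult.assoc]])
  also have "\<dots> = c * sint k"
    unfolding sint_def using mk by (intro nn_integral_cmult) auto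
  finally show ?thesis .
qed

lemma sint_zonal:
  assumes "\<And>\<phi>. \<phi> \<in> {0..pi} \<Longrightarrow> p \<phi> \<ge> 0" "continuous_on UNIV p"
    and F: "\<And>\<phi>. \<phi> \<in> {0..pi} \<Longrightarrow> (F has_real_derivative p \<phi> * sin \<phi>) (at \<phi>)"
  shows "sint (\<lambda>\<phi> \<theta>. ennreal (p \<phi>)) = ennreal (2 * pi * (F pi - F 0))"
proof -
  have "(\<integral>\<^sup>+\<phi>. ennreal (p \<phi>) * ennreal (sin \<phi>) * indicator {0..pi} \<phi> \<partial>lborel) =
    (\<integral>\<^sup>+\<phi>. ennreal (p \<phi> * sin \<phi>) * indicator {0..pi} \<phi> \<partial>lborel)"
    by (intro nn_integral_cong) (auto simp: ennreal_mult assms sin_ge_zero split: split_indicator)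
  also have "\<dots> = ennreal (F pi - F 0)"
  proof (rule nn_integral_FTC_Icc)
    show "(\<lambda>\<phi>. p \<phi> * sin \<phi>) \<in> borel_measurable borel"
      by (intro borel_measurable_continuous_onI continuous_intros assms)
  qed (use assms(1) F sin_ge_zero in auto)
  finally have 1: "(\<integral>\<^sup>+\<phi>. ennreal (p \<phi>) * ennreal (sin \<phi>) * indicator {0..pi} \<phi> \<partial>lborel) = ennreal (F pi - F 0)" .
  have "F 0 \<le> F pi"
    by (rule DERIV_nonneg_imp_nondecreasing[OF pi_ge_zero]) (use F assms(1) sin_ge_zero in force)
  then show ?thesis
    unfolding sint_def 1 by (subst nn_integral_cmult_indicator) (auto simp: ennreal_mult[symmetric] mult_ac)
qed

lemma sint_const: "c \<ge> 0 \<Longrightarrow> sint (\<lambda>\<phi> \<theta>. ennreal c) = ennreal (4 * pi * c)"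
  by (subst sint_zonal[where F="\<lambda>\<phi>. - c * cos \<phi>"]) (auto intro!: derivative_eq_intros)

text \<open>The origin of the limit constant: 2 \<pi> times the integral of (1 - sin) sin from 0 to
  \<pi>, which is 2 - \<pi> / 2.\<close>

lemma sint_one_minus_sin:
  assumes "\<kappa> \<ge> 0"
  shows "sint (\<lambda>\<phi> \<theta>. ennreal (\<kappa> * (1 - sin \<phi>))) = ennreal (pi * (4 - pi) * \<kappa>)"
proof -
  have "sint (\<lambda>\<phi> \<theta>. ennreal (\<kappa> * (1 - sin \<phi>))) =
    ennreal (2 * pi * ((\<kappa> * (- cos pi - (pi - sin pi * cos pi) / 2)) - (\<kappa> * (- cos 0 - (0 - sin 0 * cos 0) / 2))))"
  proof (rule sint_zonal[where F="\<lambda>\<phi>. \<kappa> * (- cos \<phi> - (\<phi> - sin \<phi> * cos \<phi>) / 2)"])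
    show "\<kappa> * (1 - sin \<phi>) \<ge> 0" for \<phi> using assms by simp
    show "continuous_on UNIV (\<lambda>\<phi>. \<kappa> * (1 - sin \<phi>))" by (intro continuous_intros)
    fix \<phi> :: real
    have c: "(cos \<phi>)\<^sup>2 = 1 - (sin \<phi>)\<^sup>2" by (simp add: cos_squared_eq)
    have "((\<lambda>\<phi>. \<kappa> * (- cos \<phi> - (\<phi> - sin \<phi> * cos \<phi>) / 2)) has_real_derivative
       \<kappa> * (sin \<phi> - (1 - (cos \<phi> * cos \<phi> + sin \<phi> * (- sin \<phi>))) / 2)) (at \<phi>)"
      by (auto intro!: derivative_eq_intros)
    moreover have "\<kappa> * (sin \<phi> - (1 - (cos \<phi> * cos \<phi> + sin \<phi> * (- sin \<phi>))) / 2) = \<kappa> * (1 - sin \<phi>) * sin \<phi>"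
    proof -
      have "cos \<phi> * cos \<phi> = 1 - sin \<phi> * sin \<phi>" using c by (simp add: power2_eq_square)
      then show ?thesis by (simp only:) (simp add: algebra_simps add_divide_distrib diff_divide_distrib)
    qed
    ultimately show "((\<lambda>\<phi>. \<kappa> * (- cos \<phi> - (\<phi> - sin \<phi> * cos \<phi>) / 2)) has_real_derivative \<kappa> * (1 - sin \<phi>) * sin \<phi>) (at \<phi>)" by (simp only:)
  qed
  also have "2 * pi * ((\<kappa> * (- cos pi - (pi - sin pi * cos pi) / 2)) - (\<kappa> * (- cos 0 - (0 - sin 0 * cos 0) / 2)))
      = pi * (4 - pi) * \<kappa>"
    by (simp add: algebra_simps diff_divide_distrib)
  finally show ?thesis .
qed

lemma nn_integral_polar_sint:
  fixes F :: "real^3 \<Rightarrow> ennreal"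
  assumes F: "F \<in> borel_measurable borel"
  shows "(\<integral>\<^sup>+x. F x \<partial>lebesgue_on \<Omega>) = sint (\<lambda>\<phi> \<theta>. \<integral>\<^sup>+r. F (r *\<^sub>R sph \<phi> \<theta>) * ennreal (r\<^sup>2) * indicator {1<..} r \<partial>lborel)"
proof -
  have \<Omega>: "\<Omega> \<in> sets borel" by (simp add: \<Omega>_def)
  have sm: "(\<lambda>r. F (r *\<^sub>R x)) \<in> borel_measurable borel" for x
    by (rule measurable_compose[OF _ F]) (intro borel_measurable_continuous_onI continuous_intros)
  have "(\<integral>\<^sup>+x. F x \<partial>lebesgue_on \<Omega>) = (\<integral>\<^sup>+x. F x * indicator \<Omega> x \<partial>lborel)"
    using \<Omega> by (subst nn_integral_restrict_space) (auto simp: nn_integral_completion)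
  also have "\<dots> = sint (\<lambda>\<phi> \<theta>. \<integral>\<^sup>+r. F (r *\<^sub>R sph \<phi> \<theta>) * ennreal (r\<^sup>2) * indicator {1<..} r \<partial>lborel)"
  proof -
    have "(\<integral>\<^sup>+r. F (r *\<^sub>R sph \<phi> \<theta>) * ennreal (r\<^sup>2 * sin \<phi>) * indicator {1<..} r \<partial>lborel) * indicator {0..pi} \<phi> =
      (\<integral>\<^sup>+r. F (r *\<^sub>R sph \<phi> \<theta>) * ennreal (r\<^sup>2) * indicator {1<..} r \<partial>lborel) * ennreal (sin \<phi>) * indicator {0..pi} \<phi>"
      for \<theta> \<phi> :: real
    proof (cases "\<phi> \<in> {0..pi}")
      case True
      then have s: "sin \<phi> \<ge> 0" by (simp add: sin_ge_zero)
      have "(\<integral>\<^sup>+r. F (r *\<^sub>R sph \<phi> \<theta>) * ennreal (r\<^sup>2 * sin \<phi>) * indicator {1<..} r \<partial>lborel) =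
         (\<integral>\<^sup>+r. F (r *\<^sub>R sph \<phi> \<theta>) * ennreal (r\<^sup>2) * indicator {1<..} r * ennreal (sin \<phi>) \<partial>lborel)"
        using s by (intro nn_integral_cong) (simp add: ennreal_mult mult_ac)
      also have "\<dots> = (\<integral>\<^sup>+r. F (r *\<^sub>R sph \<phi> \<theta>) * ennreal (r\<^sup>2) * indicator {1<..} r \<partial>lborel) * ennreal (sin \<phi>)"
        using sm by (intro nn_integral_multc) auto
      finally show ?thesis by simp
    qed simp
    then show ?thesis unfolding nn_integral_polar[OF F] sint_def by (simp only:)
  qed
  finally show ?thesis .
qed

section \<open>The lower bound in three dimensions\<close>

lemma radial_derivative_bound:
  fixes D :: "'a::euclidean_space \<Rightarrow> 'b::real_normed_vector"
  assumes "linear D" "norm x = 1"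
  shows "(norm (D x))\<^sup>2 \<le> (\<Sum>b\<in>Basis. (norm (D b))\<^sup>2)"
proof -
  have "D x = D (\<Sum>b\<in>Basis. (x \<bullet> b) *\<^sub>R b)" by (simp add: euclidean_representation)
  also have "\<dots> = (\<Sum>b\<in>Basis. (x \<bullet> b) *\<^sub>R D b)"
    by (simp add: linear_sum[OF assms(1)] linear_scale[OF assms(1)])
  finally have "norm (D x) \<le> (\<Sum>b\<in>Basis. \<bar>x \<bullet> b\<bar> * norm (D b))"
    by (simp add: sum_norm_le)
  then have "(norm (D x))\<^sup>2 \<le> (\<Sum>b\<in>Basis. \<bar>x \<bullet> b\<bar> * norm (D b))\<^sup>2" by (intro power_mono) auto
  also have "\<dots> \<le> (\<Sum>b\<in>Basis. \<bar>x \<bullet> b\<bar>\<^sup>2) * (\<Sum>b\<in>Basis. (norm (D b))\<^sup>2)" by (rule Cauchy_Schwarz_ineq_sum)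
  also have "(\<Sum>b\<in>Basis. \<bar>x \<bullet> b\<bar>\<^sup>2) = x \<bullet> x"
    unfolding euclidean_inner[of x x] by (simp add: power2_eq_square)
  also have "x \<bullet> x = 1" using assms(2) by (simp add: norm_eq_1)
  finally show ?thesis by simp
qed

text \<open>A test function vanishes far out, so the ray leads from its boundary value exactly to
  \<open>c\<close>. Only the radial derivative enters, and it is dominated by the full
  gradient.\<close>

lemma ray_bound:
  fixes w :: "'a::euclidean_space \<Rightarrow> 'b::euclidean_space"
  assumes L: "L > 0"
    and inc: "\<And>A B. \<bar>\<Phi> A - \<Phi> B\<bar> \<le> (G A + L * norm (A - B)) * norm (A - B)"
    and lip: "\<And>A B. \<bar>G A - G B\<bar> \<le> L * norm (A - B)" and G: "\<And>A. 0 \<le> G A"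
    and w: "test_fun UNIV w" and \<eta>: "\<eta> > 0" and \<omega>: "norm \<omega> = 1"
  shows "ennreal \<bar>\<Phi> (c + w \<omega>) - \<Phi> c\<bar> \<le>
     (\<integral>\<^sup>+r. ennreal ((\<eta> * (\<Sum>b\<in>Basis. (norm (frechet_derivative w (at (r *\<^sub>R \<omega>)) b))\<^sup>2) + (G (c + w (r *\<^sub>R \<omega>)))\<^sup>2 / \<eta>) / 2)
        * indicator {1<..} r \<partial>lborel)"
proof -
  have s: "smooth w" using w by (simp add: test_fun_def)
  obtain K where K: "compact K" "\<And>x. x \<notin> K \<Longrightarrow> w x = 0" using test_fun_support[OF w] by metis
  obtain a where a: "\<And>x. x \<in> K \<Longrightarrow> norm x \<le> a" using compact_imp_bounded[OF K(1)] by (auto simp: bounded_iff)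
  define T where "T = max 2 (a + 1)"
  have T: "T \<ge> 1" "T > a" by (auto simp: T_def)
  have wT: "w (T *\<^sub>R \<omega>) = 0"
    using K(2)[of "T *\<^sub>R \<omega>"] a[of "T *\<^sub>R \<omega>"] T \<omega> by fastforce
  define \<gamma> where "\<gamma> r = c + w (r *\<^sub>R \<omega>)" for r
  define v where "v r = frechet_derivative w (at (r *\<^sub>R \<omega>)) \<omega>" for r
  have wc: "continuous_on UNIV w" and dc: "continuous_on UNIV (\<lambda>x. frechet_derivative w (at x) b)" for b
    using smooth_derivative(2,3)[OF s] by blast+
  have \<gamma>c: "continuous_on UNIV \<gamma>"
    unfolding \<gamma>_def by (intro continuous_on_add continuous_on_const continuous_on_compose2[OF wc] continuous_on_scaleR continuous_on_id) auto
  have vc: "continuous_on UNIV v"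
    unfolding v_def by (intro continuous_on_compose2[OF dc] continuous_on_scaleR continuous_on_id continuous_on_const) auto
  have lin: "linear (frechet_derivative w (at x))" for x
    using smooth_derivative(1)[OF s] has_derivative_linear by blast
  have der: "(\<gamma> has_vector_derivative v r) (at r within S)" for r S
  proof -
    have "((\<lambda>r. w (r *\<^sub>R \<omega>)) has_derivative (\<lambda>h. frechet_derivative w (at (r *\<^sub>R \<omega>)) (h *\<^sub>R \<omega>))) (at r within S)"
      by (rule has_derivative_compose[OF _ smooth_derivative(1)[OF s], where f="\<lambda>r. r *\<^sub>R \<omega>"])
         (auto intro!: derivative_eq_intros)
    then have "((\<lambda>r. w (r *\<^sub>R \<omega>)) has_vector_derivative v r) (at r within S)"
      by (simp add: has_vector_derivative_def v_def linear_scale[OF lin])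
    then have "(\<gamma> has_vector_derivative 0 + v r) (at r within S)"
      unfolding \<gamma>_def by (intro has_vector_derivative_add has_vector_derivative_const)
    then show ?thesis by simp
  qed
  have nvm: "(\<lambda>r. norm (v r)) \<in> borel_measurable lebesgue"
    using vc by (intro measurable_completion) (simp add: borel_measurable_continuous_onI continuous_on_norm)
  have "L-lipschitz_on UNIV G" unfolding lipschitz_on_def dist_norm using L lip by auto
  then have Gc: "continuous_on UNIV G" by (rule lipschitz_on_continuous_on)
  have Gm: "(\<lambda>x. G (\<gamma> x)) \<in> borel_measurable lebesgue"
  proof (rule measurable_completion)
    have "continuous_on UNIV (\<lambda>x. G (\<gamma> x))" by (rule continuous_on_compose2[OF Gc \<gamma>c]) simp
    then show "(\<lambda>x. G (\<gamma> x)) \<in> borel_measurable lborel" by (simp add: borel_measurable_continuous_onI)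
  qed
  have iv: "integrable lborel (\<lambda>x. indicator {p..q} x *\<^sub>R v x)" for p q
    by (intro borel_integrable_compact continuous_on_subset[OF vc]) auto
  have ac: "ennreal (norm (\<gamma> q - \<gamma> p)) \<le> (\<integral>\<^sup>+x. ennreal (norm (v x)) * indicator {p<..q} x \<partial>lebesgue)" if "p \<le> q" for p q
  proof -
    have "(LINT x|lborel. indicator {p..q} x *\<^sub>R v x) = \<gamma> q - \<gamma> p"
      using that by (intro integral_FTC_Icc der continuous_on_subset[OF vc]) auto
    then have "ennreal (norm (\<gamma> q - \<gamma> p)) \<le> (\<integral>\<^sup>+x. norm (indicator {p..q} x *\<^sub>R v x) \<partial>lborel)"
      using integral_norm_bound_ennreal[OF iv[of p q]] by simp
    also have "\<dots> = (\<integral>\<^sup>+x. ennreal (norm (v x)) * indicator {p<..q} x \<partial>lborel)"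
    proof (rule nn_integral_cong_AE)
      have "AE x in lborel. x \<noteq> p" by (rule AE_lborel_singleton)
      then show "AE x in lborel. ennreal (norm (indicator {p..q} x *\<^sub>R v x)) = ennreal (norm (v x)) * indicator {p<..q} x"
        by eventually_elim (auto split: split_indicator)
    qed
    finally show ?thesis by (simp add: nn_integral_completion)
  qed
  have fin: "(\<integral>\<^sup>+x. ennreal (norm (v x)) * indicator {1<..T} x \<partial>lebesgue) < \<infinity>"
  proof -
    have "(\<integral>\<^sup>+x. ennreal (norm (v x)) * indicator {1<..T} x \<partial>lebesgue) \<le> (\<integral>\<^sup>+x. norm (indicator {1..T} x *\<^sub>R v x) \<partial>lborel)"
      unfolding nn_integral_completion by (intro nn_integral_mono) (auto split: split_indicator)
    also have "\<dots> < \<infinity>" using iv[of 1 T] by (simp add: integrable_iff_bounded)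
    finally show ?thesis .
  qed
  have "ennreal \<bar>\<Phi> (\<gamma> T) - \<Phi> (\<gamma> 1)\<bar> \<le> (\<integral>\<^sup>+x. ennreal (G (\<gamma> x) * norm (v x)) * indicator {1<..T} x \<partial>lebesgue)"
    by (rule upper_gradient_curve[OF inc lip G L continuous_on_subset[OF \<gamma>c] T(1) nvm _ ac fin Gm]) auto
  also have "\<dots> = (\<integral>\<^sup>+x. ennreal (G (\<gamma> x) * norm (v x)) * indicator {1<..T} x \<partial>lborel)"
    by (rule nn_integral_completion)
  also have "\<dots> \<le> (\<integral>\<^sup>+r. ennreal ((\<eta> * (\<Sum>b\<in>Basis. (norm (frechet_derivative w (at (r *\<^sub>R \<omega>)) b))\<^sup>2) + (G (c + w (r *\<^sub>R \<omega>)))\<^sup>2 / \<eta>) / 2)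
        * indicator {1<..} r \<partial>lborel)"
  proof (rule nn_integral_mono)
    fix r
    \<comment> \<open>Young's inequality with weight \<eta>, which is the balance of the two terms
      in \<eta> times the energy.\<close>
    have "2 * (G (\<gamma> r) * norm (v r)) \<le> \<eta> * (norm (v r))\<^sup>2 + (G (\<gamma> r))\<^sup>2 / \<eta>"
    proof -
      have "0 \<le> (\<eta> * norm (v r) - G (\<gamma> r))\<^sup>2 / \<eta>" using \<eta> by simp
      also have "\<dots> = \<eta> * (norm (v r))\<^sup>2 + (G (\<gamma> r))\<^sup>2 / \<eta> - 2 * (G (\<gamma> r) * norm (v r))"
        using \<eta> by (simp add: power2_eq_square field_simps)
      finally show ?thesis by simp
    qed
    moreover have "\<eta> * (norm (v r))\<^sup>2 \<le> \<eta> * (\<Sum>b\<in>Basis. (norm (frechet_derivative w (at (r *\<^sub>R \<omega>)) b))\<^sup>2)"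
      unfolding v_def using \<eta> by (intro mult_left_mono radial_derivative_bound[OF lin \<omega>]) auto
    ultimately have "G (\<gamma> r) * norm (v r) \<le> (\<eta> * (\<Sum>b\<in>Basis. (norm (frechet_derivative w (at (r *\<^sub>R \<omega>)) b))\<^sup>2) + (G (\<gamma> r))\<^sup>2 / \<eta>) / 2"
      by simp
    then show "ennreal (G (\<gamma> r) * norm (v r)) * indicator {1<..T} r \<le>
      ennreal ((\<eta> * (\<Sum>b\<in>Basis. (norm (frechet_derivative w (at (r *\<^sub>R \<omega>)) b))\<^sup>2) + (G (c + w (r *\<^sub>R \<omega>)))\<^sup>2 / \<eta>) / 2) * indicator {1<..} r"
      unfolding \<gamma>_def[symmetric] by (auto split: split_indicator intro: ennreal_leI)
  qed
  finally show ?thesis using wT by (simp add: \<gamma>_def abs_minus_commute)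
qed

text \<open>Serves to replace one function by a nearby one at the price of a factor 1 + t, with t as
  small as desired, while the L2 distance may get a large but fixed factor.\<close>

lemma square_young:
  fixes a b c t :: real
  assumes "0 \<le> a" "a \<le> b + c" "t > 0" shows "a\<^sup>2 \<le> (1 + t) * b\<^sup>2 + (1 + 1/t) * c\<^sup>2"
proof -
  have "a\<^sup>2 \<le> (b + c)\<^sup>2" using assms by (intro power_mono) auto
  also have "(b + c)\<^sup>2 = (1 + t) * b\<^sup>2 + (1 + 1/t) * c\<^sup>2 - (t * b - c)\<^sup>2 / t"
    using assms(3) by (simp add: power2_eq_square field_simps)
  also have "\<dots> \<le> (1 + t) * b\<^sup>2 + (1 + 1/t) * c\<^sup>2" using assms(3) by simp
  finally show ?thesis .
qed

lemma ennreal_lin: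
  assumes "x \<ge> 0" "y \<ge> 0" "c \<ge> 0" "z \<ge> 0"
  shows "ennreal (x + c * y + z) = ennreal x + ennreal c * ennreal y + ennreal z"
  using assms by (simp add: ennreal_mult)

text \<open>The boundary datum as a continuous function of the angles, hence measurable in them. It
  agrees with \<open>Q_phi e\<close> off the poles, where the latter involves an arbitrary
  choice.\<close>

definition Q_bd :: "real \<Rightarrow> real \<Rightarrow> real^3^3" where
  "Q_bd \<phi> \<theta> = uniaxial (vector [cos \<phi> * cos \<theta>, cos \<phi> * sin \<theta>, - sin \<phi>])"

lemma Q_phi_sph:
  assumes "longitudinal e" "0 < \<phi>" "\<phi> < pi" "0 \<le> \<theta>" "\<theta> < 2*pi"
  shows "Q_phi e (sph \<phi> \<theta>) = Q_bd \<phi> \<theta>"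
  using assms by (auto simp: Q_phi_def Q_bd_def longitudinal_def)

lemma continuous_Q_bd: "continuous_on UNIV (\<lambda>p. Q_bd (fst p) (snd p))"
proof -
  have "continuous_on UNIV (\<lambda>p::real\<times>real. vector [cos (fst p) * cos (snd p), cos (fst p) * sin (snd p), - sin (fst p)] :: real^3)"
    unfolding vec3_axis by (intro continuous_intros)
  from bounded_bilinear.continuous_on[OF bounded_bilinear_outer this this]
  show ?thesis unfolding Q_bd_def uniaxial_outer by (intro continuous_on_diff continuous_on_const)
qed

lemma continuous_sph: "continuous_on UNIV (\<lambda>p. sph (fst p) (snd p))"
  unfolding sph_def vec3_axis by (intro continuous_intros)

lemma norm_Q_bd_vec: "norm (vector [cos \<phi> * cos \<theta>, cos \<phi> * sin \<theta>, - sin \<phi>] :: real^3) = 1"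
proof -
  have "(norm (vector [cos \<phi> * cos \<theta>, cos \<phi> * sin \<theta>, - sin \<phi>] :: real^3))\<^sup>2 = (cos \<phi>)\<^sup>2 * ((cos \<theta>)\<^sup>2 + (sin \<theta>)\<^sup>2) + (sin \<phi>)\<^sup>2"
    by (simp add: norm3_sq vector_3 power_mult_distrib algebra_simps del: sin_cos_squared_add sin_cos_squared_add2)
  also have "\<dots> = 1\<^sup>2" by simp
  finally show ?thesis by (rule power2_eq_imp_eq) auto
qed

text \<open>The threshold \<open>K\<close> is fixed by the calibration for \<epsilon> before \<xi>,
  \<eta>, \<open>Q\<close> and t appear. Two losses remain: \<epsilon> from the calibration, and t
  from Young's inequality, once in passing from \<open>Q\<close> to its smooth approximants and once
  in the error of the boundary values.\<close>

lemma energy_lower_approx: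
  fixes \<kappa> g0 \<epsilon> :: real
  assumes \<kappa>: "\<kappa> = root 4 24" and g0: "g0 \<ge> 0" and e: "longitudinal e" and \<epsilon>: "\<epsilon> > 0"
  shows "\<exists>K>0. \<forall>\<xi> \<eta> Q. \<xi> > 0 \<longrightarrow> \<eta> > 0 \<longrightarrow> \<eta> / \<xi> \<ge> K \<longrightarrow> Q \<in> admissible (Q_phi e) \<longrightarrow>
     (\<forall>t>0. ennreal (pi * (4 - pi) * \<kappa>) \<le> ennreal (1 + t) * (ennreal \<eta> * energy g0 \<xi> \<eta> Q) + ennreal (4 * pi * (\<epsilon> + t)))"
proof -
  obtain \<Phi> G L K where cal: "L > 0" "K > 0"
      "\<And>A B. \<bar>\<Phi> A - \<Phi> B\<bar> \<le> (G A + L * norm (A - B)) * norm (A - B)"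
      "\<And>A B. \<bar>G A - G B\<bar> \<le> L * norm (A - B)" "\<And>A. 0 \<le> G A" "G Q_inf = 0"
      "\<And>A B. \<bar>\<Phi> A - \<Phi> B\<bar> \<le> L * norm (A - B)"
      "\<And>Q lam. Q \<in> S0 \<Longrightarrow> lam \<ge> K \<Longrightarrow> (G Q)\<^sup>2 \<le> 2 * (lam\<^sup>2 * f_pot Q + g_pot g0 Q)"
      "\<And>n. norm n = 1 \<Longrightarrow> \<bar>\<Phi> (uniaxial n) - \<Phi> Q_inf\<bar> \<ge> \<kappa> * (1 - \<bar>n$3\<bar>) - \<epsilon>"
    by (rule calibration[OF \<kappa> g0 \<epsilon>]) blast
  have \<kappa>0: "\<kappa> \<ge> 0" using kappa_sq[OF \<kappa>] by simp
  have "L-lipschitz_on UNIV G" unfolding lipschitz_on_def dist_norm using cal(1,4) by auto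
  then have Gc: "continuous_on UNIV G" by (rule lipschitz_on_continuous_on)
  have "L-lipschitz_on UNIV \<Phi>" unfolding lipschitz_on_def dist_norm using cal(1,7) by auto
  then have \<Phi>c: "continuous_on UNIV \<Phi>" by (rule lipschitz_on_continuous_on)
  have Gb: "G \<in> borel_measurable borel" using Gc by (rule borel_measurable_continuous_onI)
  have \<Omega>: "open \<Omega>" "\<Omega> \<in> sets lebesgue" by (auto simp: \<Omega>_def)
  let ?M = "lebesgue_on \<Omega>"
  show ?thesis
  proof (intro exI[of _ K] conjI cal(2) allI impI)
    fix \<xi> \<eta> Q and t :: real
    assume \<xi>: "\<xi> > 0" and \<eta>: "\<eta> > 0" and K: "K \<le> \<eta> / \<xi>" and adm: "Q \<in> admissible (Q_phi e)" and t: "t > 0"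
    define u where "u x = Q x - Q_inf" for x
    have H: "u \<in> H1 \<Omega> S0" and tr: "has_trace u (\<lambda>\<omega>. Q_phi e \<omega> - Q_inf)"
      using adm by (auto simp: admissible_def u_def[abs_def])
    have um: "u \<in> borel_measurable ?M" and uS: "AE x in ?M. u x \<in> S0"
      using H by (auto simp: H1_def L2_def)
    have "\<forall>b\<in>Basis. \<exists>v. v \<in> borel_measurable ?M \<and> has_weak_deriv \<Omega> b u v"
      using H by (auto simp: H1_def L2_def)
    then obtain v where v: "\<And>b. b \<in> Basis \<Longrightarrow> v b \<in> borel_measurable ?M" "\<And>b. b \<in> Basis \<Longrightarrow> has_weak_deriv \<Omega> b u (v b)"
      by metis
    have wdQ: "weak_deriv \<Omega> b Q = weak_deriv \<Omega> b u" if "b \<in> Basis" for b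
      unfolding u_def[abs_def] by (rule weak_deriv_shift[OF \<Omega>(1) that, symmetric])
    have AEb: "AE x in ?M. weak_deriv \<Omega> b u x = v b x" if "b \<in> Basis" for b
      by (rule weak_deriv_AE(2)[OF \<Omega>(1) v(2)[OF that]])
    then have AEall: "AE x in ?M. \<forall>b\<in>Basis. weak_deriv \<Omega> b u x = v b x"
      by (intro AE_ball_countable') (auto simp: countable_finite)
    obtain w where w: "\<forall>k. test_fun UNIV (w k)"
      "(\<lambda>k. \<integral>\<^sup>+x. ennreal ((norm (w k x - u x))\<^sup>2) \<partial>?M) \<longlonglongrightarrow> 0"
      "\<forall>b\<in>Basis. (\<lambda>k. \<integral>\<^sup>+x. ennreal ((norm (frechet_derivative (w k) (at x) b - weak_deriv \<Omega> b u x))\<^sup>2) \<partial>?M) \<longlonglongrightarrow> 0"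
      "(\<lambda>k. sphere_nn_integral (\<lambda>\<omega>. (norm (w k \<omega> - (Q_phi e \<omega> - Q_inf)))\<^sup>2)) \<longlonglongrightarrow> 0"
      using tr unfolding has_trace_def by blast
    have wt: "test_fun UNIV (w k)" for k using w(1) by blast
    then have s: "smooth (w k)" for k by (simp add: test_fun_def)
    have wb: "w k \<in> borel_measurable borel" for k
      using smooth_derivative(2)[OF s] by (rule borel_measurable_continuous_onI)
    have db: "(\<lambda>x. frechet_derivative (w k) (at x) b) \<in> borel_measurable borel" for k b
      using smooth_derivative(3)[OF s] by (rule borel_measurable_continuous_onI)
    have toM: "f \<in> borel_measurable borel \<Longrightarrow> f \<in> borel_measurable ?M" for f :: "real^3 \<Rightarrow> 'z::real_normed_vector"
      by (intro measurable_restrict_space1 measurable_completion) simp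
    define e0 where "e0 k = (\<integral>\<^sup>+x. ennreal ((norm (w k x - u x))\<^sup>2) \<partial>?M)" for k
    define e1 where "e1 b k = (\<integral>\<^sup>+x. ennreal ((norm (frechet_derivative (w k) (at x) b - v b x))\<^sup>2) \<partial>?M)" for b k
    define e2 where "e2 k = sphere_nn_integral (\<lambda>\<omega>. (norm (w k \<omega> - (Q_phi e \<omega> - Q_inf)))\<^sup>2)" for k
    have e1lim: "e1 b \<longlonglongrightarrow> 0" if "b \<in> Basis" for b
    proof -
      have "e1 b k = (\<integral>\<^sup>+x. ennreal ((norm (frechet_derivative (w k) (at x) b - weak_deriv \<Omega> b u x))\<^sup>2) \<partial>?M)" for k
        unfolding e1_def by (intro nn_integral_cong_AE) (use AEb[OF that] in eventually_elim, simp)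
      then have "e1 b = (\<lambda>k. \<integral>\<^sup>+x. ennreal ((norm (frechet_derivative (w k) (at x) b - weak_deriv \<Omega> b u x))\<^sup>2) \<partial>?M)" by (rule ext)
      then show ?thesis using w(3)[rule_format, OF that] by (simp only:)
    qed
    define F where "F k x = (\<eta> * (\<Sum>b\<in>Basis. (norm (frechet_derivative (w k) (at x) b))\<^sup>2) + (G (Q_inf + w k x))\<^sup>2 / \<eta>) / 2" for k x
    have Fm: "F k \<in> borel_measurable borel" for k
      unfolding F_def[abs_def]
      by (intro borel_measurable_divide borel_measurable_add borel_measurable_times borel_measurable_const borel_measurable_sum
         borel_measurable_power measurable_compose[OF db borel_measurable_norm] measurable_compose[OF _ Gb] wb)
    define A where "A x = ((\<Sum>b\<in>Basis. (norm (v b x))\<^sup>2) + (G (Q x))\<^sup>2 / \<eta>\<^sup>2) / 2" for x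
    have Qeq: "Q x = Q_inf + u x" for x by (simp add: u_def)
    have Am: "A \<in> borel_measurable ?M"
      unfolding A_def[abs_def] Qeq
      by (intro borel_measurable_divide borel_measurable_add borel_measurable_times borel_measurable_const borel_measurable_sum
         borel_measurable_power measurable_compose[OF v(1) borel_measurable_norm] measurable_compose[OF _ Gb] um) auto
    have A0: "A x \<ge> 0" for x unfolding A_def by (intro divide_nonneg_nonneg add_nonneg_nonneg sum_nonneg) auto
    \<comment> \<open>The potentials are used only here, for \<open>Q\<close> itself. The ratio
      \<open>\<eta> / \<xi>\<close> is the multiplier in the calibration, so the multiple of
      \<open>f_pot\<close> it demands is the one contained in the energy.\<close>
    have E: "(\<integral>\<^sup>+x. ennreal (A x) \<partial>?M) \<le> energy g0 \<xi> \<eta> Q"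
      unfolding energy_def
    proof (rule nn_integral_mono_AE)
      show "AE x in ?M. ennreal (A x) \<le> ennreal ((1/2) * (\<Sum>b\<in>Basis. (norm (weak_deriv \<Omega> b Q x))\<^sup>2)
              + f_pot (Q x) / \<xi>\<^sup>2 + g_pot g0 (Q x) / \<eta>\<^sup>2)"
        using AEall uS
      proof eventually_elim
        case (elim x)
        have S: "Q x \<in> S0" unfolding Qeq by (rule subspace_add[OF subspace_S0 Q_inf_S0 elim(2)])
        have "(G (Q x))\<^sup>2 \<le> 2 * ((\<eta> / \<xi>)\<^sup>2 * f_pot (Q x) + g_pot g0 (Q x))" by (rule cal(8)[OF S K])
        then have "(G (Q x))\<^sup>2 / \<eta>\<^sup>2 / 2 \<le> ((\<eta> / \<xi>)\<^sup>2 * f_pot (Q x) + g_pot g0 (Q x)) / \<eta>\<^sup>2"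
          using \<eta> by (simp add: field_simps)
        also have "\<dots> = f_pot (Q x) / \<xi>\<^sup>2 + g_pot g0 (Q x) / \<eta>\<^sup>2"
          using \<eta> \<xi> by (simp add: add_divide_distrib power_divide)
        finally have "(G (Q x))\<^sup>2 / \<eta>\<^sup>2 / 2 \<le> f_pot (Q x) / \<xi>\<^sup>2 + g_pot g0 (Q x) / \<eta>\<^sup>2" .
        moreover have "(\<Sum>b\<in>Basis. (norm (weak_deriv \<Omega> b Q x))\<^sup>2) = (\<Sum>b\<in>Basis. (norm (v b x))\<^sup>2)"
          using elim(1) wdQ by (intro sum.cong) auto
        ultimately show ?case by (intro ennreal_leI) (simp add: A_def add_divide_distrib)
      qed
    qed
    \<comment> \<open>From the approximant back to \<open>Q\<close>: the gradients and, by the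
      Lipschitz bound of \<open>G\<close>, the slopes differ by terms controlled by the errors
      \<open>e1\<close> and \<open>e0\<close>, which tend to 0.\<close>
    have upper: "(\<integral>\<^sup>+x. ennreal (F k x) \<partial>?M) \<le> ennreal (1 + t) * (ennreal \<eta> * energy g0 \<xi> \<eta> Q)
        + ennreal ((1 + 1/t) * \<eta> / 2) * (\<Sum>b\<in>Basis. e1 b k) + ennreal ((1 + 1/t) * L\<^sup>2 / (2 * \<eta>)) * e0 k" for k
    proof -
      define B where "B x = (\<Sum>b\<in>Basis. (norm (frechet_derivative (w k) (at x) b - v b x))\<^sup>2)" for x
      define C where "C x = (norm (w k x - u x))\<^sup>2" for x
      define c1 where "c1 = (1 + 1/t) * \<eta> / 2"
      define c2 where "c2 = (1 + 1/t) * L\<^sup>2 / (2 * \<eta>)"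
      have c: "c1 \<ge> 0" "c2 \<ge> 0" using t \<eta> by (auto simp: c1_def c2_def)
      have dm: "(\<lambda>x. frechet_derivative (w k) (at x) b - v b x) \<in> borel_measurable ?M" if "b \<in> Basis" for b
        by (intro borel_measurable_diff toM db v(1) that)
      have Bm: "B \<in> borel_measurable ?M"
        unfolding B_def[abs_def] by (intro borel_measurable_sum borel_measurable_power measurable_compose[OF dm borel_measurable_norm])
      have Cm: "C \<in> borel_measurable ?M"
        unfolding C_def[abs_def]
        by (intro borel_measurable_power measurable_compose[OF _ borel_measurable_norm] borel_measurable_diff toM wb um)
      have B0: "B x \<ge> 0" "C x \<ge> 0" for x by (auto simp: B_def C_def intro: sum_nonneg)
      have pt: "F k x \<le> (1 + t) * \<eta> * A x + c1 * B x + c2 * C x" for x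
      proof -
        have 1: "(norm (frechet_derivative (w k) (at x) b))\<^sup>2 \<le>
            (1 + t) * (norm (v b x))\<^sup>2 + (1 + 1/t) * (norm (frechet_derivative (w k) (at x) b - v b x))\<^sup>2" for b
          by (intro square_young t norm_ge_zero) (metis add.commute diff_add_cancel norm_triangle_ineq)
        have "(\<Sum>b\<in>Basis. (norm (frechet_derivative (w k) (at x) b))\<^sup>2) \<le>
           (\<Sum>b\<in>Basis. (1 + t) * (norm (v b x))\<^sup>2 + (1 + 1/t) * (norm (frechet_derivative (w k) (at x) b - v b x))\<^sup>2)"
          by (intro sum_mono 1)
        also have "\<dots> = (1 + t) * (\<Sum>b\<in>Basis. (norm (v b x))\<^sup>2) + (1 + 1/t) * B x"
          by (simp only: sum.distrib sum_distrib_left[symmetric] B_def)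
        finally have "\<eta> * (\<Sum>b\<in>Basis. (norm (frechet_derivative (w k) (at x) b))\<^sup>2) \<le>
           \<eta> * ((1 + t) * (\<Sum>b\<in>Basis. (norm (v b x))\<^sup>2) + (1 + 1/t) * B x)"
          using \<eta> by (intro mult_left_mono) auto
        moreover have "(G (Q_inf + w k x))\<^sup>2 \<le> (1 + t) * (G (Q x))\<^sup>2 + (1 + 1/t) * (L * norm (w k x - u x))\<^sup>2"
        proof (intro square_young t cal(5))
          have "\<bar>G (Q_inf + w k x) - G (Q x)\<bar> \<le> L * norm (Q_inf + w k x - Q x)" by (rule cal(4))
          then show "G (Q_inf + w k x) \<le> G (Q x) + L * norm (w k x - u x)" by (simp add: Qeq)
        qed
        then have "(G (Q_inf + w k x))\<^sup>2 / \<eta> \<le> ((1 + t) * (G (Q x))\<^sup>2 + (1 + 1/t) * (L * norm (w k x - u x))\<^sup>2) / \<eta>"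
          using \<eta> by (intro divide_right_mono) auto
        ultimately have "F k x \<le> (\<eta> * ((1 + t) * (\<Sum>b\<in>Basis. (norm (v b x))\<^sup>2) + (1 + 1/t) * B x)
           + ((1 + t) * (G (Q x))\<^sup>2 + (1 + 1/t) * (L * norm (w k x - u x))\<^sup>2) / \<eta>) / 2"
          unfolding F_def by (intro divide_right_mono[where c=2] add_mono) auto
        also have "\<dots> = (1 + t) * \<eta> * A x + c1 * B x + c2 * C x"
        proof -
          define s where "s = 1 + 1/t"
          show ?thesis
            unfolding A_def c1_def c2_def C_def s_def[symmetric] using \<eta>
            by (simp add: power_mult_distrib power2_eq_square[of \<eta>] field_simps)
        qed
        finally show ?thesis .
      qed
      have "(\<integral>\<^sup>+x. ennreal (F k x) \<partial>?M) \<le> (\<integral>\<^sup>+x. (ennreal ((1 + t) * \<eta>) * ennreal (A x) + ennreal c1 * ennreal (B x)) + ennreal c2 * ennreal (C x) \<partial>?M)"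
      proof (rule nn_integral_mono)
        fix x
        have "ennreal (F k x) \<le> ennreal ((1 + t) * \<eta> * A x + c1 * B x + c2 * C x)" by (rule ennreal_leI[OF pt])
        also have "\<dots> = ennreal ((1 + t) * \<eta>) * ennreal (A x) + ennreal c1 * ennreal (B x) + ennreal c2 * ennreal (C x)"
        proof -
          have "(1 + t) * \<eta> \<ge> 0" using t \<eta> by simp
          then show ?thesis using A0[of x] B0[of x] c by (simp add: ennreal_mult ennreal_plus)
        qed
        finally show "ennreal (F k x) \<le> ennreal ((1 + t) * \<eta>) * ennreal (A x) + ennreal c1 * ennreal (B x) + ennreal c2 * ennreal (C x)" .
      qed
      also have "\<dots> = ennreal ((1 + t) * \<eta>) * (\<integral>\<^sup>+x. ennreal (A x) \<partial>?M) + ennreal c1 * (\<integral>\<^sup>+x. ennreal (B x) \<partial>?M) + ennreal c2 * (\<integral>\<^sup>+x. ennreal (C x) \<partial>?M)"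
      proof -
        note [measurable] = Am Bm Cm
        show ?thesis by (simp add: nn_integral_add nn_integral_cmult)
      qed
      also have "(\<integral>\<^sup>+x. ennreal (B x) \<partial>?M) = (\<Sum>b\<in>Basis. e1 b k)"
      proof -
        have "(\<integral>\<^sup>+x. ennreal (B x) \<partial>?M) = (\<integral>\<^sup>+x. (\<Sum>b\<in>Basis. ennreal ((norm (frechet_derivative (w k) (at x) b - v b x))\<^sup>2)) \<partial>?M)"
          unfolding B_def by (intro nn_integral_cong) (simp add: sum_ennreal)
        also have "\<dots> = (\<Sum>b\<in>Basis. e1 b k)"
          unfolding e1_def by (intro nn_integral_sum measurable_compose[OF _ measurable_ennreal] borel_measurable_power measurable_compose[OF dm borel_measurable_norm])
        finally show ?thesis .
      qed
      also have "(\<integral>\<^sup>+x. ennreal (C x) \<partial>?M) = e0 k" by (simp add: C_def e0_def)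
      also have "ennreal ((1 + t) * \<eta>) * (\<integral>\<^sup>+x. ennreal (A x) \<partial>?M) \<le> ennreal ((1 + t) * \<eta>) * energy g0 \<xi> \<eta> Q"
        by (intro mult_left_mono E) auto
      also have "ennreal ((1 + t) * \<eta>) * energy g0 \<xi> \<eta> Q = ennreal (1 + t) * (ennreal \<eta> * energy g0 \<xi> \<eta> Q)"
        using t \<eta> by (simp add: ennreal_mult mult.assoc)
      finally show ?thesis by (simp add: add_right_mono c1_def c2_def)
    qed
    define \<Psi> where "\<Psi> k \<phi> \<theta> = \<bar>\<Phi> (Q_inf + w k (sph \<phi> \<theta>)) - \<Phi> Q_inf\<bar>" for k \<phi> \<theta>
    define R where "R k \<phi> \<theta> = (norm (w k (sph \<phi> \<theta>) - (Q_bd \<phi> \<theta> - Q_inf)))\<^sup>2" for k \<phi> \<theta>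
    have lower: "sint (\<lambda>\<phi> \<theta>. ennreal (\<Psi> k \<phi> \<theta>)) \<le> (\<integral>\<^sup>+x. ennreal (F k x) \<partial>?M)" for k
    proof -
      have "sint (\<lambda>\<phi> \<theta>. ennreal (\<Psi> k \<phi> \<theta>)) \<le> sint (\<lambda>\<phi> \<theta>. \<integral>\<^sup>+r. ennreal (F k (r *\<^sub>R sph \<phi> \<theta>)) * ennreal (r\<^sup>2) * indicator {1<..} r \<partial>lborel)"
      proof (rule sint_mono)
        fix \<phi> \<theta> :: real
        have "ennreal (\<Psi> k \<phi> \<theta>) \<le> (\<integral>\<^sup>+r. ennreal (F k (r *\<^sub>R sph \<phi> \<theta>)) * indicator {1<..} r \<partial>lborel)"
          unfolding \<Psi>_def F_def by (rule ray_bound[OF cal(1,3,4,5) wt \<eta> norm_sph])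
        \<comment> \<open>Outside the ball the Jacobian satisfies r^2 >= 1, so it may be inserted
          for free.\<close>
        also have "\<dots> \<le> (\<integral>\<^sup>+r. ennreal (F k (r *\<^sub>R sph \<phi> \<theta>)) * ennreal (r\<^sup>2) * indicator {1<..} r \<partial>lborel)"
        proof (rule nn_integral_mono)
          fix r :: real
          have "ennreal (F k (r *\<^sub>R sph \<phi> \<theta>)) * ennreal 1 \<le> ennreal (F k (r *\<^sub>R sph \<phi> \<theta>)) * ennreal (r\<^sup>2)" if "r > 1"
            using that by (intro mult_left_mono ennreal_leI) auto
          then show "ennreal (F k (r *\<^sub>R sph \<phi> \<theta>)) * indicator {1<..} r \<le> ennreal (F k (r *\<^sub>R sph \<phi> \<theta>)) * ennreal (r\<^sup>2) * indicator {1<..} r"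
            by (auto split: split_indicator)
        qed
        finally show "ennreal (\<Psi> k \<phi> \<theta>) \<le> (\<integral>\<^sup>+r. ennreal (F k (r *\<^sub>R sph \<phi> \<theta>)) * ennreal (r\<^sup>2) * indicator {1<..} r \<partial>lborel)" .
      qed
      also have "\<dots> = (\<integral>\<^sup>+x. ennreal (F k x) \<partial>?M)"
        by (rule nn_integral_polar_sint[symmetric]) (intro measurable_compose[OF Fm measurable_ennreal])
      finally show ?thesis .
    qed
    have e2R: "e2 k = sint (\<lambda>\<phi> \<theta>. ennreal (R k \<phi> \<theta>))" for k
      unfolding e2_def R_def
      by (subst sphere_nn_integral_sint) (auto intro!: sint_cong simp: Q_phi_sph[OF e])
    have wsc: "continuous_on UNIV (\<lambda>p. w k (sph (fst p) (snd p)))" for k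
      by (rule continuous_on_compose2[OF smooth_derivative(2)[OF s, where S=UNIV] continuous_sph]) simp
    have \<Psi>m: "(\<lambda>p. ennreal (\<Psi> k (fst p) (snd p))) \<in> borel_measurable borel" for k
      unfolding \<Psi>_def
      by (intro measurable_compose[OF _ measurable_ennreal] borel_measurable_continuous_onI continuous_intros
          continuous_on_compose2[OF \<Phi>c] wsc) auto
    have Rm: "(\<lambda>p. ennreal (R k (fst p) (snd p))) \<in> borel_measurable borel" for k
      unfolding R_def
      by (intro measurable_compose[OF _ measurable_ennreal] borel_measurable_continuous_onI continuous_intros wsc continuous_Q_bd)
    \<comment> \<open>On the sphere the approximant is compared with the datum; \<open>e2\<close>
      measures the difference, and the term 4 \<pi> (\<epsilon> + t) is the integral of the constant
      losses.\<close>
    have bnd: "ennreal (pi * (4 - pi) * \<kappa>) \<le> (\<integral>\<^sup>+x. ennreal (F k x) \<partial>?M) + ennreal (L\<^sup>2 / (4 * t)) * e2 k + ennreal (4 * pi * (\<epsilon> + t))" for k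
    proof -
      have "ennreal (pi * (4 - pi) * \<kappa>) = sint (\<lambda>\<phi> \<theta>. ennreal (\<kappa> * (1 - sin \<phi>)))"
        by (rule sint_one_minus_sin[OF \<kappa>0, symmetric])
      also have "\<dots> \<le> sint (\<lambda>\<phi> \<theta>. ennreal (\<Psi> k \<phi> \<theta>) + ennreal (L\<^sup>2 / (4 * t)) * ennreal (R k \<phi> \<theta>) + ennreal (\<epsilon> + t))"
      proof (rule sint_mono)
        fix \<phi> \<theta> :: real assume \<phi>: "0 < \<phi>" "\<phi> < pi"
        define n :: "real^3" where "n = vector [cos \<phi> * cos \<theta>, cos \<phi> * sin \<theta>, - sin \<phi>]"
        have n: "norm n = 1" unfolding n_def by (rule norm_Q_bd_vec)
        have "\<bar>n$3\<bar> = sin \<phi>" using sin_gt_zero[OF \<phi>] by (simp add: n_def vector_3)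
        then have "\<kappa> * (1 - sin \<phi>) - \<epsilon> \<le> \<bar>\<Phi> (Q_bd \<phi> \<theta>) - \<Phi> Q_inf\<bar>"
          using cal(9)[OF n] by (simp add: Q_bd_def n_def)
        moreover have "\<bar>\<Phi> (Q_inf + w k (sph \<phi> \<theta>)) - \<Phi> (Q_bd \<phi> \<theta>)\<bar> \<le> L * norm (w k (sph \<phi> \<theta>) - (Q_bd \<phi> \<theta> - Q_inf))"
          using cal(7)[of "Q_inf + w k (sph \<phi> \<theta>)" "Q_bd \<phi> \<theta>"] by (simp add: algebra_simps)
        \<comment> \<open>The boundary error enters linearly, but only its L2 norm is known to
          vanish; completing the square trades one for the other.\<close>
        moreover have "L * y \<le> t + L\<^sup>2 / (4 * t) * y\<^sup>2" for y
        proof -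
          have "0 \<le> (2 * t - L * y)\<^sup>2 / (4 * t)" using t by simp
          also have "\<dots> = t + L\<^sup>2 / (4 * t) * y\<^sup>2 - L * y" using t by (simp add: power2_eq_square field_simps)
          finally show ?thesis by simp
        qed
        ultimately have "\<kappa> * (1 - sin \<phi>) \<le> \<Psi> k \<phi> \<theta> + L\<^sup>2 / (4 * t) * R k \<phi> \<theta> + (\<epsilon> + t)"
          unfolding \<Psi>_def R_def by (smt (verit, best))
        then have "ennreal (\<kappa> * (1 - sin \<phi>)) \<le> ennreal (\<Psi> k \<phi> \<theta> + L\<^sup>2 / (4 * t) * R k \<phi> \<theta> + (\<epsilon> + t))" by (rule ennreal_leI)
        also have "\<dots> = ennreal (\<Psi> k \<phi> \<theta>) + ennreal (L\<^sup>2 / (4 * t)) * ennreal (R k \<phi> \<theta>) + ennreal (\<epsilon> + t)"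
        proof -
          have "\<Psi> k \<phi> \<theta> \<ge> 0" "R k \<phi> \<theta> \<ge> 0" "L\<^sup>2 / (4 * t) \<ge> 0" "\<epsilon> + t \<ge> 0" using t \<epsilon> by (auto simp: \<Psi>_def R_def)
          then show ?thesis by (rule ennreal_lin)
        qed
        finally show "ennreal (\<kappa> * (1 - sin \<phi>)) \<le> ennreal (\<Psi> k \<phi> \<theta>) + ennreal (L\<^sup>2 / (4 * t)) * ennreal (R k \<phi> \<theta>) + ennreal (\<epsilon> + t)" .
      qed
      also have "\<dots> = sint (\<lambda>\<phi> \<theta>. ennreal (\<Psi> k \<phi> \<theta>)) + ennreal (L\<^sup>2 / (4 * t)) * sint (\<lambda>\<phi> \<theta>. ennreal (R k \<phi> \<theta>)) + sint (\<lambda>\<phi> \<theta>. ennreal (\<epsilon> + t))"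
        by (subst sint_add sint_cmult; (intro borel_measurable_add borel_measurable_times_ennreal borel_measurable_const \<Psi>m Rm)?)+ simp
      also have "sint (\<lambda>\<phi> \<theta>. ennreal (\<epsilon> + t)) = ennreal (4 * pi * (\<epsilon> + t))" by (rule sint_const) (use \<epsilon> t in simp)
      finally show ?thesis unfolding e2R[symmetric] using lower[of k] by (meson add_right_mono order_trans)
    qed
    define Y where "Y = ennreal (1 + t) * (ennreal \<eta> * energy g0 \<xi> \<eta> Q)"
    have all: "ennreal (pi * (4 - pi) * \<kappa>) \<le> Y + ennreal ((1 + 1/t) * \<eta> / 2) * (\<Sum>b\<in>Basis. e1 b k) + ennreal ((1 + 1/t) * L\<^sup>2 / (2 * \<eta>)) * e0 k
       + ennreal (L\<^sup>2 / (4 * t)) * e2 k + ennreal (4 * pi * (\<epsilon> + t))" for k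
      using bnd[of k] upper[of k] unfolding Y_def by (meson add_right_mono order_trans)
    have "(\<lambda>k. Y + ennreal ((1 + 1/t) * \<eta> / 2) * (\<Sum>b\<in>Basis. e1 b k) + ennreal ((1 + 1/t) * L\<^sup>2 / (2 * \<eta>)) * e0 k
       + ennreal (L\<^sup>2 / (4 * t)) * e2 k + ennreal (4 * pi * (\<epsilon> + t))) \<longlonglongrightarrow>
       Y + ennreal ((1 + 1/t) * \<eta> / 2) * (\<Sum>b\<in>(Basis::(real^3) set). 0) + ennreal ((1 + 1/t) * L\<^sup>2 / (2 * \<eta>)) * 0
       + ennreal (L\<^sup>2 / (4 * t)) * 0 + ennreal (4 * pi * (\<epsilon> + t))"
      using w(2,4) e1lim unfolding e0_def[symmetric] e2_def[symmetric]
      by (intro tendsto_add tendsto_const ennreal_tendsto_cmult tendsto_sum) auto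
    then have "(\<lambda>k. Y + ennreal ((1 + 1/t) * \<eta> / 2) * (\<Sum>b\<in>Basis. e1 b k) + ennreal ((1 + 1/t) * L\<^sup>2 / (2 * \<eta>)) * e0 k
       + ennreal (L\<^sup>2 / (4 * t)) * e2 k + ennreal (4 * pi * (\<epsilon> + t))) \<longlonglongrightarrow> Y + ennreal (4 * pi * (\<epsilon> + t))" by simp
    then have "ennreal (pi * (4 - pi) * \<kappa>) \<le> Y + ennreal (4 * pi * (\<epsilon> + t))"
      by (rule LIMSEQ_le_const) (use all in blast)
    then show "ennreal (pi * (4 - pi) * \<kappa>) \<le> ennreal (1 + t) * (ennreal \<eta> * energy g0 \<xi> \<eta> Q) + ennreal (4 * pi * (\<epsilon> + t))"
      unfolding Y_def .
  qed
qed

section \<open>Sobolev functions as limits of test functions\<close>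

text \<open>A single integrable bound for the squares of values and derivatives yields at once
  membership in L2, the weak derivatives of the limit and the two convergences on \<open>U\<close>
  that \<open>has_trace\<close> asks for. No density theorem enters.\<close>

lemma H1_limit:
  fixes w :: "nat \<Rightarrow> 'a::euclidean_space \<Rightarrow> 'b::euclidean_space" and dom :: "'a \<Rightarrow> real"
  assumes U: "open U" and w: "\<And>k. test_fun UNIV (w k)"
    and dom: "dom \<in> borel_measurable (lebesgue_on U)" "(\<integral>\<^sup>+x. ennreal (dom x) \<partial>lebesgue_on U) < \<infinity>"
    and lim: "\<And>x. x \<in> U \<Longrightarrow> (\<lambda>k. w k x) \<longlonglongrightarrow> u x"
      "\<And>x b. x \<in> U \<Longrightarrow> b \<in> Basis \<Longrightarrow> (\<lambda>k. frechet_derivative (w k) (at x) b) \<longlonglongrightarrow> v b x"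
    and bnd: "\<And>k x. x \<in> U \<Longrightarrow> (norm (w k x))\<^sup>2 \<le> dom x"
      "\<And>k x b. x \<in> U \<Longrightarrow> b \<in> Basis \<Longrightarrow> (norm (frechet_derivative (w k) (at x) b))\<^sup>2 \<le> dom x"
  shows "u \<in> L2 U" and "\<And>b. b \<in> Basis \<Longrightarrow> v b \<in> L2 U"
    and "\<And>b. b \<in> Basis \<Longrightarrow> has_weak_deriv U b u (v b)"
    and "(\<lambda>k. \<integral>\<^sup>+x. ennreal ((norm (w k x - u x))\<^sup>2) \<partial>lebesgue_on U) \<longlonglongrightarrow> 0"
    and "\<And>b. b \<in> Basis \<Longrightarrow> (\<lambda>k. \<integral>\<^sup>+x. ennreal ((norm (frechet_derivative (w k) (at x) b - weak_deriv U b u x))\<^sup>2) \<partial>lebesgue_on U) \<longlonglongrightarrow> 0"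
proof -
  let ?M = "lebesgue_on U"
  have s: "smooth (w k)" for k using w by (simp add: test_fun_def)
  have sp: "x \<in> space ?M \<longleftrightarrow> x \<in> U" for x by (simp add: space_restrict_space)
  have toM: "f \<in> borel_measurable borel \<Longrightarrow> f \<in> borel_measurable ?M" for f :: "'a \<Rightarrow> 'b"
    by (intro measurable_restrict_space1 measurable_completion) simp
  have wm: "w k \<in> borel_measurable ?M" for k
    using smooth_derivative(2)[OF s] by (intro toM borel_measurable_continuous_onI)
  have dm: "(\<lambda>x. frechet_derivative (w k) (at x) b) \<in> borel_measurable ?M" for k b
    using smooth_derivative(3)[OF s] by (intro toM borel_measurable_continuous_onI)
  have L2: "r \<in> L2 U \<and> (\<lambda>k. \<integral>\<^sup>+x. ennreal ((norm (q k x - r x))\<^sup>2) \<partial>?M) \<longlonglongrightarrow> 0"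
    if q: "\<And>k. q k \<in> borel_measurable ?M" "\<And>x. x \<in> U \<Longrightarrow> (\<lambda>k. q k x) \<longlonglongrightarrow> r x"
      "\<And>k x. x \<in> U \<Longrightarrow> (norm (q k x))\<^sup>2 \<le> dom x" for q :: "nat \<Rightarrow> 'a \<Rightarrow> 'b" and r
  proof -
    have rm: "r \<in> borel_measurable ?M"
      by (rule borel_measurable_LIMSEQ_metric[OF q(1)]) (use q(2) sp in auto)
    have rb: "(norm (r x))\<^sup>2 \<le> dom x" if "x \<in> U" for x
      by (rule LIMSEQ_le_const2[OF tendsto_power[OF tendsto_norm[OF q(2)[OF that]]]]) (use q(3)[OF that] in blast)
    have "(\<integral>\<^sup>+x. ennreal (norm ((norm (r x))\<^sup>2)) \<partial>?M) \<le> (\<integral>\<^sup>+x. ennreal (dom x) \<partial>?M)"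
      by (intro nn_integral_mono ennreal_leI) (use rb sp in auto)
    then have "(\<integral>\<^sup>+x. ennreal (norm ((norm (r x))\<^sup>2)) \<partial>?M) < \<infinity>" using dom(2) by (rule le_less_trans)
    moreover have "(\<lambda>x. (norm (r x))\<^sup>2) \<in> borel_measurable ?M"
      by (intro borel_measurable_power measurable_compose[OF rm borel_measurable_norm])
    ultimately have "r \<in> L2 U" using rm by (simp add: L2_def integrable_iff_bounded)
    moreover have "(\<lambda>k. \<integral>\<^sup>+x. ennreal ((norm (q k x - r x))\<^sup>2) \<partial>?M) \<longlonglongrightarrow> (\<integral>\<^sup>+x. 0 \<partial>?M)"
    \<comment> \<open>The factor 4 comes from |q - r|^2 <= 2 |q|^2 + 2 |r|^2, both squares being
      bounded by \<open>dom\<close>.\<close>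
    proof (rule nn_integral_dominated_convergence[where w="\<lambda>x. ennreal 4 * ennreal (dom x)"])
      show "(\<lambda>x. ennreal ((norm (q k x - r x))\<^sup>2)) \<in> borel_measurable ?M" for k
        by (intro measurable_compose[OF _ measurable_ennreal] borel_measurable_power
            measurable_compose[OF _ borel_measurable_norm] borel_measurable_diff q(1) rm)
      show "(\<lambda>x. ennreal 4 * ennreal (dom x)) \<in> borel_measurable ?M"
        by (intro borel_measurable_times_ennreal borel_measurable_const measurable_compose[OF dom(1) measurable_ennreal])
      have "(\<integral>\<^sup>+x. ennreal 4 * ennreal (dom x) \<partial>?M) = ennreal 4 * (\<integral>\<^sup>+x. ennreal (dom x) \<partial>?M)"
        by (intro nn_integral_cmult measurable_compose[OF dom(1) measurable_ennreal])
      also have "\<dots> < \<infinity>" using dom(2) by (auto simp: ennreal_mult_less_top)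
      finally show "(\<integral>\<^sup>+x. ennreal 4 * ennreal (dom x) \<partial>?M) < \<infinity>" .
      show "AE x in ?M. ennreal ((norm (q k x - r x))\<^sup>2) \<le> ennreal 4 * ennreal (dom x)" for k
      proof (rule AE_I2)
        fix x assume "x \<in> space ?M"
        then have x: "x \<in> U" by (simp add: sp)
        have d0: "dom x \<ge> 0" by (rule order_trans[OF zero_le_power2 rb[OF x]])
        have "(norm (q k x - r x))\<^sup>2 \<le> (norm (q k x) + norm (r x))\<^sup>2"
          by (intro power_mono norm_triangle_ineq4) auto
        also have "\<dots> \<le> 2 * (norm (q k x))\<^sup>2 + 2 * (norm (r x))\<^sup>2"
          using zero_le_power2[of "norm (q k x) - norm (r x)"] by (simp add: power2_eq_square algebra_simps)
        also have "\<dots> \<le> 4 * dom x" using rb[OF x] q(3)[OF x, of k] by simp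
        finally have "ennreal ((norm (q k x - r x))\<^sup>2) \<le> ennreal (4 * dom x)" by (rule ennreal_leI)
        then show "ennreal ((norm (q k x - r x))\<^sup>2) \<le> ennreal 4 * ennreal (dom x)" using d0 by (simp add: ennreal_mult)
      qed
      show "AE x in ?M. (\<lambda>k. ennreal ((norm (q k x - r x))\<^sup>2)) \<longlonglongrightarrow> 0"
      proof (rule AE_I2)
        fix x assume "x \<in> space ?M"
        then have "(\<lambda>k. q k x) \<longlonglongrightarrow> r x" using q(2) by (simp add: sp)
        then have "(\<lambda>k. (norm (q k x - r x))\<^sup>2) \<longlonglongrightarrow> (norm (r x - r x))\<^sup>2" by (intro tendsto_intros)
        then have "(\<lambda>k. (norm (q k x - r x))\<^sup>2) \<longlonglongrightarrow> 0" by simp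
        from tendsto_ennrealI[OF this] show "(\<lambda>k. ennreal ((norm (q k x - r x))\<^sup>2)) \<longlonglongrightarrow> 0" by simp
      qed
    qed simp
    ultimately show ?thesis by (simp only: nn_integral_const mult_zero_left simp_thms)
  qed
  have u: "u \<in> L2 U \<and> (\<lambda>k. \<integral>\<^sup>+x. ennreal ((norm (w k x - u x))\<^sup>2) \<partial>?M) \<longlonglongrightarrow> 0"
    by (rule L2) (fact wm lim(1) bnd(1))+
  then show "u \<in> L2 U" "(\<lambda>k. \<integral>\<^sup>+x. ennreal ((norm (w k x - u x))\<^sup>2) \<partial>?M) \<longlonglongrightarrow> 0"
    by blast+
  have vv: "v b \<in> L2 U \<and> (\<lambda>k. \<integral>\<^sup>+x. ennreal ((norm (frechet_derivative (w k) (at x) b - v b x))\<^sup>2) \<partial>?M) \<longlonglongrightarrow> 0"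
    if b: "b \<in> Basis" for b
  proof (rule L2)
    show "(\<lambda>x. frechet_derivative (w k) (at x) b) \<in> borel_measurable ?M" for k by (rule dm)
    show "(\<lambda>k. frechet_derivative (w k) (at x) b) \<longlonglongrightarrow> v b x" if "x \<in> U" for x by (rule lim(2)[OF that b])
    show "(norm (frechet_derivative (w k) (at x) b))\<^sup>2 \<le> dom x" if "x \<in> U" for k x by (rule bnd(2)[OF that b])
  qed
  show "v b \<in> L2 U" if "b \<in> Basis" for b using vv[OF that] by blast
  \<comment> \<open>By y <= y^2 + 1 a bound of the squares becomes a locally integrable bound of the
    norms, as \<open>has_weak_deriv_limit\<close> requires.\<close>
  define d where "d x = dom x + 1" for x
  have dI: "integrable ?M dom"
  proof -
    have "(\<integral>\<^sup>+x. ennreal (norm (dom x)) \<partial>?M) = (\<integral>\<^sup>+x. ennreal (dom x) \<partial>?M)"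
    proof (rule nn_integral_cong)
      fix x assume "x \<in> space ?M"
      then have x: "x \<in> U" by (simp add: sp)
      have "0 \<le> (norm (w 0 x))\<^sup>2" by simp
      also have "\<dots> \<le> dom x" by (rule bnd(1)[OF x])
      finally have "0 \<le> dom x" .
      then show "ennreal (norm (dom x)) = ennreal (dom x)" by simp
    qed
    then show ?thesis using dom by (simp add: integrable_iff_bounded)
  qed
  have dloc: "locally_integrable_on d U"
    unfolding d_def
  proof (rule locally_integrable_add)
    show "locally_integrable_on (\<lambda>x. 1 :: real) U" by (rule locally_integrable_continuous) simp
    show "locally_integrable_on dom U"
      unfolding locally_integrable_on_def
    proof (intro allI impI)
      fix K assume K: "compact K \<and> K \<subseteq> U"
      have "set_integrable lebesgue U dom"
        using dI U by (simp add: set_integrable_def integrable_restrict_space)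
      then show "set_integrable lebesgue K dom"
        by (rule set_integrable_subset) (use K in \<open>auto simp: compact_imp_closed borel_closed\<close>)
    qed
  qed
  have sq: "y \<le> z + 1" if "y\<^sup>2 \<le> z" for y z :: real
    using that zero_le_power2[of "y - 1/2"] by (simp add: power2_eq_square algebra_simps)
  show wd: "has_weak_deriv U b u (v b)" if b: "b \<in> Basis" for b
  proof (rule has_weak_deriv_limit[OF U _ dloc lim(1) lim(2)[OF _ b]])
    show "has_weak_deriv U b (w k) (\<lambda>x. frechet_derivative (w k) (at x) b)" for k
      by (rule has_weak_deriv_C1[OF U b smooth_derivative(1)[OF s] smooth_derivative(3)[OF s]])
    show "norm (w k x) \<le> d x" if "x \<in> U" for k x
      unfolding d_def by (rule sq) (rule bnd(1)[OF that])
    show "norm (frechet_derivative (w k) (at x) b) \<le> d x" if "x \<in> U" for k x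
      unfolding d_def by (rule sq) (rule bnd(2)[OF that b])
  qed
  show "(\<lambda>k. \<integral>\<^sup>+x. ennreal ((norm (frechet_derivative (w k) (at x) b - weak_deriv U b u x))\<^sup>2) \<partial>?M) \<longlonglongrightarrow> 0"
    if b: "b \<in> Basis" for b
  proof -
    have "(\<integral>\<^sup>+x. ennreal ((norm (frechet_derivative (w k) (at x) b - weak_deriv U b u x))\<^sup>2) \<partial>?M) =
      (\<integral>\<^sup>+x. ennreal ((norm (frechet_derivative (w k) (at x) b - v b x))\<^sup>2) \<partial>?M)" for k
      by (intro nn_integral_cong_AE) (use weak_deriv_AE(2)[OF U wd[OF b]] in eventually_elim, simp)
    then show ?thesis using conjunct2[OF vv[OF b]] by (simp only:)
  qed
qed

lemma sint_pair:
  assumes k: "(\<lambda>p. k (fst p) (snd p)) \<in> borel_measurable (borel :: (real \<times> real) measure)"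
  shows "sint k = (\<integral>\<^sup>+p. k (snd p) (fst p) * ennreal (sin (snd p)) * indicator {0..pi} (snd p) * indicator {0..2*pi} (fst p) \<partial>(lborel \<Otimes>\<^sub>M lborel))"
proof -
  have m: "(\<lambda>p. k (snd p) (fst p) * ennreal (sin (snd p)) * indicator {0..pi} (snd p)) \<in> borel_measurable (lborel \<Otimes>\<^sub>M lborel)"
    using measurable_swap[OF k] by (simp add: case_prod_unfold)
  then have m2: "(\<lambda>p. k (snd p) (fst p) * ennreal (sin (snd p)) * indicator {0..pi} (snd p) * indicator {0..2*pi} (fst p)) \<in> borel_measurable (lborel \<Otimes>\<^sub>M lborel)"
    by (rule borel_measurable_times_ennreal) measurable
  have sec: "(\<lambda>\<phi>. k \<phi> \<theta> * ennreal (sin \<phi>) * indicator {0..pi} \<phi>) \<in> borel_measurable lborel" for \<theta>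
    using measurable_Pair2[OF measurable_swap[OF k], of \<theta>] by auto
  have "sint k = (\<integral>\<^sup>+\<theta>. (\<integral>\<^sup>+\<phi>. k \<phi> \<theta> * ennreal (sin \<phi>) * indicator {0..pi} \<phi> * indicator {0..2*pi} \<theta> \<partial>lborel) \<partial>lborel)"
    unfolding sint_def by (simp only: nn_integral_multc[OF sec])
  also have "\<dots> = (\<integral>\<^sup>+p. k (snd p) (fst p) * ennreal (sin (snd p)) * indicator {0..pi} (snd p) * indicator {0..2*pi} (fst p) \<partial>(lborel \<Otimes>\<^sub>M lborel))"
    by (subst lborel.nn_integral_fst[OF m2, symmetric]) simp
  finally show ?thesis .
qed

text \<open>The weight \<open>sin \<phi>\<close> removes the poles, where the approximants need not
  converge to the datum.\<close>

lemma sint_dominated: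
  fixes k :: "nat \<Rightarrow> real \<Rightarrow> real \<Rightarrow> real"
  assumes k: "\<And>n. (\<lambda>p. k n (fst p) (snd p)) \<in> borel_measurable (borel :: (real \<times> real) measure)"
    and bnd: "\<And>n \<phi> \<theta>. k n \<phi> \<theta> \<le> C" and C: "C \<ge> 0"
    and lim: "\<And>\<phi> \<theta>. 0 < \<phi> \<Longrightarrow> \<phi> < pi \<Longrightarrow> (\<lambda>n. k n \<phi> \<theta>) \<longlonglongrightarrow> 0"
  shows "(\<lambda>n. sint (\<lambda>\<phi> \<theta>. ennreal (k n \<phi> \<theta>))) \<longlonglongrightarrow> 0"
proof -
  let ?M = "lborel \<Otimes>\<^sub>M lborel :: (real \<times> real) measure"
  let ?f = "\<lambda>k p. ennreal (k (snd p) (fst p)) * ennreal (sin (snd p)) * indicator {0..pi} (snd p) * indicator {0..2*pi} (fst p)"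
  have m: "(\<lambda>p. ennreal (k n (fst p) (snd p))) \<in> borel_measurable borel" for n
    by (intro measurable_compose[OF k measurable_ennreal])
  have mf: "?f q \<in> borel_measurable ?M" if "(\<lambda>p. ennreal (q (fst p) (snd p))) \<in> borel_measurable borel" for q
    using borel_measurable_times_ennreal[OF measurable_swap[of "\<lambda>\<phi> \<theta>. ennreal (q \<phi> \<theta>)", OF that], of "\<lambda>p. indicator {0..2*pi} (fst p)"]
    by (simp add: case_prod_unfold)
  have mC: "(\<lambda>p::real\<times>real. ennreal C) \<in> borel_measurable borel" by simp
  have "(\<lambda>n. \<integral>\<^sup>+p. ?f (k n) p \<partial>?M) \<longlonglongrightarrow> (\<integral>\<^sup>+p. 0 \<partial>?M)"
  proof (rule nn_integral_dominated_convergence[where w="?f (\<lambda>_ _. C)"])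
    show "?f (k n) \<in> borel_measurable ?M" for n by (rule mf[OF m])
    show "?f (\<lambda>_ _. C) \<in> borel_measurable ?M" by (rule mf[OF mC])
    have "(\<integral>\<^sup>+p. ?f (\<lambda>_ _. C) p \<partial>?M) = sint (\<lambda>_ _. ennreal C)" by (rule sint_pair[OF mC, symmetric])
    also have "\<dots> < \<infinity>" using C by (simp add: sint_const)
    finally show "(\<integral>\<^sup>+p. ?f (\<lambda>_ _. C) p \<partial>?M) < \<infinity>" .
    show "AE p in ?M. ?f (k n) p \<le> ?f (\<lambda>_ _. C) p" for n
      by (intro AE_I2 mult_right_mono ennreal_leI bnd) auto
    show "AE p in ?M. (\<lambda>n. ?f (k n) p) \<longlonglongrightarrow> 0"
    proof (rule AE_I2)
      fix p :: "real \<times> real"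
      show "(\<lambda>n. ?f (k n) p) \<longlonglongrightarrow> 0"
      proof (cases "0 < snd p \<and> snd p < pi")
        case True
        then have "(\<lambda>n. ennreal (k n (snd p) (fst p))) \<longlonglongrightarrow> ennreal 0" by (intro tendsto_ennrealI lim) auto
        then have "(\<lambda>n. ennreal (sin (snd p)) * indicator {0..pi} (snd p) * indicator {0..2*pi} (fst p) * ennreal (k n (snd p) (fst p)))
            \<longlonglongrightarrow> ennreal (sin (snd p)) * indicator {0..pi} (snd p) * indicator {0..2*pi} (fst p) * ennreal 0"
          by (rule ennreal_tendsto_cmult[rotated]) (auto simp: ennreal_mult_less_top split: split_indicator)
        then show ?thesis by (simp add: mult_ac)
      next
        case False
        then have "snd p = 0 \<or> snd p = pi \<or> snd p \<notin> {0..pi}" by auto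
        then show ?thesis by auto
      qed
    qed
  qed simp
  then show ?thesis by (simp add: sint_pair[OF m])
qed

section \<open>The competitor\<close>

definition hz :: "real^3 \<Rightarrow> real^3" where
  "hz x = x - (x$3) *\<^sub>R e3"

lemma hz_simps [simp]: "hz x $ 3 = 0" "hz x $ 1 = x$1" "hz x $ 2 = x$2"
  by (simp_all add: hz_def e3_def axis_def)

lemma bounded_linear_hz: "bounded_linear hz"
  unfolding hz_def[abs_def]
  by (intro bounded_linear_sub bounded_linear_ident bounded_linear_scaleR_const bounded_linear_vec_nth)

lemma norm_hz: "x \<bullet> x = hz x \<bullet> hz x + (x$3)\<^sup>2" "norm (hz x) \<le> norm x"
proof -
  show 1: "x \<bullet> x = hz x \<bullet> hz x + (x$3)\<^sup>2"
    by (simp add: inner_vec_def sum_3 power2_eq_square)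
  have "(norm (hz x))\<^sup>2 \<le> (norm x)\<^sup>2" unfolding power2_norm_eq_inner 1 by simp
  then show "norm (hz x) \<le> norm x" by (rule power2_le_imp_le) simp
qed

text \<open>A polynomial that vanishes exactly at the two poles of the unit sphere and is comparable
  to the squared distance from them nearby. On the sphere it equals
  \<open>(sin \<phi>)\<^sup>2\<close>.\<close>

definition pp :: "real^3 \<Rightarrow> real" where
  "pp x = hz x \<bullet> hz x + (x \<bullet> x - 1)\<^sup>2"

definition sg :: "real \<Rightarrow> real^3 \<Rightarrow> real" where
  "sg \<epsilon> x = sqrt (pp x + \<epsilon>)"

text \<open>A polynomial substitute for the norm: equal to it on the unit sphere and, by the
  arithmetic-geometric mean inequality, never below it.\<close>

definition mu :: "real^3 \<Rightarrow> real" where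
  "mu x = (1 + x \<bullet> x) / 2"

text \<open>On the sphere and for \<epsilon> = 0 this is 1 / (sin \<phi> (1 + sin \<phi>)), the
  factor that turns the horizontal part of the point, of length sin \<phi>, into the stereographic
  coordinate of the datum.\<close>

definition ss :: "real \<Rightarrow> real^3 \<Rightarrow> real" where
  "ss \<epsilon> x = inverse (sg \<epsilon> x * (mu x + sg \<epsilon> x))"

text \<open>For \<open>\<epsilon> = 0\<close> an extension to the exterior domain of the stereographic coordinate of the boundary datum, with
  gradient of the order of the inverse distance to the poles; it is smooth on the whole space for positive \<open>\<epsilon>\<close>.\<close>
definition ZZ :: "real \<Rightarrow> real^3 \<Rightarrow> real^3" where
  "ZZ \<epsilon> x = (- (x$3 * ss \<epsilon> x)) *\<^sub>R hz x"

definition Dpp :: "real^3 \<Rightarrow> real^3 \<Rightarrow> real" where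
  "Dpp x h = 2 * (hz x \<bullet> hz h) + 4 * (x \<bullet> x - 1) * (x \<bullet> h)"

definition Dsg :: "real \<Rightarrow> real^3 \<Rightarrow> real^3 \<Rightarrow> real" where
  "Dsg \<epsilon> x h = Dpp x h * (inverse (sg \<epsilon> x) / 2)"

definition Dss :: "real \<Rightarrow> real^3 \<Rightarrow> real^3 \<Rightarrow> real" where
  "Dss \<epsilon> x h = - (ss \<epsilon> x * (sg \<epsilon> x * (x \<bullet> h + Dsg \<epsilon> x h) + Dsg \<epsilon> x h * (mu x + sg \<epsilon> x)) * ss \<epsilon> x)"

definition DZZ :: "real \<Rightarrow> real^3 \<Rightarrow> real^3 \<Rightarrow> real^3" where
  "DZZ \<epsilon> x h = (- (x$3 * ss \<epsilon> x)) *\<^sub>R hz h + (- (x$3 * Dss \<epsilon> x h + h$3 * ss \<epsilon> x)) *\<^sub>R hz x"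

lemma mu_pos: "mu x > 0" "norm x \<ge> 1 \<Longrightarrow> mu x \<ge> norm x" "norm x \<ge> 1 \<Longrightarrow> mu x \<ge> 1"
proof -
  show "mu x > 0" unfolding mu_def using inner_ge_zero[of x] by (intro divide_pos_pos add_pos_nonneg) auto
  have "0 \<le> (norm x - 1)\<^sup>2" by simp
  then have "2 * norm x \<le> 1 + x \<bullet> x" by (simp add: power2_eq_square algebra_simps dot_square_norm)
  then show 1: "norm x \<ge> 1 \<Longrightarrow> mu x \<ge> norm x" by (simp add: mu_def)
  then show "norm x \<ge> 1 \<Longrightarrow> mu x \<ge> 1" by simp
qed

lemma pp_nonneg: "pp x \<ge> 0"
  by (simp add: pp_def)

lemma pp_pos: "norm x > 1 \<Longrightarrow> pp x > 0"
proof -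
  assume "norm x > 1"
  then have "1 * 1 < norm x * norm x" by (intro mult_strict_mono) auto
  then have "x \<bullet> x - 1 > 0" by (simp add: dot_square_norm power2_eq_square)
  then have "(x \<bullet> x - 1)\<^sup>2 > 0" by simp
  then show ?thesis unfolding pp_def by (intro add_nonneg_pos) auto
qed

lemma pp_has_derivative: "(pp has_derivative Dpp x) (at x)"
proof -
  have hd: "(hz has_derivative hz) (at x)" by (rule bounded_linear_imp_has_derivative[OF bounded_linear_hz])
  have "((\<lambda>x. hz x \<bullet> hz x + (x \<bullet> x - 1)\<^sup>2) has_derivative
     (\<lambda>h. (hz x \<bullet> hz h + hz h \<bullet> hz x) + 2 * ((x \<bullet> h + h \<bullet> x) - 0) * (x \<bullet> x - 1))) (at x)"
    by (rule derivative_eq_intros hd refl | simp)+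
  moreover have "(\<lambda>h. (hz x \<bullet> hz h + hz h \<bullet> hz x) + 2 * ((x \<bullet> h + h \<bullet> x) - 0) * (x \<bullet> x - 1)) = Dpp x"
    by (simp add: fun_eq_iff Dpp_def inner_commute algebra_simps)
  ultimately show ?thesis by (simp only: pp_def[abs_def])
qed

text \<open>The assumption covers both uses: positive \<epsilon> at every point, and \<epsilon> = 0
  away from the poles.\<close>

context
  fixes \<epsilon> :: real and x :: "real^3"
  assumes pos: "pp x + \<epsilon> > 0"
begin

lemma sg_pos: "sg \<epsilon> x > 0"
  using pos by (simp add: sg_def)

lemma den_pos: "sg \<epsilon> x * (mu x + sg \<epsilon> x) > 0"
  using sg_pos mu_pos(1)[of x] by (intro mult_pos_pos add_pos_pos)

lemma sg_has_derivative: "(sg \<epsilon> has_derivative Dsg \<epsilon> x) (at x)"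
proof -
  have "((\<lambda>x. pp x + \<epsilon>) has_derivative (\<lambda>h. Dpp x h + 0)) (at x)"
    by (intro has_derivative_add pp_has_derivative has_derivative_const)
  from DERIV_compose_FDERIV[OF DERIV_real_sqrt[OF pos] this]
  show ?thesis by (simp add: sg_def[abs_def] Dsg_def[abs_def])
qed

lemma ss_has_derivative: "(ss \<epsilon> has_derivative Dss \<epsilon> x) (at x)"
proof -
  have "((\<lambda>x. (1 + x \<bullet> x) / 2) has_derivative (\<lambda>h. (0 + (x \<bullet> h + h \<bullet> x)) / 2)) (at x)"
    by (rule derivative_eq_intros refl | simp)+
  then have m: "(mu has_derivative (\<lambda>h. x \<bullet> h)) (at x)"
    by (simp add: mu_def[abs_def] inner_commute)
  have "((\<lambda>x. sg \<epsilon> x * (mu x + sg \<epsilon> x)) has_derivative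
      (\<lambda>h. sg \<epsilon> x * (x \<bullet> h + Dsg \<epsilon> x h) + Dsg \<epsilon> x h * (mu x + sg \<epsilon> x))) (at x)"
    by (intro has_derivative_mult has_derivative_add m sg_has_derivative)
  from Deriv.has_derivative_inverse[OF less_imp_neq[OF den_pos, symmetric] this]
  show ?thesis unfolding ss_def[abs_def] Dss_def[abs_def] ss_def .
qed

lemma ZZ_has_derivative: "(ZZ \<epsilon> has_derivative DZZ \<epsilon> x) (at x)"
proof -
  have c: "((\<lambda>x. x$3) has_derivative (\<lambda>h. h$3)) (at x)"
    by (rule bounded_linear_imp_has_derivative[OF bounded_linear_vec_nth])
  have hd: "(hz has_derivative hz) (at x)" by (rule bounded_linear_imp_has_derivative[OF bounded_linear_hz])
  have "((\<lambda>x. (- (x$3 * ss \<epsilon> x)) *\<^sub>R hz x) has_derivative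
    (\<lambda>h. (- (x$3 * ss \<epsilon> x)) *\<^sub>R hz h + (- (x$3 * Dss \<epsilon> x h + h$3 * ss \<epsilon> x)) *\<^sub>R hz x)) (at x)"
    by (intro has_derivative_scaleR has_derivative_minus has_derivative_mult c hd ss_has_derivative)
  then show ?thesis by (simp add: ZZ_def[abs_def] DZZ_def[abs_def])
qed

end

text \<open>All bounds are uniform in \<epsilon>. The first depends on the direction of x only and
  is an equality on the sphere off the poles for \<epsilon> = 0; it determines the leading order of
  the energy, so its constant matters. The constant 9 of the gradient bound enters only a
  remainder.\<close>

lemma ZZ_bounds:
  assumes x: "norm x \<ge> 1" and p: "pp x > 0" and \<epsilon>: "\<epsilon> \<ge> 0"
  shows "norm (ZZ \<epsilon> x) \<le> \<bar>x$3\<bar> / (norm x + norm (hz x))" "norm (ZZ \<epsilon> x) \<le> 1"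
    "norm b = 1 \<Longrightarrow> norm (DZZ \<epsilon> x b) \<le> 9 * (norm x)\<^sup>2 / sqrt (pp x)"
proof -
  define r where "r = norm x"
  define \<rho> where "\<rho> = norm (hz x)"
  define S where "S = sg \<epsilon> x"
  define m where "m = mu x"
  define s where "s = ss \<epsilon> x"
  have r: "r \<ge> 1" using x by (simp add: r_def)
  have \<rho>: "0 \<le> \<rho>" "\<rho> \<le> r" using norm_hz(2)[of x] by (auto simp: \<rho>_def r_def)
  have S0: "S \<ge> sqrt (pp x)" using \<epsilon> by (simp add: S_def sg_def)
  have sp: "sqrt (pp x) > 0" using p by simp
  have S: "S > 0" using S0 sp by linarith
  have "\<rho> = sqrt (hz x \<bullet> hz x)" by (simp add: \<rho>_def norm_eq_sqrt_inner)
  also have "\<dots> \<le> sqrt (pp x)" by (simp add: pp_def)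
  finally have \<rho>S: "\<rho> \<le> S" using S0 by simp
  have "\<bar>x \<bullet> x - 1\<bar> = sqrt ((x \<bullet> x - 1)\<^sup>2)" by simp
  also have "\<dots> \<le> sqrt (pp x)" unfolding pp_def by (intro real_sqrt_le_mono) auto
  finally have \<tau>S: "\<bar>x \<bullet> x - 1\<bar> \<le> S" using S0 by simp
  have m: "m \<ge> r" "m \<ge> 1" using mu_pos(2,3)[OF x] by (auto simp: m_def r_def)
  have s: "s = inverse (S * (m + S))" by (simp add: s_def ss_def S_def m_def)
  have s_pos: "s > 0" using S m r by (simp add: s add_pos_pos)
  have s1: "s * (m + S) = inverse S" "s * S = inverse (m + S)" 
  proof -
    have "S \<noteq> 0" "m + S \<noteq> 0" using S m r by auto
    then show "s * (m + S) = inverse S" "s * S = inverse (m + S)" by (simp_all add: s)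
  qed
  have iS: "inverse (m + S) \<le> inverse S" using S m r by (intro le_imp_inverse_le) auto
  have "S * 1 \<le> S * (m + S)" using S m by (intro mult_left_mono) auto
  then have s2: "s \<le> inverse S" unfolding s using S by (intro le_imp_inverse_le) auto
  have s\<rho>: "s * \<rho> \<le> inverse (m + S)"
    using mult_left_mono[OF \<rho>S, of s] s_pos s1(2) by simp
  have "inverse (m + S) \<le> inverse 1" using S m by (intro le_imp_inverse_le) auto
  then have s\<rho>1: "s * \<rho> \<le> 1" using s\<rho> by simp
  have x3: "\<bar>x$3\<bar> \<le> r" using component_le_norm_cart[of x 3] by (simp add: r_def)
  have nz: "norm (ZZ \<epsilon> x) = \<bar>x$3\<bar> * (s * \<rho>)"
    using s_pos by (simp add: ZZ_def abs_mult s_def[symmetric] \<rho>_def)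
  also have "\<dots> \<le> \<bar>x$3\<bar> * inverse (r + \<rho>)"
  proof (rule mult_left_mono)
    have "inverse (m + S) \<le> inverse (r + \<rho>)" using r \<rho> m \<rho>S by (intro le_imp_inverse_le) auto
    then show "s * \<rho> \<le> inverse (r + \<rho>)" using s\<rho> by simp
  qed simp
  finally show 1: "norm (ZZ \<epsilon> x) \<le> \<bar>x$3\<bar> / (norm x + norm (hz x))" by (simp add: divide_inverse r_def \<rho>_def)
  have "\<bar>x$3\<bar> / (r + \<rho>) \<le> 1" using x3 r \<rho> by (simp add: divide_le_eq)
  then show "norm (ZZ \<epsilon> x) \<le> 1" using 1 by (simp add: r_def \<rho>_def)
  assume b: "norm b = 1"
  have b3: "\<bar>b$3\<bar> \<le> 1" using component_le_norm_cart[of b 3] b by simp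
  have hb: "norm (hz b) \<le> 1" using norm_hz(2)[of b] b by simp
  have xb: "\<bar>x \<bullet> b\<bar> \<le> r" using Cauchy_Schwarz_ineq2[of x b] b by (simp add: r_def)
  have hxb: "\<bar>hz x \<bullet> hz b\<bar> \<le> \<rho>"
    using Cauchy_Schwarz_ineq2[of "hz x" "hz b"] mult_left_mono[OF hb \<rho>(1)] by (simp add: \<rho>_def)
  have "\<bar>Dpp x b\<bar> \<le> 2 * \<bar>hz x \<bullet> hz b\<bar> + 4 * (\<bar>x \<bullet> x - 1\<bar> * \<bar>x \<bullet> b\<bar>)"
    unfolding Dpp_def by (rule order_trans[OF abs_triangle_ineq]) (simp only: abs_mult abs_numeral mult.assoc)
  also have "\<dots> \<le> 2 * S + 4 * (S * r)"
    using hxb \<rho>S \<tau>S xb S by (intro add_mono mult_left_mono mult_mono) auto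
  also have "\<dots> \<le> 6 * (S * r)" using mult_left_mono[OF r, of S] S by simp
  finally have Dp: "\<bar>Dpp x b\<bar> \<le> 6 * (S * r)" .
  have "\<bar>Dsg \<epsilon> x b\<bar> = \<bar>Dpp x b\<bar> * (inverse S / 2)" using S by (simp add: Dsg_def S_def[symmetric] abs_mult)
  also have "\<dots> \<le> 6 * (S * r) * (inverse S / 2)" using S by (intro mult_right_mono Dp) auto
  also have "\<dots> = 3 * r" using S by simp
  finally have Ds: "\<bar>Dsg \<epsilon> x b\<bar> \<le> 3 * r" .
  have "\<bar>Dss \<epsilon> x b\<bar> = s * (\<bar>S * (x \<bullet> b + Dsg \<epsilon> x b) + Dsg \<epsilon> x b * (m + S)\<bar> * s)"
    using s_pos by (simp add: Dss_def s_def[symmetric] S_def[symmetric] m_def[symmetric] abs_mult)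
  also have "\<dots> \<le> s * ((S * (4 * r) + 3 * r * (m + S)) * s)"
  proof (intro mult_left_mono mult_right_mono)
    have "\<bar>S * (x \<bullet> b + Dsg \<epsilon> x b) + Dsg \<epsilon> x b * (m + S)\<bar> \<le> S * \<bar>x \<bullet> b + Dsg \<epsilon> x b\<bar> + \<bar>Dsg \<epsilon> x b\<bar> * (m + S)"
      using S m r by (intro order_trans[OF abs_triangle_ineq]) (simp add: abs_mult)
    also have "\<dots> \<le> S * (4 * r) + 3 * r * (m + S)"
      using Ds xb S m r by (intro add_mono mult_left_mono mult_right_mono) auto
    finally show "\<bar>S * (x \<bullet> b + Dsg \<epsilon> x b) + Dsg \<epsilon> x b * (m + S)\<bar> \<le> S * (4 * r) + 3 * r * (m + S)" .
  qed (use s_pos in auto)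
  also have "\<dots> = s * (4 * r * (s * S) + 3 * r * (s * (m + S)))" by (simp add: algebra_simps)
  also have "\<dots> \<le> s * (4 * r * inverse S + 3 * r * inverse S)"
    unfolding s1 using iS r s_pos by (intro mult_left_mono add_mono) auto
  also have "\<dots> = 7 * r * (s * inverse S)" by (simp add: algebra_simps)
  finally have Dss: "\<bar>Dss \<epsilon> x b\<bar> \<le> 7 * r * (s * inverse S)" .
  have "norm (DZZ \<epsilon> x b) \<le> \<bar>x$3\<bar> * s * norm (hz b) + \<bar>x$3 * Dss \<epsilon> x b + b$3 * s\<bar> * \<rho>"
    unfolding DZZ_def s_def[symmetric] \<rho>_def
    by (rule order_trans[OF norm_triangle_ineq])
       (simp only: norm_scaleR abs_minus_cancel abs_mult abs_of_pos[OF s_pos] order_refl)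
  also have "\<dots> \<le> r * s * 1 + (r * (7 * r * (s * inverse S)) + 1 * s) * \<rho>"
  proof (intro add_mono mult_mono mult_right_mono)
    have "\<bar>x$3 * Dss \<epsilon> x b + b$3 * s\<bar> \<le> \<bar>x$3\<bar> * \<bar>Dss \<epsilon> x b\<bar> + \<bar>b$3\<bar> * s"
      using s_pos by (intro order_trans[OF abs_triangle_ineq]) (simp add: abs_mult)
    also have "\<dots> \<le> r * (7 * r * (s * inverse S)) + 1 * s"
      using x3 Dss b3 r s_pos by (intro add_mono mult_mono) auto
    finally show "\<bar>x$3 * Dss \<epsilon> x b + b$3 * s\<bar> \<le> r * (7 * r * (s * inverse S)) + 1 * s" .
    show "0 \<le> r * (7 * r * (s * inverse S)) + 1 * s" using r S s_pos by simp
  qed (use x3 hb s_pos r \<rho> in auto)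
  also have "\<dots> = r * s + 7 * r\<^sup>2 * inverse S * (s * \<rho>) + s * \<rho>" by (simp add: algebra_simps power2_eq_square)
  also have "\<dots> \<le> r * inverse S + 7 * r\<^sup>2 * inverse S * 1 + inverse S * r"
    using s2 r S \<rho> s\<rho>1 s_pos by (intro add_mono mult_left_mono mult_mono) auto
  also have "\<dots> \<le> r\<^sup>2 * inverse S + 7 * r\<^sup>2 * inverse S * 1 + inverse S * r\<^sup>2"
    using r S by (intro add_mono mult_left_mono mult_right_mono) (auto simp: power2_eq_square)
  also have "\<dots> = 9 * r\<^sup>2 * inverse S" by simp
  also have "\<dots> \<le> 9 * r\<^sup>2 * inverse (sqrt (pp x))"
    using S0 sp by (intro mult_left_mono le_imp_inverse_le) auto
  finally show "norm (DZZ \<epsilon> x b) \<le> 9 * (norm x)\<^sup>2 / sqrt (pp x)" by (simp add: divide_inverse r_def)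
qed

lemma ndiff_ZZ:
  assumes "\<epsilon> > 0" shows "ndiff n (ZZ \<epsilon>)"
proof -
  have hzn: "ndiff n hz" by (rule ndiff_linear[OF bounded_linear_hz])
  have x3: "ndiff n (\<lambda>x::real^3. x$3)" by (rule ndiff_linear[OF bounded_linear_vec_nth])
  have xx: "ndiff n (\<lambda>x::real^3. x \<bullet> x)" by (intro ndiff_inner ndiff_linear bounded_linear_ident)
  have pos: "pp x + \<epsilon> > 0" for x using assms pp_nonneg[of x] by linarith
  have "ndiff n (\<lambda>x. pp x + \<epsilon>)"
    unfolding pp_def by (intro ndiff_add ndiff_const ndiff_inner hzn ndiff_power ndiff_diff xx)
  then have sgn: "ndiff n (sg \<epsilon>)" unfolding sg_def[abs_def] by (rule ndiff_sqrt) (rule pos)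
  have mun: "ndiff n mu" unfolding mu_def[abs_def] divide_inverse by (intro ndiff_mult ndiff_add ndiff_const xx)
  have ne: "sg \<epsilon> x * (mu x + sg \<epsilon> x) \<noteq> 0" for x by (rule less_imp_neq[OF den_pos[OF pos], symmetric])
  have "ndiff n (ss \<epsilon>)" unfolding ss_def[abs_def] by (rule ndiff_inverse[OF _ ne]) (intro ndiff_mult ndiff_add sgn mun)
  then show ?thesis unfolding ZZ_def[abs_def] by (intro ndiff_scaleR ndiff_minus ndiff_mult x3 hzn)
qed

lemma tendsto_ZZ:
  assumes e: "(e \<longlongrightarrow> 0) F" and p: "pp x > 0"
  shows "((\<lambda>k. ZZ (e k) x) \<longlongrightarrow> ZZ 0 x) F" "((\<lambda>k. DZZ (e k) x h) \<longlongrightarrow> DZZ 0 x h) F"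
proof -
  have "((\<lambda>k. sqrt (pp x + e k)) \<longlongrightarrow> sqrt (pp x + 0)) F" by (intro tendsto_intros e)
  then have sg: "((\<lambda>k. sg (e k) x) \<longlongrightarrow> sg 0 x) F" by (simp add: sg_def)
  have pos: "pp x + 0 > 0" using p by simp
  have ne: "sg 0 x \<noteq> 0" "sg 0 x * (mu x + sg 0 x) \<noteq> 0" using sg_pos[OF pos] den_pos[OF pos] by auto
  have ss: "((\<lambda>k. ss (e k) x) \<longlongrightarrow> ss 0 x) F"
    unfolding ss_def by (intro tendsto_intros sg ne)
  have Dsg: "((\<lambda>k. Dsg (e k) x h) \<longlongrightarrow> Dsg 0 x h) F"
    unfolding Dsg_def by (intro tendsto_intros sg ne) simp
  have Dss: "((\<lambda>k. Dss (e k) x h) \<longlongrightarrow> Dss 0 x h) F"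
    unfolding Dss_def by (intro tendsto_intros sg ss Dsg)
  show "((\<lambda>k. ZZ (e k) x) \<longlongrightarrow> ZZ 0 x) F" unfolding ZZ_def by (intro tendsto_intros ss)
  show "((\<lambda>k. DZZ (e k) x h) \<longlongrightarrow> DZZ 0 x h) F" unfolding DZZ_def by (intro tendsto_intros ss Dss)
qed

lemma sph_coords:
  assumes "0 \<le> sin \<phi>"
  shows "sph \<phi> \<theta> $ 3 = cos \<phi>" "hz (sph \<phi> \<theta>) \<bullet> hz (sph \<phi> \<theta>) = (sin \<phi>)\<^sup>2" "norm (hz (sph \<phi> \<theta>)) = sin \<phi>"
    "sph \<phi> \<theta> \<bullet> sph \<phi> \<theta> = 1"
proof -
  show c: "sph \<phi> \<theta> $ 3 = cos \<phi>" by (simp add: sph_def vector_3)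
  show n: "sph \<phi> \<theta> \<bullet> sph \<phi> \<theta> = 1" using norm_sph[of \<phi> \<theta>] by (simp add: norm_eq_1)
  show h: "hz (sph \<phi> \<theta>) \<bullet> hz (sph \<phi> \<theta>) = (sin \<phi>)\<^sup>2"
    using norm_hz(1)[of "sph \<phi> \<theta>"] unfolding n c by (simp add: sin_squared_eq)
  show "norm (hz (sph \<phi> \<theta>)) = sin \<phi>"
    using assms by (simp add: norm_eq_sqrt_inner h)
qed

lemma hz_scaleR: "hz (r *\<^sub>R x) = r *\<^sub>R hz x"
  using linear_scale[OF bounded_linear.linear[OF bounded_linear_hz]] .

lemma Uz_ZZ_boundary:
  assumes \<phi>: "0 < \<phi>" "\<phi> < pi"
  shows "Uz (ZZ 0 (sph \<phi> \<theta>)) = Q_bd \<phi> \<theta> - Q_inf" "pp (sph \<phi> \<theta>) > 0"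
proof -
  have s: "sin \<phi> > 0" by (rule sin_gt_zero[OF \<phi>])
  note c = sph_coords[OF less_imp_le[OF s]]
  show "pp (sph \<phi> \<theta>) > 0" using s by (simp add: pp_def c)
  \<comment> \<open>The opposite of the longitudinal vector lies in the upper hemisphere and has the
    same tensor. Its stereographic coordinate has length at most 1.\<close>
  define n :: "real^3" where "n = - vector [cos \<phi> * cos \<theta>, cos \<phi> * sin \<theta>, - sin \<phi>]"
  have n: "norm n = 1" "n$3 \<ge> 0" "n$3 = sin \<phi>" "n$1 = - (cos \<phi> * cos \<theta>)" "n$2 = - (cos \<phi> * sin \<theta>)"
    unfolding n_def using norm_Q_bd_vec[of \<phi> \<theta>] s by (simp_all add: vector_3)
  have "sg 0 (sph \<phi> \<theta>) = sin \<phi>" "mu (sph \<phi> \<theta>) = 1" using s by (simp_all add: sg_def pp_def mu_def c)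
  then have ssv: "ss 0 (sph \<phi> \<theta>) = inverse (sin \<phi> * (1 + sin \<phi>))" by (simp add: ss_def)
  have "ZZ 0 (sph \<phi> \<theta>) = (1 / (1 + n$3)) *\<^sub>R (n - n$3 *\<^sub>R e3)"
  proof -
    have e: "cos \<phi> * inverse (sin \<phi> * (1 + sin \<phi>)) * (sin \<phi> * t) = 1 / (1 + sin \<phi>) * (cos \<phi> * t)" for t
    proof -
      have "sin \<phi> \<noteq> 0" using s by simp
      then have "inverse (sin \<phi> * w) * (sin \<phi> * t) = t / w" for w by (simp add: divide_inverse)
      then show ?thesis by (simp add: mult.assoc)
    qed
    show ?thesis
      unfolding vec3_eq_iff ZZ_def ssv using e[of "cos \<theta>"] e[of "sin \<theta>"]
      by (simp add: c n e3_def axis_def) (simp add: sph_def vector_3 mult.assoc)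
  qed
  then have "stereo (ZZ 0 (sph \<phi> \<theta>)) = n" using stereo_inverse(1)[OF n(1,2)] by simp
  then have "Uz (ZZ 0 (sph \<phi> \<theta>)) = uniaxial n - Q_inf" using Uz_uniaxial(2) by metis
  also have "uniaxial n = Q_bd \<phi> \<theta>" by (simp add: n_def Q_bd_def uniaxial_def)
  finally show "Uz (ZZ 0 (sph \<phi> \<theta>)) = Q_bd \<phi> \<theta> - Q_inf" .
qed

section \<open>An integrable majorant\<close>

lemma sint_finite:
  assumes "\<And>\<phi> \<theta>. 0 < \<phi> \<Longrightarrow> \<phi> < pi \<Longrightarrow> k \<phi> \<theta> \<le> ennreal (C / sin \<phi>)" and C: "C \<ge> 0"
  shows "sint k < \<infinity>"
proof -
  have "sint k \<le> sint (\<lambda>\<phi> \<theta>. ennreal (C / sin \<phi>))" by (rule sint_mono) (use assms in auto)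
  also have "\<dots> \<le> (\<integral>\<^sup>+\<theta>. ennreal (C * pi) * indicator {0..2*pi} \<theta> \<partial>lborel)"
    unfolding sint_def
  proof (intro nn_integral_mono mult_right_mono)
    have "(\<integral>\<^sup>+\<phi>. ennreal (C / sin \<phi>) * ennreal (sin \<phi>) * indicator {0..pi} \<phi> \<partial>lborel) \<le> (\<integral>\<^sup>+\<phi>. ennreal C * indicator {0..pi} \<phi> \<partial>lborel)"
    proof (intro nn_integral_mono mult_right_mono)
      fix \<phi> :: real
      show "ennreal (C / sin \<phi>) * ennreal (sin \<phi>) \<le> ennreal C"
      proof (cases "sin \<phi> > 0")
        case True
        then show ?thesis using C by (simp add: ennreal_mult[symmetric])
      next
        case False
        then show ?thesis by (simp add: ennreal_neg)
      qed
    qed simp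
    also have "\<dots> = ennreal (C * pi)" by (subst nn_integral_cmult_indicator) (auto simp: C ennreal_mult)
    finally show "(\<integral>\<^sup>+\<phi>. ennreal (C / sin \<phi>) * ennreal (sin \<phi>) * indicator {0..pi} \<phi> \<partial>lborel) \<le> ennreal (C * pi)" .
  qed simp
  also have "\<dots> < \<infinity>" by (subst nn_integral_cmult_indicator) (auto simp: ennreal_mult_less_top)
  finally show ?thesis .
qed

text \<open>Up to a constant it dominates the squares of the approximants and of their gradients.
  The inverse of \<open>pp\<close> is singular like the inverse squared distance to a pole, which is
  integrable in three dimensions; the exponential takes care of infinity.\<close>

definition J_density :: "real \<Rightarrow> real^3 \<Rightarrow> real" where
  "J_density a x = (x \<bullet> x)^3 * exp (- 2 * a * (x \<bullet> x - 1)) / pp x"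

lemma J_density_nonneg: "J_density a x \<ge> 0"
  unfolding J_density_def by (intro divide_nonneg_nonneg mult_nonneg_nonneg pp_nonneg) auto

lemma continuous_pp: "continuous_on UNIV pp"
  unfolding pp_def
  by (intro continuous_intros linear_continuous_on[OF bounded_linear_hz] continuous_on_inner)

lemma J_density_borel: "J_density a \<in> borel_measurable borel"
  unfolding J_density_def[abs_def]
  by (intro borel_measurable_divide borel_measurable_continuous_onI continuous_intros continuous_pp)

text \<open>On the ray at polar angle \<phi> the denominator is at least s^2 + (r^2 - 1)^2 with s =
  sin \<phi>, so the radial integral is of order 1 / s. The surface weight cancels this
  singularity.\<close>

lemma J_density_finite:
  assumes a: "a > 0" shows "(\<integral>\<^sup>+x. ennreal (J_density a x) \<partial>lebesgue_on \<Omega>) < \<infinity>"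
proof -
  \<comment> \<open>From u <= exp u at u = a q / 2, raised to the fourth power. Three powers of q =
    r^2 belong to \<open>J_density\<close> and one to the Jacobian.\<close>
  define B where "B = (2 / a)^4 * exp (2 * a)"
  have B0: "B \<ge> 0" using a by (simp add: B_def)
  have B: "q^4 * exp (- 2 * a * (q - 1)) \<le> B" if "q \<ge> 0" for q :: real
  proof -
    have "a * q / 2 \<le> exp (a * q / 2)" using exp_ge_add_one_self[of "a * q / 2"] by linarith
    then have "(a * q / 2)^4 \<le> (exp (a * q / 2))^4" using a that by (intro power_mono) auto
    also have "\<dots> = exp (2 * a * q)" by (simp add: exp_of_nat_mult[symmetric])
    finally have "(a / 2)^4 * q^4 \<le> exp (2 * a * q)" by (simp add: power_mult_distrib power_divide)
    then have "(2 / a)^4 * ((a / 2)^4 * q^4) \<le> (2 / a)^4 * exp (2 * a * q)" using a by (intro mult_left_mono) auto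
    moreover have "(2 / a)^4 * ((a / 2)^4 * q^4) = q^4" using a by (simp add: power_divide)
    ultimately have "q^4 \<le> (2 / a)^4 * exp (2 * a * q)" by simp
    then have "q^4 * exp (- 2 * a * (q - 1)) \<le> (2 / a)^4 * exp (2 * a * q) * exp (- 2 * a * (q - 1))"
      by (intro mult_right_mono) auto
    also have "\<dots> = (2 / a)^4 * (exp (2 * a * q) * exp (- 2 * a * (q - 1)))" by simp
    also have "exp (2 * a * q) * exp (- 2 * a * (q - 1)) = exp (2 * a)"
      unfolding exp_add[symmetric] by (simp add: algebra_simps)
    finally show ?thesis by (simp add: B_def)
  qed
  have "(\<integral>\<^sup>+x. ennreal (J_density a x) \<partial>lebesgue_on \<Omega>) =
     sint (\<lambda>\<phi> \<theta>. \<integral>\<^sup>+r. ennreal (J_density a (r *\<^sub>R sph \<phi> \<theta>)) * ennreal (r\<^sup>2) * indicator {1<..} r \<partial>lborel)"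
    by (intro nn_integral_polar_sint measurable_compose[OF J_density_borel measurable_ennreal])
  also have "\<dots> < \<infinity>"
  proof (rule sint_finite[where C="B * pi / 4"])
    fix \<phi> \<theta> :: real assume \<phi>: "0 < \<phi>" "\<phi> < pi"
    define s where "s = sin \<phi>"
    have s: "s > 0" unfolding s_def by (rule sin_gt_zero[OF \<phi>])
    note c = sph_coords[OF less_imp_le[OF s[unfolded s_def]], of \<theta>]
    \<comment> \<open>An additional factor r, harmless for r >= 1, makes the bound the exact
      derivative of a multiple of the arctangent of (r^2 - 1) / s.\<close>
    define f where "f r = (B / (2 * s)) * (2 * r / s / (1 + ((r\<^sup>2 - 1) / s)\<^sup>2))" for r :: real
    have den: "1 + ((r\<^sup>2 - 1) / s)\<^sup>2 > 0" for r by (simp add: add_pos_nonneg)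
    have "(\<integral>\<^sup>+r. ennreal (J_density a (r *\<^sub>R sph \<phi> \<theta>)) * ennreal (r\<^sup>2) * indicator {1<..} r \<partial>lborel) \<le>
      (\<integral>\<^sup>+r. ennreal (f r) * indicator {1..} r \<partial>lborel)"
    proof (rule nn_integral_mono)
      fix r :: real
      show "ennreal (J_density a (r *\<^sub>R sph \<phi> \<theta>)) * ennreal (r\<^sup>2) * indicator {1<..} r \<le> ennreal (f r) * indicator {1..} r"
      proof (cases "r > 1")
        case True
        have xx: "(r *\<^sub>R sph \<phi> \<theta>) \<bullet> (r *\<^sub>R sph \<phi> \<theta>) = r\<^sup>2" by (simp add: c power2_eq_square)
        have pv: "pp (r *\<^sub>R sph \<phi> \<theta>) = r\<^sup>2 * s\<^sup>2 + (r\<^sup>2 - 1)\<^sup>2"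
          unfolding pp_def xx hz_scaleR by (simp add: c s_def power2_eq_square)
        have "1 * s\<^sup>2 \<le> r\<^sup>2 * s\<^sup>2" using True by (intro mult_right_mono) auto
        then have le: "s\<^sup>2 + (r\<^sup>2 - 1)\<^sup>2 \<le> pp (r *\<^sub>R sph \<phi> \<theta>)" by (simp add: pv)
        have sp: "s\<^sup>2 + (r\<^sup>2 - 1)\<^sup>2 > 0" using s by (simp add: add_pos_nonneg)
        have "J_density a (r *\<^sub>R sph \<phi> \<theta>) * r\<^sup>2 = (r\<^sup>2)^4 * exp (- 2 * a * (r\<^sup>2 - 1)) / pp (r *\<^sub>R sph \<phi> \<theta>)"
        proof -
          have "u^3 * E / P * u = u^4 * E / P" for u E P :: real
          proof -
            have "u^4 = u^3 * u" by (simp add: eval_nat_numeral)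
            then show ?thesis by (simp only: divide_inverse mult_ac)
          qed
          then show ?thesis unfolding J_density_def xx .
        qed
        also have "\<dots> \<le> (B * r) / (s\<^sup>2 + (r\<^sup>2 - 1)\<^sup>2)"
        proof (rule frac_le)
          have "(r\<^sup>2)^4 * exp (- 2 * a * (r\<^sup>2 - 1)) \<le> B" by (rule B) simp
          also have "B \<le> B * r" using B0 True by (simp add: mult_le_cancel_left1)
          finally show "(r\<^sup>2)^4 * exp (- 2 * a * (r\<^sup>2 - 1)) \<le> B * r" .
        qed (use le sp B0 True in auto)
        also have "\<dots> = f r"
        proof -
          have "1 + ((r\<^sup>2 - 1) / s)\<^sup>2 = (s\<^sup>2 + (r\<^sup>2 - 1)\<^sup>2) / s\<^sup>2" using s by (simp add: power_divide add_divide_distrib)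
          then have "f r = (B / (2 * s)) * (2 * r / s / ((s\<^sup>2 + (r\<^sup>2 - 1)\<^sup>2) / s\<^sup>2))" by (simp only: f_def)
          also have "\<dots> = (B * r) / (s\<^sup>2 + (r\<^sup>2 - 1)\<^sup>2)" using s sp by (simp add: power2_eq_square)
          finally show ?thesis by simp
        qed
        finally have "ennreal (J_density a (r *\<^sub>R sph \<phi> \<theta>) * r\<^sup>2) \<le> ennreal (f r)" by (rule ennreal_leI)
        moreover have "ennreal (J_density a (r *\<^sub>R sph \<phi> \<theta>) * r\<^sup>2) = ennreal (J_density a (r *\<^sub>R sph \<phi> \<theta>)) * ennreal (r\<^sup>2)"
          by (rule ennreal_mult) (simp_all add: J_density_nonneg)
        ultimately show ?thesis using True by simp
      qed simp
    qed
    also have "\<dots> = ennreal ((B / (2 * s)) * (pi / 2) - (B / (2 * s)) * arctan ((1\<^sup>2 - 1) / s))"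
    proof (rule nn_integral_FTC_atLeast[where F="\<lambda>r. (B / (2 * s)) * arctan ((r\<^sup>2 - 1) / s)"])
      have "continuous_on UNIV f"
        unfolding f_def[abs_def] using s less_imp_neq[OF den]
        by (auto intro!: continuous_on_mult continuous_on_divide continuous_on_add continuous_on_diff continuous_on_power
            continuous_on_const continuous_on_id)
      then show "f \<in> borel_measurable borel" by (rule borel_measurable_continuous_onI)
      show "((\<lambda>r. (B / (2 * s)) * arctan ((r\<^sup>2 - 1) / s)) has_real_derivative f r) (at r)" for r
      proof -
        have "((\<lambda>r. (r\<^sup>2 - 1) / s) has_real_derivative 2 * r / s) (at r)"
          by (rule DERIV_cong, rule DERIV_cdivide, rule DERIV_diff, rule DERIV_power, rule DERIV_ident, rule DERIV_const) simp
        from DERIV_cmult[OF DERIV_chain2[OF DERIV_arctan this], of "B / (2 * s)"]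
        show ?thesis by (simp only: f_def divide_inverse mult_ac)
      qed
      show "0 \<le> f r" if "1 \<le> r" for r
        unfolding f_def using that s B0 den[of r] by (intro mult_nonneg_nonneg divide_nonneg_nonneg) auto
      have "filterlim (\<lambda>r::real. (r\<^sup>2 - 1) / s) at_top at_top"
        using s by real_asymp
      then have "((\<lambda>r. arctan ((r\<^sup>2 - 1) / s)) \<longlongrightarrow> pi / 2) at_top"
        by (rule filterlim_compose[OF tendsto_arctan_at_top])
      then show "((\<lambda>r. (B / (2 * s)) * arctan ((r\<^sup>2 - 1) / s)) \<longlongrightarrow> (B / (2 * s)) * (pi / 2)) at_top"
        by (intro tendsto_intros)
    qed
    also have "\<dots> = ennreal (B * pi / 4 / sin \<phi>)" by (simp add: s_def)
    finally show "(\<integral>\<^sup>+r. ennreal (J_density a (r *\<^sub>R sph \<phi> \<theta>)) * ennreal (r\<^sup>2) * indicator {1<..} r \<partial>lborel) \<le> ennreal (B * pi / 4 / sin \<phi>)" .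
  qed (use B0 in simp)
  finally show ?thesis .
qed

section \<open>Radial profile and cutoff, as functions of the squared norm\<close>

definition Ex :: "real \<Rightarrow> real \<Rightarrow> real" where
  "Ex a q = exp (- a * (q - 1))"

text \<open>The factor \<open>exp 1\<close> compensates the value exp (-1) of \<open>bump 0\<close>
  at 1, so that the limit for large k is 1. Taking the squared norm as argument keeps the cutoff
  smooth at the origin.\<close>

definition cutoff :: "nat \<Rightarrow> real \<Rightarrow> real" where
  "cutoff k q = exp 1 * bump 0 (1 - q / real (Suc k))"

definition dcutoff :: "nat \<Rightarrow> real \<Rightarrow> real" where
  "dcutoff k q = - (exp 1 / real (Suc k)) * bump 2 (1 - q / real (Suc k))"

lemma cutoff_bounds:
  "0 \<le> cutoff k q" "cutoff k q \<le> 3" "\<bar>dcutoff k q\<bar> \<le> 6"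
proof -
  show "0 \<le> cutoff k q" by (simp add: cutoff_def bump_nonneg)
  have "exp 1 * bump 0 (1 - q / real (Suc k)) \<le> 3 * 1"
    using exp_le bump_le_1 bump_nonneg by (intro mult_mono) auto
  then show "cutoff k q \<le> 3" by (simp add: cutoff_def)
  have b2: "bump 2 t \<le> 2" for t
  proof (cases "t > 0")
    case True
    define v where "v = inverse t"
    have v: "v > 0" using True by (simp add: v_def)
    have "1 + v + v\<^sup>2 / 2 \<le> exp v" using v by (intro exp_lower_Taylor_quadratic) simp
    then have "v\<^sup>2 \<le> 2 * exp v" using v by simp
    then have "v\<^sup>2 * exp (- v) \<le> 2 * exp v * exp (- v)" by (intro mult_right_mono) auto
    also have "\<dots> = 2" by (simp add: mult.assoc exp_add[symmetric])
    finally show ?thesis using True by (simp add: bump_def v_def)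
  qed (simp add: bump_def)
  have "exp 1 / real (Suc k) \<le> 3 / 1"
    using exp_le by (intro frac_le) auto
  then have "exp 1 / real (Suc k) * bump 2 (1 - q / real (Suc k)) \<le> 3 * 2"
    using b2 bump_nonneg by (intro mult_mono) auto
  then show "\<bar>dcutoff k q\<bar> \<le> 6" by (simp add: dcutoff_def abs_mult bump_nonneg)
qed

lemma cutoff_zero: "q \<ge> real (Suc k) \<Longrightarrow> cutoff k q = 0"
  unfolding cutoff_def by (subst bump_zero) (auto simp: divide_simps)

lemma cutoff_deriv: "(cutoff k has_real_derivative dcutoff k q) (at q)"
proof -
  have "((\<lambda>q. 1 - q / real (Suc k)) has_real_derivative - (1 / real (Suc k))) (at q)"
    by (rule DERIV_cong[OF DERIV_diff[OF DERIV_const DERIV_cdivide[OF DERIV_ident]]]) simp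
  from DERIV_cmult[OF DERIV_chain2[OF bump_deriv[of 0] this], of "exp 1"]
  show ?thesis by (simp add: cutoff_def[abs_def] dcutoff_def numeral_2_eq_2 del: of_nat_Suc)
qed

lemma cutoff_lim: "(\<lambda>k. cutoff k q) \<longlonglongrightarrow> 1" "(\<lambda>k. dcutoff k q) \<longlonglongrightarrow> 0"
proof -
  have i: "(\<lambda>k. 1 / real (Suc k)) \<longlonglongrightarrow> 0" by (rule lim_1_over_n[THEN LIMSEQ_Suc])
  have "(\<lambda>k. 1 - q * (1 / real (Suc k))) \<longlonglongrightarrow> 1 - q * 0" by (intro tendsto_intros i)
  then have l: "(\<lambda>k. 1 - q / real (Suc k)) \<longlonglongrightarrow> 1" by simp
  have c: "(\<lambda>k. bump m (1 - q / real (Suc k))) \<longlonglongrightarrow> bump m 1" for m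
    by (rule isCont_tendsto_compose[OF DERIV_isCont[OF bump_deriv] l])
  have "(\<lambda>k. cutoff k q) \<longlonglongrightarrow> exp 1 * bump 0 1" unfolding cutoff_def by (intro tendsto_intros c)
  also have "exp 1 * bump 0 1 = 1" by (simp add: bump_def exp_add[symmetric])
  finally show "(\<lambda>k. cutoff k q) \<longlonglongrightarrow> 1" .
  have "(\<lambda>k. - (exp 1 * (1 / real (Suc k))) * bump 2 (1 - q / real (Suc k))) \<longlonglongrightarrow> - (exp 1 * 0) * bump 2 1"
    by (intro tendsto_intros c i)
  then show "(\<lambda>k. dcutoff k q) \<longlonglongrightarrow> 0" by (simp add: dcutoff_def)
qed

lemma Ex_deriv: "(Ex a has_real_derivative - a * Ex a q) (at q)"
  unfolding Ex_def[abs_def] by (auto intro!: derivative_eq_intros)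

lemma Ex_pos: "Ex a q > 0"
  by (simp add: Ex_def)

text \<open>The derivative of \<open>Y (x \<bullet> x) *\<^sub>R ZZ \<epsilon> x\<close>, where \<open>y\<close> and \<open>dy\<close> stand for the values of \<open>Y\<close> and its derivative.\<close>
definition DYZ :: "real \<Rightarrow> real \<Rightarrow> real \<Rightarrow> real^3 \<Rightarrow> real^3 \<Rightarrow> real^3" where
  "DYZ y dy \<epsilon> x h = y *\<^sub>R DZZ \<epsilon> x h + (dy * (2 * (x \<bullet> h))) *\<^sub>R ZZ \<epsilon> x"

lemma ZZ_third [simp]: "ZZ \<epsilon> x $ 3 = 0" "DZZ \<epsilon> x h $ 3 = 0" "DYZ y dy \<epsilon> x h $ 3 = 0"
  by (simp_all add: ZZ_def DZZ_def DYZ_def)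

lemma YZ_has_derivative:
  assumes Y: "(Y has_real_derivative dy) (at (x \<bullet> x))" and p: "pp x + \<epsilon> > 0"
  shows "((\<lambda>x. Y (x \<bullet> x) *\<^sub>R ZZ \<epsilon> x) has_derivative DYZ (Y (x \<bullet> x)) dy \<epsilon> x) (at x)"
proof -
  have "((\<lambda>x. x \<bullet> x) has_derivative (\<lambda>h. x \<bullet> h + h \<bullet> x)) (at x)"
    by (rule derivative_eq_intros refl)+
  then have q: "((\<lambda>x. x \<bullet> x) has_derivative (\<lambda>h. 2 * (x \<bullet> h))) (at x)" by (simp add: inner_commute)
  have "((\<lambda>x. Y (x \<bullet> x)) has_derivative (\<lambda>h. 2 * (x \<bullet> h) * dy)) (at x)"
    by (rule DERIV_compose_FDERIV[OF Y q])
  from has_derivative_scaleR[OF this ZZ_has_derivative[OF p]]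
  show ?thesis by (simp add: DYZ_def[abs_def] mult.commute mult.left_commute)
qed

text \<open>The hypotheses on \<open>y\<close> and \<open>dy\<close> are what
  \<open>cutoff_bounds\<close> gives for the product of profile and cutoff, with 3 as a bound of e.
  The same majorant then serves for all approximants.\<close>

lemma DYZ_bounds:
  fixes E :: real
  assumes x: "norm x > 1" and \<epsilon>: "\<epsilon> \<ge> 0" and a: "a > 0" and E: "E = Ex a (x \<bullet> x)"
    and y: "\<bar>y\<bar> \<le> 3 * E" and dy: "\<bar>dy\<bar> \<le> (3 * a + 6) * E"
  shows "(norm (Uz (y *\<^sub>R ZZ \<epsilon> x)))\<^sup>2 \<le> 8 * (12 * a + 51)\<^sup>2 * J_density a x"
    "b \<in> Basis \<Longrightarrow> (norm (dUz (y *\<^sub>R ZZ \<epsilon> x) (DYZ y dy \<epsilon> x b)))\<^sup>2 \<le> 8 * (12 * a + 51)\<^sup>2 * J_density a x"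
proof -
  define r where "r = norm x"
  define P where "P = sqrt (pp x)"
  have r: "r \<ge> 1" using x by (simp add: r_def)
  have xx: "x \<bullet> x = r\<^sup>2" by (simp add: r_def dot_square_norm)
  have pp: "pp x > 0" by (rule pp_pos[OF x])
  have P: "P > 0" "P\<^sup>2 = pp x" using pp by (simp_all add: P_def)
  have E0: "E > 0" by (simp add: E Ex_pos)
  have r2: "r \<le> r\<^sup>2" "r\<^sup>2 \<le> r^3" "1 \<le> r\<^sup>2"
    using power_increasing[OF _ r, of 1 2] power_increasing[OF _ r, of 2 3] one_le_power[OF r, of 2] by simp_all
  have "pp x \<le> (2 * r\<^sup>2)\<^sup>2"
  proof -
    have "hz x \<bullet> hz x \<le> x \<bullet> x" using norm_hz(1)[of x] by simp
    moreover have "(x \<bullet> x - 1)\<^sup>2 \<le> (r\<^sup>2)\<^sup>2" unfolding xx using r2 by (intro power_mono) auto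
    moreover have "r\<^sup>2 * 1 \<le> r\<^sup>2 * r\<^sup>2" using r2 by (intro mult_left_mono) auto
    moreover have "(2 * r\<^sup>2)\<^sup>2 = 4 * (r\<^sup>2 * r\<^sup>2)" "(r\<^sup>2)\<^sup>2 = r\<^sup>2 * r\<^sup>2" "0 \<le> r\<^sup>2 * r\<^sup>2"
      by (simp_all add: power_mult_distrib power2_eq_square[of "r\<^sup>2"])
    ultimately show ?thesis unfolding pp_def xx by linarith
  qed
  then have P2: "P \<le> 2 * r\<^sup>2" unfolding P_def by (rule real_le_lsqrt[rotated]) (use pp in auto)
  \<comment> \<open>Terms without the singular factor are absorbed into those with it, since the
    root of \<open>pp\<close> grows at most quadratically.\<close>
  have one: "1 \<le> 2 * r\<^sup>2 / P" using P2 P by (simp add: pos_le_divide_eq)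
  \<comment> \<open>This is 3 * 9 + 4 * (3 * a + 6): the first summand from the gradient of
    \<open>ZZ\<close>, the second from the derivative of the profile.\<close>
  define C where "C = 12 * a + 51"
  define D where "D = C * E * (r^3 / P)"
  have D2: "D\<^sup>2 = C\<^sup>2 * J_density a x"
  proof -
    have "E\<^sup>2 = exp (- 2 * a * (r\<^sup>2 - 1))" by (simp add: E Ex_def xx power2_eq_square exp_add[symmetric])
    moreover have "(r^3)\<^sup>2 = (r\<^sup>2)^3" by (simp add: power_mult[symmetric])
    ultimately show ?thesis unfolding D_def J_density_def xx P(2)[symmetric] by (simp add: power_mult_distrib power_divide)
  qed
  have nZ: "norm (ZZ \<epsilon> x) \<le> 1" using ZZ_bounds(2)[OF _ pp \<epsilon>] x by simp
  have "norm (y *\<^sub>R ZZ \<epsilon> x) \<le> 3 * E * 1"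
    using y nZ E0 by (simp only: norm_scaleR) (intro mult_mono, auto)
  also have "\<dots> \<le> 3 * E * (2 * r^3 / P)"
  proof -
    have "2 * r\<^sup>2 / P \<le> 2 * r^3 / P" using r2 P by (intro divide_right_mono) auto
    then show ?thesis using one E0 by (intro mult_left_mono) auto
  qed
  also have "\<dots> = 6 * E * (r^3 / P)" by simp
  also have "\<dots> \<le> D" unfolding D_def C_def using a E0 r P by (intro mult_right_mono) auto
  finally have z: "norm (y *\<^sub>R ZZ \<epsilon> x) \<le> D" .
  have drop: "u / (1 + z \<bullet> z)\<^sup>2 \<le> u" if "u \<ge> 0" for u :: real and z :: "real^3"
  proof -
    have "1\<^sup>2 \<le> (1 + z \<bullet> z)\<^sup>2" by (intro power_mono) auto
    then have "u / (1 + z \<bullet> z)\<^sup>2 \<le> u / 1" using that by (intro frac_le) auto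
    then show ?thesis by simp
  qed
  have "(norm (Uz z))\<^sup>2 \<le> 8 * (norm z)\<^sup>2" if "z$3 = 0" for z
    unfolding Uz_norm[OF that] unfolding power2_norm_eq_inner by (rule drop) simp
  then have "(norm (Uz (y *\<^sub>R ZZ \<epsilon> x)))\<^sup>2 \<le> 8 * (norm (y *\<^sub>R ZZ \<epsilon> x))\<^sup>2"
    by this simp
  also have "\<dots> \<le> 8 * D\<^sup>2" using z by (intro mult_left_mono power_mono) auto
  finally show "(norm (Uz (y *\<^sub>R ZZ \<epsilon> x)))\<^sup>2 \<le> 8 * (12 * a + 51)\<^sup>2 * J_density a x" by (simp add: D2 C_def)
  assume b: "b \<in> Basis"
  then have nb: "norm b = 1" by simp
  have xb: "\<bar>x \<bullet> b\<bar> \<le> r" using Cauchy_Schwarz_ineq2[of x b] nb by (simp add: r_def)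
  have DZ: "norm (DZZ \<epsilon> x b) \<le> 9 * r\<^sup>2 / P" using ZZ_bounds(3)[OF _ pp \<epsilon> nb] x by (simp add: r_def P_def)
  have "norm (DYZ y dy \<epsilon> x b) \<le> \<bar>y\<bar> * norm (DZZ \<epsilon> x b) + \<bar>dy\<bar> * (2 * \<bar>x \<bullet> b\<bar>) * norm (ZZ \<epsilon> x)"
    unfolding DYZ_def by (rule order_trans[OF norm_triangle_ineq]) (simp add: abs_mult)
  also have "\<dots> \<le> 3 * E * (9 * r\<^sup>2 / P) + (3 * a + 6) * E * (2 * r) * 1"
    using y dy DZ nZ xb E0 r a P by (intro add_mono mult_mono) auto
  also have "\<dots> \<le> 3 * E * (9 * (r^3 / P)) + (3 * a + 6) * E * (4 * (r^3 / P))"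
  proof (intro add_mono mult_left_mono)
    show "9 * r\<^sup>2 / P \<le> 9 * (r^3 / P)" using r2 P by (simp add: divide_right_mono)
    have "(3 * a + 6) * E * (2 * r) * 1 = (3 * a + 6) * E * (2 * r * 1)" by simp
    also have "\<dots> \<le> (3 * a + 6) * E * (2 * r * (2 * r\<^sup>2 / P))"
      using one a E0 r by (intro mult_left_mono) auto
    also have "\<dots> = (3 * a + 6) * E * (4 * (r^3 / P))" by (simp add: power2_eq_square power3_eq_cube)
    finally show "(3 * a + 6) * E * (2 * r) * 1 \<le> (3 * a + 6) * E * (4 * (r^3 / P))" .
  qed (use E0 in auto)
  also have "\<dots> = D" by (simp add: D_def C_def algebra_simps)
  finally have "norm (DYZ y dy \<epsilon> x b) \<le> D" .
  then have n: "(norm (DYZ y dy \<epsilon> x b))\<^sup>2 \<le> D\<^sup>2" by (intro power_mono) auto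
  have "(norm (dUz (y *\<^sub>R ZZ \<epsilon> x) (DYZ y dy \<epsilon> x b)))\<^sup>2 = 8 * (norm (DYZ y dy \<epsilon> x b))\<^sup>2 / (1 + (y *\<^sub>R ZZ \<epsilon> x) \<bullet> (y *\<^sub>R ZZ \<epsilon> x))\<^sup>2"
    by (rule dUz_norm) simp_all
  also have "\<dots> \<le> 8 * (norm (DYZ y dy \<epsilon> x b))\<^sup>2" by (rule drop) simp
  also have "\<dots> \<le> 8 * D\<^sup>2" using n by simp
  finally show "(norm (dUz (y *\<^sub>R ZZ \<epsilon> x) (DYZ y dy \<epsilon> x b)))\<^sup>2 \<le> 8 * (12 * a + 51)\<^sup>2 * J_density a x"
    by (simp add: D2 C_def)
qed

section \<open>The competitor and its approximation by test functions\<close>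

definition approximant :: "real \<Rightarrow> nat \<Rightarrow> real^3 \<Rightarrow> real^3^3" where
  "approximant a k x = Uz ((Ex a (x \<bullet> x) * cutoff k (x \<bullet> x)) *\<^sub>R ZZ (1 / real (Suc k)) x)"

definition competitor :: "real \<Rightarrow> real^3 \<Rightarrow> real^3^3" where
  "competitor a x = Uz (Ex a (x \<bullet> x) *\<^sub>R ZZ 0 x)"

definition dcompetitor :: "real \<Rightarrow> real^3 \<Rightarrow> real^3 \<Rightarrow> real^3^3" where
  "dcompetitor a b x = dUz (Ex a (x \<bullet> x) *\<^sub>R ZZ 0 x) (DYZ (Ex a (x \<bullet> x)) (- a * Ex a (x \<bullet> x)) 0 x b)"

lemma Uz_0: "Uz 0 = 0"
  using Uz_norm[of 0] by simp

lemma approximant_test_fun: "test_fun UNIV (approximant a k)"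
proof -
  have q: "ndiff n (\<lambda>x::real^3. x \<bullet> x)" for n by (intro ndiff_inner ndiff_linear bounded_linear_ident)
  have "ndiff n (approximant a k)" for n
    unfolding approximant_def[abs_def] Ex_def cutoff_def divide_inverse[of _ "real (Suc k)"]
    by (intro ndiff_Uz ndiff_scaleR ndiff_mult ndiff_exp ndiff_bump ndiff_diff ndiff_const q ndiff_ZZ) simp
  then have s: "smooth (approximant a k)" by (simp add: smooth_iff_ndiff)
  have "{x. approximant a k x \<noteq> 0} \<subseteq> cball 0 (sqrt (real (Suc k)))"
  proof
    fix x assume "x \<in> {x. approximant a k x \<noteq> 0}"
    then have "approximant a k x \<noteq> 0" by simp
    then have "\<not> x \<bullet> x \<ge> real (Suc k)"
      using cutoff_zero[of k "x \<bullet> x"] by (auto simp: approximant_def Uz_0)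
    then show "x \<in> cball 0 (sqrt (real (Suc k)))" by (simp add: norm_eq_sqrt_inner)
  qed
  then have "bounded {x. approximant a k x \<noteq> 0}" by (rule bounded_subset[OF bounded_cball])
  then show ?thesis using s by (simp add: test_fun_def)
qed

lemma approximant_derivative:
  "frechet_derivative (approximant a k) (at x) = (\<lambda>h. dUz ((Ex a (x \<bullet> x) * cutoff k (x \<bullet> x)) *\<^sub>R ZZ (1 / real (Suc k)) x)
     (DYZ (Ex a (x \<bullet> x) * cutoff k (x \<bullet> x)) (Ex a (x \<bullet> x) * dcutoff k (x \<bullet> x) + - a * Ex a (x \<bullet> x) * cutoff k (x \<bullet> x)) (1 / real (Suc k)) x h))"
proof -
  have "((\<lambda>q. Ex a q * cutoff k q) has_real_derivative (Ex a q * dcutoff k q + - a * Ex a q * cutoff k q)) (at q)" for q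
    using DERIV_mult[OF Ex_deriv cutoff_deriv] by (simp add: algebra_simps)
  moreover have "pp x + 1 / real (Suc k) > 0" using pp_nonneg[of x] by (simp add: add_nonneg_pos)
  ultimately have "((\<lambda>x. (Ex a (x \<bullet> x) * cutoff k (x \<bullet> x)) *\<^sub>R ZZ (1 / real (Suc k)) x) has_derivative
     DYZ (Ex a (x \<bullet> x) * cutoff k (x \<bullet> x)) (Ex a (x \<bullet> x) * dcutoff k (x \<bullet> x) + - a * Ex a (x \<bullet> x) * cutoff k (x \<bullet> x)) (1 / real (Suc k)) x) (at x)"
    by (rule YZ_has_derivative[where Y="\<lambda>q. Ex a q * cutoff k q"])
  from has_derivative_compose[OF this Uz_has_derivative]
  show ?thesis unfolding approximant_def[abs_def] by (rule frechet_derivative_at[symmetric])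
qed

lemma norm_Omega: "x \<in> \<Omega> \<longleftrightarrow> norm x > 1"
  by (auto simp: \<Omega>_def)

lemma open_Omega: "open \<Omega>"
  by (auto simp: \<Omega>_def)

lemma inverse_Suc_lim: "(\<lambda>k. 1 / real (Suc k)) \<longlonglongrightarrow> 0"
  by (rule lim_1_over_n[THEN LIMSEQ_Suc])

lemma competitor_H1:
  assumes a: "a > 0"
  shows "competitor a \<in> L2 \<Omega>" and "\<And>b. b \<in> Basis \<Longrightarrow> dcompetitor a b \<in> L2 \<Omega>"
    and "\<And>b. b \<in> Basis \<Longrightarrow> has_weak_deriv \<Omega> b (competitor a) (dcompetitor a b)"
    and "(\<lambda>k. \<integral>\<^sup>+x. ennreal ((norm (approximant a k x - competitor a x))\<^sup>2) \<partial>lebesgue_on \<Omega>) \<longlonglongrightarrow> 0"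
    and "\<And>b. b \<in> Basis \<Longrightarrow> (\<lambda>k. \<integral>\<^sup>+x. ennreal ((norm (frechet_derivative (approximant a k) (at x) b - weak_deriv \<Omega> b (competitor a) x))\<^sup>2) \<partial>lebesgue_on \<Omega>) \<longlonglongrightarrow> 0"
proof -
  let ?C = "8 * (12 * a + 51)\<^sup>2"
  let ?dom = "\<lambda>x. ?C * J_density a x"
  have dom: "?dom \<in> borel_measurable (lebesgue_on \<Omega>)"
    using J_density_borel[of a] by (intro borel_measurable_times measurable_restrict_space1 measurable_completion) auto
  have "(\<integral>\<^sup>+x. ennreal (?dom x) \<partial>lebesgue_on \<Omega>) = ennreal ?C * (\<integral>\<^sup>+x. ennreal (J_density a x) \<partial>lebesgue_on \<Omega>)"
    using J_density_borel[of a]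
    by (subst nn_integral_cmult[symmetric])
       (auto simp: ennreal_mult J_density_nonneg intro!: measurable_compose[OF _ measurable_ennreal] measurable_restrict_space1 measurable_completion)
  also have "\<dots> < \<infinity>" using J_density_finite[OF a] by (simp add: ennreal_mult_less_top)
  finally have fin: "(\<integral>\<^sup>+x. ennreal (?dom x) \<partial>lebesgue_on \<Omega>) < \<infinity>" .
  have b1: "\<bar>Ex a q * cutoff k q\<bar> \<le> 3 * Ex a q" for k q
    using cutoff_bounds(1,2)[of k q] Ex_pos[of a q] by (simp add: abs_mult)
  have b2: "\<bar>Ex a q * dcutoff k q + - a * Ex a q * cutoff k q\<bar> \<le> (3 * a + 6) * Ex a q" for k q
  proof -
    have "\<bar>Ex a q * dcutoff k q + - a * Ex a q * cutoff k q\<bar> \<le> Ex a q * \<bar>dcutoff k q\<bar> + a * Ex a q * cutoff k q"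
      using cutoff_bounds(1)[of k q] Ex_pos[of a q] a by (intro order_trans[OF abs_triangle_ineq]) (simp add: abs_mult)
    also have "\<dots> \<le> Ex a q * 6 + a * Ex a q * 3"
      using cutoff_bounds[of k q] Ex_pos[of a q] a by (intro add_mono mult_left_mono) auto
    finally show ?thesis by (simp add: algebra_simps)
  qed
  have lz: "(\<lambda>k. (Ex a (x \<bullet> x) * cutoff k (x \<bullet> x)) *\<^sub>R ZZ (1 / real (Suc k)) x) \<longlonglongrightarrow> (Ex a (x \<bullet> x) * 1) *\<^sub>R ZZ 0 x"
    if "x \<in> \<Omega>" for x
    using that by (intro tendsto_intros cutoff_lim tendsto_ZZ inverse_Suc_lim pp_pos) (simp add: norm_Omega)
  have ld: "(\<lambda>k. DYZ (Ex a (x \<bullet> x) * cutoff k (x \<bullet> x)) (Ex a (x \<bullet> x) * dcutoff k (x \<bullet> x) + - a * Ex a (x \<bullet> x) * cutoff k (x \<bullet> x)) (1 / real (Suc k)) x b)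
       \<longlonglongrightarrow> DYZ (Ex a (x \<bullet> x) * 1) (Ex a (x \<bullet> x) * 0 + - a * Ex a (x \<bullet> x) * 1) 0 x b" if "x \<in> \<Omega>" for x b
    unfolding DYZ_def
    using that by (intro tendsto_intros cutoff_lim tendsto_ZZ inverse_Suc_lim pp_pos) (simp_all add: norm_Omega)
  have l1: "(\<lambda>k. approximant a k x) \<longlonglongrightarrow> competitor a x" if "x \<in> \<Omega>" for x
    using tendsto_Uz[OF lz[OF that]] by (simp add: approximant_def competitor_def)
  have l2: "(\<lambda>k. frechet_derivative (approximant a k) (at x) b) \<longlonglongrightarrow> dcompetitor a b x" if "x \<in> \<Omega>" for x b
    using tendsto_dUz[OF lz[OF that] ld[OF that]] by (simp add: approximant_derivative dcompetitor_def)
  have e: "0 \<le> 1 / real (Suc k)" for k by simp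
  have n1: "(norm (approximant a k x))\<^sup>2 \<le> ?dom x" if "x \<in> \<Omega>" for k x
    unfolding approximant_def by (rule DYZ_bounds(1)[OF _ e a refl b1 b2]) (use that in \<open>simp add: norm_Omega\<close>)
  have n2: "(norm (frechet_derivative (approximant a k) (at x) b))\<^sup>2 \<le> ?dom x" if "x \<in> \<Omega>" "b \<in> Basis" for k x b
    unfolding approximant_derivative by (rule DYZ_bounds(2)[OF _ e a refl b1 b2 that(2)]) (use that in \<open>simp add: norm_Omega\<close>)
  note H = H1_limit[where w="approximant a" and u="competitor a" and v="dcompetitor a", OF open_Omega approximant_test_fun dom fin l1 l2 n1 n2]
  show "competitor a \<in> L2 \<Omega>" by (rule H(1))
  show "\<And>b. b \<in> Basis \<Longrightarrow> dcompetitor a b \<in> L2 \<Omega>" by (rule H(2))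
  show "\<And>b. b \<in> Basis \<Longrightarrow> has_weak_deriv \<Omega> b (competitor a) (dcompetitor a b)" by (rule H(3))
  show "(\<lambda>k. \<integral>\<^sup>+x. ennreal ((norm (approximant a k x - competitor a x))\<^sup>2) \<partial>lebesgue_on \<Omega>) \<longlonglongrightarrow> 0" by (rule H(4))
  show "\<And>b. b \<in> Basis \<Longrightarrow> (\<lambda>k. \<integral>\<^sup>+x. ennreal ((norm (frechet_derivative (approximant a k) (at x) b - weak_deriv \<Omega> b (competitor a) x))\<^sup>2) \<partial>lebesgue_on \<Omega>) \<longlonglongrightarrow> 0" by (rule H(5))
qed

lemma Uz_norm_le: "z$3 = 0 \<Longrightarrow> norm (Uz z) \<le> 2"
proof -
  assume z: "z$3 = 0"
  define d where "d = z \<bullet> z"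
  have d: "d \<ge> 0" by (simp add: d_def)
  have "0 \<le> (1 - d)\<^sup>2" by simp
  then have "8 * d \<le> 4 * (1 + d)\<^sup>2" using d by (simp add: power2_eq_square algebra_simps)
  then have "8 * d / (1 + d)\<^sup>2 \<le> 4" using d by (subst pos_divide_le_eq) auto
  then have "(norm (Uz z))\<^sup>2 \<le> 2\<^sup>2" unfolding Uz_norm[OF z] d_def by simp
  then show ?thesis by (rule power2_le_imp_le) simp
qed

text \<open>On the sphere the exponential is 1, so off the poles the approximants tend to the
  boundary datum. Being bounded uniformly, they converge in L2 of the sphere in spite of the
  singular poles.\<close>

lemma competitor_admissible:
  assumes a: "a > 0" and e: "longitudinal e"
  shows "(\<lambda>x. Q_inf + competitor a x) \<in> admissible (Q_phi e)"
proof -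
  note H = competitor_H1[OF a]
  have S: "competitor a x \<in> S0" for x unfolding competitor_def by (rule Uz_S0) simp
  have H1: "competitor a \<in> H1 \<Omega> S0"
    unfolding H1_def using H(1,2,3) S by blast
  have m: "(\<lambda>p. (norm (approximant a k (sph (fst p) (snd p)) - (Q_bd (fst p) (snd p) - Q_inf)))\<^sup>2) \<in> borel_measurable borel" for k
  proof (intro borel_measurable_continuous_onI continuous_intros continuous_Q_bd)
    have "continuous_on UNIV (approximant a k)"
      using approximant_test_fun[of a k] smooth_derivative(2) by (auto simp: test_fun_def)
    then show "continuous_on UNIV (\<lambda>p. approximant a k (sph (fst p) (snd p)))"
      by (rule continuous_on_compose2[OF _ continuous_sph]) simp
  qed
  have bd: "norm (approximant a k x) \<le> 2" for k x unfolding approximant_def by (rule Uz_norm_le) simp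
  have lim: "(\<lambda>k. approximant a k (sph \<phi> \<theta>)) \<longlonglongrightarrow> Q_bd \<phi> \<theta> - Q_inf" if \<phi>: "0 < \<phi>" "\<phi> < pi" for \<phi> \<theta>
  proof -
    have one: "sph \<phi> \<theta> \<bullet> sph \<phi> \<theta> = 1" using norm_sph[of \<phi> \<theta>] by (simp add: norm_eq_1)
    have "(\<lambda>k. (Ex a 1 * cutoff k 1) *\<^sub>R ZZ (1 / real (Suc k)) (sph \<phi> \<theta>)) \<longlonglongrightarrow> (Ex a 1 * 1) *\<^sub>R ZZ 0 (sph \<phi> \<theta>)"
      by (intro tendsto_intros cutoff_lim tendsto_ZZ inverse_Suc_lim Uz_ZZ_boundary(2)[OF \<phi>])
    from tendsto_Uz[OF this] show ?thesis
      unfolding Uz_ZZ_boundary(1)[OF \<phi>, symmetric] approximant_def one by (simp add: Ex_def)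
  qed
  have nQ: "norm (Q_bd \<phi> \<theta> - Q_inf) \<le> 2" if "0 < \<phi>" "\<phi> < pi" for \<phi> \<theta>
    using LIMSEQ_le_const2[OF tendsto_norm[OF lim[OF that]]] bd by blast
  \<comment> \<open>Both tensors have norm at most 2 in the open range of the polar angle, so the
    minimum changes nothing there; elsewhere it supplies the global bound asked for by
    \<open>sint_dominated\<close>.\<close>
  let ?k = "\<lambda>k \<phi> \<theta>. min 16 ((norm (approximant a k (sph \<phi> \<theta>) - (Q_bd \<phi> \<theta> - Q_inf)))\<^sup>2)"
  have eq: "sphere_nn_integral (\<lambda>\<omega>. (norm (approximant a k \<omega> - (Q_phi e \<omega> - Q_inf)))\<^sup>2) = sint (\<lambda>\<phi> \<theta>. ennreal (?k k \<phi> \<theta>))" for k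
  proof (subst sphere_nn_integral_sint)
    show "sint (\<lambda>\<phi> \<theta>. ennreal ((norm (approximant a k (sph \<phi> \<theta>) - (Q_phi e (sph \<phi> \<theta>) - Q_inf)))\<^sup>2)) = sint (\<lambda>\<phi> \<theta>. ennreal (?k k \<phi> \<theta>))"
    proof (rule sint_cong)
      fix \<phi> \<theta> :: real assume *: "0 < \<phi>" "\<phi> < pi" "0 \<le> \<theta>" "\<theta> < 2*pi"
      have "norm (approximant a k (sph \<phi> \<theta>) - (Q_bd \<phi> \<theta> - Q_inf)) \<le> 2 + 2"
        by (rule order_trans[OF norm_triangle_ineq4 add_mono[OF bd nQ[OF *(1,2)]]])
      then have "(norm (approximant a k (sph \<phi> \<theta>) - (Q_bd \<phi> \<theta> - Q_inf)))\<^sup>2 \<le> 4\<^sup>2" by (intro power_mono) auto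
      then show "ennreal ((norm (approximant a k (sph \<phi> \<theta>) - (Q_phi e (sph \<phi> \<theta>) - Q_inf)))\<^sup>2) = ennreal (?k k \<phi> \<theta>)"
        unfolding Q_phi_sph[OF e *] by (simp add: min_absorb2)
    qed
  qed simp
  have tr: "(\<lambda>k. sint (\<lambda>\<phi> \<theta>. ennreal (?k k \<phi> \<theta>))) \<longlonglongrightarrow> 0"
  proof (rule sint_dominated[where C=16])
    show "(\<lambda>p. ?k n (fst p) (snd p)) \<in> borel_measurable borel" for n
      by (intro borel_measurable_min borel_measurable_const m)
    show "(\<lambda>n. ?k n \<phi> \<theta>) \<longlonglongrightarrow> 0" if "0 < \<phi>" "\<phi> < pi" for \<phi> \<theta>
    proof -
      have "(\<lambda>n. ?k n \<phi> \<theta>) \<longlonglongrightarrow> min 16 ((norm ((Q_bd \<phi> \<theta> - Q_inf) - (Q_bd \<phi> \<theta> - Q_inf)))\<^sup>2)"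
        by (intro tendsto_min tendsto_intros lim that)
      then show ?thesis by simp
    qed
  qed auto
  have "has_trace (competitor a) (\<lambda>\<omega>. Q_phi e \<omega> - Q_inf)"
    unfolding has_trace_def
  proof (intro exI[of _ "approximant a"] conjI allI ballI)
    show "(\<lambda>k. sphere_nn_integral (\<lambda>\<omega>. (norm (approximant a k \<omega> - (Q_phi e \<omega> - Q_inf)))\<^sup>2)) \<longlonglongrightarrow> 0"
      unfolding eq by (rule tr)
  qed (rule approximant_test_fun H(4) H(5), assumption?)+
  then show ?thesis using H1 by (simp add: admissible_def)
qed

section \<open>Energy of the competitor\<close>

definition mm :: "real \<Rightarrow> real" where
  "mm z = 4 * z / (1 + z)\<^sup>2"

text \<open>With z the squared length of a stereographic coordinate, \<open>mm z\<close> is 1 -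
  n3^2. It grows as the director moves from \<open>e3\<close> to the equator, so bounds for the
  coordinate carry over to the potential.\<close>

lemma mm_mono:
  assumes "0 \<le> z" "z \<le> y" "y \<le> 1" shows "mm z \<le> mm y"
proof -
  have "z * y \<le> 1 * 1" using assms by (intro mult_mono) auto
  then have "0 \<le> (y - z) * (1 - z * y)" using assms by (intro mult_nonneg_nonneg) auto
  then have "4 * z * (1 + y)\<^sup>2 \<le> 4 * y * (1 + z)\<^sup>2" by (simp add: power2_eq_square algebra_simps)
  moreover have "(1 + y)\<^sup>2 > 0" "(1 + z)\<^sup>2 > 0" using assms by auto
  ultimately show ?thesis unfolding mm_def by (simp add: frac_le_eq divide_simps)
qed

lemma mm_nonneg: "z \<ge> 0 \<Longrightarrow> mm z \<ge> 0"
  by (simp add: mm_def)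

text \<open>With \<open>H = (1 - y) / (1 + y)\<close> and \<open>y = T * exp (- c * (r\<^sup>2 - 1) / \<eta>)\<close>, the bound of the integrand is
  \<open>c * H' * r * (1 + r\<^sup>2)\<close>, whose leading part \<open>2 * c * H'\<close> is exact.\<close>
lemma radial_upper:
  fixes c \<eta> s :: real
  assumes c: "c > 0" and \<eta>: "0 < \<eta>" "\<eta> \<le> 1" and s: "0 < s" "s \<le> 1"
  defines "T \<equiv> (1 - s) / (1 + s)"
  shows "(\<integral>\<^sup>+r. ennreal (c\<^sup>2 / \<eta> * (1 + r\<^sup>2) * mm (exp (- c * (r\<^sup>2 - 1) / \<eta>) * T) * r\<^sup>2) * indicator {1..} r \<partial>lborel)
    \<le> ennreal (2 * c * (1 - s) + 16 * (c + 1) / c * \<eta>)"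
proof -
  have T: "0 \<le> T" "T \<le> 1" using s by (simp_all add: T_def)
  define y where "y r = exp (- c * (r\<^sup>2 - 1) / \<eta>) * T" for r :: real
  \<comment> \<open>The square root of the exponential in \<open>y\<close>: one such factor absorbs
    the powers of r^2 - 1, the other is left to be integrated.\<close>
  define e where "e r = exp (- c * (r\<^sup>2 - 1) / (2 * \<eta>))" for r :: real
  define dy where "dy r = - (2 * c * r / \<eta>) * y r" for r :: real
  have y: "0 \<le> y r" for r using T by (simp add: y_def)
  have yp: "1 + y r > 0" for r using y[of r] by simp
  have dy: "(y has_real_derivative dy r) (at r)" for r
    unfolding y_def[abs_def] dy_def y_def using \<eta> by (auto intro!: derivative_eq_intros)
  have de: "(e has_real_derivative - (c * r / \<eta>) * e r) (at r)" for r
    unfolding e_def[abs_def] e_def using \<eta> by (auto intro!: derivative_eq_intros)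
  \<comment> \<open>The second summand is the derivative of a multiple of \<open>e\<close> of size
    \<eta>; its integral is the error term 16 (c + 1) \<eta> / c.\<close>
  define f where "f r = 2 * c * ((c * r / \<eta>) * mm (y r)) + 16 * (c + 1) * r * e r" for r :: real
  have dH: "((\<lambda>r. (1 - y r) / (1 + y r)) has_real_derivative (c * r / \<eta>) * mm (y r)) (at r)" for r
  proof -
    have "((\<lambda>r. (1 - y r) / (1 + y r)) has_real_derivative ((0 - dy r) * (1 + y r) - (1 - y r) * (0 + dy r)) / ((1 + y r) * (1 + y r))) (at r)"
      using yp[of r] by (intro DERIV_divide DERIV_diff DERIV_add DERIV_const dy) auto
    moreover have "((0 - dy r) * (1 + y r) - (1 - y r) * (0 + dy r)) / ((1 + y r) * (1 + y r)) = (c * r / \<eta>) * mm (y r)"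
    proof -
      have "(0 - dy r) * (1 + y r) - (1 - y r) * (0 + dy r) = - 2 * dy r" by (simp add: algebra_simps)
      then show ?thesis by (simp add: dy_def mm_def power2_eq_square)
    qed
    ultimately show ?thesis by simp
  qed
  have "(\<integral>\<^sup>+r. ennreal (c\<^sup>2 / \<eta> * (1 + r\<^sup>2) * mm (y r) * r\<^sup>2) * indicator {1..} r \<partial>lborel) \<le> (\<integral>\<^sup>+r. ennreal (f r) * indicator {1..} r \<partial>lborel)"
  proof (rule nn_integral_mono)
    fix r :: real
    show "ennreal (c\<^sup>2 / \<eta> * (1 + r\<^sup>2) * mm (y r) * r\<^sup>2) * indicator {1..} r \<le> ennreal (f r) * indicator {1..} r"
    proof (cases "r \<ge> 1")
      case True
      define q where "q = r\<^sup>2 - 1"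
      have q: "q \<ge> 0" using one_le_power[OF True, of 2] by (simp add: q_def)
      \<comment> \<open>The tangent bound for the root of 1 + q. The leading part of (1 + r^2) r is
        then its value 2 on the sphere, and the rest has a factor q.\<close>
      have "r \<le> 1 + q / 2"
      proof -
        have "0 \<le> (r - 1)\<^sup>2" by simp
        then show ?thesis by (simp add: q_def power2_eq_square field_simps)
      qed
      then have "r * (2 + q) \<le> (1 + q / 2) * (2 + q)" using q by (intro mult_right_mono) auto
      moreover have "(1 + q / 2) * (2 + q) = 2 + (2 * q + q\<^sup>2 / 2)" by (simp add: power2_eq_square field_simps)
      moreover have "(1 + r\<^sup>2) * r = r * (2 + q)" by (simp add: q_def)
      ultimately have rq: "(1 + r\<^sup>2) * r \<le> 2 + (2 * q + q\<^sup>2 / 2)" by (simp only:)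
      have m0: "(c * r / \<eta>) * mm (y r) \<ge> 0" using c True \<eta> mm_nonneg[OF y] by simp
      have "c\<^sup>2 / \<eta> * (1 + r\<^sup>2) * mm (y r) * r\<^sup>2 = c * ((c * r / \<eta>) * mm (y r)) * ((1 + r\<^sup>2) * r)"
        by (simp add: power2_eq_square)
      also have "\<dots> \<le> c * ((c * r / \<eta>) * mm (y r)) * (2 + (2 * q + q\<^sup>2 / 2))"
        using c m0 by (intro mult_left_mono rq mult_nonneg_nonneg[OF _ m0]) simp
      also have "\<dots> = 2 * c * ((c * r / \<eta>) * mm (y r)) + c * (c * r / \<eta>) * (mm (y r) * (2 * q + q\<^sup>2 / 2))"
        by (simp add: algebra_simps)
      also have "c * (c * r / \<eta>) * (mm (y r) * (2 * q + q\<^sup>2 / 2)) \<le> c * (c * r / \<eta>) * (4 * (e r * (4 / c + 4 / c\<^sup>2) * \<eta>))"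
      proof (rule mult_left_mono)
        \<comment> \<open>In this variable \<open>e r\<close> is exp (-u), and u exp (-u) <= 1 and
          u^2 exp (-u) <= 2 dispose of the powers of q. Since \<eta> <= 1, both contributions are of
          order \<eta>.\<close>
        define u where "u = c * q / (2 * \<eta>)"
        have u: "u \<ge> 0" using c q \<eta> by (simp add: u_def)
        have qu: "q = 2 * \<eta> / c * u" using c \<eta> by (simp add: u_def)
        have eu: "e r = exp (- u)" by (simp add: e_def u_def q_def)
        have E2: "exp (- c * (r\<^sup>2 - 1) / \<eta>) = exp (- u) * exp (- u)"
          using \<eta> by (simp add: exp_add[symmetric] u_def q_def)
        have "1 + u + u\<^sup>2 / 2 \<le> exp u" by (rule exp_lower_Taylor_quadratic[OF u])
        then have "u \<le> exp u" "u\<^sup>2 \<le> 2 * exp u" using u zero_le_power2[of u] by linarith+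
        then have "u * exp (- u) \<le> exp u * exp (- u)" "u\<^sup>2 * exp (- u) \<le> 2 * exp u * exp (- u)"
          by (intro mult_right_mono; simp)+
        then have u1: "u * exp (- u) \<le> 1" and u2: "u\<^sup>2 * exp (- u) \<le> 2"
          by (simp_all add: mult.assoc exp_add[symmetric])
        have ey: "y r \<le> exp (- u) * exp (- u) * 1" unfolding y_def E2 using T by (intro mult_left_mono) auto
        have "mm (y r) \<le> 4 * y r"
        proof -
          have "1\<^sup>2 \<le> (1 + y r)\<^sup>2" using y[of r] by (intro power_mono) auto
          then have "4 * y r / (1 + y r)\<^sup>2 \<le> 4 * y r / 1" using y[of r] by (intro frac_le) auto
          then show ?thesis by (simp add: mm_def)
        qed
        then have "mm (y r) * (2 * q + q\<^sup>2 / 2) \<le> 4 * (exp (- u) * exp (- u)) * (2 * q + q\<^sup>2 / 2)"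
          using ey q by (intro mult_right_mono) auto
        also have "\<dots> = 4 * (exp (- u) * ((4 * \<eta> / c) * (u * exp (- u)) + (2 * \<eta>\<^sup>2 / c\<^sup>2) * (u\<^sup>2 * exp (- u))))"
          unfolding qu by (simp add: power2_eq_square algebra_simps)
        also have "\<dots> \<le> 4 * (exp (- u) * ((4 * \<eta> / c) * 1 + (2 * \<eta> / c\<^sup>2) * 2))"
        proof (intro mult_left_mono add_mono mult_mono)
          show "2 * \<eta>\<^sup>2 / c\<^sup>2 \<le> 2 * \<eta> / c\<^sup>2" using \<eta> by (intro divide_right_mono) (auto simp: power2_eq_square)
        qed (use u1 u2 c \<eta> in auto)
        also have "\<dots> = 4 * (e r * (4 / c + 4 / c\<^sup>2) * \<eta>)" by (simp add: eu algebra_simps)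
        finally show "mm (y r) * (2 * q + q\<^sup>2 / 2) \<le> 4 * (e r * (4 / c + 4 / c\<^sup>2) * \<eta>)" .
        show "0 \<le> c * (c * r / \<eta>)" using c True \<eta> by simp
      qed
      also have "c * (c * r / \<eta>) * (4 * (e r * (4 / c + 4 / c\<^sup>2) * \<eta>)) = 16 * (c + 1) * r * e r"
        using c \<eta> by (simp add: field_simps power2_eq_square)
      finally have "c\<^sup>2 / \<eta> * (1 + r\<^sup>2) * mm (y r) * r\<^sup>2 \<le> f r" by (simp add: f_def)
      then show ?thesis using True by (simp add: ennreal_leI)
    qed simp
  qed
  also have "\<dots> = ennreal (2 * c * 1 - 16 * (c + 1) * \<eta> / c * 0 - (2 * c * ((1 - y 1) / (1 + y 1)) - 16 * (c + 1) * \<eta> / c * e 1))"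
  proof (rule nn_integral_FTC_atLeast[where F="\<lambda>r. 2 * c * ((1 - y r) / (1 + y r)) - 16 * (c + 1) * \<eta> / c * e r"])
    have yc: "continuous_on UNIV y" "continuous_on UNIV e"
      using DERIV_isCont[OF dy] DERIV_isCont[OF de] by (auto intro: continuous_at_imp_continuous_on)
    have "continuous_on UNIV f"
      unfolding f_def[abs_def] mm_def using less_imp_neq[OF yp] \<eta>
      by (auto intro!: continuous_on_mult continuous_on_divide continuous_on_add continuous_on_power
          continuous_on_const continuous_on_id yc)
    then show "f \<in> borel_measurable borel" by (rule borel_measurable_continuous_onI)
    show "((\<lambda>r. 2 * c * ((1 - y r) / (1 + y r)) - 16 * (c + 1) * \<eta> / c * e r) has_real_derivative f r) (at r)" for r
    proof (rule DERIV_cong[OF DERIV_diff[OF DERIV_cmult[OF dH] DERIV_cmult[OF de]]])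
      have "16 * (c + 1) * \<eta> / c * (- (c * r / \<eta>) * e r) = - (16 * (c + 1) * r * e r)"
        using c \<eta> by simp
      then show "2 * c * ((c * r / \<eta>) * mm (y r)) - 16 * (c + 1) * \<eta> / c * (- (c * r / \<eta>) * e r) = f r"
        by (simp only: f_def)
    qed
    show "0 \<le> f r" if "1 \<le> r" for r
      unfolding f_def using that c \<eta> mm_nonneg[OF y] by (intro add_nonneg_nonneg mult_nonneg_nonneg) (auto simp: e_def)
    have y0: "(y \<longlongrightarrow> 0) at_top"
    proof -
      have "((\<lambda>r. exp (- c * (r\<^sup>2 - 1) / \<eta>)) \<longlongrightarrow> 0) at_top" using c \<eta> by real_asymp
      from tendsto_mult_right[OF this, of T] show ?thesis by (simp add: y_def[abs_def])
    qed
    have e0: "(e \<longlongrightarrow> 0) at_top"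
      unfolding e_def[abs_def] using c \<eta> by real_asymp
    have "((\<lambda>r. 2 * c * ((1 - y r) / (1 + y r)) - 16 * (c + 1) * \<eta> / c * e r) \<longlongrightarrow> 2 * c * ((1 - 0) / (1 + 0)) - 16 * (c + 1) * \<eta> / c * 0) at_top"
      by (rule tendsto_diff[OF tendsto_mult_left[OF tendsto_divide[OF tendsto_diff[OF tendsto_const y0] tendsto_add[OF tendsto_const y0]]] tendsto_mult_left[OF e0]]) simp
    then show "((\<lambda>r. 2 * c * ((1 - y r) / (1 + y r)) - 16 * (c + 1) * \<eta> / c * e r) \<longlongrightarrow> 2 * c * 1 - 16 * (c + 1) * \<eta> / c * 0) at_top" by simp
  qed
  also have "2 * c * 1 - 16 * (c + 1) * \<eta> / c * 0 - (2 * c * ((1 - y 1) / (1 + y 1)) - 16 * (c + 1) * \<eta> / c * e 1) = 2 * c * (1 - s) + 16 * (c + 1) / c * \<eta>"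
  proof -
    have "y 1 = T" "e 1 = 1" by (simp_all add: y_def e_def)
    moreover have "(1 - T) / (1 + T) = s" using s by (simp add: T_def field_simps)
    ultimately show ?thesis by (simp add: algebra_simps)
  qed
  finally show ?thesis by (simp add: y_def)
qed

text \<open>The derivative of the profile and the potential form the main term: x \<bullet> x comes
  from the gradient, 1 from the potential, and on the sphere the two balance. The gradient of the
  extended coordinate carries no 1 / \<eta>, so after multiplication of the energy by \<eta> it
  leaves a term that vanishes with \<eta>. The constant 972 is 4 * 3 * 81.\<close>

lemma competitor_density:
  fixes c \<eta> t :: real
  assumes x: "norm x > 1" and c: "c > 0" "c\<^sup>2 = sqrt (3/2)" and \<eta>: "0 < \<eta>" "\<eta> \<le> 1" and t: "t > 0"
  defines "a \<equiv> c / (2 * \<eta>)"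
  shows "(1/2) * (\<Sum>b\<in>Basis. (norm (dcompetitor a b x))\<^sup>2) + f_pot (Q_inf + competitor a x) / \<xi>\<^sup>2 + g_pot g0 (Q_inf + competitor a x) / \<eta>\<^sup>2
    \<le> 1 / \<eta> * ((1 + t) * (c\<^sup>2 / \<eta> * (1 + x \<bullet> x) * mm (exp (- c * (x \<bullet> x - 1) / \<eta>) * (x$3 / (norm x + norm (hz x)))\<^sup>2))
       + 972 * (1 + 1/t) * \<eta> * J_density (c / 2) x)"
proof -
  define E where "E = Ex a (x \<bullet> x)"
  define Z where "Z = ZZ 0 x"
  define z where "z = (E *\<^sub>R Z) \<bullet> (E *\<^sub>R Z)"
  define P where "P = sqrt (pp x)"
  define r where "r = norm x"
  define D where "D b = DYZ E (- a * E) 0 x b" for b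
  define J where "J = J_density (c / 2) x"
  define W where "W = mm (exp (- c * (x \<bullet> x - 1) / \<eta>) * (x$3 / (norm x + norm (hz x)))\<^sup>2)"
  have r: "r > 1" using x by (simp add: r_def)
  have xx: "x \<bullet> x = r\<^sup>2" by (simp add: r_def dot_square_norm)
  have r2: "r\<^sup>2 \<ge> 1" using r by simp
  have pp: "pp x > 0" by (rule pp_pos[OF x])
  have P: "P > 0" "P\<^sup>2 = pp x" using pp by (simp_all add: P_def)
  have E0: "E > 0" by (simp add: E_def Ex_pos)
  have E2: "E\<^sup>2 = exp (- c * (x \<bullet> x - 1) / \<eta>)"
    using \<eta> by (simp add: E_def Ex_def a_def power2_eq_square exp_add[symmetric])
  have z0: "z \<ge> 0" unfolding z_def by (rule inner_ge_zero)
  have zeq: "z = E\<^sup>2 * (norm Z)\<^sup>2" by (simp add: z_def power2_eq_square dot_square_norm)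
  have W: "mm z \<le> W" unfolding W_def
  proof (rule mm_mono[OF z0])
    have "(norm Z)\<^sup>2 \<le> (\<bar>x$3\<bar> / (norm x + norm (hz x)))\<^sup>2"
      unfolding Z_def using ZZ_bounds(1)[OF _ pp] x by (intro power_mono) auto
    also have "\<dots> = (x$3 / (norm x + norm (hz x)))\<^sup>2" by (simp add: power_divide)
    finally show "z \<le> exp (- c * (x \<bullet> x - 1) / \<eta>) * (x$3 / (norm x + norm (hz x)))\<^sup>2"
      unfolding zeq E2 by (intro mult_left_mono) auto
    have "exp (- c * (x \<bullet> x - 1) / \<eta>) \<le> 1"
      using c \<eta> r2 by (simp add: xx)
    moreover have "(\<bar>x$3\<bar> / (norm x + norm (hz x)))\<^sup>2 \<le> 1\<^sup>2"
    proof (intro power_mono)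
      have "\<bar>x$3\<bar> \<le> norm x + norm (hz x)" using component_le_norm_cart[of x 3] norm_ge_zero[of "hz x"] by linarith
      then show "\<bar>x$3\<bar> / (norm x + norm (hz x)) \<le> 1" by (intro divide_le_eq_1[THEN iffD2]) (use x in auto)
    qed simp
    then have "(x$3 / (norm x + norm (hz x)))\<^sup>2 \<le> 1" by (simp add: power_divide)
    ultimately have "exp (- c * (x \<bullet> x - 1) / \<eta>) * (x$3 / (norm x + norm (hz x)))\<^sup>2 \<le> 1 * 1"
      by (intro mult_mono) auto
    then show "exp (- c * (x \<bullet> x - 1) / \<eta>) * (x$3 / (norm x + norm (hz x)))\<^sup>2 \<le> 1" by simp
  qed
  have W0: "W \<ge> 0" using W mm_nonneg[OF z0] by linarith
  \<comment> \<open>Since \<eta> <= 1, the exponential decays at least as fast as for \<eta> = 1.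
    The majorant thus has the rate c / 2 and an integral that does not depend on \<eta>.\<close>
  have J: "E\<^sup>2 * (r\<^sup>2 / P)\<^sup>2 \<le> J"
  proof -
    have "exp (- c * (x \<bullet> x - 1) / \<eta>) \<le> exp (- 2 * (c / 2) * (x \<bullet> x - 1))"
    proof -
      have "c * (x \<bullet> x - 1) * \<eta> \<le> c * (x \<bullet> x - 1) * 1" using c \<eta> r2 xx by (intro mult_left_mono) auto
      then show ?thesis using \<eta> by (simp add: pos_le_divide_eq)
    qed
    moreover have "(r\<^sup>2)\<^sup>2 \<le> (r\<^sup>2)^3" using r2 by (intro power_increasing) auto
    ultimately have "E\<^sup>2 * (r\<^sup>2)\<^sup>2 \<le> exp (- 2 * (c / 2) * (x \<bullet> x - 1)) * (r\<^sup>2)^3"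
      unfolding E2 by (intro mult_mono) auto
    then have "E\<^sup>2 * (r\<^sup>2)\<^sup>2 / pp x \<le> exp (- 2 * (c / 2) * (x \<bullet> x - 1)) * (r\<^sup>2)^3 / pp x"
      using pp by (intro divide_right_mono) auto
    then show ?thesis by (simp add: J_def J_density_def power_divide P(2) xx mult.commute)
  qed
  \<comment> \<open>Young's inequality separates the derivative of the profile, whose constant must
    tend to 1, from the gradient of \<open>ZZ\<close>, whose constant may be large; 81 is the square
    of 9.\<close>
  have Db: "(norm (D b))\<^sup>2 \<le> (1 + t) * ((c / \<eta>)\<^sup>2 * z) * (x \<bullet> b)\<^sup>2 + (1 + 1/t) * (81 * J)" if b: "b \<in> Basis" for b
  proof -
    have nb: "norm b = 1" using b by simp
    have D1: "norm (DZZ 0 x b) \<le> 9 * r\<^sup>2 / P"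
      using ZZ_bounds(3)[OF _ pp order_refl nb] x by (simp add: r_def P_def)
    have a2: "\<bar>- a * E * (2 * (x \<bullet> b))\<bar> = c / \<eta> * E * \<bar>x \<bullet> b\<bar>"
      using c \<eta> E0 by (simp add: a_def abs_mult)
    have "norm (D b) \<le> \<bar>- a * E * (2 * (x \<bullet> b))\<bar> * norm Z + \<bar>E\<bar> * norm (DZZ 0 x b)"
      unfolding D_def DYZ_def Z_def by (rule order_trans[OF norm_triangle_ineq]) simp
    also have "\<dots> = c / \<eta> * E * \<bar>x \<bullet> b\<bar> * norm Z + E * norm (DZZ 0 x b)" unfolding a2 using E0 by simp
    also have "\<dots> \<le> c / \<eta> * E * \<bar>x \<bullet> b\<bar> * norm Z + E * (9 * r\<^sup>2 / P)"
      using D1 E0 by (intro add_left_mono mult_left_mono) auto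
    finally have "(norm (D b))\<^sup>2 \<le> (1 + t) * (c / \<eta> * E * \<bar>x \<bullet> b\<bar> * norm Z)\<^sup>2 + (1 + 1/t) * (E * (9 * r\<^sup>2 / P))\<^sup>2"
      by (rule square_young[OF norm_ge_zero _ t])
    also have "(c / \<eta> * E * \<bar>x \<bullet> b\<bar> * norm Z)\<^sup>2 = (c / \<eta>)\<^sup>2 * z * (x \<bullet> b)\<^sup>2"
      by (simp add: zeq power_mult_distrib power_divide)
    also have "(E * (9 * r\<^sup>2 / P))\<^sup>2 = 81 * (E\<^sup>2 * (r\<^sup>2 / P)\<^sup>2)"
      by (simp add: power_mult_distrib power_divide)
    also have "(1 + 1/t) * (81 * (E\<^sup>2 * (r\<^sup>2 / P)\<^sup>2)) \<le> (1 + 1/t) * (81 * J)"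
      using t J by (intro mult_left_mono) auto
    finally show ?thesis by (simp add: mult_ac)
  qed
  have sx: "(\<Sum>b\<in>Basis. (x \<bullet> b)\<^sup>2) = r\<^sup>2"
    unfolding xx[symmetric] by (simp add: euclidean_inner[of x x] power2_eq_square)
  have "(\<Sum>b\<in>Basis. (norm (D b))\<^sup>2) \<le> (\<Sum>b\<in>(Basis :: (real^3) set). (1 + t) * ((c / \<eta>)\<^sup>2 * z) * (x \<bullet> b)\<^sup>2 + (1 + 1/t) * (81 * J))"
    by (rule sum_mono) (rule Db)
  also have "\<dots> = (1 + t) * ((c / \<eta>)\<^sup>2 * z) * r\<^sup>2 + 243 * (1 + 1/t) * J"
    unfolding sum.distrib sum_distrib_left[symmetric] sx by simp
  finally have G: "(\<Sum>b\<in>Basis. (norm (D b))\<^sup>2) \<le> (1 + t) * ((c / \<eta>)\<^sup>2 * z) * r\<^sup>2 + 243 * (1 + 1/t) * J" .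
  have J0: "J \<ge> 0" by (simp add: J_def J_density_nonneg)
  have d1: "(1 + z)\<^sup>2 \<ge> 1" using z0 by simp
  have "(1/2) * (\<Sum>b\<in>Basis. (norm (dcompetitor a b x))\<^sup>2) = 4 * (\<Sum>b\<in>Basis. (norm (D b))\<^sup>2) / (1 + z)\<^sup>2"
  proof -
    have "(norm (dcompetitor a b x))\<^sup>2 = 8 * (norm (D b))\<^sup>2 / (1 + z)\<^sup>2" for b
      unfolding dcompetitor_def z_def D_def E_def Z_def by (rule dUz_norm) simp_all
    then show ?thesis by (simp add: sum_distrib_left[symmetric] sum_divide_distrib[symmetric])
  qed
  also have "\<dots> \<le> 4 * ((1 + t) * ((c / \<eta>)\<^sup>2 * z) * r\<^sup>2 + 243 * (1 + 1/t) * J) / (1 + z)\<^sup>2"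
    using G by (intro divide_right_mono mult_left_mono) auto
  also have "\<dots> = (1 + t) * ((c / \<eta>)\<^sup>2 * r\<^sup>2 * mm z) + 972 * (1 + 1/t) * J / (1 + z)\<^sup>2"
    by (simp add: mm_def add_divide_distrib algebra_simps)
  also have "\<dots> \<le> (1 + t) * ((c / \<eta>)\<^sup>2 * r\<^sup>2 * W) + 972 * (1 + 1/t) * J / 1"
    using t W J0 d1 by (intro add_mono mult_left_mono divide_left_mono) auto
  finally have grad: "(1/2) * (\<Sum>b\<in>Basis. (norm (dcompetitor a b x))\<^sup>2) \<le> (1 + t) * ((c / \<eta>)\<^sup>2 * r\<^sup>2 * W) + 972 * (1 + 1/t) * J" by simp
  have third: "(E *\<^sub>R Z) $ 3 = 0" by (simp add: Z_def)
  have competitor: "competitor a x = Uz (E *\<^sub>R Z)" by (simp add: competitor_def E_def Z_def)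
  have "g_pot g0 (Q_inf + competitor a x) = c\<^sup>2 * mm z"
    unfolding competitor g_pot_Uz[OF third] c(2) mm_def z_def ..
  also have "\<dots> \<le> (1 + t) * (c\<^sup>2 * W)"
  proof -
    have "c\<^sup>2 * mm z \<le> 1 * (c\<^sup>2 * W)" using W by (simp add: mult_left_mono)
    also have "\<dots> \<le> (1 + t) * (c\<^sup>2 * W)" using t W0 by (intro mult_right_mono) auto
    finally show ?thesis .
  qed
  finally have pot: "g_pot g0 (Q_inf + competitor a x) / \<eta>\<^sup>2 \<le> (1 + t) * (c\<^sup>2 * W) / \<eta>\<^sup>2" by (rule divide_right_mono) simp
  have "f_pot (Q_inf + competitor a x) = 0" unfolding competitor by (rule f_pot_Uz[OF third])
  then have "(1/2) * (\<Sum>b\<in>Basis. (norm (dcompetitor a b x))\<^sup>2) + f_pot (Q_inf + competitor a x) / \<xi>\<^sup>2 + g_pot g0 (Q_inf + competitor a x) / \<eta>\<^sup>2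
    \<le> (1 + t) * ((c / \<eta>)\<^sup>2 * r\<^sup>2 * W) + 972 * (1 + 1/t) * J + (1 + t) * (c\<^sup>2 * W) / \<eta>\<^sup>2"
    using grad pot by simp
  also have "\<dots> = 1 / \<eta> * ((1 + t) * (c\<^sup>2 / \<eta> * (1 + r\<^sup>2) * W) + 972 * (1 + 1/t) * \<eta> * J)"
  proof -
    have "(1 + t) * ((c / \<eta>)\<^sup>2 * r\<^sup>2 * W) + (1 + t) * (c\<^sup>2 * W) / \<eta>\<^sup>2 = 1 / \<eta> * ((1 + t) * (c\<^sup>2 / \<eta> * (1 + r\<^sup>2) * W))"
      by (simp add: power_divide power2_eq_square[of \<eta>] add_divide_distrib distrib_left distrib_right mult_ac)
    moreover have "1 / \<eta> * (972 * (1 + 1/t) * \<eta> * J) = 972 * (1 + 1/t) * J" using \<eta> by simp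
    ultimately show ?thesis by (simp only: distrib_left[of "1 / \<eta>"])
  qed
  finally show ?thesis by (simp only: W_def J_def xx)
qed

text \<open>The bound for the length of \<open>ZZ\<close> depends on the direction only, so every
  ray reduces to \<open>radial_upper\<close> with s = sin \<phi>. Its main term is \<kappa> (1 - sin
  \<phi>), whose surface integral is known.\<close>

lemma energy_upper:
  fixes \<kappa> c \<eta> t g0 :: real
  assumes \<kappa>: "\<kappa> = root 4 24" and \<eta>: "0 < \<eta>" "\<eta> \<le> 1" and t: "t > 0"
  defines "c \<equiv> \<kappa> / 2"
  shows "ennreal \<eta> * energy g0 \<xi> \<eta> (\<lambda>x. Q_inf + competitor (c / (2 * \<eta>)) x)
    \<le> ennreal (1 + t) * ennreal (pi * (4 - pi) * \<kappa> + 4 * pi * (16 * (c + 1) / c * \<eta>))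
      + ennreal (972 * (1 + 1/t) * \<eta>) * (\<integral>\<^sup>+x. ennreal (J_density (c / 2) x) \<partial>lebesgue_on \<Omega>)"
proof -
  let ?M = "lebesgue_on \<Omega>"
  have c: "c > 0" "c\<^sup>2 = sqrt (3/2)" and \<kappa>0: "\<kappa> > 0" unfolding c_def using kappa_sq[OF \<kappa>] by auto
  define a where "a = c / (2 * \<eta>)"
  have a: "a > 0" using c \<eta> by (simp add: a_def)
  define A where "A x = c\<^sup>2 / \<eta> * (1 + x \<bullet> x) * mm (exp (- c * (x \<bullet> x - 1) / \<eta>) * (x$3 / (norm x + norm (hz x)))\<^sup>2)" for x :: "real^3"
  define J where "J = J_density (c / 2)"
  have A0: "A x \<ge> 0" for x unfolding A_def using \<eta> mm_nonneg by simp
  have J0: "J x \<ge> 0" for x by (simp add: J_def J_density_nonneg)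
  have "A \<in> borel_measurable borel"
    unfolding A_def[abs_def] mm_def
    by (intro borel_measurable_times borel_measurable_divide borel_measurable_add borel_measurable_power borel_measurable_const
       borel_measurable_continuous_onI continuous_intros linear_continuous_on[OF bounded_linear_hz])
      (use \<eta> in auto)
  then have Am: "(\<lambda>x. ennreal (A x)) \<in> borel_measurable borel" by (rule measurable_compose[OF _ measurable_ennreal])
  have Jm: "(\<lambda>x. ennreal (J x)) \<in> borel_measurable borel"
    unfolding J_def by (rule measurable_compose[OF J_density_borel measurable_ennreal])
  have toM: "f \<in> borel_measurable borel \<Longrightarrow> f \<in> borel_measurable ?M" for f :: "real^3 \<Rightarrow> ennreal"
    by (intro measurable_restrict_space1 measurable_completion) simp
  have wd: "weak_deriv \<Omega> b (\<lambda>x. Q_inf + competitor a x) = weak_deriv \<Omega> b (competitor a)" if "b \<in> Basis" for b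
    using weak_deriv_shift[OF open_Omega that, of "\<lambda>x. Q_inf + competitor a x" Q_inf] by simp
  have "AE x in ?M. weak_deriv \<Omega> b (\<lambda>x. Q_inf + competitor a x) x = dcompetitor a b x" if "b \<in> Basis" for b
    unfolding wd[OF that] by (rule weak_deriv_AE(2)[OF open_Omega competitor_H1(3)[OF a that]])
  then have AE: "AE x in ?M. \<forall>b\<in>Basis. weak_deriv \<Omega> b (\<lambda>x. Q_inf + competitor a x) x = dcompetitor a b x"
    by (intro AE_finite_allI) auto
  let ?B = "\<lambda>x. (1 + t) * A x + 972 * (1 + 1/t) * \<eta> * J x"
  have B: "ennreal (?B x) = ennreal (1 + t) * ennreal (A x) + ennreal (972 * (1 + 1/t) * \<eta>) * ennreal (J x)" for x
  proof -
    have "0 \<le> 1 + t" "0 \<le> 972 * (1 + 1/t) * \<eta>" using t \<eta> by simp_all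
    then show ?thesis using A0[of x] J0[of x] by (simp only: ennreal_mult ennreal_plus mult_nonneg_nonneg)
  qed
  have "energy g0 \<xi> \<eta> (\<lambda>x. Q_inf + competitor a x) \<le> (\<integral>\<^sup>+x. ennreal (1 / \<eta>) * ennreal (?B x) \<partial>?M)"
    unfolding energy_def
  proof (rule nn_integral_mono_AE)
    show "AE x in ?M. ennreal ((1/2) * (\<Sum>b\<in>Basis. (norm (weak_deriv \<Omega> b (\<lambda>x. Q_inf + competitor a x) x))\<^sup>2)
              + f_pot (Q_inf + competitor a x) / \<xi>\<^sup>2 + g_pot g0 (Q_inf + competitor a x) / \<eta>\<^sup>2) \<le> ennreal (1 / \<eta>) * ennreal (?B x)"
      using AE AE_space
    proof eventually_elim
      case (elim x)
      have x: "norm x > 1" using elim(2) by (simp add: space_restrict_space norm_Omega)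
      have "(\<Sum>b\<in>Basis. (norm (weak_deriv \<Omega> b (\<lambda>x. Q_inf + competitor a x) x))\<^sup>2) = (\<Sum>b\<in>Basis. (norm (dcompetitor a b x))\<^sup>2)"
        using elim(1) by (intro sum.cong) auto
      then have "(1/2) * (\<Sum>b\<in>Basis. (norm (weak_deriv \<Omega> b (\<lambda>x. Q_inf + competitor a x) x))\<^sup>2)
              + f_pot (Q_inf + competitor a x) / \<xi>\<^sup>2 + g_pot g0 (Q_inf + competitor a x) / \<eta>\<^sup>2 \<le> 1 / \<eta> * ?B x"
        using competitor_density[OF x c \<eta> t, of \<xi> g0] by (simp only: a_def A_def J_def)
      moreover have "?B x \<ge> 0" using t \<eta> A0[of x] J0[of x] by simp
      ultimately show ?case using \<eta> by (subst ennreal_mult[symmetric]) (auto intro: ennreal_leI)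
    qed
  qed
  also have "\<dots> = ennreal (1 / \<eta>) * (\<integral>\<^sup>+x. ennreal (?B x) \<partial>?M)"
    unfolding B by (intro nn_integral_cmult toM borel_measurable_add borel_measurable_times_ennreal borel_measurable_const Am Jm)
  finally have "ennreal \<eta> * energy g0 \<xi> \<eta> (\<lambda>x. Q_inf + competitor a x) \<le> ennreal \<eta> * (ennreal (1 / \<eta>) * (\<integral>\<^sup>+x. ennreal (?B x) \<partial>?M))"
    by (rule mult_left_mono) simp
  also have "\<dots> = (\<integral>\<^sup>+x. ennreal (?B x) \<partial>?M)"
    using \<eta> by (simp add: mult.assoc[symmetric] ennreal_mult[symmetric])
  also have "\<dots> = ennreal (1 + t) * (\<integral>\<^sup>+x. ennreal (A x) \<partial>?M) + ennreal (972 * (1 + 1/t) * \<eta>) * (\<integral>\<^sup>+x. ennreal (J x) \<partial>?M)"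
    unfolding B
    by (subst nn_integral_add) (simp_all add: nn_integral_cmult toM Am Jm borel_measurable_times_ennreal)
  also have "(\<integral>\<^sup>+x. ennreal (A x) \<partial>?M) \<le> ennreal (pi * (4 - pi) * \<kappa> + 4 * pi * (16 * (c + 1) / c * \<eta>))"
  proof -
    have "(\<integral>\<^sup>+x. ennreal (A x) \<partial>?M) = sint (\<lambda>\<phi> \<theta>. \<integral>\<^sup>+r. ennreal (A (r *\<^sub>R sph \<phi> \<theta>)) * ennreal (r\<^sup>2) * indicator {1<..} r \<partial>lborel)"
      by (rule nn_integral_polar_sint[OF Am])
    also have "\<dots> \<le> sint (\<lambda>\<phi> \<theta>. ennreal (\<kappa> * (1 - sin \<phi>)) + ennreal (16 * (c + 1) / c * \<eta>))"
    proof (rule sint_mono)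
      fix \<phi> \<theta> :: real assume \<phi>: "0 < \<phi>" "\<phi> < pi"
      define s where "s = sin \<phi>"
      have s: "0 < s" "s \<le> 1" unfolding s_def using sin_gt_zero[OF \<phi>] by auto
      note sc = sph_coords[OF less_imp_le[OF s(1)[unfolded s_def]], of \<theta>]
      have "(\<integral>\<^sup>+r. ennreal (A (r *\<^sub>R sph \<phi> \<theta>)) * ennreal (r\<^sup>2) * indicator {1<..} r \<partial>lborel) \<le>
        (\<integral>\<^sup>+r. ennreal (c\<^sup>2 / \<eta> * (1 + r\<^sup>2) * mm (exp (- c * (r\<^sup>2 - 1) / \<eta>) * ((1 - s) / (1 + s))) * r\<^sup>2) * indicator {1..} r \<partial>lborel)"
      proof (rule nn_integral_mono)
        fix r :: real
        show "ennreal (A (r *\<^sub>R sph \<phi> \<theta>)) * ennreal (r\<^sup>2) * indicator {1<..} r \<le>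
          ennreal (c\<^sup>2 / \<eta> * (1 + r\<^sup>2) * mm (exp (- c * (r\<^sup>2 - 1) / \<eta>) * ((1 - s) / (1 + s))) * r\<^sup>2) * indicator {1..} r"
        proof (cases "r > 1")
          case True
          have x2: "(r *\<^sub>R sph \<phi> \<theta>) \<bullet> (r *\<^sub>R sph \<phi> \<theta>) = r\<^sup>2" by (simp add: sc power2_eq_square)
          have "norm (r *\<^sub>R sph \<phi> \<theta>) = r" "norm (hz (r *\<^sub>R sph \<phi> \<theta>)) = r * s" "(r *\<^sub>R sph \<phi> \<theta>) $ 3 = r * cos \<phi>"
            using True by (simp_all add: norm_sph hz_scaleR sc s_def)
          then have "(r *\<^sub>R sph \<phi> \<theta>) $ 3 / (norm (r *\<^sub>R sph \<phi> \<theta>) + norm (hz (r *\<^sub>R sph \<phi> \<theta>))) = r * cos \<phi> / (r * (1 + s))"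
            by (simp only: distrib_left mult_1_right)
          also have "\<dots> = cos \<phi> / (1 + s)" using True by simp
          finally have q: "((r *\<^sub>R sph \<phi> \<theta>) $ 3 / (norm (r *\<^sub>R sph \<phi> \<theta>) + norm (hz (r *\<^sub>R sph \<phi> \<theta>))))\<^sup>2 = (cos \<phi>)\<^sup>2 / (1 + s)\<^sup>2"
            by (simp only: power_divide)
          \<comment> \<open>The squared length of the stereographic coordinate of the datum, (1 - s)
            / (1 + s), is the number \<open>T\<close> of \<open>radial_upper\<close>.\<close>
          also have "(cos \<phi>)\<^sup>2 = (1 - s) * (1 + s)" by (simp add: cos_squared_eq s_def power2_eq_square algebra_simps)
          also have "(1 - s) * (1 + s) / (1 + s)\<^sup>2 = (1 - s) / (1 + s)" using s by (simp add: power2_eq_square)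
          finally have "A (r *\<^sub>R sph \<phi> \<theta>) = c\<^sup>2 / \<eta> * (1 + r\<^sup>2) * mm (exp (- c * (r\<^sup>2 - 1) / \<eta>) * ((1 - s) / (1 + s)))"
            unfolding A_def x2 by simp
          moreover have "ennreal (A (r *\<^sub>R sph \<phi> \<theta>)) * ennreal (r\<^sup>2) = ennreal (A (r *\<^sub>R sph \<phi> \<theta>) * r\<^sup>2)"
            by (rule ennreal_mult[symmetric]) (simp_all add: A0)
          moreover have "indicator {1<..} r = (1::ennreal)" "indicator {1..} r = (1::ennreal)" using True by auto
          ultimately show ?thesis by (simp only: order_refl)
        qed simp
      qed
      also have "\<dots> \<le> ennreal (2 * c * (1 - s) + 16 * (c + 1) / c * \<eta>)" by (rule radial_upper[OF c(1) \<eta> s])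
      also have "\<dots> = ennreal (\<kappa> * (1 - sin \<phi>)) + ennreal (16 * (c + 1) / c * \<eta>)"
        using c \<eta> s \<kappa>0 by (subst ennreal_plus[symmetric]) (auto simp: c_def s_def)
      finally show "(\<integral>\<^sup>+r. ennreal (A (r *\<^sub>R sph \<phi> \<theta>)) * ennreal (r\<^sup>2) * indicator {1<..} r \<partial>lborel) \<le>
        ennreal (\<kappa> * (1 - sin \<phi>)) + ennreal (16 * (c + 1) / c * \<eta>)" .
    qed
    also have "\<dots> = sint (\<lambda>\<phi> \<theta>. ennreal (\<kappa> * (1 - sin \<phi>))) + sint (\<lambda>\<phi> \<theta>. ennreal (16 * (c + 1) / c * \<eta>))"
      by (rule sint_add) (intro measurable_compose[OF _ measurable_ennreal] borel_measurable_continuous_onI continuous_intros)+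
    also have "\<dots> = ennreal (pi * (4 - pi) * \<kappa>) + ennreal (4 * pi * (16 * (c + 1) / c * \<eta>))"
      using c \<eta> \<kappa>0 by (simp only: sint_one_minus_sin[OF less_imp_le]) (subst sint_const, simp_all)
    also have "\<dots> = ennreal (pi * (4 - pi) * \<kappa> + 4 * pi * (16 * (c + 1) / c * \<eta>))"
      using c \<eta> \<kappa>0 pi_less_4 by (intro ennreal_plus[symmetric]) auto
    finally show ?thesis .
  qed
  finally show ?thesis by (simp add: a_def J_def mult_left_mono)
qed

theorem mainTheorem4:
  fixes \<kappa> g0 :: real
    and e :: "real^3 \<Rightarrow> real^3"
    and \<F> :: "'i filter"
  assumes "\<kappa> = root 4 24"
    and "g0 \<ge> 0"
    and "longitudinal e"
  shows "(\<forall>\<phi>\<in>{0..pi}. \<forall>\<theta>\<in>{0..<2*pi}.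
            D_inf g0 (Q_phi e (sph \<phi> \<theta>)) = ennreal (\<kappa> * (1 - \<bar>sin \<phi>\<bar>)) \<and>
            (\<exists>Q \<in> radial_class (Q_phi e (sph \<phi> \<theta>)).
               F_inf g0 Q = D_inf g0 (Q_phi e (sph \<phi> \<theta>))))
       \<and> (\<forall>(\<xi> :: 'i \<Rightarrow> real) \<eta> Q.
            (\<forall>\<^sub>F i in \<F>. \<xi> i > 0 \<and> \<eta> i > 0) \<and>
            (\<xi> \<longlongrightarrow> 0) \<F> \<and> (\<eta> \<longlongrightarrow> 0) \<F> \<and>
            filterlim (\<lambda>i. \<eta> i / \<xi> i) at_top \<F> \<and>
            (\<forall>\<^sub>F i in \<F>. minimizes g0 (\<xi> i) (\<eta> i) (Q_phi e) (Q i))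
            \<longrightarrow> ((\<lambda>i. ennreal (\<eta> i) * energy g0 (\<xi> i) (\<eta> i) (Q i))
                  \<longlongrightarrow> ennreal (pi * (4 - pi) * \<kappa>)) \<F>)"
proof (intro conjI allI impI ballI)
  fix \<phi> \<theta> :: real assume "\<phi> \<in> {0..pi}" "\<theta> \<in> {0..<2*pi}"
  note R = radial_problem[OF assms this]
  show "D_inf g0 (Q_phi e (sph \<phi> \<theta>)) = ennreal (\<kappa> * (1 - \<bar>sin \<phi>\<bar>))" using R by (rule conjunct1)
  show "\<exists>Q \<in> radial_class (Q_phi e (sph \<phi> \<theta>)). F_inf g0 Q = D_inf g0 (Q_phi e (sph \<phi> \<theta>))" using R by (rule conjunct2)
next
  fix \<xi> \<eta> :: "'i \<Rightarrow> real" and Q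
  assume H: "(\<forall>\<^sub>F i in \<F>. \<xi> i > 0 \<and> \<eta> i > 0) \<and> (\<xi> \<longlongrightarrow> 0) \<F> \<and> (\<eta> \<longlongrightarrow> 0) \<F> \<and>
    filterlim (\<lambda>i. \<eta> i / \<xi> i) at_top \<F> \<and> (\<forall>\<^sub>F i in \<F>. minimizes g0 (\<xi> i) (\<eta> i) (Q_phi e) (Q i))"
  define L where "L = pi * (4 - pi) * \<kappa>"
  define X where "X i = ennreal (\<eta> i) * energy g0 (\<xi> i) (\<eta> i) (Q i)" for i
  have pos: "\<forall>\<^sub>F i in \<F>. \<xi> i > 0 \<and> \<eta> i > 0" and \<eta>0: "(\<eta> \<longlongrightarrow> 0) \<F>"
    and ratio: "filterlim (\<lambda>i. \<eta> i / \<xi> i) at_top \<F>"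
    and min: "\<forall>\<^sub>F i in \<F>. minimizes g0 (\<xi> i) (\<eta> i) (Q_phi e) (Q i)" using H by auto
  define c where "c = \<kappa> / 2"
  have c: "c > 0" unfolding c_def by (rule kappa_sq(3)[OF assms(1)])
  have L0: "L \<ge> 0" unfolding L_def using kappa_sq(1)[OF assms(1)] pi_less_4 by simp
  obtain j where j: "j \<ge> 0" "(\<integral>\<^sup>+x. ennreal (J_density (c / 2) x) \<partial>lebesgue_on \<Omega>) = ennreal j"
    using J_density_finite[of "c / 2"] c by (cases "\<integral>\<^sup>+x. ennreal (J_density (c / 2) x) \<partial>lebesgue_on \<Omega>") auto
  \<comment> \<open>The upper bound with t = sqrt \<eta>, a choice for which both t and \<eta> / t
    tend to 0.\<close>
  define h where "h y = (1 + sqrt y) * (L + 4 * pi * (16 * (c + 1) / c * y)) + 972 * (y + sqrt y) * j" for y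
  have "((\<lambda>i. h (\<eta> i)) \<longlongrightarrow> (1 + sqrt 0) * (L + 4 * pi * (16 * (c + 1) / c * 0)) + 972 * (0 + sqrt 0) * j) \<F>"
    unfolding h_def by (intro tendsto_intros \<eta>0)
  then have hl: "((\<lambda>i. ennreal (h (\<eta> i))) \<longlongrightarrow> ennreal L) \<F>" by (simp add: tendsto_ennrealI)
  have "\<forall>\<^sub>F i in \<F>. \<eta> i < 1" by (rule order_tendstoD(2)[OF \<eta>0]) simp
  with pos min have upper: "\<forall>\<^sub>F i in \<F>. X i \<le> ennreal (h (\<eta> i))"
  proof eventually_elim
    case (elim i)
    have \<eta>: "0 < \<eta> i" "\<eta> i \<le> 1" using elim by auto
    have "energy g0 (\<xi> i) (\<eta> i) (Q i) \<le> energy g0 (\<xi> i) (\<eta> i) (\<lambda>x. Q_inf + competitor (c / (2 * \<eta> i)) x)"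
      using elim(2) competitor_admissible[OF _ assms(3), of "c / (2 * \<eta> i)"] c \<eta> by (simp add: minimizes_def)
    then have "X i \<le> ennreal (\<eta> i) * energy g0 (\<xi> i) (\<eta> i) (\<lambda>x. Q_inf + competitor (c / (2 * \<eta> i)) x)"
      unfolding X_def by (rule mult_left_mono) simp
    also have "\<dots> \<le> ennreal (1 + sqrt (\<eta> i)) * ennreal (L + 4 * pi * (16 * (c + 1) / c * \<eta> i)) + ennreal (972 * (1 + 1 / sqrt (\<eta> i)) * \<eta> i) * ennreal j"
      unfolding L_def c_def j(2)[unfolded c_def, symmetric]
      by (rule energy_upper[OF assms(1) \<eta>]) (use \<eta> in simp)
    also have "\<dots> = ennreal ((1 + sqrt (\<eta> i)) * (L + 4 * pi * (16 * (c + 1) / c * \<eta> i)) + 972 * (1 + 1 / sqrt (\<eta> i)) * \<eta> i * j)"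
    proof -
      have "0 \<le> L + 4 * pi * (16 * (c + 1) / c * \<eta> i)" using L0 c \<eta> by (intro add_nonneg_nonneg) auto
      moreover have "0 \<le> 972 * (1 + 1 / sqrt (\<eta> i)) * \<eta> i" using \<eta> by simp
      moreover have "0 \<le> 1 + sqrt (\<eta> i)" using \<eta> by simp
      ultimately show ?thesis using j(1) by (simp only: ennreal_mult ennreal_plus mult_nonneg_nonneg)
    qed
    also have "(1 + 1 / sqrt (\<eta> i)) * \<eta> i = \<eta> i + sqrt (\<eta> i)"
      using \<eta> by (simp add: distrib_right real_div_sqrt)
    then have "972 * (1 + 1 / sqrt (\<eta> i)) * \<eta> i = 972 * (\<eta> i + sqrt (\<eta> i))" by (simp only: mult.assoc)
    finally show ?case by (simp only: h_def)
  qed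
  have lower: "\<forall>\<^sub>F i in \<F>. ennreal l < X i" if l: "0 \<le> l" "l < L" for l
  proof -
    \<comment> \<open>Makes (1 + t) l + 8 \<pi> t the midpoint of l and L. The same t is used for
      \<epsilon> in \<open>energy_lower_approx\<close>, which gives the 4 \<pi> (t + t).\<close>
    define t where "t = (L - l) / (2 * (l + 8 * pi))"
    have d: "l + 8 * pi > 0" using l pi_gt_zero by linarith
    have t: "t > 0" using l d by (simp add: t_def)
    have "t * (l + 8 * pi) = (L - l) / 2" 
    proof -
      have "(L - l) / (2 * w) * w = (L - l) / 2" if "w > 0" for w :: real using that by simp
      from this[OF d] show ?thesis by (simp only: t_def)
    qed
    then have tl: "(1 + t) * l + 4 * pi * (t + t) < L" using l by (simp add: algebra_simps)
    obtain K where K: "\<And>\<xi> \<eta> Q. \<xi> > 0 \<Longrightarrow> \<eta> > 0 \<Longrightarrow> \<eta> / \<xi> \<ge> K \<Longrightarrow> Q \<in> admissible (Q_phi e) \<Longrightarrow>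
       ennreal L \<le> ennreal (1 + t) * (ennreal \<eta> * energy g0 \<xi> \<eta> Q) + ennreal (4 * pi * (t + t))"
      using energy_lower_approx[OF assms t] t unfolding L_def by blast
    have "\<forall>\<^sub>F i in \<F>. \<eta> i / \<xi> i \<ge> K" using ratio by (simp add: filterlim_at_top)
    with pos min show ?thesis
    proof eventually_elim
      case (elim i)
      have "ennreal L \<le> ennreal (1 + t) * X i + ennreal (4 * pi * (t + t))"
        unfolding X_def by (rule K) (use elim in \<open>auto simp: minimizes_def\<close>)
      show ?case
      proof (rule ccontr)
        assume "\<not> ennreal l < X i"
        then have "ennreal (1 + t) * X i + ennreal (4 * pi * (t + t)) \<le> ennreal (1 + t) * ennreal l + ennreal (4 * pi * (t + t))"
          by (intro add_mono mult_left_mono) auto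
        also have "\<dots> = ennreal ((1 + t) * l + 4 * pi * (t + t))"
        proof -
          have "0 \<le> 1 + t" "0 \<le> 4 * pi * (t + t)" using t by simp_all
          then show ?thesis using l by (simp only: ennreal_mult ennreal_plus mult_nonneg_nonneg)
        qed
        also have "\<dots> < ennreal L" using tl t l by (intro ennreal_lessI) auto
        finally show False using \<open>ennreal L \<le> _\<close> by simp
      qed
    qed
  qed
  have "(X \<longlongrightarrow> ennreal L) \<F>"
  proof (rule order_tendstoI)
    fix y assume y: "y < ennreal L"
    then obtain l where l: "0 \<le> l" "y = ennreal l" by (cases y) auto
    then show "\<forall>\<^sub>F i in \<F>. y < X i" using lower[of l] y by (simp add: ennreal_less_iff)
  next
    fix y assume "ennreal L < y"
    from order_tendstoD(2)[OF hl this] upper show "\<forall>\<^sub>F i in \<F>. X i < y"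
      by eventually_elim (rule order.strict_trans1)
  qed
  then show "((\<lambda>i. ennreal (\<eta> i) * energy g0 (\<xi> i) (\<eta> i) (Q i)) \<longlongrightarrow> ennreal (pi * (4 - pi) * \<kappa>)) \<F>"
    by (simp only: X_def[abs_def] L_def)
qed

end
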